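(* Let $q\in[0,1]$ and $n\in\mathbb{N}$. (i) $\mathcal{M}(\mathcal{PR}_n(q))=\{f(\pm z): f\in\overline{\mathcal{PN}}_n(q)\}$. In particular, if $q\in(0,1]$, then $\mathcal{M}(\mathcal{R}_n(q))=\{f(\pm z): f\in\overline{\mathcal{PN}}_n(q)\}$. (ii) $\mathcal{M}(\mathcal{PN}_n(q))=\overline{\mathcal{PN}}_n(q)$. In particular, if $q\in(0,1]$, then $\mathcal{M}(\mathcal{N}_n(q))=\overline{\mathcal{PN}}_n(q)$. (iii) If $r\in[0,q)$ and if $f$ is not extremal and belongs to $\overline{\mathcal{PR}}_n(q)$ or $\overline{\mathcal{PN}}_n(q)$, then $f$ is also an element of $\mathcal{PR}_n(r)$ or $\mathcal{PN}_n(r)$, respectively. (iv) $\mathcal{PR}_n(0)=\mathcal{LC}_n$ and $\mathcal{PN}_n(0)=\mathcal{LC}_n^{+}$.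
   Context: Zeros are counted with multiplicity. For $f=\sum a_kz^k$, $g=\sum b_kz^k$ in $\mathbb{C}[[z]]$ put $f*g=\sum a_kb_kz^k$. For $\mathcal{X}\subset\mathbb{C}[[z]]$ the multiplier class $\mathcal{M}(\mathcal{X})$ is the set of $g\in\mathbb{C}[[z]]$ with $\deg g\le\max\{\deg h:h\in\mathcal{X}\}$ such that $f*g\in\mathcal{X}$ for all $f\in\mathcal{X}$. For $h\in\mathbb{C}[[z]]$, $\mathcal{P}(\mathcal{X};h)$ is the set of $f\in\mathbb{C}[[z]]$ with $\deg f\le\deg h$ and $f*h\in\mathcal{X}$. The notation $\{f(\pm z):f\in\mathcal{Y}\}$ means the set of all $f(z)$ and all $f(-z)$ with $f\in\mathcal{Y}$. For $q\in[0,1]$, a finite or infinite sequence $\{x_k\}$ of real numbers is $q$-separated if $x_k/x_l\le q$ for all indices $k\ne l$ with $x_l\le x_k<0$ or $0<x_k\le x_l$; it is strictly $q$-separated if $x_k/x_l<q$ for all such indices. For $n\in\mathbb{N}=\{1,2,\dots\}$, $\mathcal{R}_n(q)$ is the set consisting of $0$ and all real polynomials of degree $\le n$ having only real zeros, the zeros being strictly $q$-separated (so a multiple zero at the origin is allowed); $\mathcal{N}_n(q)$ is the set consisting of $0$ and those elements of $\mathcal{R}_n(q)$ all of whose zeros lie in $(-\infty,0]$. For $q\in(0,1]$ let $R_n(q;z)=\prod_{j=1}^n(1+q^{j-1}z)$, and put $\mathcal{PR}_n(q)=\mathcal{P}(\mathcal{R}_n(q);R_n(q;z))$, $\mathcal{PN}_n(q)=\mathcal{P}(\mathcal{N}_n(q);R_n(q;z))$.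 Put $\mathcal{PR}_n(0)=\bigcup_{q\in(0,1]}\mathcal{PR}_n(q)$ and $\mathcal{PN}_n(0)=\bigcup_{q\in(0,1]}\mathcal{PN}_n(q)$. An overline denotes closure in the finite-dimensional space of polynomials of degree $\le n$. A polynomial $f$ of degree $\le n$ is called extremal if there are $a,b\in\mathbb{R}\setminus\{0\}$ with $f(z)=b\,(1+az+a^2z^2+\dots+a^nz^n)$ (equivalently, for $q\in(0,1]$, $f*R_n(q;z)=b\,R_n(q;az)$). $\mathcal{LC}_n$ is the set of all real polynomials $\sum_{k=0}^na_kz^k$ such that (with $a_{-1}=a_{n+1}=0$) $a_k^2>a_{k-1}a_{k+1}$ for all $0\le k\le n$ for which there are $l\le k$ and $m\ge k$ with $a_l\neq0$ and $a_m\ne0$. $\mathcal{LC}_n^{+}$ is the set of those elements of $\mathcal{LC}_n$ for which $a_k\ge0$ for all $k$ or $a_k\le0$ for all $k$. *)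

theory Defs
  imports "HOL-Analysis.Analysis"
begin

definition hadamard :: "complex fps \<Rightarrow> complex fps \<Rightarrow> complex fps" (infixl \<open>\<star>\<close> 70)
  where "f \<star> g = Abs_fps (\<lambda>k. fps_nth f k * fps_nth g k)"

text \<open>The supremum is taken in the extended reals, so that the degree of \<open>0\<close> is \<open>-\<infinity>\<close> and the
  degree of a series that is not a polynomial is \<open>\<infinity>\<close>.\<close>

definition fps_deg :: "complex fps \<Rightarrow> ereal"
  where "fps_deg f = (SUP k\<in>{k. fps_nth f k \<noteq> 0}. ereal (real k))"

definition multiplier_class :: "complex fps set \<Rightarrow> complex fps set"
  where "multiplier_class X = {g. fps_deg g \<le> (SUP h\<in>X. fps_deg h) \<and> (\<forall>f\<in>X. f \<star> g \<in> X)}"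

definition precoeff_class :: "complex fps set \<Rightarrow> complex fps \<Rightarrow> complex fps set"
  where "precoeff_class X h = {f. fps_deg f \<le> fps_deg h \<and> f \<star> h \<in> X}"

definition plus_minus :: "complex fps set \<Rightarrow> complex fps set"
  where "plus_minus Y = Y \<union> (\<lambda>f. fps_compose f (- fps_X)) ` Y"

text \<open>Embedding of the real polynomials into the complex power series.\<close>

definition rfps :: "real poly \<Rightarrow> complex fps"
  where "rfps p = fps_of_poly (map_poly complex_of_real p)"

definition strictly_separated :: "real \<Rightarrow> 'i set \<Rightarrow> ('i \<Rightarrow> real) \<Rightarrow> bool"
  where "strictly_separated q I x \<longleftrightarrow>
    (\<forall>k\<in>I. \<forall>l\<in>I. k \<noteq> l \<longrightarrow> (x l \<le> x k \<and> x k < 0) \<or> (0 < x k \<and> x k \<le> x l) \<longrightarrow> x k / x l < q)"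

text \<open>The list \<open>xs\<close> enumerates the zeros with multiplicity; the order is irrelevant.\<close>

definition real_sep_polys :: "nat \<Rightarrow> real \<Rightarrow> real poly set"
  where "real_sep_polys n q = {0} \<union>
    {p. p \<noteq> 0 \<and> degree p \<le> n \<and>
        (\<forall>z. poly (map_poly complex_of_real p) z = 0 \<longrightarrow> z \<in> \<real>) \<and>
        (\<exists>xs. mset xs = proots p \<and> strictly_separated q {..<length xs} (nth xs))}"

definition R_class :: "nat \<Rightarrow> real \<Rightarrow> complex fps set"
  where "R_class n q = rfps ` real_sep_polys n q"

definition N_class :: "nat \<Rightarrow> real \<Rightarrow> complex fps set"
  where "N_class n q =
    rfps ` ({0} \<union> {p \<in> real_sep_polys n q. \<forall>x. poly p x = 0 \<longrightarrow> x \<le> 0})"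

definition R_poly :: "nat \<Rightarrow> real \<Rightarrow> real poly"
  where "R_poly n q = (\<Prod>j=1..n. [:1, q ^ (j - 1):])"

definition PR_class :: "nat \<Rightarrow> real \<Rightarrow> complex fps set"
  where "PR_class n q =
    (if q = 0 then (\<Union>s\<in>{0<..1}. precoeff_class (R_class n s) (rfps (R_poly n s)))
     else precoeff_class (R_class n q) (rfps (R_poly n q)))"

definition PN_class :: "nat \<Rightarrow> real \<Rightarrow> complex fps set"
  where "PN_class n q =
    (if q = 0 then (\<Union>s\<in>{0<..1}. precoeff_class (N_class n s) (rfps (R_poly n s)))
     else precoeff_class (N_class n q) (rfps (R_poly n q)))"

text \<open>The library topology on \<^typ>\<open>complex fps\<close> is the adic one, in which every set of polynomials
  of degree at most \<open>n\<close> is closed. The topology of the finite-dimensional space of polynomials of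
  degree at most \<open>n\<close> is instead the one induced by the product topology on coefficient sequences.\<close>

definition poly_closure :: "nat \<Rightarrow> complex fps set \<Rightarrow> complex fps set"
  where "poly_closure n Y =
    {f. fps_deg f \<le> ereal (real n) \<and> fps_nth f \<in> closure (fps_nth ` Y)}"

definition extremal :: "nat \<Rightarrow> complex fps \<Rightarrow> bool"
  where "extremal n f \<longleftrightarrow>
    (\<exists>a b. a \<noteq> 0 \<and> b \<noteq> 0 \<and> f = rfps (smult b (\<Sum>k\<le>n. monom (a ^ k) k)))"

text \<open>Coefficients indexed by the integers, so that those at \<open>-1\<close> and \<open>n + 1\<close> vanish.\<close>

definition icoeff :: "real poly \<Rightarrow> int \<Rightarrow> real"
  where "icoeff p k = (if k < 0 then 0 else coeff p (nat k))"

definition log_concave_polys :: "nat \<Rightarrow> real poly set"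
  where "log_concave_polys n = {p. degree p \<le> n \<and>
    (\<forall>k\<in>{0..int n}. (\<exists>l\<le>k. icoeff p l \<noteq> 0) \<and> (\<exists>m\<ge>k. icoeff p m \<noteq> 0) \<longrightarrow>
       (icoeff p k)\<^sup>2 > icoeff p (k - 1) * icoeff p (k + 1))}"

definition LC_class :: "nat \<Rightarrow> complex fps set"
  where "LC_class n = rfps ` log_concave_polys n"

definition LC_plus_class :: "nat \<Rightarrow> complex fps set"
  where "LC_plus_class n =
    rfps ` {p \<in> log_concave_polys n. (\<forall>k. coeff p k \<ge> 0) \<or> (\<forall>k. coeff p k \<le> 0)}"

lemma fps_deg_le_iff: "fps_deg f \<le> ereal (real n) \<longleftrightarrow> (\<forall>k>n. fps_nth f k = 0)"
proof -
  have "fps_deg f \<le> ereal (real n) \<longleftrightarrow> (\<forall>k. fps_nth f k \<noteq> 0 \<longrightarrow> k \<le> n)"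
    by (simp add: fps_deg_def SUP_le_iff)
  then show ?thesis
    by (metis not_less)
qed

lemma coeff_lim:
  fixes t :: "nat \<Rightarrow> nat \<Rightarrow> complex"
  shows "t \<longlonglongrightarrow> a \<longleftrightarrow> (\<forall>k. (\<lambda>i. t i k) \<longlonglongrightarrow> a k)"
  using limitin_componentwise[of "\<lambda>_. euclidean" UNIV t a sequentially]
  by (simp add: euclidean_product_topology)

lemma poly_closure_iff_sequence:
  "f \<in> poly_closure n Y \<longleftrightarrow> (\<forall>k>n. fps_nth f k = 0) \<and>
     (\<exists>s. (\<forall>i. s i \<in> Y) \<and> (\<forall>k. (\<lambda>i. fps_nth (s i) k) \<longlonglongrightarrow> fps_nth f k))"
proof -
  have "fps_nth f \<in> closure (fps_nth ` Y) \<longleftrightarrow>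
      (\<exists>t. (\<forall>i. t i \<in> fps_nth ` Y) \<and> t \<longlonglongrightarrow> fps_nth f)"
    by (rule closure_sequential)
  also have "\<dots> \<longleftrightarrow> (\<exists>s. (\<forall>i. s i \<in> Y) \<and> (\<lambda>i. fps_nth (s i)) \<longlonglongrightarrow> fps_nth f)"
  proof
    assume "\<exists>t. (\<forall>i. t i \<in> fps_nth ` Y) \<and> t \<longlonglongrightarrow> fps_nth f"
    then obtain t where t: "\<forall>i. \<exists>g. g \<in> Y \<and> t i = fps_nth g" "t \<longlonglongrightarrow> fps_nth f"
      by (auto simp: image_iff Bex_def)
    from t(1) obtain s where "\<forall>i. s i \<in> Y \<and> t i = fps_nth (s i)"
      by metis
    moreover from this have "t = (\<lambda>i. fps_nth (s i))"
      by auto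
    ultimately show "\<exists>s. (\<forall>i. s i \<in> Y) \<and> (\<lambda>i. fps_nth (s i)) \<longlonglongrightarrow> fps_nth f"
      using t(2) by auto
  next
    assume "\<exists>s. (\<forall>i. s i \<in> Y) \<and> (\<lambda>i. fps_nth (s i)) \<longlonglongrightarrow> fps_nth f"
    then obtain s where "\<forall>i. s i \<in> Y" "(\<lambda>i. fps_nth (s i)) \<longlonglongrightarrow> fps_nth f"
      by auto
    then show "\<exists>t. (\<forall>i. t i \<in> fps_nth ` Y) \<and> t \<longlonglongrightarrow> fps_nth f"
      by (intro exI[of _ "\<lambda>i. fps_nth (s i)"]) simp
  qed
  finally show ?thesis
    unfolding poly_closure_def by (simp add: fps_deg_le_iff coeff_lim)
qed

end

theory Submission
  imports Defs "HOL-Computational_Algebra.Fundamental_Theorem_Algebra"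
begin

text \<open>
  Let \<open>F = f * R\<^sub>n(q)\<close> and \<open>G = g * R\<^sub>n(q)\<close> be \<open>q\<close>-separated, the zeros of \<open>G\<close> being nonpositive.
  Splitting off a zero of either factor expresses \<open>f * G\<close> through the convolutions of shifted and
  truncated coefficient windows, which have one degree less. Interlacing of such a pair is the
  statement that a quotient has nonnegative imaginary part on the upper half plane; partial
  fractions and the Cauchy-Schwarz inequality carry two inequalities of this kind from degree
  \<open>m\<close> to degree \<open>m + 1\<close>. Applied to the dilation \<open>z \<mapsto> q z\<close> they show that \<open>f * G\<close> is weakly
  \<open>q\<close>-separated, and since the set of separated polynomials is open, the separation is strict. The
  case \<open>q = 1\<close> and the closures follow by limits. A limit belongs to \<open>PR\<^sub>n(r)\<close> for
  every \<open>r < q\<close>, because a common zero of its shifted and truncated convolutions would turn all the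
  inequalities into equalities, that is, force a geometric coefficient sequence. For
  \<open>f = \<Sum> a\<^sub>k z\<^sup>k\<close> and \<open>s \<rightarrow> 0\<close>, the zeros of \<open>f * R\<^sub>n(s)\<close> are asymptotic to
  \<open>- a\<^bsub>k\<^esub> / (a\<^bsub>k+1\<^esub> s\<^sup>k)\<close> (or come in pairs of opposite sign at a gap \<open>a\<^sub>k = 0\<close>), which yields the
  description by log-concavity. Conversely, convolving a multiplier with separated polynomials whose
  coefficients tend to \<open>1\<close> shows that it lies in the closure, and the convolution with the two-term
  polynomials \<open>z\<^bsup>k+1\<^esup> - z\<^bsup>k-1\<^esup>\<close> forces a constant or alternating sign pattern.
\<close>

subsection \<open>Linear factors of real polynomials\<close>

text \<open>Strict separation is an open condition, while only weak inequalities survive a limit, so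
  strictness has to be recovered at every stage. The inequality chosen for this is
  \<open>Im (z * H(r z) * cnj (H z)) >= 0\<close> on the upper half plane. It is closed under
  limits, and for 0 < r < 1 it forces a nonzero H to have only real zeros and, if those off the
  origin are simple, no two of them in a ratio strictly between r and 1. Only double zeros and the
  ratio exactly r are left to separate arguments.

  The induction rests on absorption identities of q-binomial coefficients: dropping the last or the
  first entry of a sequence acts on \<open>f * R_(n+1)(q)\<close> as a q-difference operator and
  leads to \<open>f * R_n(q)\<close> with the same q. Removing a zero of one factor shifts the
  other, so the two factors exchange roles at each step; hence two inequalities that prove each
  other. The identities carry the factor \<open>1 - q^(n+1)\<close>, which vanishes at q = 1, and
  that value is approached from below instead.\<close>

definition cpoly :: "real poly \<Rightarrow> complex \<Rightarrow> complex"
  where "cpoly p z = poly (map_poly complex_of_real p) z"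

lemma cpoly_0 [simp]: "cpoly 0 z = 0"
  by (simp add: cpoly_def)

lemma cpoly_pCons [simp]: "cpoly (pCons a p) z = of_real a + z * cpoly p z"
  by (simp add: cpoly_def map_poly_pCons)

lemma cpoly_add [simp]: "cpoly (p + r) z = cpoly p z + cpoly r z"
proof -
  have "map_poly complex_of_real (p + r) = map_poly of_real p + map_poly of_real r"
    by (rule poly_eqI) (simp add: coeff_map_poly)
  then show ?thesis
    by (simp add: cpoly_def)
qed

lemma cpoly_smult [simp]: "cpoly (smult c p) z = of_real c * cpoly p z"
  by (simp add: cpoly_def map_poly_smult)

lemma cpoly_minus [simp]: "cpoly (- p) z = - cpoly p z"
  using cpoly_smult[of "-1" p z] by simp

lemma cpoly_diff [simp]: "cpoly (p - r) z = cpoly p z - cpoly r z"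
  using cpoly_add[of p "- r" z] by simp

lemma cpoly_mult [simp]: "cpoly (p * r) z = cpoly p z * cpoly r z"
  by (induction p) (auto simp: algebra_simps)

lemma cpoly_1 [simp]: "cpoly 1 z = 1"
  by (simp add: cpoly_def)

lemma cpoly_monom [simp]: "cpoly (monom c k) z = of_real c * z ^ k"
  by (simp add: cpoly_def map_poly_monom poly_monom)

lemma cpoly_sum [simp]: "cpoly (\<Sum>i\<in>A. f i) z = (\<Sum>i\<in>A. cpoly (f i) z)"
  by (induction A rule: infinite_finite_induct) auto

lemma cpoly_of_real [simp]: "cpoly p (of_real x) = of_real (poly p x)"
  by (induction p) auto

lemma cpoly_cnj: "cpoly p (cnj z) = cnj (cpoly p z)"
  by (induction p) auto

lemma cpoly_altdef:
  assumes "degree p \<le> n"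
  shows "cpoly p z = (\<Sum>k\<le>n. of_real (coeff p k) * z ^ k)"
proof -
  have "p = (\<Sum>k\<le>n. monom (coeff p k) k)"
    using assms by (simp add: poly_as_sum_of_monoms')
  then have "cpoly p z = cpoly (\<Sum>k\<le>n. monom (coeff p k) k) z"
    by simp
  then show ?thesis
    by simp
qed

lemma poly_altdef_le:
  fixes p :: "real poly"
  assumes "degree p \<le> n"
  shows "poly p x = (\<Sum>k\<le>n. coeff p k * x ^ k)"
proof -
  have "p = (\<Sum>k\<le>n. monom (coeff p k) k)"
    using assms by (simp add: poly_as_sum_of_monoms')
  then have "poly p x = poly (\<Sum>k\<le>n. monom (coeff p k) k) x"
    by simp
  then show ?thesis
    by (simp add: poly_sum poly_monom)
qed

lemma tendsto_cpoly [tendsto_intros]: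
  assumes "(f \<longlongrightarrow> l) F"
  shows "((\<lambda>t. cpoly p (f t)) \<longlongrightarrow> cpoly p l) F"
  unfolding cpoly_def by (intro tendsto_intros assms)

lemma real_rooted_root:
  assumes "\<And>z. cpoly p z = 0 \<Longrightarrow> z \<in> \<real>" "degree p \<noteq> 0"
  obtains x where "poly p x = 0"
proof -
  have "degree (map_poly complex_of_real p) = degree p"
    by (intro degree_map_poly) simp
  then obtain z where z: "cpoly p z = 0"
    using assms(2) fundamental_theorem_of_algebra[of "map_poly complex_of_real p"]
    by (auto simp: cpoly_def constant_degree)
  then show ?thesis
    using assms(1)[OF z] that by (auto elim!: Reals_cases)
qed

definition lin_quot :: "real poly \<Rightarrow> real \<Rightarrow> real poly"
  where "lin_quot p x = p div [:- x, 1:]"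

lemma lin_quot_eq:
  assumes "poly p x = 0"
  shows "p = [:- x, 1:] * lin_quot p x"
  unfolding lin_quot_def using assms by (metis poly_eq_0_iff_dvd dvd_mult_div_cancel)

lemma cpoly_lin_quot:
  assumes "poly p x = 0"
  shows "cpoly p z = (z - of_real x) * cpoly (lin_quot p x) z"
  by (subst lin_quot_eq[OF assms], subst cpoly_mult) simp

lemma poly_lin_quot:
  assumes "poly p x = 0"
  shows "poly p y = (y - x) * poly (lin_quot p x) y"
  by (subst lin_quot_eq[OF assms], subst poly_mult) simp

lemma poly_pderiv_eq_lin_quot:
  assumes "poly p x = 0"
  shows "poly (pderiv p) x = poly (lin_quot p x) x"
proof -
  have "pderiv p = pderiv ([:- x, 1:] * lin_quot p x)"
    using lin_quot_eq[OF assms] by simp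
  then show ?thesis
    by (simp add: pderiv_mult pderiv_pCons del: mult_pCons_left)
qed

lemma lin_quot_nonzero:
  assumes "poly p x = 0" "p \<noteq> 0"
  shows "lin_quot p x \<noteq> 0"
  using lin_quot_eq[OF assms(1)] assms(2) by auto

lemma degree_lin_quot:
  assumes "poly p x = 0" "p \<noteq> 0"
  shows "degree p = Suc (degree (lin_quot p x))"
proof -
  have "degree p = degree ([:- x, 1:] * lin_quot p x)"
    using lin_quot_eq[OF assms(1)] by simp
  then show ?thesis
    using lin_quot_nonzero[OF assms] by (simp add: degree_mult_eq del: mult_pCons_left)
qed

lemma coeff_lin_quot:
  assumes "poly p x = 0"
  shows "coeff p (Suc k) = coeff (lin_quot p x) k - x * coeff (lin_quot p x) (Suc k)"
    and "coeff p 0 = - x * coeff (lin_quot p x) 0"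
proof -
  show "coeff p (Suc k) = coeff (lin_quot p x) k - x * coeff (lin_quot p x) (Suc k)"
    by (subst lin_quot_eq[OF assms]) simp
  show "coeff p 0 = - x * coeff (lin_quot p x) 0"
    by (subst lin_quot_eq[OF assms]) simp
qed

lemma lead_coeff_lin_quot:
  assumes "poly p x = 0" "p \<noteq> 0"
  shows "lead_coeff (lin_quot p x) = lead_coeff p"
proof -
  have "lead_coeff p = lead_coeff ([:- x, 1:] * lin_quot p x)"
    using lin_quot_eq[OF assms(1)] by simp
  then show ?thesis
    by (simp only: lead_coeff_mult) simp
qed

lemma poly_same_sign:
  fixes p :: "real poly"
  assumes "\<And>t. t \<in> closed_segment a b \<Longrightarrow> poly p t \<noteq> 0"
  shows "poly p a * poly p b > 0"
proof (rule ccontr)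
  assume "\<not> ?thesis"
  moreover have "poly p a \<noteq> 0" "poly p b \<noteq> 0"
    using assms by auto
  ultimately have neg: "poly p a * poly p b < 0"
    by (meson linorder_neqE_linordered_idom mult_eq_0_iff)
  then have "a \<noteq> b"
    by (auto simp: mult_less_0_iff)
  then consider "a < b" | "b < a"
    by linarith
  then show False
  proof cases
    case 1
    then show ?thesis
      using poly_IVT[OF 1 neg] assms by (auto simp: closed_segment_eq_real_ivl)
  next
    case 2
    have "poly p b * poly p a < 0"
      using neg by (simp add: mult.commute)
    then show ?thesis
      using poly_IVT[OF 2] assms 2 by (force simp: closed_segment_eq_real_ivl split: if_splits)
  qed
qed

subsection \<open>Separated polynomials\<close>

text \<open>A zero at the origin may have any order, as in the classes of the theorem; simplicity is
  therefore required only off the origin.\<close>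

definition real_simple :: "real poly \<Rightarrow> bool"
  where "real_simple p \<longleftrightarrow> p \<noteq> 0 \<and> (\<forall>z. cpoly p z = 0 \<longrightarrow> z \<in> \<real>) \<and>
    (\<forall>x. x \<noteq> 0 \<longrightarrow> poly p x = 0 \<longrightarrow> poly (pderiv p) x \<noteq> 0)"

text \<open>Speaking of distinct zeros instead of indexed ones leaves multiplicities to
  \<open>real_simple\<close>. For q > 0 a ratio \<open>y / x\<close> in [q, 1] already means equal
  signs and \<open>|y| <= |x|\<close>, so the two sign cases of strict separation merge. For q = 1
  the predicate is \<open>real_simple\<close>.\<close>

definition sep :: "real \<Rightarrow> real poly \<Rightarrow> bool"
  where "sep q p \<longleftrightarrow> real_simple p \<and>
    (\<forall>x y. poly p x = 0 \<and> poly p y = 0 \<and> x \<noteq> 0 \<and> y \<noteq> x \<and> q \<le> y / x \<longrightarrow> \<not> y / x \<le> 1)"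

lemma sep_nonzero: "sep q p \<Longrightarrow> p \<noteq> 0"
  by (simp add: sep_def real_simple_def)

lemma sep_mono: "sep r p \<Longrightarrow> r \<le> q \<Longrightarrow> sep q p"
  unfolding sep_def by (meson order_trans)

lemma sep_smult: "c \<noteq> 0 \<Longrightarrow> sep q (smult c p) \<longleftrightarrow> sep q p"
  by (simp add: sep_def real_simple_def pderiv_smult)

lemma real_simple_lin_quot:
  assumes "real_simple p" "poly p x = 0"
  shows "real_simple (lin_quot p x)"
  unfolding real_simple_def
proof (intro conjI allI impI)
  have p0: "p \<noteq> 0"
    using assms(1) by (simp add: real_simple_def)
  show "lin_quot p x \<noteq> 0"
    using lin_quot_nonzero[OF assms(2) p0] .
  show "z \<in> \<real>" if "cpoly (lin_quot p x) z = 0" for z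
    using that assms(1) cpoly_lin_quot[OF assms(2), of z] by (simp add: real_simple_def)
  show "poly (pderiv (lin_quot p x)) y \<noteq> 0" if "y \<noteq> 0" "poly (lin_quot p x) y = 0" for y
  proof
    assume d: "poly (pderiv (lin_quot p x)) y = 0"
    have "pderiv p = pderiv ([:- x, 1:] * lin_quot p x)"
      using lin_quot_eq[OF assms(2)] by simp
    then have "poly (pderiv p) y = 0"
      using d that(2) by (simp add: pderiv_mult pderiv_pCons del: mult_pCons_left)
    moreover have "poly p y = 0"
      using poly_lin_quot[OF assms(2), of y] that(2) by simp
    ultimately show False
      using assms(1) that(1) by (simp add: real_simple_def)
  qed
qed

lemma sep_lin_quot:
  assumes "sep q p" "poly p x = 0"
  shows "sep q (lin_quot p x)"
proof -
  have "poly p y = 0" if "poly (lin_quot p x) y = 0" for y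
    using poly_lin_quot[OF assms(2), of y] that by simp
  then show ?thesis
    using assms real_simple_lin_quot[of p x] unfolding sep_def by blast
qed

lemma coeff_below_order:
  fixes p :: "real poly"
  assumes "k < order 0 p"
  shows "coeff p k = 0"
proof (cases "p = 0")
  case False
  have "[:- 0, 1:] ^ order 0 p dvd p"
    by (rule order_1)
  then obtain r where r: "p = monom 1 (order 0 p) * r"
    by (auto simp: monom_altdef elim: dvdE)
  show ?thesis
    using assms by (subst r) (simp add: coeff_monom_mult)
qed simp

lemma coeff_order_nonzero:
  fixes p :: "real poly"
  assumes "p \<noteq> 0"
  shows "coeff p (order 0 p) \<noteq> 0"
proof
  assume 0: "coeff p (order 0 p) = 0"
  have "[:- 0, 1:] ^ order 0 p dvd p"
    by (rule order_1)
  then obtain r where r: "p = monom 1 (order 0 p) * r"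
    by (auto simp: monom_altdef elim: dvdE)
  have "coeff r 0 = 0"
    using 0 by (subst (asm) r) (simp add: coeff_monom_mult)
  then have "[:-0, 1:] dvd r"
    by (simp only: poly_eq_0_iff_dvd[symmetric] poly_0_coeff_0)
  then have "[:-0, 1:] ^ Suc (order 0 p) dvd p"
    by (metis monom_altdef mult_dvd_mono power_Suc2 r dvd_refl smult_1_left minus_zero)
  then show False
    using order_2[OF assms, of 0] by simp
qed

text \<open>Peel off one zero at a time: a zero at the origin raises the order there, and any other
  one is new because it is simple.\<close>

lemma real_simple_degree:
  assumes "real_simple p"
  shows "degree p = order 0 p + card {x. x \<noteq> 0 \<and> poly p x = 0}"
  using assms
proof (induction "degree p" arbitrary: p rule: less_induct)
  case less
  have p0: "p \<noteq> 0"
    using less.prems by (simp add: real_simple_def)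
  show ?case
  proof (cases "degree p = 0")
    case True
    then obtain c where "p = [:c:]"
      by (rule degree_eq_zeroE)
    with p0 show ?thesis
      by (auto simp: order_0I)
  next
    case False
    have "degree (map_poly complex_of_real p) = degree p"
      by (intro degree_map_poly) simp
    then obtain z where z: "cpoly p z = 0"
      using False alg_closed_imp_poly_has_root[of "map_poly complex_of_real p"]
      unfolding cpoly_def by auto
    then have "z \<in> \<real>"
      using less.prems by (simp add: real_simple_def)
    then obtain x where x: "poly p x = 0"
      using z by (auto elim!: Reals_cases)
    define k where "k = lin_quot p x"
    have k: "p = [:- x, 1:] * k"
      unfolding k_def by (rule lin_quot_eq[OF x])
    have deg: "degree p = Suc (degree k)"
      unfolding k_def by (rule degree_lin_quot[OF x p0])
    have IH: "degree k = order 0 k + card {y. y \<noteq> 0 \<and> poly k y = 0}"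
      using less.hyps[of k] deg real_simple_lin_quot[OF less.prems x] by (simp add: k_def)
    have k0: "k \<noteq> 0"
      using p0 k by auto
    have ord: "order 0 p = order 0 [:- x, 1:] + order 0 k"
      using k p0 order_mult by metis
    have fin: "finite {y. y \<noteq> 0 \<and> poly k y = 0}"
      by (rule finite_subset[OF _ poly_roots_finite[OF k0]]) auto
    have pk: "poly p y = (y - x) * poly k y" for y
      unfolding k_def by (rule poly_lin_quot[OF x])
    show ?thesis
    proof (cases "x = 0")
      case True
      have "order 0 [:- x, 1:] = 1"
        using order_power_n_n[of "0::real" 1] True by simp
      moreover have "{y. y \<noteq> 0 \<and> poly p y = 0} = {y. y \<noteq> 0 \<and> poly k y = 0}"
        using True by (auto simp: pk)
      ultimately show ?thesis
        using ord IH deg by simp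
    next
      case False
      have "order 0 [:- x, 1:] = 0"
        using False by (intro order_0I) simp
      moreover have "poly k x \<noteq> 0"
        using less.prems x False poly_pderiv_eq_lin_quot[OF x] unfolding real_simple_def k_def by metis
      then have "{y. y \<noteq> 0 \<and> poly p y = 0} = insert x {y. y \<noteq> 0 \<and> poly k y = 0}"
        "x \<notin> {y. y \<noteq> 0 \<and> poly k y = 0}"
        using False by (auto simp: pk)
      ultimately show ?thesis
        using ord IH deg fin by simp
    qed
  qed
qed

lemma card_nonzero_roots_le:
  fixes p :: "real poly"
  assumes "p \<noteq> 0" "degree p \<le> d" "\<And>k. k < l \<Longrightarrow> coeff p k = 0"
    and "finite X" "\<And>x. x \<in> X \<Longrightarrow> x \<noteq> 0 \<and> poly p x = 0"
  shows "l + card X \<le> d"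
proof -
  have l: "l \<le> order 0 p"
    using assms(3) coeff_order_nonzero[OF assms(1)] by (meson not_less)
  have "(\<Sum>x\<in>insert 0 X. order x p) \<le> (\<Sum>x\<in>insert 0 {x. poly p x = 0}. order x p)"
    using assms(1,5) by (intro sum_mono2) (auto simp: poly_roots_finite)
  also have "\<dots> = (\<Sum>x | poly p x = 0. order x p)"
    using assms(1) by (cases "poly p 0 = 0") (auto simp: insert_absorb poly_roots_finite order_0I)
  also have "\<dots> \<le> degree p"
    using assms(1) by (rule sum_order_le_degree)
  finally have "(\<Sum>x\<in>insert 0 X. order x p) \<le> degree p" .
  moreover have "(\<Sum>x\<in>insert 0 X. order x p) = order 0 p + (\<Sum>x\<in>X. order x p)"
    using assms(4,5) by (subst sum.insert) auto
  moreover have "card X \<le> (\<Sum>x\<in>X. order x p)"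
  proof -
    have "(\<Sum>x\<in>X. 1) \<le> (\<Sum>x\<in>X. order x p)"
      using assms(1,5) by (intro sum_mono) (simp add: Suc_le_eq order_gt_0_iff)
    then show ?thesis
      by simp
  qed
  ultimately show ?thesis
    using l assms(2) by linarith
qed

lemma coeff_lin_quot_below_order:
  assumes "poly p x = 0" "x \<noteq> 0" "k < order 0 p"
  shows "coeff (lin_quot p x) k = 0"
  using assms(3)
proof (induction k)
  case 0
  then show ?case
    using coeff_lin_quot(2)[OF assms(1)] coeff_below_order[of 0 p] assms(2) by simp
next
  case (Suc k)
  then show ?case
    using coeff_lin_quot(1)[OF assms(1), of k] coeff_below_order[of "Suc k" p] assms(2) by simp
qed

lemma coeff_lin_quot_0:
  assumes "poly p 0 = 0"
  shows "coeff (lin_quot p 0) k = coeff p (Suc k)"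
  using coeff_lin_quot(1)[OF assms, of k] by simp

text \<open>The difference D of the two sides has degree below that of T, vanishes at the origin to
  the order of T, and vanishes at every nonzero zero of T. By \<open>real_simple_degree\<close>
  these are too many zeros, so D = 0. The assumption on the low coefficients says that S/T has at
  most a simple pole at the origin, even where T has a multiple zero.\<close>

lemma partial_fractions:
  assumes T: "real_simple T" and deg: "degree S \<le> Suc (degree T)"
    and low: "\<And>k. Suc k < order 0 T \<Longrightarrow> coeff S k = 0"
  obtains e c w where
    "S = smult (- e) (pCons 0 T) + smult c T + (\<Sum>x | poly T x = 0. smult (w x) (lin_quot T x))"
    "\<And>x. x \<noteq> 0 \<Longrightarrow> poly T x = 0 \<Longrightarrow> w x * poly (pderiv T) x = poly S x"
    "poly T 0 = 0 \<Longrightarrow> w 0 * coeff T (order 0 T) = coeff S (order 0 T - 1)"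
    "- e * lead_coeff T = coeff S (Suc (degree T))"
    "e = 0 \<Longrightarrow> c * lead_coeff T = coeff S (degree T)"
proof -
  have T0: "T \<noteq> 0"
    using T by (simp add: real_simple_def)
  have simple: "poly (pderiv T) x \<noteq> 0" if "x \<noteq> 0" "poly T x = 0" for x
    using T that by (simp add: real_simple_def)
  define d where "d = degree T"
  define l where "l = order 0 T"
  define e where "e = - coeff S (Suc d) / lead_coeff T"
  define c where "c = (coeff S d + e * coeff (pCons 0 T) d) / lead_coeff T"
  \<comment> \<open>Off the origin the residue is S/T'. At the origin T' may vanish, and the residue
    is the quotient of the lowest relevant coefficients.\<close>
  define w where "w x = (if x = 0 then coeff S (l - 1) / coeff T l
    else poly S x / poly (pderiv T) x)" for x
  define D where "D = S - (smult (- e) (pCons 0 T) + smult c T +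
    (\<Sum>x | poly T x = 0. smult (w x) (lin_quot T x)))"
  have lc: "lead_coeff T \<noteq> 0" and lT: "coeff T l \<noteq> 0"
    using T0 coeff_order_nonzero[OF T0] by (auto simp: l_def)
  have fin: "finite {x. poly T x = 0}"
    using T0 by (rule poly_roots_finite)
  have coeffD: "coeff D k = coeff S k + e * coeff (pCons 0 T) k - c * coeff T k -
      (\<Sum>x | poly T x = 0. w x * coeff (lin_quot T x) k)" for k
    unfolding D_def coeff_diff coeff_add coeff_smult coeff_sum by simp
  have lin_quot_high: "coeff (lin_quot T x) k = 0" if "poly T x = 0" "k \<ge> d" for x k
    using degree_lin_quot[OF that(1) T0] that(2) by (intro coeff_eq_0) (simp add: d_def)
  have high: "coeff D k = 0" if k: "k \<ge> d" for k
  proof -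
    have s: "(\<Sum>x | poly T x = 0. w x * coeff (lin_quot T x) k) = 0"
      using lin_quot_high k by (intro sum.neutral) auto
    consider "k = d" | "k = Suc d" | "k > Suc d"
      using k by linarith
    then show ?thesis
    proof cases
      case 1
      then show ?thesis
        using lc unfolding coeffD s by (simp add: c_def d_def)
    next
      case 2
      then show ?thesis
        using lc unfolding coeffD s by (simp add: e_def d_def coeff_eq_0)
    next
      case 3
      then have "coeff S k = 0" "coeff T k = 0" "coeff (pCons 0 T) k = 0"
        using deg by (auto simp: d_def coeff_eq_0 coeff_pCons split: nat.splits)
      then show ?thesis
        by (simp add: coeffD s)
    qed
  qed
  have lowD: "coeff D k = 0" if k: "k < l" for k
  proof -
    have pT: "coeff (pCons 0 T) k = 0" "coeff T k = 0"
      using k coeff_below_order[of _ T] by (auto simp: l_def coeff_pCons split: nat.splits)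
    have T00: "poly T 0 = 0"
      using k T0 coeff_below_order[of 0 T] by (simp add: l_def poly_0_coeff_0)
    have "(\<Sum>x | poly T x = 0. w x * coeff (lin_quot T x) k) =
        (\<Sum>x\<in>{0}. w x * coeff (lin_quot T x) k)"
      using fin T00 k coeff_lin_quot_below_order[of T _ k]
      by (intro sum.mono_neutral_right) (auto simp: l_def)
    then have s: "(\<Sum>x | poly T x = 0. w x * coeff (lin_quot T x) k) = w 0 * coeff T (Suc k)"
      by (simp add: coeff_lin_quot_0[OF T00])
    show ?thesis
    proof (cases "Suc k = l")
      case True
      then show ?thesis
        using lT pT unfolding coeffD s by (auto simp: w_def)
    next
      case False
      then have "Suc k < l"
        using k by simp
      then show ?thesis
        using low[of k] coeff_below_order[of "Suc k" T] pT unfolding coeffD s by (simp add: l_def)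
    qed
  qed
  have rootD: "poly D x = 0" if x: "x \<noteq> 0" "poly T x = 0" for x
  proof -
    have "poly (lin_quot T y) x = 0" if "poly T y = 0" "y \<noteq> x" for y
      using poly_lin_quot[OF that(1), of x] x that(2) by simp
    then have "(\<Sum>y | poly T y = 0. w y * poly (lin_quot T y) x) = (\<Sum>y\<in>{x}. w y * poly (lin_quot T y) x)"
      using fin x by (intro sum.mono_neutral_right) auto
    then have "(\<Sum>y | poly T y = 0. w y * poly (lin_quot T y) x) = poly S x"
      using x simple[OF x] poly_pderiv_eq_lin_quot[OF x(2)] by (simp add: w_def)
    then show ?thesis
      using x by (simp add: D_def poly_sum)
  qed
  have "D = 0"
  proof (rule ccontr)
    assume D0: "D \<noteq> 0"
    then have "degree D < d"
      using high by (meson leading_coeff_0_iff not_less)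
    moreover have "l + card {x. x \<noteq> 0 \<and> poly T x = 0} \<le> degree D"
      using fin by (intro card_nonzero_roots_le[OF D0]) (auto intro: lowD rootD)
    ultimately show False
      using real_simple_degree[OF T] by (simp add: d_def l_def)
  qed
  show ?thesis
  proof (rule that[of e c w])
    show "S = smult (- e) (pCons 0 T) + smult c T + (\<Sum>x | poly T x = 0. smult (w x) (lin_quot T x))"
      using \<open>D = 0\<close> by (simp add: D_def)
    show "w x * poly (pderiv T) x = poly S x" if "x \<noteq> 0" "poly T x = 0" for x
      using simple[OF that] that by (simp add: w_def)
    show "w 0 * coeff T (order 0 T) = coeff S (order 0 T - 1)"
      using lT by (simp add: w_def l_def)
    show "- e * lead_coeff T = coeff S (Suc (degree T))"
      using lc by (simp add: e_def d_def)
    show "c * lead_coeff T = coeff S (degree T)" if "e = 0"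
      using lc that by (simp add: c_def d_def)
  qed
qed

text \<open>Zeros found by sign changes are certified to be all the zeros by counting.\<close>

lemma sep_by_count:
  fixes p :: "real poly"
  assumes p0: "p \<noteq> 0" and deg: "degree p \<le> d" and low: "\<And>k. k < l \<Longrightarrow> coeff p k = 0"
    and fin: "finite J" and card: "d \<le> l + card J"
    and root: "\<And>j. j \<in> J \<Longrightarrow> \<rho> j \<noteq> 0 \<and> poly p (\<rho> j) = 0"
    and separated: "\<And>i j. i \<in> J \<Longrightarrow> j \<in> J \<Longrightarrow> i \<noteq> j \<Longrightarrow> q \<le> \<rho> i / \<rho> j \<Longrightarrow> \<not> \<rho> i / \<rho> j \<le> 1"
    and q: "0 < q" "q \<le> 1"
  shows "sep q p"
proof -
  have inj: "inj_on \<rho> J"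
    using separated root q(2) by (intro inj_onI) (metis divide_self order_refl)
  have lp: "l \<le> order 0 p"
    using low coeff_order_nonzero[OF p0] by (meson not_less)
  define X where "X = \<rho> ` J"
  have X: "finite X" "card X = card J" "\<And>x. x \<in> X \<Longrightarrow> x \<noteq> 0 \<and> poly p x = 0"
    using fin inj root by (auto simp: X_def card_image)
  have fac: "\<exists>r. p = monom 1 l * (\<Prod>x\<in>Y. [:- x, 1:]) * r"
    if "Y \<subseteq> X" for Y
    using finite_subset[OF that X(1)] that
  proof (induction Y rule: finite_induct)
    case empty
    have "[:- 0, 1:] ^ l dvd p"
      using lp by (simp add: order_divides del: minus_zero)
    then show ?case
      by (auto simp: monom_altdef elim!: dvdE)
  next
    case (insert y Y)
    then obtain r where r: "p = monom 1 l * (\<Prod>x\<in>Y. [:- x, 1:]) * r"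
      by auto
    have "poly p y = 0" "y \<noteq> 0"
      using insert.prems X(3) by auto
    then have "y ^ l * (\<Prod>x\<in>Y. y - x) * poly r y = 0"
      by (subst (asm) r) (simp add: poly_monom poly_prod)
    then have "poly r y = 0"
      using insert.hyps \<open>y \<noteq> 0\<close> by auto
    then obtain k where k: "r = [:- y, 1:] * k"
      using lin_quot_eq by blast
    have "p = monom 1 l * (\<Prod>x\<in>insert y Y. [:- x, 1:]) * k"
      unfolding r k using insert.hyps by (simp add: mult.assoc mult.left_commute del: mult_pCons_left mult_pCons_right)
    then show ?case
      by blast
  qed
  then obtain r where r: "p = monom 1 l * (\<Prod>x\<in>X. [:- x, 1:]) * r"
    by blast
  have r0: "r \<noteq> 0"
    using r p0 by auto
  have "degree (\<Prod>x\<in>X. [:- x, 1:]) = card X"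
    by (subst degree_prod_eq_sum_degree) auto
  moreover have "(\<Prod>x\<in>X. [:- x, 1::real:]) \<noteq> 0"
    using X(1) by auto
  ultimately have "degree p = l + card X + degree r"
    using r r0 by (simp add: degree_mult_eq degree_monom_eq)
  then have "degree r = 0"
    using deg card X(2) by simp
  then obtain a where a: "r = [:a:]" "a \<noteq> 0"
    using r0 by (metis degree_eq_zeroE pCons_0_0)
  have cevp: "cpoly p z = z ^ l * (\<Prod>x\<in>X. z - of_real x) * of_real a" for z
  proof -
    have "cpoly (\<Prod>x\<in>X. [:- x, 1:]) z = (\<Prod>x\<in>X. z - of_real x)"
      by (induction X rule: infinite_finite_induct) (auto simp del: mult_pCons_left)
    then show ?thesis
      by (subst r) (simp add: a)
  qed
  have roots: "x \<in> X" if "poly p x = 0" "x \<noteq> 0" for x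
    using cevp[of "of_real x"] that X(1) a(2) by auto
  have real: "z \<in> \<real>" if "cpoly p z = 0" for z
    using cevp[of z] that X(1) a(2) by auto
  have "poly (pderiv p) x \<noteq> 0" if x: "x \<noteq> 0" "poly p x = 0" for x
  proof -
    have xX: "x \<in> X"
      using roots x by blast
    define m where "m = monom 1 l * (\<Prod>y\<in>X - {x}. [:- y, 1:]) * r"
    have "p = [:- x, 1:] * m"
      unfolding m_def
      by (subst r, subst prod.remove[OF X(1) xX])
        (simp add: mult.assoc mult.left_commute del: mult_pCons_left mult_pCons_right)
    then have "poly (pderiv p) x = poly m x"
      by (simp add: pderiv_mult pderiv_pCons del: mult_pCons_left)
    also have "\<dots> = x ^ l * (\<Prod>y\<in>X - {x}. x - y) * a"
      by (simp add: m_def poly_monom poly_prod a del: mult_pCons_left)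
    finally have "poly (pderiv p) x = x ^ l * (\<Prod>y\<in>X - {x}. x - y) * a" .
    then show ?thesis
      using x(1) a(2) X(1) by simp
  qed
  then have "real_simple p"
    using p0 real by (simp add: real_simple_def)
  moreover have "\<not> y / x \<le> 1"
    if h: "poly p x = 0" "poly p y = 0" "x \<noteq> 0" "y \<noteq> x" "q \<le> y / x" for x y
  proof
    assume y1: "y / x \<le> 1"
    show False
    proof (cases "y = 0")
      case True
      then show ?thesis
        using q(1) h(5) by simp
    next
      case False
      then obtain i j where "i \<in> J" "j \<in> J" "y = \<rho> i" "x = \<rho> j"
        using roots[of x] roots[of y] h by (auto simp: X_def)
      then show ?thesis
        using separated[of i j] h y1 by auto
    qed
  qed
  ultimately show ?thesis
    unfolding sep_def by blast
qed

subsection \<open>Convolution and the polynomials \<open>R\<^sub>n(q)\<close>\<close>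

text \<open>One factor is a sequence rather than a polynomial, so that dilations
  \<open>c ^ k\<close>, shifts and quotients of coefficients all act as multipliers without a bound
  on their length.\<close>

definition hprod :: "real poly \<Rightarrow> (nat \<Rightarrow> real) \<Rightarrow> real poly"
  where "hprod p b = (\<Sum>k\<le>degree p. monom (coeff p k * b k) k)"

lemma coeff_hprod [simp]: "coeff (hprod p b) k = coeff p k * b k"
  by (auto simp: hprod_def coeff_sum coeff_eq_0 not_le)

lemma hprod_0 [simp]: "hprod 0 b = 0"
  by (rule poly_eqI) simp

lemma hprod_add: "hprod (p + r) b = hprod p b + hprod r b"
  by (rule poly_eqI) (simp add: algebra_simps)

lemma hprod_smult: "hprod (smult c p) b = smult c (hprod p b)"
  by (rule poly_eqI) simp

lemma hprod_sum: "hprod (\<Sum>i\<in>A. f i) b = (\<Sum>i\<in>A. hprod (f i) b)"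
  by (rule poly_eqI) (simp add: coeff_sum sum_distrib_right)

lemma hprod_pCons_0: "hprod (pCons 0 p) b = pCons 0 (hprod p (\<lambda>k. b (Suc k)))"
  by (rule poly_eqI) (simp add: coeff_pCons split: nat.splits)

lemma hprod_hprod: "hprod (hprod p a) b = hprod p (\<lambda>k. a k * b k)"
  by (rule poly_eqI) (simp add: algebra_simps)

lemma degree_hprod_le: "degree (hprod p b) \<le> degree p"
  by (rule degree_le) (simp add: coeff_eq_0)

text \<open>The polar decomposition behind the induction: a zero of the first factor splits the
  convolution into one with the sequence and one with the shifted sequence.\<close>

lemma hprod_lin_quot:
  assumes "poly p x = 0"
  shows "hprod p b = pCons 0 (hprod (lin_quot p x) (\<lambda>k. b (Suc k))) - smult x (hprod (lin_quot p x) b)"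
  by (rule poly_eqI)
    (simp add: coeff_lin_quot[OF assms] coeff_pCons algebra_simps split: nat.splits)

abbreviation (input) shift_seq :: "(nat \<Rightarrow> real) \<Rightarrow> nat \<Rightarrow> real"
  where "shift_seq b \<equiv> \<lambda>k. b (Suc k)"

lemma cpoly_hprod_lin_quot:
  assumes "poly p x = 0"
  shows "cpoly (hprod p b) z = z * cpoly (hprod (lin_quot p x) (shift_seq b)) z - of_real x * cpoly (hprod (lin_quot p x) b) z"
  by (simp add: hprod_lin_quot[OF assms])

lemma R_poly_0 [simp]: "R_poly 0 q = 1"
  by (simp add: R_poly_def)

lemma R_poly_Suc: "R_poly (Suc n) q = R_poly n q * [:1, q ^ n:]"
  by (simp add: R_poly_def)

lemma degree_R_poly_le: "degree (R_poly n q) \<le> n"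
proof (induction n)
  case (Suc n)
  have "degree (R_poly (Suc n) q) \<le> degree (R_poly n q) + degree [:1, q ^ n:]"
    unfolding R_poly_Suc by (rule degree_mult_le)
  moreover have "degree [:1, q ^ n:] \<le> 1"
    by simp
  ultimately show ?case
    using Suc by linarith
qed simp

lemma coeff_R_poly_gt: "n < k \<Longrightarrow> coeff (R_poly n q) k = 0"
  using degree_R_poly_le[of n q] by (intro coeff_eq_0) simp

lemma coeff_R_poly_Suc:
  "coeff (R_poly (Suc n) q) (Suc k) = coeff (R_poly n q) (Suc k) + q ^ n * coeff (R_poly n q) k"
  by (simp add: R_poly_Suc coeff_pCons)

lemma coeff_R_poly_0 [simp]: "coeff (R_poly n q) 0 = 1"
  by (induction n) (simp_all add: R_poly_Suc)

text \<open>The second q-Pascal rule. \<open>coeff_R_poly_Suc\<close> splits off the last factor of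
  the product, this one the first: \<open>R_(n+1)(z) = (1 + z) R_n(q z)\<close>. Comparing the two
  determines the ratio of neighbouring coefficients.\<close>

lemma coeff_R_poly_Suc':
  "coeff (R_poly (Suc n) q) (Suc k) =
    q ^ Suc k * coeff (R_poly n q) (Suc k) + q ^ k * coeff (R_poly n q) k"
proof (induction n arbitrary: k)
  case 0
  then show ?case
    by (cases k) (simp_all add: coeff_R_poly_Suc)
next
  case (Suc n)
  show ?case
  proof (cases k)
    case 0
    have "q * (coeff (R_poly n q) 1 + q ^ n) = q * (q * coeff (R_poly n q) 1 + 1)"
      using Suc[of 0] coeff_R_poly_Suc[of n q 0] by simp
    then show ?thesis
      using 0 Suc[of 0] coeff_R_poly_Suc[of "Suc n" q 0] coeff_R_poly_Suc[of n q 0]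
      by (simp add: distrib_left del: mult_cancel_left)
  next
    case (Suc j)
    have "coeff (R_poly (Suc (Suc n)) q) (Suc k) =
        q ^ Suc k * coeff (R_poly n q) (Suc k) + q ^ k * coeff (R_poly n q) k +
        q ^ Suc n * (q ^ k * coeff (R_poly n q) k + q ^ j * coeff (R_poly n q) j)"
      using coeff_R_poly_Suc[of "Suc n" q k] Suc.IH[of k] Suc.IH[of j] Suc by simp
    also have "\<dots> = q ^ Suc k * (coeff (R_poly n q) (Suc k) + q ^ n * coeff (R_poly n q) k) +
        q ^ k * (coeff (R_poly n q) (Suc j) + q ^ n * coeff (R_poly n q) j)"
      using Suc by (simp add: algebra_simps)
    also have "\<dots> = q ^ Suc k * coeff (R_poly (Suc n) q) (Suc k) + q ^ k * coeff (R_poly (Suc n) q) k"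
      using coeff_R_poly_Suc[of n q] Suc by simp
    finally show ?thesis .
  qed
qed

lemma coeff_R_poly_pos:
  assumes "0 < q" "k \<le> n"
  shows "coeff (R_poly n q) k > 0"
  using assms(2)
proof (induction n arbitrary: k)
  case (Suc n)
  show ?case
  proof (cases k)
    case (Suc j)
    have "coeff (R_poly n q) (Suc j) \<ge> 0"
      using Suc.IH[of "Suc j"] coeff_R_poly_gt[of n "Suc j" q]
      by (cases "Suc j \<le> n") (auto simp: less_imp_le)
    moreover have "coeff (R_poly n q) j > 0"
      using Suc.IH[of j] Suc.prems Suc by simp
    ultimately show ?thesis
      using assms(1) Suc coeff_R_poly_Suc[of n q j] by (simp add: add_nonneg_pos)
  qed simp
qed simp

text \<open>The absorption identity of q-binomial coefficients. Up to a power of q, the factor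
  \<open>1 - q ^ Suc k\<close> is what a q-difference multiplies the coefficient at
  \<open>Suc k\<close> by; this is how the shift of a sequence becomes such an operator.\<close>

lemma coeff_R_poly_shift:
  "(1 - q ^ Suc n) * (q ^ k * coeff (R_poly n q) k) =
    coeff (R_poly (Suc n) q) (Suc k) * (1 - q ^ Suc k)"
proof -
  let ?X = "coeff (R_poly n q) (Suc k)" and ?Y = "coeff (R_poly n q) k"
  have "?X + q ^ n * ?Y = q ^ Suc k * ?X + q ^ k * ?Y"
    using coeff_R_poly_Suc[of n q k] coeff_R_poly_Suc'[of n q k] by simp
  then have "?X * (1 - q ^ Suc k) = ?Y * (q ^ k - q ^ n)"
    by (simp add: algebra_simps)
  moreover have "coeff (R_poly (Suc n) q) (Suc k) * (1 - q ^ Suc k) =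
      ?X * (1 - q ^ Suc k) + q ^ n * ?Y * (1 - q ^ Suc k)"
    by (simp add: coeff_R_poly_Suc algebra_simps)
  ultimately show ?thesis
    by (simp add: algebra_simps)
qed

lemma coeff_R_poly_trunc:
  assumes "0 < q"
  shows "(1 - q ^ Suc n) * coeff (R_poly n q) k =
    coeff (R_poly (Suc n) q) k * (1 - q ^ Suc n / q ^ k)"
proof (cases k)
  case (Suc j)
  have "(1 - q ^ Suc n) * coeff (R_poly n q) k =
      (1 - q ^ Suc n) * coeff (R_poly (Suc n) q) k - q ^ n * ((1 - q ^ Suc n) * coeff (R_poly n q) j)"
    using coeff_R_poly_Suc[of n q j] Suc by (simp add: algebra_simps)
  also have "(1 - q ^ Suc n) * coeff (R_poly n q) j =
      coeff (R_poly (Suc n) q) k * (1 - q ^ k) / q ^ j"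
    using coeff_R_poly_shift[of q n j] assms Suc by (simp add: field_simps)
  finally show ?thesis
    using assms Suc by (simp add: field_simps)
qed simp

definition lift :: "real \<Rightarrow> nat \<Rightarrow> (nat \<Rightarrow> real) \<Rightarrow> real poly"
  where "lift q n a = hprod (R_poly n q) a"

lemma coeff_lift [simp]: "coeff (lift q n a) k = coeff (R_poly n q) k * a k"
  by (simp add: lift_def)

lemma degree_lift_le: "degree (lift q n a) \<le> n"
  unfolding lift_def using degree_hprod_le degree_R_poly_le order_trans by blast

lemma ex_lift:
  assumes "0 < q" "degree p \<le> n"
  obtains a where "p = lift q n a"
proof
  show "p = lift q n (\<lambda>k. coeff p k / coeff (R_poly n q) k)"
  proof (rule poly_eqI)
    show "coeff p k = coeff (lift q n (\<lambda>k. coeff p k / coeff (R_poly n q) k)) k" for k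
      using coeff_R_poly_pos[OF assms(1), of k n] assms(2)
      by (cases "k \<le> n") (auto simp: coeff_eq_0)
  qed
qed

section \<open>Dilations and the q-difference operator\<close>

lemma cpoly_dilate: "cpoly (hprod p (\<lambda>k. c ^ k)) z = cpoly p (of_real c * z)"
  using cpoly_altdef[OF degree_hprod_le[of p "\<lambda>k. c ^ k"], of z]
    cpoly_altdef[of p "degree p" "of_real c * z"]
  by (simp add: power_mult_distrib mult.assoc)

lemma poly_dilate: "poly (hprod p (\<lambda>k. c ^ k)) (x::real) = poly p (c * x)"
  using poly_altdef_le[OF degree_hprod_le[of p "\<lambda>k. c ^ k"], of x]
    poly_altdef_le[of p "degree p" "c * x"]
  by (simp add: power_mult_distrib mult.assoc)

text \<open>\<open>(F(z/q) - F(z)) / z\<close>, a q-analogue of the derivative;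
  \<open>poly_shift 1\<close> is the division by z, exact because the constant coefficients
  cancel.\<close>

definition qdiff :: "real \<Rightarrow> real poly \<Rightarrow> real poly"
  where "qdiff q F = poly_shift 1 (hprod F (\<lambda>k. (1 / q) ^ k - 1))"

lemma pCons_qdiff: "pCons 0 (qdiff q F) = hprod F (\<lambda>k. (1 / q) ^ k) - F"
  by (rule poly_eqI) (auto simp: qdiff_def coeff_pCons coeff_poly_shift algebra_simps split: nat.splits)

lemma coeff_qdiff: "coeff (qdiff q F) k = coeff F (Suc k) * ((1 / q) ^ Suc k - 1)"
  by (simp add: qdiff_def coeff_poly_shift)

lemma poly_qdiff: "x * poly (qdiff q F) x = poly F (x / q) - poly F x"
  using arg_cong[OF pCons_qdiff[of q F], of "\<lambda>p. poly p x"] by (simp add: poly_dilate)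

text \<open>With N = Suc n and F the longer convolution, the right-hand side is
  \<open>F(z) - q^N F(z/q)\<close>, whose coefficient at z^N cancels: a q-analogue of Laguerre's
  \<open>N F - z F'\<close>.\<close>

lemma lift_trunc:
  assumes "0 < q"
  shows "smult (1 - q ^ Suc n) (lift q n f) =
    smult (1 - q ^ Suc n) (lift q (Suc n) f) - smult (q ^ Suc n) (pCons 0 (qdiff q (lift q (Suc n) f)))"
proof (rule poly_eqI)
  fix k
  have "coeff (smult (1 - q ^ Suc n) (lift q n f)) k =
      coeff (R_poly (Suc n) q) k * (1 - q ^ Suc n / q ^ k) * f k"
    using coeff_R_poly_trunc[OF assms, of n k] by (simp flip: mult.assoc)
  then show "coeff (smult (1 - q ^ Suc n) (lift q n f)) k =
      coeff (smult (1 - q ^ Suc n) (lift q (Suc n) f) -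
        smult (q ^ Suc n) (pCons 0 (qdiff q (lift q (Suc n) f)))) k"
    by (simp add: pCons_qdiff algebra_simps power_one_over divide_inverse power_inverse)
qed

text \<open>The q-difference kills the constant coefficient, and absorption turns the remaining
  weights of R_(n+1) into those of R_n with the same q.\<close>

lemma lift_shift:
  assumes "0 < q"
  shows "smult (1 - q ^ Suc n) (lift q n (shift_seq f)) = smult q (qdiff q (lift q (Suc n) f))"
proof (rule poly_eqI)
  fix k
  have "q ^ k * ((1 - q ^ Suc n) * coeff (R_poly n q) k) =
      coeff (R_poly (Suc n) q) (Suc k) * (1 - q ^ Suc k)"
    using coeff_R_poly_shift[of q n k] by (simp only: mult.left_commute)
  then have "(1 - q ^ Suc n) * coeff (R_poly n q) k =
      coeff (R_poly (Suc n) q) (Suc k) * (1 - q ^ Suc k) / q ^ k"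
    using assms by (simp add: nonzero_eq_divide_eq mult.commute)
  also have "\<dots> = q * (coeff (R_poly (Suc n) q) (Suc k) * ((1 / q) ^ Suc k - 1))"
    using assms by (simp add: field_simps)
  finally show "coeff (smult (1 - q ^ Suc n) (lift q n (shift_seq f))) k =
      coeff (smult q (qdiff q (lift q (Suc n) f))) k"
    by (simp add: coeff_qdiff mult.assoc mult.commute mult.left_commute)
qed

section \<open>Signs of a separated polynomial near one of its zeros\<close>

lemma sep_no_root_near:
  assumes "sep q F" "poly F p = 0" "p \<noteq> 0" "y \<noteq> p" "poly F y = 0" "0 < q"
  shows "\<not> (q \<le> y / p \<and> y / p \<le> 1 / q)"
proof
  assume y: "q \<le> y / p \<and> y / p \<le> 1 / q"
  then have y0: "y \<noteq> 0"
    using assms(6) by auto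
  show False
  proof (cases "y / p \<le> 1")
    case True
    then show ?thesis
      using assms y unfolding sep_def by blast
  next
    case False
    have "p / y = 1 / (y / p)"
      by simp
    moreover have "1 / (y / p) \<le> 1" "q \<le> 1 / (y / p)"
      using y assms(6) False by (auto simp: field_simps simp del: divide_divide_eq_right)
    ultimately have "p / y \<le> 1" "q \<le> p / y"
      by auto
    then show ?thesis
      using assms y0 unfolding sep_def by blast
  qed
qed

text \<open>The points whose ratio to p lies in [q, 1/q] form an interval in which p is the only
  zero of F, and p is simple; so the cofactor of \<open>z - p\<close> keeps its sign there.\<close>

lemma lin_quot_sign_near:
  assumes F: "sep q F" and p: "poly F p = 0" "p \<noteq> 0" and q: "0 < q"
    and a: "q \<le> a / p" "a / p \<le> 1 / q" and b: "q \<le> b / p" "b / p \<le> 1 / q"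
  shows "poly (lin_quot F p) a * poly (lin_quot F p) b > 0"
proof (rule poly_same_sign)
  fix t assume t: "t \<in> closed_segment a b"
  obtain u where u: "0 \<le> u" "u \<le> 1" "t = (1 - u) * a + u * b"
    using t by (auto simp: in_segment)
  then have "t / p \<in> closed_segment (a / p) (b / p)"
    by (auto simp: in_segment add_divide_distrib intro!: exI[of _ u])
  then have tp: "q \<le> t / p" "t / p \<le> 1 / q"
    using a b by (auto simp: closed_segment_eq_real_ivl split: if_splits)
  show "poly (lin_quot F p) t \<noteq> 0"
  proof
    assume 0: "poly (lin_quot F p) t = 0"
    show False
    proof (cases "t = p")
      case True
      then show ?thesis
        using 0 F p poly_pderiv_eq_lin_quot[OF p(1)] unfolding sep_def real_simple_def by metis
    next
      case False
      then show ?thesis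
        using sep_no_root_near[OF F p False _ q] tp poly_lin_quot[OF p(1), of t] 0 by simp
    qed
  qed
qed

text \<open>The zero p lies between a and a/q and is the only sign change of F there, so
  \<open>F(a) F(a/q) <= 0\<close>; proportionality with a positive factor would make both values
  vanish. With Q = 1 this keeps the zeros of the q-difference, and with Q = q^N those of the
  truncation, away from the zeros of F.\<close>

lemma sep_dilate_no_common:
  assumes F: "sep q F" and p: "poly F p = 0" "p \<noteq> 0" and q: "0 < q" "q < 1"
    and a: "q \<le> a / p" "a / p \<le> 1" and Q: "Q > 0"
  shows "poly F a \<noteq> Q * poly F (a / q)"
proof
  assume eq: "poly F a = Q * poly F (a / q)"
  have r: "q \<le> a / q / p" "a / q / p \<le> 1 / q" "a / p \<le> 1 / q"
  proof -
    define s where "s = a / p"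
    have s: "q \<le> s" "s \<le> 1" "a / q / p = s / q"
      using a by (auto simp: s_def)
    have "q * q \<le> q * 1"
      using q by (intro mult_left_mono) auto
    then have "q * q \<le> s"
      using s by simp
    then have "q \<le> s / q" "s / q \<le> 1 / q"
      using s q by (auto simp: le_divide_eq divide_right_mono intro: order_trans)
    moreover have "1 \<le> 1 / q"
      using q by simp
    ultimately show "q \<le> a / q / p" "a / q / p \<le> 1 / q" "a / p \<le> 1 / q"
      unfolding s(3) s_def[symmetric] using s by auto
  qed
  have K: "poly (lin_quot F p) a * poly (lin_quot F p) (a / q) > 0"
    using lin_quot_sign_near[OF F p q(1) a(1) r(3) r(1) r(2)] .
  have "(a - p) * (a / q - p) = p\<^sup>2 * ((a / p - 1) * (a / p / q - 1))"
    using p q by (simp add: field_simps power2_eq_square)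
  also have "\<dots> \<le> 0"
  proof -
    have "a / p / q - 1 \<ge> 0"
      using a q by (simp add: le_divide_eq del: divide_divide_eq_left)
    then have "(a / p - 1) * (a / p / q - 1) \<le> 0"
      using a by (intro mult_nonpos_nonneg) auto
    then show ?thesis
      by (rule mult_nonneg_nonpos[OF zero_le_power2])
  qed
  finally have "(a - p) * (a / q - p) \<le> 0" .
  then have "((a - p) * (a / q - p)) * (poly (lin_quot F p) a * poly (lin_quot F p) (a / q)) \<le> 0"
    by (rule mult_nonpos_nonneg) (use K in linarith)
  then have "poly F a * poly F (a / q) \<le> 0"
    using poly_lin_quot[OF p(1), of a] poly_lin_quot[OF p(1), of "a / q"] by (simp add: mult_ac)
  then have "Q * (poly F (a / q))\<^sup>2 \<le> 0"
    using eq by (simp add: power2_eq_square)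
  then have "poly F (a / q) = 0"
    using Q by (simp add: mult_le_0_iff)
  then have "a = p" "a / q = p"
    using eq K poly_lin_quot[OF p(1), of a] poly_lin_quot[OF p(1), of "a / q"] by auto
  then show False
    using p q by (simp add: field_simps)
qed

text \<open>The analogue of writing F'/F as the sum of \<open>1/(z - x)\<close>. At a nonzero zero x
  the weight is \<open>(1/q - 1) K(x/q) / K(x)\<close> with K the cofactor of \<open>z - x\<close>,
  and K has one sign from x to x/q. The total weight is read off the leading coefficient; its exact
  value decides the sign of the slope in \<open>sep_trunc\<close>.\<close>

lemma qdiff_expansion:
  assumes F: "sep q F" and q: "0 < q" "q < 1"
  obtains e where "qdiff q F = (\<Sum>x | poly F x = 0. smult (e x) (lin_quot F x))"
    "\<And>x. poly F x = 0 \<Longrightarrow> e x > 0"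
    "(\<Sum>x | poly F x = 0. e x) = (1 / q) ^ degree F - 1"
proof -
  have rs: "real_simple F" and F0: "F \<noteq> 0"
    using F by (auto simp: sep_def real_simple_def)
  have high: "coeff (qdiff q F) k = 0" if "k \<ge> degree F" for k
    using that by (simp add: coeff_qdiff coeff_eq_0)
  have deg: "degree (qdiff q F) \<le> Suc (degree F)"
    using high by (intro degree_le) auto
  have low: "coeff (qdiff q F) k = 0" if "Suc k < order 0 F" for k
    using coeff_below_order[OF that] by (simp add: coeff_qdiff)
  obtain e c w where w:
    "qdiff q F = smult (- e) (pCons 0 F) + smult c F + (\<Sum>x | poly F x = 0. smult (w x) (lin_quot F x))"
    "\<And>x. x \<noteq> 0 \<Longrightarrow> poly F x = 0 \<Longrightarrow> w x * poly (pderiv F) x = poly (qdiff q F) x"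
    "poly F 0 = 0 \<Longrightarrow> w 0 * coeff F (order 0 F) = coeff (qdiff q F) (order 0 F - 1)"
    "- e * lead_coeff F = coeff (qdiff q F) (Suc (degree F))"
    "e = 0 \<Longrightarrow> c * lead_coeff F = coeff (qdiff q F) (degree F)"
    using partial_fractions[OF rs deg low] by blast
  have e: "e = 0"
    using w(4) high[of "Suc (degree F)"] F0 by simp
  then have c: "c = 0"
    using w(5) high[of "degree F"] F0 by simp
  have exp: "qdiff q F = (\<Sum>x | poly F x = 0. smult (w x) (lin_quot F x))"
    using w(1) e c by simp
  show ?thesis
  proof (rule that[OF exp])
    fix x assume x: "poly F x = 0"
    show "w x > 0"
    proof (cases "x = 0")
      case True
      then have l: "order 0 F > 0"
        using x F0 by (simp add: order_gt_0_iff)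
      have "w 0 * coeff F (order 0 F) = coeff F (order 0 F) * ((1 / q) ^ order 0 F - 1)"
        using w(3) x True l by (simp add: coeff_qdiff)
      then have "w 0 = (1 / q) ^ order 0 F - 1"
        using coeff_order_nonzero[OF F0] by simp
      moreover have "(1 / q) ^ order 0 F > 1"
        using q l by (intro one_less_power) auto
      ultimately show ?thesis
        using True by simp
    next
      case False
      have "poly (lin_quot F x) x * poly (lin_quot F x) (x / q) > 0"
        using q False by (intro lin_quot_sign_near[OF F x False q(1)]) (auto simp: field_simps mult_le_one)
      moreover have "x * poly (qdiff q F) x = x * ((1 / q - 1) * poly (lin_quot F x) (x / q))"
        using poly_qdiff[of x q F] x poly_lin_quot[OF x, of "x / q"] by (simp add: algebra_simps)
      then have "w x * poly (lin_quot F x) x = (1 / q - 1) * poly (lin_quot F x) (x / q)"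
        using w(2)[OF False x] False by (simp add: poly_pderiv_eq_lin_quot[OF x])
      then have "w x * (poly (lin_quot F x) x)\<^sup>2 =
          (1 / q - 1) * (poly (lin_quot F x) x * poly (lin_quot F x) (x / q))"
        by (simp add: power2_eq_square mult.assoc mult.commute mult.left_commute)
      ultimately have "w x * (poly (lin_quot F x) x)\<^sup>2 > 0"
        using q by simp
      then show ?thesis
        by (simp add: zero_less_mult_iff)
    qed
  next
    show "(\<Sum>x | poly F x = 0. w x) = (1 / q) ^ degree F - 1"
    proof (cases "degree F")
      case 0
      then obtain a where "F = [:a:]"
        by (rule degree_eq_zeroE)
      then show ?thesis
        using 0 F0 by auto
    next
      case (Suc m)
      have "coeff (lin_quot F x) m = lead_coeff F" if "poly F x = 0" for x
        using lead_coeff_lin_quot[OF that F0] degree_lin_quot[OF that F0] Suc by simp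
      then have "(\<Sum>x | poly F x = 0. w x) * lead_coeff F = coeff (qdiff q F) m"
        by (subst exp) (simp add: coeff_sum sum_distrib_right)
      also have "\<dots> = lead_coeff F * ((1 / q) ^ degree F - 1)"
        using Suc by (simp add: coeff_qdiff)
      finally show ?thesis
        using F0 by simp
    qed
  qed
qed

subsection \<open>Interlacing of shifts and truncations\<close>

text \<open>A rational function \<open>\<kappa> z - c - \<Sum> w x / (z - x)\<close> with nonnegative weights is increasing
  between its poles, so that zeros of \<open>P\<close> are real, simple, and separated by poles.\<close>

lemma Im_of_real_divide:
  "Im (of_real a / (z - of_real x)) = - Im z * (a * (1 / (cmod (z - of_real x))\<^sup>2))"
  by (simp add: Im_divide cmod_power2)

locale increasing_fraction =
  fixes F P :: "real poly" and \<kappa> c :: real and w :: "real \<Rightarrow> real"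
  assumes F0: "F \<noteq> 0" and real: "\<And>z. cpoly F z = 0 \<Longrightarrow> z \<in> \<real>"
    and P: "P = [:- c, \<kappa>:] * F - (\<Sum>x | poly F x = 0. smult (w x) (lin_quot F x))"
    and kappa: "\<kappa> \<ge> 0" and w: "\<And>x. w x \<ge> 0"
    and nontrivial: "\<kappa> > 0 \<or> (\<exists>x. poly F x = 0 \<and> w x > 0)"
begin

lemma finite_roots: "finite {x. poly F x = 0}"
  using F0 by (rule poly_roots_finite)

lemma cpoly_eq:
  assumes "cpoly F z \<noteq> 0"
  shows "cpoly P z = cpoly F z *
    (of_real \<kappa> * z - of_real c - (\<Sum>x | poly F x = 0. of_real (w x) / (z - of_real x)))"
proof -
  have "cpoly (lin_quot F x) z = cpoly F z / (z - of_real x)" if "poly F x = 0" for x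
    using cpoly_lin_quot[OF that, of z] assms by auto
  then have "(\<Sum>x | poly F x = 0. of_real (w x) * cpoly (lin_quot F x) z) =
      cpoly F z * (\<Sum>x | poly F x = 0. of_real (w x) / (z - of_real x))"
    by (auto simp: sum_distrib_left intro!: sum.cong)
  then show ?thesis
    unfolding P cpoly_diff cpoly_mult cpoly_sum by (simp add: algebra_simps)
qed

lemma poly_eq:
  assumes "poly F t \<noteq> 0"
  shows "poly P t = poly F t * (\<kappa> * t - c - (\<Sum>x | poly F x = 0. w x / (t - x)))"
proof -
  have "poly (lin_quot F x) t = poly F t / (t - x)" if "poly F x = 0" for x
    using poly_lin_quot[OF that, of t] assms by auto
  then have "(\<Sum>x | poly F x = 0. w x * poly (lin_quot F x) t) =
      poly F t * (\<Sum>x | poly F x = 0. w x / (t - x))"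
    by (auto simp: sum_distrib_left intro!: sum.cong)
  then show ?thesis
    unfolding P poly_diff poly_mult poly_sum by (simp add: algebra_simps)
qed

text \<open>The one positivity behind all three consequences: \<phi> is \<open>1/|z - x|^2\<close>
  for imaginary parts, \<open>1/((t - x)(s - x))\<close> for difference quotients and
  \<open>1/(s - x)^2\<close> for the derivative.\<close>

lemma positive:
  assumes "\<And>x. poly F x = 0 \<Longrightarrow> \<phi> x > 0"
  shows "\<kappa> + (\<Sum>x | poly F x = 0. w x * \<phi> x) > 0"
proof -
  have nn: "(\<Sum>x | poly F x = 0. w x * \<phi> x) \<ge> 0"
    using assms w by (intro sum_nonneg mult_nonneg_nonneg) (auto simp: less_imp_le)
  show ?thesis
  proof (cases "\<kappa> > 0")
    case False
    then obtain x where x: "poly F x = 0" "w x > 0"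
      using nontrivial by auto
    have "(\<Sum>x | poly F x = 0. w x * \<phi> x) > 0"
    proof (rule sum_pos2[of _ x])
      show "0 \<le> w y * \<phi> y" if "y \<in> {x. poly F x = 0}" for y
        using assms[of y] w[of y] that by (simp add: less_imp_le)
    qed (use finite_roots x assms in auto)
    then show ?thesis
      using kappa by simp
  qed (use nn in simp)
qed

lemma roots_real:
  assumes "cpoly P z = 0"
  shows "z \<in> \<real>"
proof (rule ccontr)
  assume nr: "z \<notin> \<real>"
  then have Fz: "cpoly F z \<noteq> 0"
    using real by blast
  have Im: "Im z \<noteq> 0"
    using nr by (simp add: complex_is_Real_iff)
  have zx: "z - of_real x \<noteq> 0" for x
    using Im by (auto simp: complex_eq_iff)
  have "0 = Im (of_real \<kappa> * z - of_real c - (\<Sum>x | poly F x = 0. of_real (w x) / (z - of_real x)))"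
    using cpoly_eq[OF Fz] assms Fz by simp
  also have "\<dots> = \<kappa> * Im z - (\<Sum>x | poly F x = 0. Im (of_real (w x) / (z - of_real x)))"
    by simp
  also have "(\<Sum>x | poly F x = 0. Im (of_real (w x) / (z - of_real x))) =
      - Im z * (\<Sum>x | poly F x = 0. w x * (1 / (cmod (z - of_real x))\<^sup>2))"
    by (simp add: Im_of_real_divide sum_distrib_left)
  finally have "Im z * (\<kappa> + (\<Sum>x | poly F x = 0. w x * (1 / (cmod (z - of_real x))\<^sup>2))) = 0"
    by (simp add: algebra_simps)
  moreover have "\<kappa> + (\<Sum>x | poly F x = 0. w x * (1 / (cmod (z - of_real x))\<^sup>2)) > 0"
    using zx by (intro positive) simp
  ultimately show False
    using Im by simp
qed

lemma pole_between:
  assumes "s < t" "poly P s = 0" "poly P t = 0" "poly F s \<noteq> 0" "poly F t \<noteq> 0"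
  shows "\<exists>p. s < p \<and> p < t \<and> poly F p = 0"
proof (rule ccontr)
  assume none: "\<not> ?thesis"
  \<comment> \<open>Without a pole between them, s and t lie on the same side of every x.\<close>
  have out: "(t - x) * (s - x) > 0" if "poly F x = 0" for x
  proof -
    have "x \<noteq> s" "x \<noteq> t"
      using that assms by auto
    then have "x < s \<or> t < x"
      using none that by force
    then show ?thesis
      using assms(1) by (auto simp: zero_less_mult_iff)
  qed
  have "\<kappa> * s - c - (\<Sum>x | poly F x = 0. w x / (s - x)) = 0"
    "\<kappa> * t - c - (\<Sum>x | poly F x = 0. w x / (t - x)) = 0"
    using poly_eq assms by auto
  then have "\<kappa> * (t - s) + ((\<Sum>x | poly F x = 0. w x / (s - x)) -
      (\<Sum>x | poly F x = 0. w x / (t - x))) = 0"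
    by (simp add: algebra_simps)
  also have "(\<Sum>x | poly F x = 0. w x / (s - x)) - (\<Sum>x | poly F x = 0. w x / (t - x)) =
      (t - s) * (\<Sum>x | poly F x = 0. w x * (1 / ((t - x) * (s - x))))"
    unfolding sum_subtractf[symmetric] sum_distrib_left
  proof (rule sum.cong)
    fix x assume "x \<in> {x. poly F x = 0}"
    then have "t - x \<noteq> 0" "s - x \<noteq> 0"
      using assms by auto
    then show "w x / (s - x) - w x / (t - x) = (t - s) * (w x * (1 / ((t - x) * (s - x))))"
      by (simp add: divide_simps) (simp add: algebra_simps)
  qed simp
  finally have "(t - s) * (\<kappa> + (\<Sum>x | poly F x = 0. w x * (1 / ((t - x) * (s - x))))) = 0"
    by (simp add: algebra_simps)
  moreover have "\<kappa> + (\<Sum>x | poly F x = 0. w x * (1 / ((t - x) * (s - x)))) > 0"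
    using out by (intro positive) simp
  ultimately show False
    using assms(1) by simp
qed

lemma roots_simple:
  assumes "poly P s = 0" "poly F s \<noteq> 0"
  shows "poly (pderiv P) s \<noteq> 0"
proof
  assume d: "poly (pderiv P) s = 0"
  define U where "U = - {x. poly F x = 0}"
  have U: "open U" "s \<in> U"
    using finite_roots assms by (auto simp: U_def finite_imp_closed open_Compl)
  have "((\<lambda>t. poly P t / poly F t) has_real_derivative 0) (at s)"
    using assms d by (auto intro!: derivative_eq_intros)
  then have d1: "((\<lambda>t. \<kappa> * t - c - (\<Sum>x | poly F x = 0. w x / (t - x))) has_real_derivative 0) (at s)"
    by (rule has_field_derivative_transform_within_open[OF _ U]) (auto simp: U_def poly_eq)
  have "((\<lambda>t. w x / (t - x)) has_real_derivative - (w x * (1 / (s - x)\<^sup>2))) (at s)"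
    if "poly F x = 0" for x
  proof -
    have "s - x \<noteq> 0"
      using assms that by auto
    then show ?thesis
      using DERIV_cmult[OF DERIV_inverse'[OF DERIV_diff[OF DERIV_ident DERIV_const[of x]]], of s "w x"]
      by (simp add: divide_inverse power2_eq_square)
  qed
  then have "((\<lambda>t. \<Sum>x | poly F x = 0. w x / (t - x))
      has_real_derivative (\<Sum>x | poly F x = 0. - (w x * (1 / (s - x)\<^sup>2)))) (at s)"
    by (intro DERIV_sum) simp
  from DERIV_diff[OF DERIV_diff[OF DERIV_cmult[OF DERIV_ident, of \<kappa>] DERIV_const, of c] this]
  have d2: "((\<lambda>t. \<kappa> * t - c - (\<Sum>x | poly F x = 0. w x / (t - x)))
      has_real_derivative (\<kappa> * 1 - 0 - (\<Sum>x | poly F x = 0. - (w x * (1 / (s - x)\<^sup>2))))) (at s)" .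
  have "\<kappa> + (\<Sum>x | poly F x = 0. w x * (1 / (s - x)\<^sup>2)) = 0"
    using DERIV_unique[OF d1 d2] by (simp add: sum_negf)
  moreover have "\<kappa> + (\<Sum>x | poly F x = 0. w x * (1 / (s - x)\<^sup>2)) > 0"
    using assms by (intro positive) auto
  ultimately show False
    by simp
qed

text \<open>Two zeros of P with ratio in [q, 1] enclose a zero p of F, and then the one of smaller
  modulus has a ratio to p in [q, 1] as well, which \<open>far\<close> forbids. So separation of P
  follows from keeping its zeros away from those of F on one side.\<close>

lemma sep_transfer:
  assumes F: "sep q F" and q: "0 < q"
    and far: "\<And>a p. poly P a = 0 \<Longrightarrow> poly F p = 0 \<Longrightarrow> a \<noteq> 0 \<Longrightarrow> p \<noteq> 0 \<Longrightarrow> q \<le> a / p \<Longrightarrow> a / p \<le> 1 \<Longrightarrow> False"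
    and P0: "P \<noteq> 0" and q1: "q \<le> 1"
  shows "sep q P"
proof -
  have nF: "poly F a \<noteq> 0" if "poly P a = 0" "a \<noteq> 0" for a
    using far[OF that(1) _ that(2) that(2)] q1 that by auto
  have "real_simple P"
    unfolding real_simple_def using P0 roots_real roots_simple nF by blast
  moreover have "\<not> y / x \<le> 1"
    if h: "poly P x = 0" "poly P y = 0" "x \<noteq> 0" "y \<noteq> x" "q \<le> y / x" for x y
  proof
    assume le: "y / x \<le> 1"
    have y0: "y \<noteq> 0"
      using h q by auto
    have yx: "y / x > 0"
      using h(5) q by simp
    have Fx: "poly F x \<noteq> 0" "poly F y \<noteq> 0"
      using nF h y0 by auto
    show False
    proof (cases "x > 0")
      case True
      then have "y > 0" "y < x"
        using yx le h(4) by (auto simp: zero_less_divide_iff divide_le_eq)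
      then obtain p where p: "y < p" "p < x" "poly F p = 0"
        using pole_between[of y x] h Fx by auto
      have "q \<le> y / p"
        using h(5) p True \<open>y > 0\<close> by (smt (verit) frac_le)
      then show ?thesis
        using far[OF h(2) p(3) y0] p \<open>y > 0\<close> by simp
    next
      case False
      then have "x < 0"
        using h(3) by simp
      then have "y < 0" "x < y"
        using yx le h(4) by (auto simp: zero_less_divide_iff divide_le_eq)
      then obtain p where p: "x < p" "p < y" "poly F p = 0"
        using pole_between[of x y] h Fx by auto
      have "q \<le> (- y) / (- x)"
        using h(5) by simp
      also have "\<dots> \<le> (- y) / (- p)"
        using p \<open>y < 0\<close> \<open>x < 0\<close> by (intro frac_le) auto
      finally have "q \<le> y / p"
        by simp
      then show ?thesis
        using far[OF h(2) p(3) y0] p \<open>y < 0\<close> by (simp add: divide_le_eq)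
    qed
  qed
  ultimately show ?thesis
    unfolding sep_def by blast
qed

end

section \<open>Separation of the shifted and the truncated convolution\<close>

lemma Im_of_real_mult: "Im (of_real a * z) = a * Im z"
  by simp

lemma sep_real: "sep q F \<Longrightarrow> cpoly F z = 0 \<Longrightarrow> z \<in> \<real>"
  by (simp add: sep_def real_simple_def)

lemma sep_pCons_0:
  assumes "sep q (pCons 0 A)" "A \<noteq> 0" "0 < q"
  shows "sep q A"
proof -
  have "poly (pCons 0 A) 0 = 0"
    by simp
  moreover have "lin_quot (pCons 0 A) 0 = A"
    using lin_quot_eq[of "pCons 0 A" 0] by simp
  ultimately show ?thesis
    using sep_lin_quot[OF assms(1), of 0] by simp
qed

lemma sep_qdiff:
  assumes F: "sep q F" and q: "0 < q" "q < 1" and nz: "qdiff q F \<noteq> 0"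
  shows "sep q (qdiff q F)"
proof -
  obtain e where e: "qdiff q F = (\<Sum>x | poly F x = 0. smult (e x) (lin_quot F x))"
    "\<And>x. poly F x = 0 \<Longrightarrow> e x > 0" "(\<Sum>x | poly F x = 0. e x) = (1 / q) ^ degree F - 1"
    by (rule qdiff_expansion[OF F q]) blast
  have "{x. poly F x = 0} \<noteq> {}"
    using e(1) nz by (metis sum.empty)
  then obtain x0 where x0: "poly F x0 = 0"
    by blast
  define w where "w x = (if poly F x = 0 then e x else 0)" for x
  \<comment> \<open>The negation gives the positive weights the sign that the locale expects; the
    linear part is 0.\<close>
  have eq: "- qdiff q F = [:- 0, 0:] * F - (\<Sum>x | poly F x = 0. smult (w x) (lin_quot F x))"
    unfolding e(1) by (simp add: w_def)
  interpret increasing_fraction F "- qdiff q F" 0 0 w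
  proof unfold_locales
    show "F \<noteq> 0"
      using F by (rule sep_nonzero)
    show "cpoly F z = 0 \<Longrightarrow> z \<in> \<real>" for z
      by (rule sep_real[OF F])
    show "w x \<ge> 0" for x
      using e(2)[of x] by (simp add: w_def less_imp_le)
    show "0 < (0::real) \<or> (\<exists>x. poly F x = 0 \<and> 0 < w x)"
      using x0 e(2)[OF x0] by (auto simp: w_def)
  qed (use eq in auto)
  have "sep q (- qdiff q F)"
  proof (rule sep_transfer[OF F q(1)])
    fix a p assume h: "poly (- qdiff q F) a = 0" "poly F p = 0" "a \<noteq> 0" "p \<noteq> 0" "q \<le> a / p" "a / p \<le> 1"
    then have "poly F a = 1 * poly F (a / q)"
      using poly_qdiff[of a q F] by simp
    then show False
      using sep_dilate_no_common[OF F h(2,4) q h(5,6), of 1] by simp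
  qed (use nz q in auto)
  then show ?thesis
    using sep_smult[of "-1" q "qdiff q F"] by simp
qed

text \<open>Multiply by z: since \<open>z^2/(z - x) = z + x + x^2/(z - x)\<close>, the quotient
  \<open>z A / F\<close> is a linear function minus poles with weights proportional to
  \<open>x^2\<close>, nonnegative whatever the sign of x. With d the degree of F, the total weight
  in \<open>qdiff_expansion\<close> makes the slope \<open>1 - q^(N - d)\<close>, which is
  nonnegative because d <= N.\<close>

lemma sep_trunc:
  assumes F: "sep q F" and q: "0 < q" "q < 1" and N: "degree F \<le> N"
    and A: "A = smult (1 - q ^ N) F - smult (q ^ N) (pCons 0 (qdiff q F))" and nz: "A \<noteq> 0"
  shows "sep q A"
proof -
  obtain e where e: "qdiff q F = (\<Sum>x | poly F x = 0. smult (e x) (lin_quot F x))"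
    "\<And>x. poly F x = 0 \<Longrightarrow> e x > 0" "(\<Sum>x | poly F x = 0. e x) = (1 / q) ^ degree F - 1"
    by (rule qdiff_expansion[OF F q]) blast
  define E where "E = (\<Sum>x | poly F x = 0. e x)"
  define w where "w x = (if poly F x = 0 then q ^ N * e x * x\<^sup>2 else 0)" for x
  define \<kappa> where "\<kappa> = 1 - q ^ N - q ^ N * E"
  define c where "c = q ^ N * (\<Sum>x | poly F x = 0. e x * x)"
  have F0: "F \<noteq> 0"
    using F by (rule sep_nonzero)
  have eq: "pCons 0 A = [:- c, \<kappa>:] * F - (\<Sum>x | poly F x = 0. smult (w x) (lin_quot F x))"
  proof -
    have "poly (pCons 0 A) t = poly ([:- c, \<kappa>:] * F - (\<Sum>x | poly F x = 0. smult (w x) (lin_quot F x))) t" for t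
    proof -
      have "t\<^sup>2 * poly (qdiff q F) t = (\<Sum>x | poly F x = 0. e x * (t\<^sup>2 * poly (lin_quot F x) t))"
        unfolding e(1) by (simp add: poly_sum sum_distrib_left mult_ac)
      also have "\<dots> = (\<Sum>x | poly F x = 0. t * poly F t * e x + poly F t * (e x * x) +
          e x * x\<^sup>2 * poly (lin_quot F x) t)"
        by (intro sum.cong) (auto simp: poly_lin_quot[of F _ t] power2_eq_square algebra_simps)
      also have "\<dots> = t * poly F t * E + poly F t * (\<Sum>x | poly F x = 0. e x * x) +
          (\<Sum>x | poly F x = 0. e x * x\<^sup>2 * poly (lin_quot F x) t)"
        by (simp add: E_def sum.distrib sum_distrib_left)
      finally have "t\<^sup>2 * poly (qdiff q F) t = \<dots>" .
      then have "q ^ N * (t\<^sup>2 * poly (qdiff q F) t) = q ^ N * (t * poly F t * E) + c * poly F t +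
          (\<Sum>x | poly F x = 0. w x * poly (lin_quot F x) t)"
        by (simp add: c_def w_def sum_distrib_left algebra_simps)
      then show ?thesis
        by (simp add: A \<kappa>_def poly_sum power2_eq_square algebra_simps)
    qed
    then show ?thesis
      by (simp add: poly_eq_poly_eq_iff[symmetric] fun_eq_iff)
  qed
  have kap: "\<kappa> \<ge> 0"
  proof -
    have "q ^ N * (1 / q) ^ degree F \<le> q ^ degree F * (1 / q) ^ degree F"
      using q N by (intro mult_right_mono power_decreasing) auto
    also have "\<dots> = 1"
      using q by (simp add: power_one_over)
    finally show ?thesis
      by (simp add: \<kappa>_def E_def e(3) algebra_simps)
  qed
  have "\<kappa> > 0 \<or> (\<exists>x. poly F x = 0 \<and> w x > 0)"
  proof (rule ccontr)
    assume "\<not> ?thesis"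
    then have "\<kappa> = 0" and "\<And>x. poly F x = 0 \<Longrightarrow> w x \<le> 0"
      using kap by force+
    then have z: "x = 0" if "poly F x = 0" for x
      using that e(2)[OF that] q unfolding w_def
      by (metis mult_pos_pos not_le zero_less_power zero_less_power2)
    have "(\<Sum>x | poly F x = 0. smult (w x) (lin_quot F x)) = 0" "c = 0"
      using z by (auto simp: w_def c_def intro!: sum.neutral)
    then have "pCons 0 A = 0"
      using eq \<open>\<kappa> = 0\<close> by simp
    then show False
      using nz by simp
  qed
  then interpret increasing_fraction F "pCons 0 A" \<kappa> c w
  proof unfold_locales
    show "cpoly F z = 0 \<Longrightarrow> z \<in> \<real>" for z
      by (rule sep_real[OF F])
    show "w x \<ge> 0" for x
      using e(2)[of x] q by (simp add: w_def less_imp_le)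
  qed (use F0 eq kap in auto)
  have "sep q (pCons 0 A)"
  proof (rule sep_transfer[OF F q(1)])
    fix a p assume h: "poly (pCons 0 A) a = 0" "poly F p = 0" "a \<noteq> 0" "p \<noteq> 0" "q \<le> a / p" "a / p \<le> 1"
    then have "(1 - q ^ N) * poly F a = q ^ N * (a * poly (qdiff q F) a)"
      by (simp add: A)
    then have "poly F a = q ^ N * poly F (a / q)"
      unfolding poly_qdiff by (simp add: algebra_simps)
    then show False
      using sep_dilate_no_common[OF F h(2,4) q h(5,6), of "q ^ N"] q by simp
  qed (use nz q in auto)
  then show ?thesis
    using sep_pCons_0 nz q by blast
qed

text \<open>Laguerre's argument: by the Cauchy-Schwarz inequality, the harmonic mean of the points
  \<open>z - x\<close> has imaginary part at least \<open>Im z\<close>.\<close>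

lemma Im_qdiff_trunc_le:
  assumes F: "sep q F" and q: "0 < q" "q < 1" and N: "degree F \<le> N"
    and A: "A = smult (1 - q ^ N) F - smult (q ^ N) (pCons 0 (qdiff q F))" and z: "Im z > 0"
  shows "Im (cpoly (qdiff q F) z * cnj (cpoly A z)) \<le> 0"
proof -
  obtain e where e: "qdiff q F = (\<Sum>x | poly F x = 0. smult (e x) (lin_quot F x))"
    "\<And>x. poly F x = 0 \<Longrightarrow> e x > 0" "(\<Sum>x | poly F x = 0. e x) = (1 / q) ^ degree F - 1"
    by (rule qdiff_expansion[OF F q]) blast
  define Y where "Y = (\<Sum>x | poly F x = 0. of_real (e x) / (z - of_real x))"
  define S where "S = (\<Sum>x | poly F x = 0. e x * (1 / (cmod (z - of_real x))\<^sup>2))"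
  define Q where "Q = q ^ N"
  have Fz: "cpoly F z \<noteq> 0"
    using sep_real[OF F, of z] z by (auto simp: complex_is_Real_iff)
  have zx: "z - of_real x \<noteq> 0" for x
    using z by (auto simp: complex_eq_iff)
  have B: "cpoly (qdiff q F) z = cpoly F z * Y"
  proof -
    have "cpoly (lin_quot F x) z = cpoly F z / (z - of_real x)" if "poly F x = 0" for x
      using cpoly_lin_quot[OF that, of z] Fz zx[of x] by auto
    then show ?thesis
      unfolding e(1) Y_def by (auto simp: sum_distrib_left intro!: sum.cong)
  qed
  have ImY: "Im Y = - Im z * S"
    by (simp add: Y_def S_def Im_of_real_divide sum_distrib_left)
  have "cmod Y \<le> (\<Sum>x | poly F x = 0. sqrt (e x) * (sqrt (e x) * (1 / cmod (z - of_real x))))"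
    unfolding Y_def
  proof (rule order_trans[OF norm_sum], rule sum_mono)
    fix x assume "x \<in> {x. poly F x = 0}"
    then show "cmod (of_real (e x) / (z - of_real x)) \<le>
        sqrt (e x) * (sqrt (e x) * (1 / cmod (z - of_real x)))"
      using e(2)[of x] by (simp add: norm_divide flip: mult.assoc)
  qed
  then have "(cmod Y)\<^sup>2 \<le> (\<Sum>x | poly F x = 0. sqrt (e x) * (sqrt (e x) * (1 / cmod (z - of_real x))))\<^sup>2"
    by (intro power_mono) auto
  also have "\<dots> \<le> (\<Sum>x | poly F x = 0. (sqrt (e x))\<^sup>2) *
      (\<Sum>x | poly F x = 0. (sqrt (e x) * (1 / cmod (z - of_real x)))\<^sup>2)"
    by (rule Cauchy_Schwarz_ineq_sum)
  also have "(\<Sum>x | poly F x = 0. (sqrt (e x))\<^sup>2) = (1 / q) ^ degree F - 1"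
    unfolding e(3)[symmetric] using e(2) by (intro sum.cong) (auto simp: less_imp_le)
  also have "(\<Sum>x | poly F x = 0. (sqrt (e x) * (1 / cmod (z - of_real x)))\<^sup>2) = S"
    unfolding S_def using e(2)
    by (intro sum.cong) (auto simp: less_imp_le power_mult_distrib power_divide)
  finally have CS: "(cmod Y)\<^sup>2 \<le> ((1 / q) ^ degree F - 1) * S" .
  have "Q * (1 / q) ^ degree F \<le> q ^ degree F * (1 / q) ^ degree F"
    unfolding Q_def using q N by (intro mult_right_mono power_decreasing) auto
  also have "\<dots> = 1"
    using q by (simp add: power_one_over)
  finally have QE: "Q * ((1 / q) ^ degree F - 1) \<le> 1 - Q"
    by (simp add: algebra_simps)
  have S0: "S \<ge> 0"
    unfolding S_def using e(2) by (intro sum_nonneg) (auto simp: less_imp_le)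
  have Q0: "Q > 0"
    using q by (simp add: Q_def)
  have "Q * (cmod Y)\<^sup>2 \<le> Q * (((1 / q) ^ degree F - 1) * S)"
    using CS Q0 by (intro mult_left_mono) auto
  also have "\<dots> \<le> (1 - Q) * S"
    using mult_right_mono[OF QE S0] by (simp add: mult.assoc)
  finally have key: "Im z * (Q * (cmod Y)\<^sup>2) \<le> Im z * ((1 - Q) * S)"
    using z by (intro mult_left_mono) auto
  have "cpoly (qdiff q F) z * cnj (cpoly A z) =
      (cpoly F z * cnj (cpoly F z)) * (of_real (1 - Q) * Y - of_real Q * (Y * cnj Y) * cnj z)"
    by (simp add: A B Q_def algebra_simps)
  also have "\<dots> = of_real ((cmod (cpoly F z))\<^sup>2) *
      (of_real (1 - Q) * Y - of_real Q * of_real ((cmod Y)\<^sup>2) * cnj z)"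
    by (simp only: complex_norm_square)
  finally have "Im (cpoly (qdiff q F) z * cnj (cpoly A z)) =
      (cmod (cpoly F z))\<^sup>2 * ((1 - Q) * Im Y + Q * (cmod Y)\<^sup>2 * Im z)"
    by (simp add: Im_divide flip: of_real_mult)
  also have "\<dots> \<le> 0"
    using key ImY by (intro mult_nonneg_nonpos) (auto simp: algebra_simps)
  finally show ?thesis .
qed

lemma lift_trunc_sep:
  assumes "0 < q" "q < 1" "sep q (lift q (Suc n) f)" "lift q n f \<noteq> 0"
  shows "sep q (lift q n f)"
proof -
  have c: "1 - q ^ Suc n \<noteq> 0"
    using power_Suc_less_one[OF assms(1,2), of n] by simp
  have "sep q (smult (1 - q ^ Suc n) (lift q n f))"
    using assms c by (intro sep_trunc[OF assms(3,1,2) degree_lift_le lift_trunc]) auto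
  then show ?thesis
    using c by (simp add: sep_smult)
qed

lemma lift_shift_sep:
  assumes "0 < q" "q < 1" "sep q (lift q (Suc n) f)" "lift q n (shift_seq f) \<noteq> 0"
  shows "sep q (lift q n (shift_seq f))"
proof -
  have c: "1 - q ^ Suc n \<noteq> 0"
    using power_Suc_less_one[OF assms(1,2), of n] by simp
  have "qdiff q (lift q (Suc n) f) \<noteq> 0"
    using lift_shift[OF assms(1), of n f] assms(4) c by auto
  then have "sep q (smult q (qdiff q (lift q (Suc n) f)))"
    using assms sep_qdiff by (simp add: sep_smult)
  then show ?thesis
    using c lift_shift[OF assms(1), of n f] by (metis sep_smult)
qed

lemma Im_lift_shift_trunc_le:
  assumes "0 < q" "q < 1" "sep q (lift q (Suc n) f)" "Im z > 0"
  shows "Im (cpoly (lift q n (shift_seq f)) z * cnj (cpoly (lift q n f) z)) \<le> 0"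
proof -
  have c: "1 - q ^ Suc n > 0"
    using power_Suc_less_one[OF assms(1,2), of n] by simp
  have "Im (cpoly (qdiff q (lift q (Suc n) f)) z *
      cnj (cpoly (smult (1 - q ^ Suc n) (lift q n f)) z)) \<le> 0"
    by (rule Im_qdiff_trunc_le[OF assms(3,1,2) degree_lift_le lift_trunc[OF assms(1)] assms(4)])
  then have "q * Im (cpoly (qdiff q (lift q (Suc n) f)) z *
      cnj (cpoly (smult (1 - q ^ Suc n) (lift q n f)) z)) \<le> 0"
    using assms(1) by (simp only: mult_le_0_iff) auto
  then have "Im (cpoly (smult q (qdiff q (lift q (Suc n) f))) z *
      cnj (cpoly (smult (1 - q ^ Suc n) (lift q n f)) z)) \<le> 0"
    by (simp add: mult.assoc)
  then have "Im (cpoly (smult (1 - q ^ Suc n) (lift q n (shift_seq f))) z *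
      cnj (cpoly (smult (1 - q ^ Suc n) (lift q n f)) z)) \<le> 0"
    using lift_shift[OF assms(1), of n f] by simp
  also have "cpoly (smult (1 - q ^ Suc n) (lift q n (shift_seq f))) z *
      cnj (cpoly (smult (1 - q ^ Suc n) (lift q n f)) z) =
      of_real ((1 - q ^ Suc n)\<^sup>2) * (cpoly (lift q n (shift_seq f)) z * cnj (cpoly (lift q n f) z))"
    by (simp add: power2_eq_square)
  also have "Im \<dots> = (1 - q ^ Suc n)\<^sup>2 * Im (cpoly (lift q n (shift_seq f)) z * cnj (cpoly (lift q n f) z))"
    by (rule Im_of_real_mult)
  finally have "(1 - q ^ Suc n)\<^sup>2 * Im (cpoly (lift q n (shift_seq f)) z * cnj (cpoly (lift q n f) z)) \<le> 0" .
  then show ?thesis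
    using c by (simp add: mult_le_0_iff)
qed

section \<open>Growth at infinity and residues from a half-plane inequality\<close>

lemma cpoly_asymptotic:
  "((\<lambda>R. cpoly S (of_real R * u) / of_real R ^ degree S) \<longlongrightarrow> of_real (lead_coeff S) * u ^ degree S) at_top"
proof -
  let ?d = "degree S"
  have lim: "((\<lambda>R::real. R ^ k / R ^ ?d) \<longlongrightarrow> (if k = ?d then 1 else 0)) at_top" if "k \<le> ?d" for k
  proof (cases "k = ?d")
    case True
    have "\<forall>\<^sub>F R in at_top. R ^ k / R ^ ?d = (1::real)"
      using eventually_gt_at_top[of 0] by eventually_elim (simp add: True)
    then show ?thesis
      unfolding if_P[OF True] by (rule tendsto_eventually)
  next
    case False
    have "((\<lambda>R::real. inverse R ^ (?d - k)) \<longlongrightarrow> 0 ^ (?d - k)) at_top"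
      by (intro tendsto_power tendsto_inverse_0_at_top filterlim_ident)
    moreover have "\<forall>\<^sub>F R in at_top. inverse R ^ (?d - k) = R ^ k / (R::real) ^ ?d"
      using eventually_gt_at_top[of 0]
    proof eventually_elim
      case (elim R)
      have "R ^ ?d = R ^ k * R ^ (?d - k)"
        using that by (simp flip: power_add)
      then show ?case
        using elim by (simp add: field_simps)
    qed
    ultimately have "((\<lambda>R::real. R ^ k / R ^ ?d) \<longlongrightarrow> 0 ^ (?d - k)) at_top"
      by (rule Lim_transform_eventually)
    moreover have "(0::real) ^ (?d - k) = 0"
      using False that by simp
    ultimately show ?thesis
      using False by simp
  qed
  have "((\<lambda>R. \<Sum>k\<le>?d. of_real (coeff S k) * u ^ k * of_real (R ^ k / R ^ ?d)) \<longlongrightarrow>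
      (\<Sum>k\<le>?d. of_real (coeff S k) * u ^ k * of_real (if k = ?d then 1 else 0))) at_top"
    by (intro tendsto_sum tendsto_mult tendsto_const tendsto_of_real lim) simp
  also have "(\<Sum>k\<le>?d. of_real (coeff S k) * u ^ k * of_real (if k = ?d then 1 else 0)) =
      (\<Sum>k\<in>{?d}. of_real (coeff S k) * u ^ k)"
    by (rule sum.mono_neutral_cong_right) auto
  finally have "((\<lambda>R. \<Sum>k\<le>?d. of_real (coeff S k) * u ^ k * of_real (R ^ k / R ^ ?d)) \<longlongrightarrow>
      of_real (lead_coeff S) * u ^ ?d) at_top"
    by simp
  moreover have "(\<Sum>k\<le>?d. of_real (coeff S k) * u ^ k * of_real (R ^ k / R ^ ?d)) =
      cpoly S (of_real R * u) / of_real R ^ ?d" for R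
    by (simp add: cpoly_altdef[OF order_refl] sum_divide_distrib power_mult_distrib mult_ac)
  ultimately show ?thesis
    by simp
qed

text \<open>On the ray of angle \<theta> the leading behaviour of \<open>S * cnj T\<close> is a real
  multiple of \<open>cis (j \<theta>)\<close> with j the excess of degree, so
  \<open>sin (j \<theta>)\<close> must keep one sign for 0 < \<theta> < pi. For j >= 2 the angles
  \<open>pi/(2 j)\<close> and \<open>3 pi/(2 j)\<close> give both signs; for j = 1 the sign of the
  leading coefficients is determined.\<close>

lemma growth_at_infinity:
  assumes Im: "\<And>z. Im z > 0 \<Longrightarrow> Im (cpoly S z * cnj (cpoly T z)) \<le> 0"
    and nz: "S \<noteq> 0" "T \<noteq> 0"
  shows "degree S \<le> Suc (degree T)"
    and "degree S = Suc (degree T) \<Longrightarrow> lead_coeff S * lead_coeff T < 0"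
proof -
  have key: "lead_coeff S * lead_coeff T * sin (real j * \<theta>) \<le> 0"
    if th: "0 < \<theta>" "\<theta> < pi" and j: "degree S = degree T + j" for \<theta> j
  proof -
    let ?u = "cis \<theta>"
    let ?L = "(of_real (lead_coeff S) * ?u ^ degree S) * cnj (of_real (lead_coeff T) * ?u ^ degree T)"
    have "((\<lambda>R. Im ((cpoly S (of_real R * ?u) / of_real R ^ degree S) *
        cnj (cpoly T (of_real R * ?u) / of_real R ^ degree T))) \<longlongrightarrow> Im ?L) at_top"
      by (intro tendsto_intros cpoly_asymptotic)
    moreover have "\<forall>\<^sub>F R in at_top. Im ((cpoly S (of_real R * ?u) / of_real R ^ degree S) *
        cnj (cpoly T (of_real R * ?u) / of_real R ^ degree T)) \<le> 0"
      using eventually_gt_at_top[of "0::real"]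
    proof eventually_elim
      case (elim R)
      have "Im (of_real R * ?u) > 0"
        using elim th sin_gt_zero by simp
      then have "Im (cpoly S (of_real R * ?u) * cnj (cpoly T (of_real R * ?u))) \<le> 0"
        by (rule Im)
      then have "inverse (R ^ degree S * R ^ degree T) *
          Im (cpoly S (of_real R * ?u) * cnj (cpoly T (of_real R * ?u))) \<le> 0"
        using elim by (intro mult_nonneg_nonpos) auto
      also have "inverse (R ^ degree S * R ^ degree T) *
          Im (cpoly S (of_real R * ?u) * cnj (cpoly T (of_real R * ?u))) =
          Im (of_real (inverse (R ^ degree S * R ^ degree T)) *
            (cpoly S (of_real R * ?u) * cnj (cpoly T (of_real R * ?u))))"
        by (rule Im_of_real_mult[symmetric])
      finally show ?case
        by (simp add: divide_inverse mult_ac)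
    qed
    ultimately have "Im ?L \<le> 0"
      by (rule tendsto_upperbound) simp
    also have "?L = of_real (lead_coeff S * lead_coeff T) * (?u ^ j * (?u * cnj ?u) ^ degree T)"
      by (simp add: j power_add power_mult_distrib mult_ac)
    also have "?u * cnj ?u = 1"
      by (simp add: cis_cnj cis_mult)
    also have "?u ^ j * 1 ^ degree T = cis (real j * \<theta>)"
      by (simp add: Complex.DeMoivre)
    finally show ?thesis
      by (simp add: Im_of_real_mult)
  qed
  have L0: "lead_coeff S * lead_coeff T \<noteq> 0"
    using nz by simp
  show "degree S \<le> Suc (degree T)"
  proof (rule ccontr)
    assume "\<not> ?thesis"
    moreover define j where "j = degree S - degree T"
    ultimately have j: "degree S = degree T + j" "j \<ge> 2"
      by auto
    have "lead_coeff S * lead_coeff T * sin (real j * (pi / (2 * real j))) \<le> 0"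
      using j by (intro key) (auto simp: field_simps)
    moreover have "real j * (pi / (2 * real j)) = pi / 2"
      using j by simp
    ultimately have 1: "lead_coeff S * lead_coeff T \<le> 0"
      by (simp only: sin_pi_half mult_1_right)
    have "lead_coeff S * lead_coeff T * sin (real j * (3 * pi / (2 * real j))) \<le> 0"
      using j by (intro key) (auto simp: field_simps)
    moreover have "real j * (3 * pi / (2 * real j)) = 3 / 2 * pi"
      using j by simp
    ultimately have "lead_coeff S * lead_coeff T * sin (3 / 2 * pi) \<le> 0"
      by (simp only:)
    then have "lead_coeff S * lead_coeff T \<ge> 0"
      by (simp only: sin_3over2_pi)
    then show False
      using 1 L0 by simp
  qed
  show "lead_coeff S * lead_coeff T < 0" if "degree S = Suc (degree T)"
  proof -
    have "lead_coeff S * lead_coeff T \<le> 0"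
      using key[of "pi / 2" 1] that by simp
    then show ?thesis
      using L0 by (rule order_le_neq_trans)
  qed
qed

text \<open>Approach x vertically: \<open>T(x + i y)\<close> is i y times the cofactor K of
  \<open>z - x\<close>, so the imaginary part of \<open>S * cnj T\<close> becomes a real part of
  \<open>S * cnj K\<close>. In this way the half-plane inequalities are brought back to the real
  axis.\<close>

lemma residue_nonneg:
  assumes Im: "\<And>z. Im z > 0 \<Longrightarrow> Im (cpoly S z * cnj (cpoly T z)) \<le> 0" and x: "poly T x = 0"
  shows "poly S x * poly (lin_quot T x) x \<ge> 0"
proof -
  let ?K = "lin_quot T x"
  let ?z = "\<lambda>y. complex_of_real x + \<i> * of_real y"
  have "((\<lambda>y. Re (cpoly S (?z y) * cnj (cpoly ?K (?z y)))) \<longlongrightarrow>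
      Re (cpoly S (?z 0) * cnj (cpoly ?K (?z 0)))) (at_right 0)"
    by (intro tendsto_intros)
  moreover have "\<forall>\<^sub>F y in at_right 0. Re (cpoly S (?z y) * cnj (cpoly ?K (?z y))) \<ge> 0"
    using eventually_at_right_less[of "0::real"]
  proof eventually_elim
    case (elim y)
    have "Im (cpoly S (?z y) * cnj (cpoly T (?z y))) \<le> 0"
      using elim by (intro Im) simp
    also have "cpoly T (?z y) = \<i> * of_real y * cpoly ?K (?z y)"
      by (simp add: cpoly_lin_quot[OF x])
    also have "cpoly S (?z y) * cnj (\<i> * of_real y * cpoly ?K (?z y)) =
        of_real y * (- \<i> * (cpoly S (?z y) * cnj (cpoly ?K (?z y))))"
      by simp
    also have "Im \<dots> = y * (- Re (cpoly S (?z y) * cnj (cpoly ?K (?z y))))"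
      by (subst Im_of_real_mult) simp
    finally show ?case
      using elim by (simp add: mult_le_0_iff)
  qed
  ultimately have "Re (cpoly S (?z 0) * cnj (cpoly ?K (?z 0))) \<ge> 0"
    by (rule tendsto_lowerbound) simp
  then show ?thesis
    by simp
qed

text \<open>The quotient S/T maps the upper half plane to the closed lower one, so its poles have
  nonnegative residues and its slope -e at infinity is at most 0. At the origin, where T may have a
  multiple zero, the residue is computed instead: it is a ratio of two positive coefficients of R_m.
  A nonzero e means deg S = deg T + 1, and deg S <= m.\<close>

lemma lift_partial_fractions:
  assumes T: "real_simple (lift q m f)" and q: "0 < q"
    and Im: "\<And>z. Im z > 0 \<Longrightarrow> Im (cpoly (lift q m (shift_seq f)) z * cnj (cpoly (lift q m f) z)) \<le> 0"
  obtains e c w where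
    "lift q m (shift_seq f) = smult (- e) (pCons 0 (lift q m f)) + smult c (lift q m f) +
      (\<Sum>x | poly (lift q m f) x = 0. smult (w x) (lin_quot (lift q m f) x))"
    "e \<ge> 0" "\<And>x. poly (lift q m f) x = 0 \<Longrightarrow> w x \<ge> 0"
    "e \<noteq> 0 \<Longrightarrow> degree (lift q m f) < m"
    "- e * lead_coeff (lift q m f) = coeff (lift q m (shift_seq f)) (Suc (degree (lift q m f)))"
    "e = 0 \<Longrightarrow> c * lead_coeff (lift q m f) = coeff (lift q m (shift_seq f)) (degree (lift q m f))"
proof -
  define S T where "S = lift q m (shift_seq f)" and "T = lift q m f"
  have T: "real_simple T"
    using T by (simp add: T_def)
  then have T0: "T \<noteq> 0"
    by (simp add: real_simple_def)
  have Im': "Im (cpoly S z * cnj (cpoly T z)) \<le> 0" if "Im z > 0" for z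
    using Im[OF that] by (simp add: S_def T_def)
  have C: "coeff (R_poly m q) k > 0" if "k \<le> m" for k
    using coeff_R_poly_pos[OF q that] .
  have degT: "degree T \<le> m"
    unfolding T_def by (rule degree_lift_le)
  have low: "coeff S k = 0" if "Suc k < order 0 T" for k
  proof -
    have "order 0 T \<le> m"
      using order_degree[OF T0, of 0] degT by simp
    then have "f (Suc k) = 0"
      using coeff_below_order[OF that] C[of "Suc k"] that by (simp add: T_def)
    then show ?thesis
      by (simp add: S_def)
  qed
  have deg: "degree S \<le> Suc (degree T)"
    using growth_at_infinity(1)[OF Im' _ T0] by (cases "S = 0") auto
  obtain e c w where w:
    "S = smult (- e) (pCons 0 T) + smult c T + (\<Sum>x | poly T x = 0. smult (w x) (lin_quot T x))"
    "\<And>x. x \<noteq> 0 \<Longrightarrow> poly T x = 0 \<Longrightarrow> w x * poly (pderiv T) x = poly S x"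
    "poly T 0 = 0 \<Longrightarrow> w 0 * coeff T (order 0 T) = coeff S (order 0 T - 1)"
    "- e * lead_coeff T = coeff S (Suc (degree T))"
    "e = 0 \<Longrightarrow> c * lead_coeff T = coeff S (degree T)"
    using partial_fractions[OF T deg low] by blast
  have degS: "degree S = Suc (degree T)" if "e \<noteq> 0"
    using deg w(4) that T0 le_degree[of S "Suc (degree T)"] by force
  show ?thesis
  proof (rule that[of e c w])
    show "e \<ge> 0"
    proof (cases "e = 0")
      case False
      then have "lead_coeff S * lead_coeff T < 0"
        using growth_at_infinity(2)[OF Im' _ T0] degS by (cases "S = 0") auto
      then have "- e * (lead_coeff T)\<^sup>2 < 0"
        using w(4) degS[OF False] by (simp add: power2_eq_square flip: mult.assoc)
      then have "0 < e * (lead_coeff T)\<^sup>2"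
        by simp
      then show ?thesis
        unfolding zero_less_mult_iff by auto
    qed simp
    show "w x \<ge> 0" if x: "poly (lift q m f) x = 0" for x
    proof (cases "x = 0")
      case True
      have xT: "poly T 0 = 0"
        using x True by (simp add: T_def)
      define l where "l = order 0 T"
      have l: "0 < l" "l \<le> m"
        using xT T0 order_degree[OF T0, of 0] degT by (auto simp: order_gt_0_iff l_def)
      have nz: "coeff (R_poly m q) l * f l \<noteq> 0"
        using coeff_order_nonzero[OF T0] by (simp add: T_def l_def)
      have "w 0 * (coeff (R_poly m q) l * f l) = coeff (R_poly m q) (l - 1) * f l"
        using w(3)[OF xT] l by (simp add: T_def S_def l_def)
      then have "w 0 * coeff (R_poly m q) l = coeff (R_poly m q) (l - 1)"
        using nz by (simp flip: mult.assoc)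
      then have "w 0 * coeff (R_poly m q) l > 0"
        using C[of "l - 1"] l by simp
      then show ?thesis
        using C[of l] l True by (simp add: zero_less_mult_iff)
    next
      case False
      have xT: "poly T x = 0"
        using x by (simp add: T_def)
      have "0 \<le> poly S x * poly (pderiv T) x"
        using residue_nonneg[OF Im' xT] poly_pderiv_eq_lin_quot[OF xT] by simp
      also have "\<dots> = w x * (poly (pderiv T) x)\<^sup>2"
        using w(2)[OF False xT] by (simp add: power2_eq_square flip: mult.assoc)
      finally show ?thesis
        using T False xT by (auto simp: real_simple_def zero_le_mult_iff)
    qed
    show "degree (lift q m f) < m" if "e \<noteq> 0"
    proof -
      have "degree S \<le> m"
        unfolding S_def by (rule degree_lift_le)
      then show ?thesis
        using degS[OF that] by (simp add: T_def)
    qed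
  qed (use w in \<open>simp_all add: S_def T_def\<close>)
qed

section \<open>Signs of zeros and signs of coefficients\<close>

lemma root_nonpos:
  fixes p :: "real poly"
  assumes nn: "\<And>k. coeff p k \<ge> 0" and p0: "p \<noteq> 0" and root: "poly p x = 0"
  shows "x \<le> 0"
proof (rule ccontr)
  assume "\<not> x \<le> 0"
  then have x: "x > 0"
    by (simp only: not_le)
  have lc: "0 < lead_coeff p"
    using nn[of "degree p"] p0 by (simp add: order_less_le)
  have "0 < lead_coeff p * x ^ degree p"
    by (rule mult_pos_pos[OF lc zero_less_power[OF x]])
  also have "\<dots> \<le> (\<Sum>k\<le>degree p. coeff p k * x ^ k)"
    by (rule member_le_sum) (simp_all add: nn x less_imp_le)
  also have "\<dots> = 0"
    using root by (simp add: poly_altdef)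
  finally show False
    by simp
qed

lemma coeffs_nonneg:
  assumes "p \<noteq> 0" "\<And>z. cpoly p z = 0 \<Longrightarrow> z \<in> \<real>" "\<And>x. poly p x = 0 \<Longrightarrow> x \<le> 0"
    and "lead_coeff p > 0"
  shows "coeff p k \<ge> 0"
  using assms
proof (induction "degree p" arbitrary: p k)
  case 0
  then show ?case
    by (metis coeff_eq_0 less_imp_le neq0_conv order_refl)
next
  case (Suc d)
  obtain x where x: "poly p x = 0"
    by (rule real_rooted_root[of p, OF Suc.prems(2)]) (use Suc.hyps(2) in auto)
  have x0: "x \<le> 0"
    using Suc.prems(3) x by blast
  have "coeff (lin_quot p x) j \<ge> 0" for j
  proof (rule Suc.hyps(1))
    show "d = degree (lin_quot p x)"
      using degree_lin_quot[OF x Suc.prems(1)] Suc.hyps(2) by simp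
    show "z \<in> \<real>" if "cpoly (lin_quot p x) z = 0" for z
      using Suc.prems(2)[of z] cpoly_lin_quot[OF x, of z] that by simp
    show "y \<le> 0" if "poly (lin_quot p x) y = 0" for y
      using Suc.prems(3)[of y] poly_lin_quot[OF x, of y] that by simp
    show "0 < lead_coeff (lin_quot p x)"
      using lead_coeff_lin_quot[OF x Suc.prems(1)] Suc.prems(4) by simp
  qed (rule lin_quot_nonzero[OF x Suc.prems(1)])
  then have "coeff (lin_quot p x) j \<ge> 0" "x * coeff (lin_quot p x) j \<le> 0" for j
    using x0 by (auto simp: mult_nonpos_nonneg)
  then show ?case
    using coeff_lin_quot[OF x] by (cases k) (auto intro: order_trans)
qed

lemma lin_quot_coeffs_nonneg:
  assumes p: "sep q p" "\<And>k. coeff p k \<ge> 0" and x: "poly p x = 0"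
  shows "coeff (lin_quot p x) k \<ge> 0"
proof (rule coeffs_nonneg)
  have p0: "p \<noteq> 0"
    using p(1) by (rule sep_nonzero)
  show "lin_quot p x \<noteq> 0"
    by (rule lin_quot_nonzero[OF x p0])
  show "z \<in> \<real>" if "cpoly (lin_quot p x) z = 0" for z
    using sep_real[OF p(1), of z] cpoly_lin_quot[OF x, of z] that by simp
  show "y \<le> 0" if "poly (lin_quot p x) y = 0" for y
    using root_nonpos[OF p(2) p0, of y] poly_lin_quot[OF x, of y] that by simp
  show "0 < lead_coeff (lin_quot p x)"
    using lead_coeff_lin_quot[OF x p0] p(2)[of "degree p"] p0 by (simp add: order_less_le)
qed

lemma hprod_lift_commute: "hprod (lift q m a) b = hprod (lift q m b) a"
  by (rule poly_eqI) (simp add: mult_ac)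

subsection \<open>The two half-plane inequalities\<close>

text \<open>The two inequalities that are proved by a simultaneous induction: the first moves a zero of
  the factor with nonpositive zeros outwards, the second moves a zero of the other factor to the
  right.\<close>

definition outward :: "real \<Rightarrow> nat \<Rightarrow> bool"
  where "outward q m \<longleftrightarrow> (\<forall>f g v z. sep q (lift q m f) \<and> sep q (lift q m g) \<and> (\<forall>k\<le>m. g k \<ge> 0) \<and>
    poly (lift q m g) v = 0 \<and> Im z > 0 \<longrightarrow>
    Im (z * cpoly (hprod (lin_quot (lift q m g) v) f) z * cnj (cpoly (hprod (lift q m g) f) z)) \<ge> 0)"

definition rightward :: "real \<Rightarrow> nat \<Rightarrow> bool"
  where "rightward q m \<longleftrightarrow> (\<forall>P g z. sep q P \<and> degree P < m \<and> sep q (lift q m g) \<and> (\<forall>k\<le>m. g k \<ge> 0) \<and>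
    Im z > 0 \<longrightarrow> Im (z * cpoly (hprod P (shift_seq g)) z * cnj (cpoly (hprod P g) z)) \<ge> 0)"

lemma lift_coeff_nonneg:
  assumes "0 < q" "\<And>k. k \<le> m \<Longrightarrow> g k \<ge> 0"
  shows "coeff (lift q m g) k \<ge> 0"
proof (cases "k \<le> m")
  case True
  then show ?thesis
    using assms coeff_R_poly_pos[OF assms(1) True] by simp
qed (simp add: coeff_R_poly_gt)

text \<open>Since P = R_m * p, convolving P with g or with its shift is convolving p with the
  truncated or the shifted window of g. The shifted window is expanded over the truncated one. Its
  nonnegative coefficients rule out a pole at infinity and make c >= 0, and every remaining pole
  term is an instance of \<open>outward\<close>.\<close>

lemma outward_imp_rightward:
  assumes q: "0 < q" "q < 1" and out: "outward q m"
  shows "rightward q (Suc m)"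
  unfolding rightward_def
proof (intro allI impI, elim conjE)
  fix P g z
  assume P: "sep q P" "degree P < Suc m" and g: "sep q (lift q (Suc m) g)" "\<forall>k\<le>Suc m. 0 \<le> g k"
    and z: "Im z > 0"
  obtain p where p: "P = lift q m p"
    using ex_lift[OF q(1), of P m] P(2) by auto
  define A where "A = lift q m g"
  define B where "B = lift q m (shift_seq g)"
  have U: "hprod P g = hprod A p" and V: "hprod P (shift_seq g) = hprod B p"
    unfolding p A_def B_def by (rule hprod_lift_commute)+
  show "0 \<le> Im (z * cpoly (hprod P (shift_seq g)) z * cnj (cpoly (hprod P g) z))"
  proof (cases "A = 0")
    case False
    then have A: "sep q A"
      unfolding A_def using lift_trunc_sep[OF q g(1)] by simp
    have Im: "Im (cpoly (lift q m (shift_seq g)) z * cnj (cpoly (lift q m g) z)) \<le> 0" if "Im z > 0" for z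
      by (rule Im_lift_shift_trunc_le[OF q g(1) that])
    have cA: "coeff A k \<ge> 0" "coeff B k \<ge> 0" for k
      unfolding A_def B_def using g(2) q by (intro lift_coeff_nonneg; simp)+
    obtain e c w where w:
      "B = smult (- e) (pCons 0 A) + smult c A + (\<Sum>x | poly A x = 0. smult (w x) (lin_quot A x))"
      "e \<ge> 0" "\<And>x. poly A x = 0 \<Longrightarrow> w x \<ge> 0"
      "- e * lead_coeff A = coeff B (Suc (degree A))"
      "e = 0 \<Longrightarrow> c * lead_coeff A = coeff B (degree A)"
      unfolding A_def B_def
      by (rule lift_partial_fractions[OF _ q(1) Im]) (use A in \<open>auto simp: A_def sep_def\<close>)
    have lc: "lead_coeff A > 0"
      using cA(1)[of "degree A"] False by (simp add: order_less_le)
    have "- e * lead_coeff A \<ge> 0"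
      using w(4) cA(2) by simp
    then have e: "e = 0"
      using w(2) lc by (simp add: mult_le_0_iff)
    then have c: "c \<ge> 0"
      using w(5) cA(2)[of "degree A"] lc by (metis zero_le_mult_iff not_le)
    have B: "hprod B p = smult c (hprod A p) + (\<Sum>x | poly A x = 0. smult (w x) (hprod (lin_quot A x) p))"
      unfolding w(1) e by (simp add: hprod_add hprod_smult hprod_sum)
    have *: "Im (z * cpoly (hprod (lin_quot A x) p) z * cnj (cpoly (hprod A p) z)) \<ge> 0" if "poly A x = 0" for x
      using out P(1) A g(2) that z unfolding outward_def p A_def by simp
    have "Im (z * cpoly (hprod B p) z * cnj (cpoly (hprod A p) z)) =
        c * ((cmod (cpoly (hprod A p) z))\<^sup>2 * Im z) +
        (\<Sum>x | poly A x = 0. w x * Im (z * cpoly (hprod (lin_quot A x) p) z * cnj (cpoly (hprod A p) z)))"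
    proof -
      let ?U = "cpoly (hprod A p) z"
      have "z * cpoly (hprod B p) z * cnj ?U = of_real c * ((?U * cnj ?U) * z) +
          (\<Sum>x | poly A x = 0. of_real (w x) * (z * cpoly (hprod (lin_quot A x) p) z * cnj ?U))"
        unfolding B by (simp add: algebra_simps sum_distrib_left sum_distrib_right)
      also have "?U * cnj ?U = of_real ((cmod ?U)\<^sup>2)"
        by (rule complex_norm_square[symmetric])
      finally show ?thesis
        by (simp only: plus_complex.sel Im_sum Im_of_real_mult)
    qed
    also have "\<dots> \<ge> 0"
      using c z w(3) * by (intro add_nonneg_nonneg mult_nonneg_nonneg sum_nonneg) auto
    finally show ?thesis
      unfolding U V .
  qed (simp add: U)
qed

text \<open>Removing the zero v of G leaves Q and gives
  \<open>G * f = z (Q * shift f) - v (Q * f)\<close>. As v <= 0, the second term contributes with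
  the right sign, and \<open>neg\<close> controls the first. There the windows of f are expanded,
  and each pole term reduces to an instance of \<open>rightward\<close>.\<close>

lemma rightward_imp_outward:
  assumes q: "0 < q" "q < 1" and right: "rightward q m"
  shows "outward q (Suc m)"
  unfolding outward_def
proof (intro allI impI, elim conjE)
  fix f g v z
  assume f: "sep q (lift q (Suc m) f)" and g: "sep q (lift q (Suc m) g)" "\<forall>k\<le>Suc m. 0 \<le> g k"
    and v: "poly (lift q (Suc m) g) v = 0" and z: "Im z > 0"
  define G where "G = lift q (Suc m) g"
  define Q where "Q = lin_quot G v"
  have G: "sep q G" "G \<noteq> 0" "poly G v = 0"
    using g(1) v by (auto simp: G_def sep_nonzero)
  have cG: "coeff G k \<ge> 0" for k
    unfolding G_def using g(2) q by (intro lift_coeff_nonneg) auto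
  have v0: "v \<le> 0"
    by (rule root_nonpos[OF cG G(2,3)])
  have Q: "sep q Q"
    unfolding Q_def by (rule sep_lin_quot[OF G(1,3)])
  have "degree Q \<le> m"
    using degree_lin_quot[OF G(3,2)] degree_lift_le[of q "Suc m" g] by (simp add: Q_def G_def)
  then obtain \<kappa> where kap: "Q = lift q m \<kappa>"
    using ex_lift[OF q(1)] by metis
  have kap0: "\<kappa> k \<ge> 0" if "k \<le> m" for k
  proof -
    have "coeff (R_poly m q) k * \<kappa> k \<ge> 0"
      using lin_quot_coeffs_nonneg[OF G(1) cG G(3), of k] kap by (simp add: Q_def)
    then show ?thesis
      using coeff_R_poly_pos[OF q(1) that] by (simp add: zero_le_mult_iff)
  qed
  define A where "A = lift q m f"
  define B where "B = lift q m (shift_seq f)"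
  have U: "hprod Q f = hprod A \<kappa>" and V: "hprod Q (shift_seq f) = hprod B \<kappa>"
    unfolding kap A_def B_def by (rule hprod_lift_commute)+
  have neg: "Im (cpoly (hprod Q (shift_seq f)) z * cnj (cpoly (hprod Q f) z)) \<le> 0"
  proof (cases "A = 0")
    case False
    then have A: "sep q A"
      unfolding A_def using lift_trunc_sep[OF q f] by simp
    have Im: "Im (cpoly (lift q m (shift_seq f)) z * cnj (cpoly (lift q m f) z)) \<le> 0" if "Im z > 0" for z
      by (rule Im_lift_shift_trunc_le[OF q f that])
    obtain e c w where w:
      "B = smult (- e) (pCons 0 A) + smult c A + (\<Sum>x | poly A x = 0. smult (w x) (lin_quot A x))"
      "e \<ge> 0" "\<And>x. poly A x = 0 \<Longrightarrow> w x \<ge> 0" "e \<noteq> 0 \<Longrightarrow> degree A < m"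
      unfolding A_def B_def
      by (rule lift_partial_fractions[OF _ q(1) Im]) (use A in \<open>auto simp: A_def sep_def\<close>)
    have right': "Im (z * cpoly (hprod P (shift_seq \<kappa>)) z * cnj (cpoly (hprod P \<kappa>) z)) \<ge> 0"
      if "sep q P" "degree P < m" for P
      using right that Q kap0 z unfolding rightward_def kap by blast
    have B: "hprod B \<kappa> = smult (- e) (pCons 0 (hprod A (shift_seq \<kappa>))) + smult c (hprod A \<kappa>) +
        (\<Sum>x | poly A x = 0. smult (w x) (hprod (lin_quot A x) \<kappa>))"
      unfolding w(1) by (simp only: hprod_add hprod_smult hprod_sum hprod_pCons_0)
    have x: "Im (cpoly (hprod (lin_quot A x) \<kappa>) z * cnj (cpoly (hprod A \<kappa>) z)) \<le> 0" if "poly A x = 0" for x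
    proof -
      let ?P = "lin_quot A x"
      have "degree ?P < m"
        using degree_lin_quot[OF that False] degree_lift_le[of q m f] by (simp add: A_def)
      then have r: "Im (z * cpoly (hprod ?P (shift_seq \<kappa>)) z * cnj (cpoly (hprod ?P \<kappa>) z)) \<ge> 0"
        using right' sep_lin_quot[OF A that] by blast
      have "cpoly (hprod ?P \<kappa>) z * cnj (cpoly (hprod A \<kappa>) z) =
          cnj (z * cpoly (hprod ?P (shift_seq \<kappa>)) z * cnj (cpoly (hprod ?P \<kappa>) z)) -
          of_real x * (cpoly (hprod ?P \<kappa>) z * cnj (cpoly (hprod ?P \<kappa>) z))"
        unfolding cpoly_hprod_lin_quot[OF that] by (simp add: algebra_simps)
      also have "cpoly (hprod ?P \<kappa>) z * cnj (cpoly (hprod ?P \<kappa>) z) = of_real ((cmod (cpoly (hprod ?P \<kappa>) z))\<^sup>2)"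
        by (rule complex_norm_square[symmetric])
      finally show ?thesis
        using r by (simp only: minus_complex.sel Im_of_real_mult cnj.sel) simp
    qed
    have "Im (cpoly (hprod B \<kappa>) z * cnj (cpoly (hprod A \<kappa>) z)) =
        - e * Im (z * cpoly (hprod A (shift_seq \<kappa>)) z * cnj (cpoly (hprod A \<kappa>) z)) +
        (\<Sum>x | poly A x = 0. w x * Im (cpoly (hprod (lin_quot A x) \<kappa>) z * cnj (cpoly (hprod A \<kappa>) z)))"
    proof -
      let ?U = "cpoly (hprod A \<kappa>) z"
      have "cpoly (hprod B \<kappa>) z * cnj ?U = of_real (- e) * (z * cpoly (hprod A (shift_seq \<kappa>)) z * cnj ?U) +
          of_real c * (?U * cnj ?U) +
          (\<Sum>x | poly A x = 0. of_real (w x) * (cpoly (hprod (lin_quot A x) \<kappa>) z * cnj ?U))"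
        unfolding B by (simp add: algebra_simps sum_distrib_left sum_distrib_right)
      also have "?U * cnj ?U = of_real ((cmod ?U)\<^sup>2)"
        by (rule complex_norm_square[symmetric])
      finally show ?thesis
        by (simp only: plus_complex.sel Im_sum Im_of_real_mult) simp
    qed
    also have "\<dots> \<le> 0"
    proof (intro add_nonpos_nonpos sum_nonpos)
      \<comment> \<open>The term at infinity applies \<open>rightward\<close> to A itself, whose
        degree must be below m; a nonzero e guarantees that.\<close>
      show "- e * Im (z * cpoly (hprod A (shift_seq \<kappa>)) z * cnj (cpoly (hprod A \<kappa>) z)) \<le> 0"
        using w(2,4) right'[OF A] by (cases "e = 0") (auto intro!: mult_nonneg_nonneg)
      show "w y * Im (cpoly (hprod (lin_quot A y) \<kappa>) z * cnj (cpoly (hprod A \<kappa>) z)) \<le> 0"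
        if "y \<in> {y. poly A y = 0}" for y
        using w(3)[of y] x[of y] that by (intro mult_nonneg_nonpos) auto
    qed
    finally show ?thesis
      unfolding U V .
  qed (simp add: U)
  let ?U = "cpoly (hprod Q f) z" and ?V = "cpoly (hprod Q (shift_seq f)) z"
  have "z * ?U * cnj (cpoly (hprod G f) z) =
      (z * cnj z) * cnj (?V * cnj ?U) - of_real v * (z * (?U * cnj ?U))"
    unfolding cpoly_hprod_lin_quot[OF G(3)] Q_def by (simp add: algebra_simps)
  also have "\<dots> = of_real ((cmod z)\<^sup>2) * cnj (?V * cnj ?U) - of_real v * (of_real ((cmod ?U)\<^sup>2) * z)"
    by (simp only: complex_norm_square mult.commute)
  also have "Im \<dots> = (cmod z)\<^sup>2 * - Im (?V * cnj ?U) + (- v) * ((cmod ?U)\<^sup>2 * Im z)"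
    by (simp only: minus_complex.sel Im_of_real_mult cnj.sel)
  also have "\<dots> \<ge> 0"
    using neg v0 z by (intro add_nonneg_nonneg mult_nonneg_nonneg) auto
  finally show "0 \<le> Im (z * cpoly (hprod (lin_quot (lift q (Suc m) g) v) f) z * cnj (cpoly (hprod (lift q (Suc m) g) f) z))"
    by (simp add: Q_def G_def)
qed

lemma outward_rightward:
  assumes "0 < q" "q < 1"
  shows "outward q m \<and> rightward q m"
proof (induction m)
  case 0
  have "outward q 0"
    unfolding outward_def
  proof (intro allI impI, elim conjE)
    fix f g v z
    assume g: "sep q (lift q 0 g)" "poly (lift q 0 g) v = 0"
    have "degree (lift q 0 g) = 0"
      using degree_lift_le[of q 0 g] by simp
    then obtain a where "lift q 0 g = [:a:]"
      by (rule degree_eq_zeroE)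
    then show "0 \<le> Im (z * cpoly (hprod (lin_quot (lift q 0 g) v) f) z * cnj (cpoly (hprod (lift q 0 g) f) z))"
      using g by (simp add: sep_def real_simple_def)
  qed
  then show ?case
    by (simp add: rightward_def)
next
  case (Suc m)
  then show ?case
    using outward_imp_rightward[OF assms] rightward_imp_outward[OF assms] by blast
qed

section \<open>The dilation inequality and the location of zeros\<close>

text \<open>With d the degree of G, the quotient \<open>G(r z)/G(z)\<close> is \<open>r^d\<close>
  plus poles at the nonzero zeros x with weights \<open>(r - 1) x K(r x)/K(x)\<close>, K being the
  cofactor of \<open>z - x\<close>. These are positive because x < 0 and because r-separation keeps
  K of one sign between r x and x. So the dilation is a nonnegative combination of the quotients
  treated by \<open>outward\<close>.\<close>

lemma Im_dilate_nonneg: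
  assumes q: "0 < r" "r \<le> q" "q < 1" and f: "sep q (lift q n f)"
    and g: "sep r (lift q n g)" "\<And>k. k \<le> n \<Longrightarrow> g k \<ge> 0" and z: "Im z > 0"
  shows "Im (z * cpoly (hprod (lift q n g) f) (of_real r * z) * cnj (cpoly (hprod (lift q n g) f) z)) \<ge> 0"
proof -
  have q0: "0 < q"
    using q by simp
  define G where "G = lift q n g"
  have G: "sep r G" "G \<noteq> 0" "real_simple G"
    using g(1) by (auto simp: G_def sep_def real_simple_def)
  have cG: "coeff G k \<ge> 0" for k
    unfolding G_def using g(2) q0 by (intro lift_coeff_nonneg) auto
  define S where "S = hprod G (\<lambda>k. r ^ k)"
  have degS: "degree S \<le> Suc (degree G)"
    unfolding S_def using degree_hprod_le[of G] le_SucI by blast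
  have low: "coeff S k = 0" if "Suc k < order 0 G" for k
    using coeff_below_order[of k G] that by (simp add: S_def)
  obtain e c w where w:
    "S = smult (- e) (pCons 0 G) + smult c G + (\<Sum>x | poly G x = 0. smult (w x) (lin_quot G x))"
    "\<And>x. x \<noteq> 0 \<Longrightarrow> poly G x = 0 \<Longrightarrow> w x * poly (pderiv G) x = poly S x"
    "poly G 0 = 0 \<Longrightarrow> w 0 * coeff G (order 0 G) = coeff S (order 0 G - 1)"
    "- e * lead_coeff G = coeff S (Suc (degree G))"
    "e = 0 \<Longrightarrow> c * lead_coeff G = coeff S (degree G)"
    using partial_fractions[OF G(3) degS low] by blast
  have e: "e = 0"
    using w(4) G(2) by (simp add: S_def coeff_eq_0)
  have c: "c = r ^ degree G"
    using w(5)[OF e] G(2) by (simp add: S_def)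
  have wx: "w x \<ge> 0" if x: "poly G x = 0" for x
  proof (cases "x = 0")
    case True
    then have "order 0 G > 0"
      using x G(2) by (simp add: order_gt_0_iff)
    then have "w 0 * coeff G (order 0 G) = 0"
      using w(3) x True coeff_below_order[of "order 0 G - 1" G] by (simp add: S_def)
    then show ?thesis
      using coeff_order_nonzero[OF G(2)] True by simp
  next
    case False
    have x0: "x < 0"
      using root_nonpos[OF cG G(2) x] False by simp
    have pos: "poly (lin_quot G x) x * poly (lin_quot G x) (r * x) > 0"
      using q False by (intro lin_quot_sign_near[OF G(1) x False q(1)]) (auto simp: field_simps mult_le_one)
    have "w x * poly (lin_quot G x) x = (r - 1) * x * poly (lin_quot G x) (r * x)"
      using w(2)[OF False x] poly_pderiv_eq_lin_quot[OF x] poly_lin_quot[OF x, of "r * x"]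
      by (simp add: S_def poly_dilate algebra_simps)
    then have "w x * (poly (lin_quot G x) x)\<^sup>2 =
        ((r - 1) * x) * (poly (lin_quot G x) x * poly (lin_quot G x) (r * x))"
      by (simp add: power2_eq_square mult.assoc mult.commute mult.left_commute)
    also have "\<dots> > 0"
      by (rule mult_pos_pos[OF mult_neg_neg pos]) (use q x0 in auto)
    finally show ?thesis
      by (simp add: zero_less_mult_iff)
  qed
  have G': "sep q (lift q n g)"
    using sep_mono[OF g(1) q(2)] .
  let ?U = "cpoly (hprod G f) z"
  have out: "Im (z * cpoly (hprod (lin_quot G x) f) z * cnj ?U) \<ge> 0" if "poly G x = 0" for x
    using outward_rightward[OF q0 q(3), of n] f G' g(2) z that unfolding outward_def G_def by blast
  have "cpoly (hprod G f) (of_real r * z) = cpoly (hprod (hprod G f) (\<lambda>k. r ^ k)) z"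
    by (simp add: cpoly_dilate)
  also have "hprod (hprod G f) (\<lambda>k. r ^ k) = hprod S f"
    by (simp add: S_def hprod_hprod mult.commute)
  also have "hprod S f = smult c (hprod G f) + (\<Sum>x | poly G x = 0. smult (w x) (hprod (lin_quot G x) f))"
    unfolding w(1) e by (simp add: hprod_add hprod_smult hprod_sum)
  finally have S: "cpoly (hprod G f) (of_real r * z) = of_real c * ?U +
      (\<Sum>x | poly G x = 0. of_real (w x) * cpoly (hprod (lin_quot G x) f) z)"
    by simp
  have "z * cpoly (hprod G f) (of_real r * z) * cnj ?U = of_real c * ((?U * cnj ?U) * z) +
      (\<Sum>x | poly G x = 0. of_real (w x) * (z * cpoly (hprod (lin_quot G x) f) z * cnj ?U))"
    unfolding S by (simp add: algebra_simps sum_distrib_left sum_distrib_right)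
  also have "?U * cnj ?U = of_real ((cmod ?U)\<^sup>2)"
    by (rule complex_norm_square[symmetric])
  also have "Im (of_real c * (of_real ((cmod ?U)\<^sup>2) * z) +
      (\<Sum>x | poly G x = 0. of_real (w x) * (z * cpoly (hprod (lin_quot G x) f) z * cnj ?U))) =
      c * ((cmod ?U)\<^sup>2 * Im z) +
      (\<Sum>x | poly G x = 0. w x * Im (z * cpoly (hprod (lin_quot G x) f) z * cnj ?U))"
    by (simp only: plus_complex.sel Im_sum Im_of_real_mult)
  also have "\<dots> \<ge> 0"
    using c q z wx out by (intro add_nonneg_nonneg mult_nonneg_nonneg sum_nonneg) auto
  finally show ?thesis
    by (simp add: G_def)
qed

text \<open>Take a zero z0 in the upper half plane of least modulus, so that \<open>H(r z0)\<close>
  is nonzero. Around z0 the factor \<open>cnj (H z)\<close> takes every argument while the other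
  factors are nearly constant, so the imaginary part becomes negative in some direction.\<close>

lemma Im_dilate_imp_real_roots:
  assumes H0: "H \<noteq> 0" and r: "0 < r" "r < 1"
    and Im: "\<And>z. Im z > 0 \<Longrightarrow> Im (z * cpoly H (of_real r * z) * cnj (cpoly H z)) \<ge> 0"
    and z: "cpoly H z = 0"
  shows "z \<in> \<real>"
proof (rule ccontr)
  assume "z \<notin> \<real>"
  then have Imz: "Im z \<noteq> 0"
    by (simp add: complex_is_Real_iff)
  define p where "p = map_poly complex_of_real H"
  have p0: "p \<noteq> 0"
    using H0 by (simp add: p_def map_poly_eq_0_iff)
  have cpoly_p: "cpoly H w = poly p w" for w
    by (simp add: cpoly_def p_def)
  define Z where "Z = {w. poly p w = 0 \<and> Im w > 0}"
  have finZ: "finite Z"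
    unfolding Z_def by (rule finite_subset[OF _ poly_roots_finite[OF p0]]) auto
  have "Z \<noteq> {}"
  proof (cases "Im z > 0")
    case True
    then show ?thesis
      using z by (auto simp: Z_def cpoly_p)
  next
    case False
    then have "cnj z \<in> Z"
      using z Imz cpoly_cnj[of H z] by (auto simp: Z_def simp flip: cpoly_p)
    then show ?thesis
      by blast
  qed
  then obtain z0 where z0: "z0 \<in> Z" "\<And>w. w \<in> Z \<Longrightarrow> cmod z0 \<le> cmod w"
    using finZ ex_min_if_finite[of "cmod ` Z"] by (force simp: not_less)
  have Im0: "Im z0 > 0" and root: "poly p z0 = 0"
    using z0(1) by (auto simp: Z_def)
  have z00: "z0 \<noteq> 0"
    using Im0 by auto
  have nr: "cpoly H (of_real r * z0) \<noteq> 0"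
  proof
    assume "cpoly H (of_real r * z0) = 0"
    then have "of_real r * z0 \<in> Z"
      using r Im0 by (simp add: Z_def cpoly_p)
    then have "cmod z0 \<le> r * cmod z0"
      using z0(2) r by (fastforce simp: norm_mult)
    then show False
      using r z00 by simp
  qed
  define m where "m = order z0 p"
  obtain K where K: "p = [:- z0, 1:] ^ m * K" "\<not> [:- z0, 1:] dvd K"
    using order_decomp[OF p0, of z0] by (auto simp: m_def)
  have Kz0: "poly K z0 \<noteq> 0"
    using K(2) by (simp add: poly_eq_0_iff_dvd)
  have m0: "m \<noteq> 0"
    using root p0 order_root m_def by blast
  define W where "W = z0 * cpoly H (of_real r * z0) * cnj (poly K z0)"
  have W0: "W \<noteq> 0"
    using z00 nr Kz0 by (simp add: W_def)
  \<comment> \<open>The direction u will satisfy \<open>cnj u ^ m * W = - i\<close>, which gives the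
    normalised expression the imaginary part -1.\<close>
  obtain v where v: "- \<i> / W = v ^ m"
    using exists_complex_root[OF m0] by metis
  define u where "u = cnj v"
  let ?z = "\<lambda>t::real. z0 + of_real t * u"
  let ?f = "\<lambda>t. ?z t * cpoly H (of_real r * ?z t) * cnj (poly K (?z t)) * v ^ m"
  have l1: "((\<lambda>t. Im (?f t)) \<longlongrightarrow> Im (?f 0)) (at_right 0)"
    by (intro tendsto_intros)
  have "?f 0 = W * v ^ m"
    by (simp add: W_def)
  then have l2: "Im (?f 0) = -1"
    using W0 by (simp flip: v)
  have l3: "\<forall>\<^sub>F t in at_right 0. Im (?f t) \<ge> 0"
  proof -
    have "((\<lambda>t. Im (?z t)) \<longlongrightarrow> Im (?z 0)) (at_right 0)"
      by (intro tendsto_intros)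
    then have "\<forall>\<^sub>F t in at_right 0. Im (?z t) > 0"
      using Im0 by (auto elim: order_tendstoD)
    then show ?thesis
      using eventually_at_right_less[of "0::real"]
    proof eventually_elim
      case (elim t)
      have "cpoly H (?z t) = (of_real t * u) ^ m * poly K (?z t)"
        unfolding cpoly_p by (subst K(1)) simp
      then have eq: "?z t * cpoly H (of_real r * ?z t) * cnj (cpoly H (?z t)) = of_real (t ^ m) * ?f t"
        by (simp add: u_def power_mult_distrib mult_ac)
      have "0 \<le> Im (of_real (t ^ m) * ?f t)"
        using Im[OF elim(1)] unfolding eq .
      then have "0 \<le> t ^ m * Im (?f t)"
        by (simp only: Im_of_real_mult)
      moreover have "t ^ m > 0"
        using elim(2) by simp
      ultimately show ?case
        by (metis zero_le_mult_iff not_le)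
    qed
  qed
  have "0 \<le> Im (?f 0)"
    by (rule tendsto_lowerbound[OF l1 l3]) simp
  then show False
    unfolding l2 by simp
qed

text \<open>Take a of least modulus among the zeros that have another zero b at a ratio in (r, 1).
  Minimality makes b the only zero in that range and excludes r a, so the cofactor K of
  \<open>z - a\<close> changes sign exactly once from r a to a. But the residue of
  \<open>- z H(r z) / H(z)\<close> at a is nonnegative, which means
  \<open>K(a) K(r a) >= 0\<close>.\<close>

lemma Im_dilate_imp_separated:
  assumes H: "real_simple H" and r: "0 < r" "r < 1"
    and Im: "\<And>z. Im z > 0 \<Longrightarrow> Im (z * cpoly H (of_real r * z) * cnj (cpoly H z)) \<ge> 0"
    and xy: "poly H x = 0" "poly H y = 0" "x \<noteq> 0"
  shows "\<not> (r < y / x \<and> y / x < 1)"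
proof
  assume h: "r < y / x \<and> y / x < 1"
  have H0: "H \<noteq> 0"
    using H by (simp add: real_simple_def)
  define B where "B = {x. poly H x = 0 \<and> x \<noteq> 0 \<and> (\<exists>y. poly H y = 0 \<and> r < y / x \<and> y / x < 1)}"
  have "finite B"
    unfolding B_def by (rule finite_subset[OF _ poly_roots_finite[OF H0]]) auto
  moreover have "x \<in> B"
    using h xy by (auto simp: B_def)
  ultimately obtain a where a: "a \<in> B" "\<And>b. b \<in> B \<Longrightarrow> \<bar>a\<bar> \<le> \<bar>b\<bar>"
    using ex_min_if_finite[of "abs ` B"] by (force simp: not_less)
  then obtain b where b: "poly H b = 0" "r < b / a" "b / a < 1" and a0: "poly H a = 0" "a \<noteq> 0"
    by (auto simp: B_def)
  \<comment> \<open>A zero c with a ratio to a in (r, 1) has smaller modulus than a, so by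
    minimality it has no such partner d.\<close>
  have no: False if "poly H c = 0" "poly H d = 0" "r < c / a" "c / a < 1" "r < d / c" "d / c < 1" for c d
  proof -
    have "c / a > 0"
      using that r by linarith
    then have "c \<noteq> 0"
      by auto
    then have "c \<in> B"
      using that by (auto simp: B_def)
    then have "\<bar>a\<bar> \<le> \<bar>c\<bar>"
      by (rule a(2))
    moreover have "\<bar>c / a\<bar> < 1"
      using that(4) \<open>c / a > 0\<close> by simp
    ultimately show False
      using a0(2) by simp
  qed
  have quot: "r < s / t" if "r < s" "0 < t" "t < 1" for s t
  proof -
    have "r * t < r * 1"
      using that r by (intro mult_strict_left_mono) auto
    then show ?thesis
      using that by (simp add: less_divide_eq)
  qed
  have b0: "b \<noteq> 0"
    using b(2) r by auto
  have ba: "b \<noteq> a"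
    using b(3) a0(2) by auto
  have only: "c = b" if c: "poly H c = 0" "r < c / a" "c / a < 1" for c
  proof (rule ccontr)
    assume ne: "c \<noteq> b"
    have pos: "0 < c / a" "0 < b / a"
      using c b r by auto
    have q: "(b / a) / (c / a) = b / c" "(c / a) / (b / a) = c / b"
      using a0(2) by auto
    have "b / c \<noteq> 1"
      using ne by auto
    then consider "b / a < c / a" | "c / a < b / a"
      using a0(2) ne by (metis divide_cancel_right linorder_neqE_linordered_idom)
    then show False
    proof cases
      case 1
      have "r < b / c"
        using quot[OF b(2) pos(1) c(3)] unfolding q .
      moreover have "b / c < 1"
        unfolding q(1)[symmetric] using 1 pos by (simp only: divide_less_eq_1_pos)
      ultimately show False
        using no[OF c(1) b(1) c(2,3)] by blast
    next
      case 2
      have "r < c / b"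
        using quot[OF c(2) pos(2) b(3)] unfolding q .
      moreover have "c / b < 1"
        unfolding q(2)[symmetric] using 2 pos by (simp only: divide_less_eq_1_pos)
      ultimately show False
        using no[OF b(1) c(1) b(2,3)] by blast
    qed
  qed
  have ra: "poly H (r * a) \<noteq> 0"
  proof
    assume 0: "poly H (r * a) = 0"
    have pos: "0 < b / a"
      using b r by auto
    have q: "r * a / b = r / (b / a)"
      by simp
    have "r * (b / a) < r * 1"
      using b r by (intro mult_strict_left_mono) auto
    then have "r < r * a / b"
      unfolding q using pos by (simp only: pos_less_divide_eq mult_1_right)
    moreover have "r * a / b < 1"
      unfolding q using pos b(2) by (simp only: pos_divide_less_eq mult_1)
    ultimately have "r < r * a / b" "r * a / b < 1" .
    then show False
      using no[OF b(1) 0 b(2,3)] by blast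
  qed
  define K where "K = lin_quot H a"
  have Kb: "poly K b = 0"
    using poly_lin_quot[OF a0(1), of b] b(1) ba by (simp add: K_def)
  define L where "L = lin_quot K b"
  have HK: "poly H t = (t - a) * poly K t" for t
    unfolding K_def by (rule poly_lin_quot[OF a0(1)])
  have KL: "poly K t = (t - b) * poly L t" for t
    unfolding L_def by (rule poly_lin_quot[OF Kb])
  have Ka: "poly K a \<noteq> 0"
    using H a0 poly_pderiv_eq_lin_quot[OF a0(1)] unfolding real_simple_def K_def by metis
  have Lb: "poly L b \<noteq> 0"
  proof -
    have "real_simple K"
      unfolding K_def by (rule real_simple_lin_quot[OF H a0(1)])
    then show ?thesis
      using b0 Kb poly_pderiv_eq_lin_quot[OF Kb] unfolding real_simple_def L_def by metis
  qed
  have "poly L a * poly L (r * a) > 0"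
  proof (rule poly_same_sign)
    fix t assume "t \<in> closed_segment a (r * a)"
    then obtain u where u: "0 \<le> u" "u \<le> 1" "t = (1 - u) * a + u * (r * a)"
      by (auto simp: in_segment)
    then have ta: "t / a = (1 - u) + u * r"
      using a0(2) by (simp add: add_divide_distrib)
    have "t / a = r + (1 - u) * (1 - r)" "t / a = 1 - u * (1 - r)"
      unfolding ta by (simp_all add: algebra_simps)
    moreover have "0 \<le> (1 - u) * (1 - r)" "0 \<le> u * (1 - r)"
      using u r by simp_all
    ultimately have tr: "r \<le> t / a" "t / a \<le> 1"
      by linarith+
    show "poly L t \<noteq> 0"
    proof
      assume L: "poly L t = 0"
      then have Ht: "poly H t = 0" "poly K t = 0"
        by (auto simp: HK KL)
      have "t \<noteq> a" "t \<noteq> r * a"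
        using Ht Ka ra by auto
      then have "t / a \<noteq> 1" "t / a \<noteq> r"
        using a0(2) by (auto simp: field_simps)
      then have "r < t / a" "t / a < 1"
        using tr by (simp_all only: order_less_le) simp_all
      then have "t = b"
        by (rule only[OF Ht(1)])
      then show False
        using L Lb by simp
    qed
  qed
  moreover have "(a - b) * (r * a - b) < 0"
  proof -
    have "(a - b) * (r * a - b) = a\<^sup>2 * ((1 - b / a) * (r - b / a))"
      using a0(2) by (simp add: field_simps power2_eq_square)
    also have "\<dots> < 0"
      using b a0(2) by (intro mult_pos_neg mult_pos_neg) auto
    finally show ?thesis .
  qed
  ultimately have "((a - b) * (r * a - b)) * (poly L a * poly L (r * a)) < 0"
    by (rule mult_neg_pos[rotated])
  then have neg: "poly K a * poly K (r * a) < 0"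
    by (simp add: KL mult_ac)
  have "poly (- pCons 0 (hprod H (\<lambda>k. r ^ k))) a * poly (lin_quot H a) a \<ge> 0"
  proof (rule residue_nonneg[OF _ a0(1)])
    fix z assume "Im z > 0"
    then show "Im (cpoly (- pCons 0 (hprod H (\<lambda>k. r ^ k))) z * cnj (cpoly H z)) \<le> 0"
      using Im[of z] by (simp add: cpoly_dilate)
  qed
  then have "(1 - r) * a\<^sup>2 * (poly K a * poly K (r * a)) \<ge> 0"
    by (simp add: poly_dilate HK K_def[symmetric] power2_eq_square algebra_simps)
  moreover have "(1 - r) * a\<^sup>2 > 0"
    using r a0(2) by simp
  ultimately show False
    using mult_pos_neg[OF _ neg] by (metis not_le)
qed

subsection \<open>Perturbation of separated polynomials\<close>

lemma finite_nonzero_roots: "(p::real poly) \<noteq> 0 \<Longrightarrow> finite {x. x \<noteq> 0 \<and> poly p x = 0}"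
  by (rule finite_subset[OF _ poly_roots_finite]) auto

lemma tendsto_poly_coeffs:
  assumes "\<And>k. ((\<lambda>s. coeff (P s) k) \<longlongrightarrow> coeff p k) F"
    and "\<And>s. degree (P s) \<le> d" "degree p \<le> d"
  shows "((\<lambda>s. poly (P s) y) \<longlongrightarrow> poly p (y::real)) F"
  unfolding poly_altdef_le[OF assms(2)] poly_altdef_le[OF assms(3)]
  by (intro tendsto_sum tendsto_mult assms(1) tendsto_const)

lemma tendsto_cpoly_coeffs:
  assumes "\<And>k. ((\<lambda>s. coeff (P s) k) \<longlongrightarrow> coeff p k) F"
    and "\<And>s. degree (P s) \<le> d" "degree p \<le> d"
  shows "((\<lambda>s. cpoly (P s) y) \<longlongrightarrow> cpoly p y) F"
  unfolding cpoly_altdef[OF assms(2)] cpoly_altdef[OF assms(3)]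
  by (intro tendsto_sum tendsto_mult assms(1) tendsto_const tendsto_of_real)

lemma root_near_if_sign_change:
  assumes x0: "x \<noteq> 0" and d: "0 < \<delta>" and neg: "poly p (x * (1 - \<delta>)) * poly p (x * (1 + \<delta>)) < (0::real)"
  obtains a where "\<bar>a\<bar> < \<delta>" "poly p (x * (1 + a)) = 0"
proof -
  obtain t where t: "poly p t = 0" "\<bar>t / x - 1\<bar> < \<delta>"
  proof (cases "x > 0")
    case True
    then have "x * (1 - \<delta>) < x * (1 + \<delta>)"
      using d by simp
    then obtain t where "x * (1 - \<delta>) < t" "t < x * (1 + \<delta>)" "poly p t = 0"
      using poly_IVT[OF _ neg] by blast
    then show ?thesis
      using True by (intro that[of t]) (auto simp: abs_less_iff field_simps)
  next
    case False
    then have "x < 0"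
      using x0 by simp
    then have "x * (1 + \<delta>) < x * (1 - \<delta>)"
      using d by simp
    then obtain t where "x * (1 + \<delta>) < t" "t < x * (1 - \<delta>)" "poly p t = 0"
      using poly_IVT[of "x * (1 + \<delta>)" "x * (1 - \<delta>)" p] neg by (auto simp: mult.commute)
    then show ?thesis
      using \<open>x < 0\<close> by (intro that[of t]) (auto simp: abs_less_iff field_simps)
  qed
  then show ?thesis
    using x0 that[of "t / x - 1"] by simp
qed

text \<open>Around each nonzero zero a sign change survives the perturbation within relative
  distance \<delta>, and relative errors change ratios by at most the factor
  \<open>(1 + \<delta>)/(1 - \<delta>)\<close>. The degree bound and the vanishing low coefficients
  keep zeros from coming in from infinity or leaving the origin, so the count is complete.\<close>

lemma sep_open:
  fixes P :: "'a \<Rightarrow> real poly"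
  assumes p: "sep q p" and q: "0 < q" "q \<le> 1"
    and lim: "\<And>k. ((\<lambda>s. coeff (P s) k) \<longlongrightarrow> coeff p k) F"
    and deg: "\<And>s. degree (P s) \<le> degree p"
    and low: "\<And>s k. k < order 0 p \<Longrightarrow> coeff (P s) k = 0"
  shows "\<forall>\<^sub>F s in F. sep q (P s)"
proof -
  have rs: "real_simple p" and p0: "p \<noteq> 0"
    using p by (auto simp: sep_def real_simple_def)
  define J where "J = {x. x \<noteq> 0 \<and> poly p x = 0}"
  have fin: "finite J"
    unfolding J_def using finite_nonzero_roots[OF p0] .
  have card: "degree p \<le> order 0 p + card J"
    using real_simple_degree[OF rs] by (simp add: J_def)
  have pairs: "\<forall>\<^sub>F \<delta> in at_right (0::real).
      ((1 + \<delta>) / (1 - \<delta>) * (i / j) < q \<or> (1 - \<delta>) / (1 + \<delta>) * (i / j) > 1)"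
    if ij: "i \<in> J" "j \<in> J" "i \<noteq> j" for i j
  proof -
    have "((\<lambda>\<delta>::real. (1 + \<delta>) / (1 - \<delta>) * (i / j)) \<longlongrightarrow> (1 + 0) / (1 - 0) * (i / j)) (at_right 0)"
      "((\<lambda>\<delta>::real. (1 - \<delta>) / (1 + \<delta>) * (i / j)) \<longlongrightarrow> (1 - 0) / (1 + 0) * (i / j)) (at_right 0)"
      by (intro tendsto_intros; simp)+
    then have l: "((\<lambda>\<delta>::real. (1 + \<delta>) / (1 - \<delta>) * (i / j)) \<longlongrightarrow> i / j) (at_right 0)"
      "((\<lambda>\<delta>::real. (1 - \<delta>) / (1 + \<delta>) * (i / j)) \<longlongrightarrow> i / j) (at_right 0)"
      by simp_all
    have "\<not> (q \<le> i / j \<and> i / j \<le> 1)"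
      using p ij unfolding sep_def J_def by blast
    then consider "i / j < q" | "i / j > 1"
      by linarith
    then show ?thesis
    proof cases
      case 1
      from order_tendstoD(2)[OF l(1) 1] show ?thesis
        by eventually_elim blast
    next
      case 2
      from order_tendstoD(1)[OF l(2) 2] show ?thesis
        by eventually_elim blast
    qed
  qed
  have signs: "\<forall>\<^sub>F \<delta> in at_right (0::real). poly p (x * (1 - \<delta>)) * poly p (x * (1 + \<delta>)) < 0"
    if x: "x \<in> J" for x
  proof -
    have px: "poly p x = 0" "x \<noteq> 0"
      using x by (auto simp: J_def)
    have "poly (lin_quot p x) x \<noteq> 0"
      using rs px poly_pderiv_eq_lin_quot[OF px(1)] unfolding real_simple_def by metis
    then have pos: "poly (lin_quot p x) x * poly (lin_quot p x) x > 0"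
      by (auto simp: zero_less_mult_iff linorder_neq_iff)
    have "((\<lambda>\<delta>. poly (lin_quot p x) (x * (1 - \<delta>)) * poly (lin_quot p x) (x * (1 + \<delta>))) \<longlongrightarrow>
        poly (lin_quot p x) (x * (1 - 0)) * poly (lin_quot p x) (x * (1 + 0))) (at_right 0)"
      by (intro tendsto_intros)
    then have "\<forall>\<^sub>F \<delta> in at_right 0. poly (lin_quot p x) (x * (1 - \<delta>)) * poly (lin_quot p x) (x * (1 + \<delta>)) > 0"
      using pos by (auto elim: order_tendstoD)
    then show ?thesis
      using eventually_at_right_less[of "0::real"]
    proof eventually_elim
      case (elim \<delta>)
      have "poly p (x * (1 - \<delta>)) * poly p (x * (1 + \<delta>)) =
          - ((x * \<delta>)\<^sup>2 * (poly (lin_quot p x) (x * (1 - \<delta>)) * poly (lin_quot p x) (x * (1 + \<delta>))))"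
        by (simp add: poly_lin_quot[OF px(1)] power2_eq_square algebra_simps)
      moreover have "(x * \<delta>)\<^sup>2 > 0"
        using elim px by simp
      ultimately show ?case
        using elim(1) by (simp add: mult_pos_pos)
    qed
  qed
  have "\<forall>\<^sub>F \<delta> in at_right (0::real). \<delta> > 0 \<and> \<delta> < 1 \<and>
      (\<forall>x\<in>J. poly p (x * (1 - \<delta>)) * poly p (x * (1 + \<delta>)) < 0) \<and>
      (\<forall>i\<in>J. \<forall>j\<in>J. i \<noteq> j \<longrightarrow> ((1 + \<delta>) / (1 - \<delta>) * (i / j) < q \<or> (1 - \<delta>) / (1 + \<delta>) * (i / j) > 1))"
    using fin signs pairs
    by (intro eventually_conj eventually_ball_finite ballI eventually_at_right_less)
      (auto simp: eventually_at_right_less intro: eventually_at_rightI[of 0 1])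
  from eventually_happens'[OF trivial_limit_at_right_real this]
  obtain \<delta> where d: "\<delta> > 0" "\<delta> < 1"
    "\<And>x. x \<in> J \<Longrightarrow> poly p (x * (1 - \<delta>)) * poly p (x * (1 + \<delta>)) < 0"
    "\<And>i j. i \<in> J \<Longrightarrow> j \<in> J \<Longrightarrow> i \<noteq> j \<Longrightarrow>
      (1 + \<delta>) / (1 - \<delta>) * (i / j) < q \<or> (1 - \<delta>) / (1 + \<delta>) * (i / j) > 1"
    by blast
  have "\<forall>\<^sub>F s in F. coeff (P s) (degree p) \<noteq> 0"
    using lim[of "degree p"] p0 by (intro tendsto_imp_eventually_ne) auto
  moreover have "\<forall>\<^sub>F s in F. \<forall>x\<in>J. poly (P s) (x * (1 - \<delta>)) * poly (P s) (x * (1 + \<delta>)) < 0"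
  proof (intro eventually_ball_finite fin ballI)
    fix x assume "x \<in> J"
    have "((\<lambda>s. poly (P s) (x * (1 - \<delta>)) * poly (P s) (x * (1 + \<delta>))) \<longlongrightarrow>
        poly p (x * (1 - \<delta>)) * poly p (x * (1 + \<delta>))) F"
      by (intro tendsto_mult tendsto_poly_coeffs[OF lim deg order_refl])
    then show "\<forall>\<^sub>F s in F. poly (P s) (x * (1 - \<delta>)) * poly (P s) (x * (1 + \<delta>)) < 0"
      using d(3)[OF \<open>x \<in> J\<close>] by (rule order_tendstoD(2))
  qed
  ultimately show ?thesis
  proof eventually_elim
    case (elim s)
    have "\<exists>a. \<bar>a\<bar> < \<delta> \<and> poly (P s) (x * (1 + a)) = 0" if x: "x \<in> J" for x
    proof -
      have x0: "x \<noteq> 0"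
        using x by (simp add: J_def)
      have neg: "poly (P s) (x * (1 - \<delta>)) * poly (P s) (x * (1 + \<delta>)) < 0"
        using elim(2) x by blast
      show ?thesis
        using root_near_if_sign_change[OF x0 d(1) neg] by blast
    qed
    then obtain a where a: "\<And>x. x \<in> J \<Longrightarrow> \<bar>a x\<bar> < \<delta>" "\<And>x. x \<in> J \<Longrightarrow> poly (P s) (x * (1 + a x)) = 0"
      by metis
    show "sep q (P s)"
    proof (rule sep_by_count[OF _ deg low fin card, of s "\<lambda>x. x * (1 + a x)"])
      show "P s \<noteq> 0"
        using elim(1) by auto
      show "x * (1 + a x) \<noteq> 0 \<and> poly (P s) (x * (1 + a x)) = 0" if "x \<in> J" for x
        using a[OF that] d that by (auto simp: J_def)
      show "\<not> i * (1 + a i) / (j * (1 + a j)) \<le> 1"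
        if ij: "i \<in> J" "j \<in> J" "i \<noteq> j" "q \<le> i * (1 + a i) / (j * (1 + a j))" for i j
      proof -
        let ?u = "(1 + a i) / (1 + a j)"
        have pos: "1 + a i > 0" "1 + a j > 0" "1 - \<delta> > 0"
          using a(1)[OF ij(1)] a(1)[OF ij(2)] d by auto
        have u: "?u \<le> (1 + \<delta>) / (1 - \<delta>)" "?u \<ge> (1 - \<delta>) / (1 + \<delta>)"
          using a(1)[OF ij(1)] a(1)[OF ij(2)] d pos by (auto intro!: frac_le)
        have eq: "i * (1 + a i) / (j * (1 + a j)) = ?u * (i / j)"
          by (simp add: mult_ac)
        have "?u * (i / j) > 0"
          using ij(4) q unfolding eq by linarith
        moreover have "?u > 0"
          using pos by simp
        ultimately have t: "i / j > 0"
          by (rule zero_less_mult_pos)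
        have "?u * (i / j) \<le> (1 + \<delta>) / (1 - \<delta>) * (i / j)" "?u * (i / j) \<ge> (1 - \<delta>) / (1 + \<delta>) * (i / j)"
          using u t by (intro mult_right_mono; simp)+
        then show ?thesis
          using d(4)[OF ij(1-3)] ij(4) unfolding eq by linarith
      qed
    qed (use q in auto)
  qed
qed

text \<open>There are finitely many ratios of distinct nonzero zeros, none in the closed interval
  [q, 1], so the interval can be enlarged a little.\<close>

lemma sep_shrink:
  assumes p: "sep q p" and q: "0 < q"
  obtains s where "0 < s" "s < q" "sep s p"
proof -
  define J where "J = {x. x \<noteq> 0 \<and> poly p x = 0}"
  have fin: "finite J"
    unfolding J_def using finite_nonzero_roots sep_nonzero[OF p] by blast
  have "\<forall>\<^sub>F s in at_left q. \<not> (s \<le> j / i \<and> j / i \<le> 1)" if "i \<in> J" "j \<in> J" "i \<noteq> j" for i j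
  proof -
    have "\<not> (q \<le> j / i \<and> j / i \<le> 1)"
      using p that unfolding sep_def J_def by blast
    then consider "j / i < q" | "j / i > 1"
      by linarith
    then show ?thesis
    proof cases
      case 1
      then have "\<forall>\<^sub>F s in at_left q. s \<in> {j / i <..<q}"
        by (rule eventually_at_leftI[rotated])
      then show ?thesis
        by eventually_elim auto
    qed auto
  qed
  then have "\<forall>\<^sub>F s in at_left q. \<forall>i\<in>J. \<forall>j\<in>J. i \<noteq> j \<longrightarrow> \<not> (s \<le> j / i \<and> j / i \<le> 1)"
    using fin by (intro eventually_ball_finite ballI) auto
  moreover have "\<forall>\<^sub>F s in at_left q. s \<in> {0<..<q}"
    using q by (rule eventually_at_leftI[rotated])
  ultimately have "\<forall>\<^sub>F s in at_left q. s \<in> {0<..<q} \<and>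
      (\<forall>i\<in>J. \<forall>j\<in>J. i \<noteq> j \<longrightarrow> \<not> (s \<le> j / i \<and> j / i \<le> 1))"
    by eventually_elim blast
  from eventually_happens'[OF trivial_limit_at_left_real this]
  obtain s where s: "0 < s" "s < q"
    "\<And>i j. i \<in> J \<Longrightarrow> j \<in> J \<Longrightarrow> i \<noteq> j \<Longrightarrow> \<not> (s \<le> j / i \<and> j / i \<le> 1)"
    by auto
  have "sep s p"
    unfolding sep_def
  proof (intro conjI allI impI)
    show "real_simple p"
      using p by (simp add: sep_def)
    fix x y assume h: "poly p x = 0 \<and> poly p y = 0 \<and> x \<noteq> 0 \<and> y \<noteq> x \<and> s \<le> y / x"
    then have "y \<noteq> 0"
      using s(1) by auto
    then show "\<not> y / x \<le> 1"
      using s(3)[of x y] h by (auto simp: J_def)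
  qed
  then show ?thesis
    using that s by blast
qed

text \<open>A prescribed perturbation D of the image is realised by perturbing F: divide D by g
  coefficientwise, which is possible because D is supported where g is nonzero. Openness keeps the
  perturbed F separated.\<close>

lemma sep_perturb:
  assumes F: "sep q F" and q: "0 < q" "q \<le> 1"
    and D: "degree D \<le> degree (hprod F g)" "\<And>k. k < order 0 (hprod F g) \<Longrightarrow> coeff D k = 0"
    and g: "\<And>k. order 0 (hprod F g) \<le> k \<Longrightarrow> k \<le> degree (hprod F g) \<Longrightarrow> g k \<noteq> 0"
    and H0: "hprod F g \<noteq> 0"
  shows "\<forall>\<^sub>F \<epsilon> in at_right 0. \<exists>F'. sep q F' \<and> degree F' \<le> degree F \<and> hprod F' g = hprod F g + smult \<epsilon> D"
proof -
  define E where "E = hprod D (\<lambda>k. if g k = 0 then 0 else 1 / g k)"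
  have E: "hprod E g = D"
  proof (rule poly_eqI)
    fix k
    have "coeff D k = 0" if "g k = 0"
      using D g[of k] that coeff_eq_0[of D k] by (meson not_le order_trans le_less_trans)
    then show "coeff (hprod E g) k = coeff D k"
      by (auto simp: E_def)
  qed
  have degE: "degree E \<le> degree F"
    using degree_hprod_le[of D] D(1) degree_hprod_le[of F g] unfolding E_def by (meson order_trans)
  have low: "coeff E k = 0" if "k < order 0 F" for k
  proof -
    have "coeff (hprod F g) j = 0" if "j < order 0 F" for j
      using coeff_below_order[OF that] by simp
    then have "order 0 F \<le> order 0 (hprod F g)"
      using coeff_order_nonzero[OF H0] by (meson not_le)
    then show ?thesis
      using D(2)[of k] that by (simp add: E_def)
  qed
  have "((\<lambda>\<epsilon>. coeff F k + \<epsilon> * coeff E k) \<longlongrightarrow> coeff F k + 0 * coeff E k) (at_right 0)" for k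
    by (intro tendsto_intros)
  then have lim: "((\<lambda>\<epsilon>. coeff (F + smult \<epsilon> E) k) \<longlongrightarrow> coeff F k) (at_right 0)" for k
    by simp
  have "\<forall>\<^sub>F \<epsilon> in at_right 0. sep q (F + smult \<epsilon> E)"
    by (rule sep_open[OF F q lim])
      (use degE low coeff_below_order in \<open>auto intro!: degree_add_le order_trans[OF degree_smult_le]\<close>)
  then show ?thesis
  proof eventually_elim
    case (elim \<epsilon>)
    have "degree (F + smult \<epsilon> E) \<le> degree F"
      using degE by (intro degree_add_le order_trans[OF degree_smult_le]) auto
    moreover have "hprod (F + smult \<epsilon> E) g = hprod F g + smult \<epsilon> D"
      by (simp add: hprod_add hprod_smult E)
    ultimately show ?case
      using elim by blast
  qed
qed

lemma order_0_lin_quot: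
  assumes "poly p x = 0" "x \<noteq> 0" "p \<noteq> 0"
  shows "order 0 p \<le> order 0 (lin_quot p x)"
  using coeff_lin_quot_below_order[OF assms(1,2)] coeff_order_nonzero[OF lin_quot_nonzero[OF assms(1,3)]]
  by (meson not_le)

text \<open>If a multiplier maps the open class of separated polynomials into a weakly separated class,
  the image consists of strictly separated polynomials, because a polynomial with a double zero or
  with two zeros of ratio exactly \<open>r\<close> has arbitrarily small perturbations which are not weakly
  separated.\<close>

locale weak_multiplier =
  fixes q :: real and n :: nat and g :: "nat \<Rightarrow> real"
  assumes q: "0 < q" "q \<le> 1"
    and nogap: "\<And>i j k. i \<le> j \<Longrightarrow> j \<le> k \<Longrightarrow> k \<le> n \<Longrightarrow> g i \<noteq> 0 \<Longrightarrow> g k \<noteq> 0 \<Longrightarrow> g j \<noteq> 0"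
    and real: "\<And>F z. sep q F \<Longrightarrow> degree F \<le> n \<Longrightarrow> hprod F g \<noteq> 0 \<Longrightarrow> cpoly (hprod F g) z = 0 \<Longrightarrow> z \<in> \<real>"
begin

text \<open>Makes every perturbation between the order at the origin and the degree of the image
  accessible to \<open>sep_perturb\<close>.\<close>

lemma window_nonzero:
  assumes "degree F \<le> n" "hprod F g \<noteq> 0" "order 0 (hprod F g) \<le> k" "k \<le> degree (hprod F g)"
  shows "g k \<noteq> 0"
proof (rule nogap)
  show "g (order 0 (hprod F g)) \<noteq> 0"
    using coeff_order_nonzero[OF assms(2)] by auto
  show "g (degree (hprod F g)) \<noteq> 0"
    using assms(2) by (metis coeff_hprod leading_coeff_0_iff mult_zero_right)
  show "degree (hprod F g) \<le> n"
    using degree_hprod_le[of F g] assms(1) by simp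
qed (use assms in auto)

lemma simple:
  assumes F: "sep q F" "degree F \<le> n" "hprod F g \<noteq> 0"
  shows "real_simple (hprod F g)"
proof -
  define H where "H = hprod F g"
  have H0: "H \<noteq> 0"
    using F by (simp add: H_def)
  have "poly (pderiv H) x \<noteq> 0" if x: "x \<noteq> 0" "poly H x = 0" for x
  proof
    assume "poly (pderiv H) x = 0"
    then have qx: "poly (lin_quot H x) x = 0"
      using poly_pderiv_eq_lin_quot[OF x(2)] by simp
    \<comment> \<open>\<open>H = (z - x)^2 K\<close>, and adding \<open>\<epsilon> K\<close> splits
      the double zero into the nonreal pair \<open>x + i sqrt \<epsilon>\<close>,
      \<open>x - i sqrt \<epsilon>\<close>.\<close>
    define K where "K = lin_quot (lin_quot H x) x"
    have nz: "lin_quot H x \<noteq> 0" "K \<noteq> 0"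
      unfolding K_def using lin_quot_nonzero x(2) H0 qx by blast+
    have degK: "degree K \<le> degree H"
      using degree_lin_quot[OF x(2) H0] degree_lin_quot[OF qx nz(1)] by (simp add: K_def)
    have lowK: "coeff K k = 0" if "k < order 0 H" for k
      unfolding K_def using that order_0_lin_quot[OF x(2,1) H0]
      by (intro coeff_lin_quot_below_order[OF qx x(1)]) simp
    have "\<forall>\<^sub>F \<epsilon> in at_right 0. \<exists>F'. sep q F' \<and> degree F' \<le> degree F \<and> hprod F' g = H + smult \<epsilon> K"
      unfolding H_def using degK lowK window_nonzero F
      by (intro sep_perturb[OF F(1) q]) (auto simp: H_def)
    then have "\<forall>\<^sub>F \<epsilon> in at_right 0. 0 < \<epsilon> \<and>
        (\<exists>F'. sep q F' \<and> degree F' \<le> degree F \<and> hprod F' g = H + smult \<epsilon> K)"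
      using eventually_at_right_less[of "0::real"] by eventually_elim blast
    from eventually_happens'[OF trivial_limit_at_right_real this]
    obtain \<epsilon> F' where e: "0 < \<epsilon>" and F': "sep q F'" "degree F' \<le> degree F"
      "hprod F' g = H + smult \<epsilon> K"
      by blast
    have cevH: "cpoly H z = (z - of_real x)\<^sup>2 * cpoly K z" for z
      using cpoly_lin_quot[OF x(2), of z] cpoly_lin_quot[OF qx, of z] by (simp add: K_def power2_eq_square mult.assoc)
    let ?z = "complex_of_real x + \<i> * of_real (sqrt \<epsilon>)"
    have "(?z - of_real x)\<^sup>2 = - of_real \<epsilon>"
      using e by (simp add: power_mult_distrib flip: of_real_power)
    then have root: "cpoly (hprod F' g) ?z = 0"
      by (simp add: F' cevH)
    have "hprod F' g \<noteq> 0"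
    proof
      assume "hprod F' g = 0"
      then have "cpoly H z + of_real \<epsilon> * cpoly K z = 0" for z
        using F'(3) by (metis cpoly_0 cpoly_add cpoly_smult)
      then have "((z - of_real x)\<^sup>2 + of_real \<epsilon>) * cpoly K z = 0" for z
        by (simp add: cevH algebra_simps)
      then have "((t - x)\<^sup>2 + \<epsilon>) * poly K t = 0" for t
        by (metis (no_types) cpoly_of_real of_real_add of_real_diff of_real_eq_0_iff of_real_mult
            of_real_power)
      moreover have "(t - x)\<^sup>2 + \<epsilon> > 0" for t
        using e by (simp add: add_nonneg_pos)
      ultimately have "poly K t = 0" for t
        by (metis less_irrefl mult_eq_0_iff)
      then show False
        using nz(2) by (simp add: poly_eq_poly_eq_iff[symmetric] fun_eq_iff)
    qed
    then have "?z \<in> \<real>"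
      using real[OF F'(1) _ _ root] F'(2) F(2) by simp
    then show False
      using e by (simp add: complex_is_Real_iff)
  qed
  then show ?thesis
    using H0 real[OF F] unfolding real_simple_def H_def by blast
qed

lemma strict:
  assumes r: "0 < r" "r \<le> 1"
    and weak: "\<And>F x y. r < 1 \<Longrightarrow> sep q F \<Longrightarrow> degree F \<le> n \<Longrightarrow> real_simple (hprod F g) \<Longrightarrow>
      poly (hprod F g) x = 0 \<Longrightarrow> poly (hprod F g) y = 0 \<Longrightarrow> x \<noteq> 0 \<Longrightarrow> r < y / x \<Longrightarrow> y / x < 1 \<Longrightarrow> False"
    and F: "sep q F" "degree F \<le> n" "hprod F g \<noteq> 0"
  shows "sep r (hprod F g)"
proof -
  define H where "H = hprod F g"
  have H: "real_simple H" "H \<noteq> 0"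
    using simple[OF F] F by (auto simp: H_def)
  have "\<not> y / x \<le> 1" if h: "poly H x = 0" "poly H y = 0" "x \<noteq> 0" "y \<noteq> x" "r \<le> y / x" for x y
  proof
    assume le: "y / x \<le> 1"
    have "y / x \<noteq> 1"
      using h by auto
    with le have lt: "y / x < 1"
      by (rule order_le_neq_trans)
    then have r1: "r < 1"
      using h(5) by simp
    have "y / x = r"
    proof (rule ccontr)
      assume "y / x \<noteq> r"
      then have "r < y / x"
        using h(5) by simp
      then show False
        using weak[OF r1 F(1,2) H(1)[unfolded H_def] _ _ h(3) _ lt] h by (simp add: H_def)
    qed
    then have y: "y = r * x"
      using h(3) by (simp add: field_simps)
    have y0: "y \<noteq> 0"
      using y r h by simp
    \<comment> \<open>\<open>H + \<epsilon> D\<close> replaces the zero y = r x by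
      \<open>(r + \<epsilon>) x\<close> and keeps x, so the ratio enters the forbidden open interval
      (r, 1).\<close>
    define D where "D = smult (- x) (lin_quot H y)"
    have D: "degree D \<le> degree H" "\<And>k. k < order 0 H \<Longrightarrow> coeff D k = 0"
      using degree_lin_quot[OF h(2) H(2)] coeff_lin_quot_below_order[OF h(2) y0] h(3) by (auto simp: D_def)
    have "\<forall>\<^sub>F \<epsilon> in at_right 0. \<exists>F'. sep q F' \<and> degree F' \<le> degree F \<and> hprod F' g = H + smult \<epsilon> D"
      unfolding H_def using D window_nonzero F
      by (intro sep_perturb[OF F(1) q]) (auto simp: H_def)
    moreover have "\<forall>\<^sub>F \<epsilon> in at_right 0. \<epsilon> \<in> {0<..<1 - r}"
      using r1 by (intro eventually_at_rightI) auto
    ultimately have "\<forall>\<^sub>F \<epsilon> in at_right 0. \<epsilon> \<in> {0<..<1 - r} \<and>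
        (\<exists>F'. sep q F' \<and> degree F' \<le> degree F \<and> hprod F' g = H + smult \<epsilon> D)"
      by eventually_elim blast
    from eventually_happens'[OF trivial_limit_at_right_real this]
    obtain \<epsilon> F' where e: "0 < \<epsilon>" "\<epsilon> < 1 - r" and F': "sep q F'" "degree F' \<le> degree F"
      "hprod F' g = H + smult \<epsilon> D"
      by auto
    have H': "poly (hprod F' g) t = (t - (r + \<epsilon>) * x) * poly (lin_quot H y) t" for t
      using poly_lin_quot[OF h(2), of t] by (simp add: F' D_def y algebra_simps)
    have rx: "poly (hprod F' g) ((r + \<epsilon>) * x) = 0"
      by (simp add: H')
    have "poly (lin_quot H y) x = 0"
      using poly_lin_quot[OF h(2), of x] h by simp
    then have x: "poly (hprod F' g) x = 0"
      by (simp add: H')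
    have ne: "hprod F' g \<noteq> 0"
    proof
      assume 0: "hprod F' g = 0"
      have "hprod F' g = [:- ((r + \<epsilon>) * x), 1:] * lin_quot H y"
        by (simp add: poly_eq_poly_eq_iff[symmetric] fun_eq_iff H' del: mult_pCons_left)
      then show False
        using 0 lin_quot_nonzero[OF h(2) H(2)] by (simp del: mult_pCons_left)
    qed
    have "degree F' \<le> n"
      using F' F by simp
    from weak[OF r1 F'(1) this simple[OF F'(1) this ne] x rx h(3)] show False
      using e h(3) r by simp
  qed
  then show ?thesis
    using H unfolding sep_def H_def by blast
qed

end

section \<open>Nonnegative multipliers and their limits\<close>

lemma coeffs_pos:
  assumes "p \<noteq> 0" "\<And>z. cpoly p z = 0 \<Longrightarrow> z \<in> \<real>" "\<And>k. coeff p k \<ge> 0"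
    and "coeff p i \<noteq> 0" "i \<le> j" "j \<le> degree p"
  shows "coeff p j > 0"
  using assms
proof (induction "degree p" arbitrary: p i j)
  case 0
  then show ?case
    by (metis le_zero_eq order_less_le)
next
  case (Suc d)
  obtain x where x: "poly p x = 0"
    by (rule real_rooted_root[of p, OF Suc.prems(2)]) (use Suc.hyps(2) in auto)
  have x0: "x \<le> 0"
    by (rule root_nonpos[OF Suc.prems(3,1) x])
  define K where "K = lin_quot p x"
  have K0: "K \<noteq> 0" and degK: "degree K = d"
    using lin_quot_nonzero[OF x Suc.prems(1)] degree_lin_quot[OF x Suc.prems(1)] Suc.hyps(2) by (auto simp: K_def)
  have Kreal: "z \<in> \<real>" if "cpoly K z = 0" for z
    using Suc.prems(2)[of z] cpoly_lin_quot[OF x, of z] that by (simp add: K_def)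
  have Knn: "coeff K k \<ge> 0" for k
  proof (rule coeffs_nonneg[OF K0 Kreal])
    show "y \<le> 0" if "poly K y = 0" for y
      using root_nonpos[OF Suc.prems(3,1), of y] poly_lin_quot[OF x, of y] that by (simp add: K_def)
    show "0 < lead_coeff K"
      using lead_coeff_lin_quot[OF x Suc.prems(1)] Suc.prems(3)[of "degree p"] Suc.prems(1)
      by (simp add: K_def order_less_le)
  qed
  have IH: "coeff K b > 0" if "coeff K a \<noteq> 0" "a \<le> b" "b \<le> d" for a b
    using Suc.hyps(1)[of K a b] K0 Kreal Knn that degK by simp
  show ?case
  proof (cases "i = j")
    case True
    then show ?thesis
      using Suc.prems(3)[of i] Suc.prems(4) by simp
  next
    case False
    then obtain j' where j': "j = Suc j'" "i \<le> j'"
      using Suc.prems(5) by (metis Suc_leI le_Suc_eq le_neq_implies_less less_imp_Suc_add less_iff_Suc_add)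
    have "\<exists>a\<le>i. coeff K a \<noteq> 0"
    proof (rule ccontr)
      assume "\<not> ?thesis"
      then show False
        using coeff_lin_quot[OF x] Suc.prems(4) by (cases i) (auto simp: K_def)
    qed
    then have "coeff K j' > 0"
      using IH[of _ j'] j' Suc.prems(6) Suc.hyps(2) by auto
    moreover have "x * coeff K (Suc j') \<le> 0"
      using x0 Knn by (rule mult_nonpos_nonneg)
    ultimately show ?thesis
      using coeff_lin_quot(1)[OF x, of j'] j'(1) by (simp add: K_def)
  qed
qed

text \<open>Consecutive zeros of R_n(s) have ratio exactly s. So for n >= 2 the polynomial R_n(q)
  just misses strict q-separation and is only a limit of the separated R_n(s) with s < q.\<close>

lemma sep_R_poly:
  assumes s: "0 < s" "s < q" and q: "q \<le> 1"
  shows "sep q (R_poly n s)"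
proof (rule sep_by_count[of _ n 0 "{..<n}" "\<lambda>j. - (1 / s ^ j)"])
  show "R_poly n s \<noteq> 0"
    using coeff_R_poly_0[of n s] by (metis coeff_0 zero_neq_one)
  show "- (1 / s ^ j) \<noteq> 0 \<and> poly (R_poly n s) (- (1 / s ^ j)) = 0" if "j \<in> {..<n}" for j
  proof -
    have "poly (R_poly n s) (- (1 / s ^ j)) = (\<Prod>i=1..n. 1 - s ^ (i - 1) / s ^ j)"
      by (simp add: R_poly_def poly_prod)
    also have "\<dots> = 0"
      using that s by (auto intro!: bexI[of _ "Suc j"])
    finally show ?thesis
      using s by simp
  qed
  show "\<not> - (1 / s ^ i) / - (1 / s ^ j) \<le> 1"
    if ij: "i \<in> {..<n}" "j \<in> {..<n}" "i \<noteq> j" "q \<le> - (1 / s ^ i) / - (1 / s ^ j)" for i j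
  proof
    have eq: "- (1 / s ^ i) / - (1 / s ^ j) = s ^ j / s ^ i"
      by simp
    assume "- (1 / s ^ i) / - (1 / s ^ j) \<le> 1"
    then have "s ^ j \<le> s ^ i"
      using s unfolding eq by simp
    then have "i < j"
      using s q ij(3) power_strict_decreasing[of j i s] by (metis less_le_trans linorder_neqE_nat not_le)
    then have "s ^ j \<le> s ^ Suc i"
      using s q by (intro power_decreasing) auto
    then have "s ^ j / s ^ i \<le> s"
      using s by (simp add: divide_le_eq)
    then show False
      using ij(4) s unfolding eq by simp
  qed
qed (use s q degree_R_poly_le in auto)

text \<open>Tests g on R_n(s), whose coefficients are all positive: the image has the support of g
  up to n, and a real-rooted polynomial with nonnegative coefficients has no internal gaps.\<close>

lemma nogap_if_real:
  assumes s: "0 < s" and g: "\<And>k. k \<le> n \<Longrightarrow> g k \<ge> 0"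
    and real: "\<And>z. hprod (R_poly n s) g \<noteq> 0 \<Longrightarrow> cpoly (hprod (R_poly n s) g) z = 0 \<Longrightarrow> z \<in> \<real>"
    and ijk: "i \<le> j" "j \<le> k" "k \<le> n" "g i \<noteq> 0" "g k \<noteq> 0"
  shows "g j \<noteq> 0"
proof -
  let ?H = "hprod (R_poly n s) g"
  have C: "coeff (R_poly n s) a > 0" if "a \<le> n" for a
    using coeff_R_poly_pos[OF s that] .
  have nz: "coeff ?H i \<noteq> 0" "coeff ?H k \<noteq> 0"
    using C[of i] C[of k] ijk by auto
  have H0: "?H \<noteq> 0"
    using nz(1) by (metis coeff_0)
  have "coeff ?H j > 0"
  proof (rule coeffs_pos[OF H0 real[OF H0] _ nz(1) ijk(1)])
    show "0 \<le> coeff ?H a" for a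
      using lift_coeff_nonneg[of s n g a, OF s g] by (simp add: lift_def)
    show "j \<le> degree ?H"
      using le_degree[OF nz(2)] ijk by simp
  qed
  then show ?thesis
    by auto
qed

lemma Im_dilate_nonneg_limit:
  assumes q: "0 < r" "r \<le> q" "q < 1" and F: "sep q F" "degree F \<le> n"
    and gs: "\<And>i. lift q n (gs i) = 0 \<or> sep r (lift q n (gs i))" "\<And>i k. k \<le> n \<Longrightarrow> gs i k \<ge> 0"
    and lim: "\<And>k. k \<le> n \<Longrightarrow> (\<lambda>i. gs i k) \<longlonglongrightarrow> g k" and z: "Im z > 0"
  shows "Im (z * cpoly (hprod F g) (of_real r * z) * cnj (cpoly (hprod F g) z)) \<ge> 0"
proof -
  obtain f where f: "F = lift q n f"
    using ex_lift[of q F n] q F(2) by auto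
  have coeffs: "(\<lambda>i. coeff (hprod F (gs i)) k) \<longlonglongrightarrow> coeff (hprod F g) k" for k
    using lim[of k] F(2) by (cases "k \<le> n") (auto simp: coeff_eq_0 intro: tendsto_intros)
  have deg: "degree (hprod F b) \<le> n" for b
    using degree_hprod_le[of F b] F(2) by simp
  have "(\<lambda>i. cpoly (hprod F (gs i)) w) \<longlonglongrightarrow> cpoly (hprod F g) w" for w
    by (rule tendsto_cpoly_coeffs[OF coeffs deg deg])
  then have "(\<lambda>i. Im (z * cpoly (hprod F (gs i)) (of_real r * z) * cnj (cpoly (hprod F (gs i)) z))) \<longlonglongrightarrow>
      Im (z * cpoly (hprod F g) (of_real r * z) * cnj (cpoly (hprod F g) z))"
    by (intro tendsto_intros)
  moreover have "Im (z * cpoly (hprod F (gs i)) (of_real r * z) * cnj (cpoly (hprod F (gs i)) z)) \<ge> 0" for i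
  proof (cases "lift q n (gs i) = 0")
    case True
    then have "hprod F (gs i) = 0"
      unfolding f hprod_lift_commute[of q n f] by simp
    then show ?thesis
      by simp
  next
    case False
    then have s: "sep r (lift q n (gs i))"
      using gs(1) by blast
    have "sep q (lift q n f)"
      using F(1) f by simp
    from Im_dilate_nonneg[OF q this s gs(2) z] show ?thesis
      unfolding f hprod_lift_commute[of q n f] .
  qed
  ultimately show ?thesis
    using LIMSEQ_le_const by blast
qed

text \<open>The dilation inequality survives the limit in g and yields real zeros and weak
  r-separation for all q-separated F at once; this uniformity is what \<open>weak_multiplier\<close>
  turns into strictness. The approximants are r-separated with r <= q, so the result also serves to
  compare different values of q.\<close>

lemma multiplier_strict:
  assumes q: "0 < r" "r \<le> q" "q < 1" and F: "sep q F" "degree F \<le> n" "hprod F g \<noteq> 0"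
    and gs: "\<And>i. lift q n (gs i) = 0 \<or> sep r (lift q n (gs i))" "\<And>i k. k \<le> n \<Longrightarrow> gs i k \<ge> 0"
    and lim: "\<And>k. k \<le> n \<Longrightarrow> (\<lambda>i. gs i k) \<longlonglongrightarrow> g k"
  shows "sep r (hprod F g)"
proof -
  have r1: "r < 1" and q0: "0 < q" and r0: "0 < r"
    using q by auto
  note Im = Im_dilate_nonneg_limit[OF q _ _ gs lim]
  have real: "z \<in> \<real>" if "sep q F" "degree F \<le> n" "hprod F g \<noteq> 0" "cpoly (hprod F g) z = 0" for F z
    using Im_dilate_imp_real_roots[OF that(3) q(1) r1 Im[OF that(1,2)] that(4)] .
  have g: "g k \<ge> 0" if "k \<le> n" for k
    using lim[OF that] gs(2)[OF that] by (intro LIMSEQ_le_const) auto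
  interpret weak_multiplier q n g
  proof
    show "g j \<noteq> 0" if "i \<le> j" "j \<le> k" "k \<le> n" "g i \<noteq> 0" "g k \<noteq> 0" for i j k
    \<comment> \<open>Any R_n(s) with 0 < s < q is q-separated and can serve as the test
      polynomial.\<close>
    proof (rule nogap_if_real[OF _ g _ that, of "q / 2"])
      have "sep q (R_poly n (q / 2))"
        using q q0 by (intro sep_R_poly) auto
      then show "z \<in> \<real>" if "hprod (R_poly n (q / 2)) g \<noteq> 0" "cpoly (hprod (R_poly n (q / 2)) g) z = 0" for z
        using real that degree_R_poly_le by blast
    qed (use q0 in auto)
  qed (use q q0 real in auto)
  show ?thesis
  proof (rule strict[OF r0 _ _ F])
    fix F x y
    assume h: "sep q F" "degree F \<le> n" "real_simple (hprod F g)" "poly (hprod F g) x = 0"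
      "poly (hprod F g) y = 0" "x \<noteq> 0" "r < y / x" "y / x < 1"
    show False
      using Im_dilate_imp_separated[OF h(3) r0 r1 Im[OF h(1,2)] h(4-6)] h(7,8) by blast
  qed (use r1 in simp)
qed

subsection \<open>Pre-coefficient sequences\<close>

text \<open>The sequences are only relevant up to the index \<open>n\<close>; \<open>PRs q n a\<close> says that
  \<open>\<Sum>k\<le>n. a\<^sub>k z\<^sup>k\<close> belongs to \<open>PR\<^sub>n(q)\<close>, where \<open>q > 0\<close>.\<close>

definition PRs :: "real \<Rightarrow> nat \<Rightarrow> (nat \<Rightarrow> real) \<Rightarrow> bool"
  where "PRs q n a \<longleftrightarrow> lift q n a = 0 \<or> sep q (lift q n a)"

lemma lift_eq_0_iff:
  assumes "0 < q"
  shows "lift q n a = 0 \<longleftrightarrow> (\<forall>k\<le>n. a k = 0)"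
proof
  assume 0: "lift q n a = 0"
  show "\<forall>k\<le>n. a k = 0"
  proof (intro allI impI)
    fix k assume "k \<le> n"
    then show "a k = 0"
      using coeff_lift[of q n a k] coeff_R_poly_pos[OF assms, of k n] by (simp add: 0)
  qed
next
  assume "\<forall>k\<le>n. a k = 0"
  then show "lift q n a = 0"
    by (intro poly_eqI) (metis coeff_0 coeff_R_poly_gt coeff_lift mult_zero_left mult_zero_right not_le)
qed

lemma lift_cong: "(\<And>k. k \<le> n \<Longrightarrow> a k = b k) \<Longrightarrow> lift q n a = lift q n b"
  by (intro poly_eqI) (metis coeff_R_poly_gt coeff_lift mult_zero_left not_le)

lemma PRs_cong: "(\<And>k. k \<le> n \<Longrightarrow> a k = b k) \<Longrightarrow> PRs q n a \<longleftrightarrow> PRs q n b"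
  unfolding PRs_def using lift_cong by metis

lemma hprod_lift: "hprod (lift q n a) b = lift q n (\<lambda>k. a k * b k)"
  by (rule poly_eqI) simp

lemma lift_const_1: "lift q n (\<lambda>k. 1) = R_poly n q"
  by (rule poly_eqI) simp

lemma lift_ratio:
  assumes "0 < q"
  shows "lift q n (\<lambda>k. coeff (R_poly n r) k / coeff (R_poly n q) k * a k) = lift r n a"
proof (rule poly_eqI)
  fix k
  show "coeff (lift q n (\<lambda>k. coeff (R_poly n r) k / coeff (R_poly n q) k * a k)) k = coeff (lift r n a) k"
    using coeff_R_poly_pos[OF assms, of k n] by (cases "k \<le> n") (auto simp: coeff_R_poly_gt)
qed

lemma tendsto_coeff_R_poly [tendsto_intros]:
  "(f \<longlongrightarrow> q) F \<Longrightarrow> ((\<lambda>s. coeff (R_poly n (f s)) k) \<longlongrightarrow> coeff (R_poly n q) k) F"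
proof (induction n arbitrary: k)
  case (Suc n)
  show ?case
  proof (cases k)
    case (Suc j)
    show ?thesis
      unfolding Suc coeff_R_poly_Suc by (intro tendsto_intros Suc.IH Suc.prems)
  qed simp
qed simp

lemma approx_below:
  assumes "0 < (r::real)"
  obtains t :: "nat \<Rightarrow> real" where "\<And>i. 0 < t i" "\<And>i. t i < r" "t \<longlonglongrightarrow> r"
proof
  let ?t = "\<lambda>i. r * (1 - 1 / (real i + 2))"
  show "0 < ?t i" "?t i < r" for i
    using assms by (auto simp: field_simps intro: add_pos_nonneg)
  show "?t \<longlonglongrightarrow> r"
  proof -
    have "(\<lambda>i. r * (1 - 1 / (real i + 2))) \<longlonglongrightarrow> r * (1 - 0)"
    proof (intro tendsto_intros)
      have "(\<lambda>i. 1 / real (i + 2)) \<longlonglongrightarrow> 0"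
        using LIMSEQ_ignore_initial_segment[OF lim_1_over_n, of 2] by simp
      then show "(\<lambda>i. 1 / (real i + 2)) \<longlonglongrightarrow> 0"
        by (simp add: add.commute)
    qed
    then show ?thesis
      by simp
  qed
qed

text \<open>The multiplier that passes from R_n(q) to R_n(r) leads to R_n(r) itself, which need not
  be strictly r-separated; it is approximated by those leading to R_n(t) with t increasing to
  r.\<close>

lemma R_poly_approx:
  assumes r: "0 < r" "r \<le> q" "q \<le> 1"
  obtains gs where "\<And>i. sep r (lift q n (gs i))" "\<And>i k. k \<le> n \<Longrightarrow> gs i k \<ge> 0"
    "\<And>k. k \<le> n \<Longrightarrow> (\<lambda>i. gs i k) \<longlonglongrightarrow> coeff (R_poly n r) k / coeff (R_poly n q) k"
proof -
  obtain t where t: "\<And>i. 0 < t i" "\<And>i. t i < r" "t \<longlonglongrightarrow> r"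
    using approx_below[OF r(1)] by blast
  have q: "0 < q"
    using r by simp
  show ?thesis
  proof (rule that[of "\<lambda>i k. coeff (R_poly n (t i)) k / coeff (R_poly n q) k"])
    fix i
    have "lift q n (\<lambda>k. coeff (R_poly n (t i)) k / coeff (R_poly n q) k) = R_poly n (t i)"
      using lift_ratio[OF q, of n "t i" "\<lambda>k. 1"] by (simp add: lift_const_1)
    then show "sep r (lift q n (\<lambda>k. coeff (R_poly n (t i)) k / coeff (R_poly n q) k))"
      using sep_R_poly[OF t(1,2)] r by simp
    show "coeff (R_poly n (t i)) k / coeff (R_poly n q) k \<ge> 0" if "k \<le> n" for k
      using coeff_R_poly_pos[OF t(1) that] coeff_R_poly_pos[OF q that] by (simp add: less_imp_le)
  next
    fix k assume k: "k \<le> n"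
    show "(\<lambda>i. coeff (R_poly n (t i)) k / coeff (R_poly n q) k) \<longlonglongrightarrow>
        coeff (R_poly n r) k / coeff (R_poly n q) k"
      using coeff_R_poly_pos[OF q k] by (intro tendsto_intros t) auto
  qed
qed

lemma PRs_mono_less_1:
  assumes r: "0 < r" "r \<le> q" "q < 1" and a: "PRs q n a"
  shows "PRs r n a"
proof (cases "lift r n a = 0")
  case False
  obtain gs where gs: "\<And>i. sep r (lift q n (gs i))" "\<And>i k. k \<le> n \<Longrightarrow> gs i k \<ge> 0"
    "\<And>k. k \<le> n \<Longrightarrow> (\<lambda>i. gs i k) \<longlonglongrightarrow> coeff (R_poly n r) k / coeff (R_poly n q) k"
    using R_poly_approx[of r q n] r by auto
  have q: "0 < q"
    using r by simp
  have s: "sep q (lift q n a)"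
    using a False lift_eq_0_iff[OF q] lift_eq_0_iff[OF r(1)] unfolding PRs_def by blast
  have H: "hprod (lift q n a) (\<lambda>k. coeff (R_poly n r) k / coeff (R_poly n q) k) = lift r n a"
    using lift_ratio[OF q, of n r a] by (simp add: hprod_lift mult.commute)
  have "sep r (hprod (lift q n a) (\<lambda>k. coeff (R_poly n r) k / coeff (R_poly n q) k))"
    using gs False by (intro multiplier_strict[OF r s degree_lift_le]) (auto simp: H)
  then show ?thesis
    by (simp add: H PRs_def)
qed (simp add: PRs_def)

lemma PRs_Im_dilate:
  assumes r: "0 < r" "r \<le> q" "q < 1" and a: "PRs q n a" and z: "Im z > 0"
  shows "Im (z * cpoly (lift r n a) (of_real r * z) * cnj (cpoly (lift r n a) z)) \<ge> 0"
proof (cases "lift r n a = 0")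
  case False
  obtain gs where gs: "\<And>i. sep r (lift q n (gs i))" "\<And>i k. k \<le> n \<Longrightarrow> gs i k \<ge> 0"
    "\<And>k. k \<le> n \<Longrightarrow> (\<lambda>i. gs i k) \<longlonglongrightarrow> coeff (R_poly n r) k / coeff (R_poly n q) k"
    using R_poly_approx[of r q n] r by auto
  have q: "0 < q"
    using r by simp
  have s: "sep q (lift q n a)"
    using a False lift_eq_0_iff[OF q] lift_eq_0_iff[OF r(1)] unfolding PRs_def by blast
  have H: "hprod (lift q n a) (\<lambda>k. coeff (R_poly n r) k / coeff (R_poly n q) k) = lift r n a"
    using lift_ratio[OF q, of n r a] by (simp add: hprod_lift mult.commute)
  let ?k = "\<lambda>k. coeff (R_poly n r) k / coeff (R_poly n q) k"
  have "Im (z * cpoly (hprod (lift q n a) ?k) (of_real r * z) * cnj (cpoly (hprod (lift q n a) ?k) z)) \<ge> 0"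
    by (rule Im_dilate_nonneg_limit[where gs = gs, OF r s degree_lift_le _ gs(2,3) z])
      (use gs(1) in blast)
  then show ?thesis
    unfolding H .
qed simp

text \<open>Strict 1-separation is only simplicity, but finitely many zeros leave a margin u < 1,
  and openness carries u-separation over to the convolutions with R_n(s) for s near 1. Once u < s,
  this is s-separation, and the results for parameters below 1 apply.\<close>

lemma PRs_near_1:
  assumes a: "PRs 1 n a"
  obtains t where "0 < t" "t < 1" "\<And>s. t < s \<Longrightarrow> s < 1 \<Longrightarrow> PRs s n a"
proof (cases "lift 1 n a = 0")
  case True
  then have "PRs s n a" if "0 < s" for s
    using that lift_eq_0_iff[of 1 n a] lift_eq_0_iff[of s n a] by (simp add: PRs_def)
  then show ?thesis
    by (intro that[of "1 / 2"]) auto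
next
  case False
  then have "sep 1 (lift 1 n a)"
    using a by (simp add: PRs_def)
  then obtain u where u: "0 < u" "u < 1" "sep u (lift 1 n a)"
    by (rule sep_shrink) auto
  have supp: "coeff (lift s n a) k = 0" if "coeff (lift 1 n a) k = 0" for s k
    using that coeff_R_poly_pos[of 1 k n] coeff_R_poly_gt[of n k s] by (cases "k \<le> n") auto
  have "\<forall>\<^sub>F s in at_left 1. sep u (lift s n a)"
  proof (rule sep_open[OF u(3,1)])
    show "((\<lambda>s. coeff (lift s n a) k) \<longlongrightarrow> coeff (lift 1 n a) k) (at_left 1)" for k
      unfolding coeff_lift by (intro tendsto_intros)
    show "degree (lift s n a) \<le> degree (lift 1 n a)" for s
      by (rule degree_le) (use supp coeff_eq_0 in blast)
    show "coeff (lift s n a) k = 0" if "k < order 0 (lift 1 n a)" for s k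
      by (rule supp) (rule coeff_below_order[OF that])
  qed (use u in simp)
  then obtain b where b: "b < 1" "\<And>s. b < s \<Longrightarrow> s < 1 \<Longrightarrow> sep u (lift s n a)"
    unfolding eventually_at_left_field by auto
  show ?thesis
  proof (rule that[of "max b u"])
    show "PRs s n a" if "max b u < s" "s < 1" for s
      using sep_mono[OF b(2)] that unfolding PRs_def by simp
  qed (use u b in auto)
qed

lemma PRs_mono:
  assumes r: "0 < r" "r \<le> q" "q \<le> 1" and a: "PRs q n a"
  shows "PRs r n a"
proof (cases "r = q")
  case False
  show ?thesis
  proof (cases "q = 1")
    case True
    obtain t where t: "0 < t" "t < 1" "\<And>s. t < s \<Longrightarrow> s < 1 \<Longrightarrow> PRs s n a"
      using PRs_near_1 a True by blast
    define s where "s = (1 + max t r) / 2"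
    have "t < s" "r < s" "s < 1"
      using t r False True by (auto simp: s_def)
    then show ?thesis
      using PRs_mono_less_1[of r s] r t(3) by simp
  qed (use PRs_mono_less_1[OF r(1,2) _ a] r in simp)
qed (use a in simp)

text \<open>A real-rooted polynomial has modulus increasing along vertical half-lines starting on the
  real axis, which is a closed condition.\<close>

lemma real_roots_vertical_mono:
  assumes "p \<noteq> 0" "\<And>z. cpoly p z = 0 \<Longrightarrow> z \<in> \<real>" "0 \<le> s" "s \<le> t"
  shows "cmod (cpoly p (Complex x s)) \<le> cmod (cpoly p (Complex x t))"
  using assms(1,2)
proof (induction "degree p" arbitrary: p)
  case 0
  then obtain c where "p = [:c:]"
    by (metis degree_eq_zeroE)
  then show ?case
    by simp
next
  case (Suc d)
  obtain y where y: "poly p y = 0"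
    by (rule real_rooted_root[of p, OF Suc.prems(2)]) (use Suc.hyps(2) in auto)
  have "cmod (cpoly (lin_quot p y) (Complex x s)) \<le> cmod (cpoly (lin_quot p y) (Complex x t))"
  proof (rule Suc.hyps(1))
    show "d = degree (lin_quot p y)"
      using degree_lin_quot[OF y Suc.prems(1)] Suc.hyps(2) by simp
    show "z \<in> \<real>" if "cpoly (lin_quot p y) z = 0" for z
      using Suc.prems(2)[of z] cpoly_lin_quot[OF y, of z] that by simp
  qed (rule lin_quot_nonzero[OF y Suc.prems(1)])
  moreover have "cmod (Complex x s - of_real y) \<le> cmod (Complex x t - of_real y)"
    using assms(3,4) by (auto simp: cmod_def intro!: power_mono)
  ultimately show ?case
    unfolding cpoly_lin_quot[OF y] norm_mult by (intro mult_mono) auto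
qed

text \<open>In place of Hurwitz's theorem: monotonicity along vertical half-lines passes to the
  limit, and a zero of the limit at height t > 0 would make it vanish on the whole segment below,
  which a nonzero polynomial cannot do.\<close>

lemma real_roots_limit:
  assumes F: "F \<noteq> bot" and lim: "\<And>k. ((\<lambda>s. coeff (P s) k) \<longlongrightarrow> coeff p k) F"
    and deg: "\<And>s. degree (P s) \<le> d" "degree p \<le> d"
    and real: "\<forall>\<^sub>F s in F. P s = 0 \<or> (\<forall>z. cpoly (P s) z = 0 \<longrightarrow> z \<in> \<real>)"
    and p0: "p \<noteq> 0" and z: "cpoly p z = 0"
  shows "z \<in> \<real>"
proof (rule ccontr)
  assume nr: "z \<notin> \<real>"
  have mono: "cmod (cpoly p (Complex x s)) \<le> cmod (cpoly p (Complex x t))" if "0 \<le> s" "s \<le> t" for x s t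
  proof (rule tendsto_le[OF F])
    show "((\<lambda>i. cmod (cpoly (P i) (Complex x t))) \<longlongrightarrow> cmod (cpoly p (Complex x t))) F"
      "((\<lambda>i. cmod (cpoly (P i) (Complex x s))) \<longlongrightarrow> cmod (cpoly p (Complex x s))) F"
      by (intro tendsto_norm tendsto_cpoly_coeffs[OF lim deg])+
    show "\<forall>\<^sub>F i in F. cmod (cpoly (P i) (Complex x s)) \<le> cmod (cpoly (P i) (Complex x t))"
      using real
    proof eventually_elim
      case (elim i)
      show ?case
      proof (cases "P i = 0")
        case False
        then show ?thesis
          using elim that by (intro real_roots_vertical_mono) auto
      qed simp
    qed
  qed
  obtain x t where xt: "cpoly p (Complex x t) = 0" "t > 0"
  proof (cases "Im z > 0")
    case True
    then show ?thesis
      using that[of "Re z" "Im z"] z by simp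
  next
    case False
    then have "Im z < 0"
      using nr by (metis complex_is_Real_iff linorder_neqE_linordered_idom)
    moreover have "cnj z = Complex (Re z) (- Im z)"
      by (simp add: complex_eq_iff)
    ultimately show ?thesis
      using that[of "Re z" "- Im z"] z cpoly_cnj[of p z] by simp
  qed
  have "Complex x ` {0..t} \<subseteq> {w. poly (map_poly complex_of_real p) w = 0}"
    using mono[of _ t x] xt by (fastforce simp: cpoly_def)
  moreover have "finite {w. poly (map_poly complex_of_real p) w = 0}"
    using p0 by (intro poly_roots_finite) (simp add: map_poly_eq_0_iff)
  ultimately have "finite (Complex x ` {0..t})"
    by (rule finite_subset)
  moreover have "inj_on (Complex x) {0..t}"
    by (auto intro: inj_onI)
  ultimately have "finite {0..t}"
    using finite_imageD by blast
  then show False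
    using xt(2) infinite_Icc by blast
qed

lemma PRs_mult_less_1:
  assumes q: "0 < q" "q < 1" and f: "PRs q n f"
    and gs: "\<And>i. PRs q n (gs i)" "\<And>i k. k \<le> n \<Longrightarrow> gs i k \<ge> 0"
    and lim: "\<And>k. k \<le> n \<Longrightarrow> (\<lambda>i. gs i k) \<longlonglongrightarrow> g k"
  shows "PRs q n (\<lambda>k. f k * g k)"
proof (cases "lift q n (\<lambda>k. f k * g k) = 0")
  case False
  then have nz: "hprod (lift q n f) g \<noteq> 0"
    by (simp add: hprod_lift)
  then have "sep q (lift q n f)"
    using f by (auto simp: PRs_def)
  then have "sep q (hprod (lift q n f) g)"
    using gs q nz lim unfolding PRs_def by (intro multiplier_strict[where gs = gs, OF q(1) order_refl q(2) _ degree_lift_le]) auto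
  then show ?thesis
    by (simp add: PRs_def hprod_lift)
qed (simp add: PRs_def)

text \<open>For q = 1 only the reality of the zeros has to be transported, since
  \<open>weak_multiplier\<close> then supplies simplicity. This takes two successive limits: s tends
  to 1 from below for a fixed \<open>gs i\<close>, and afterwards i tends to infinity.\<close>

lemma PRs_mult:
  assumes q: "0 < q" "q \<le> 1" and f: "PRs q n f"
    and gs: "\<And>i. PRs q n (gs i)" "\<And>i k. k \<le> n \<Longrightarrow> gs i k \<ge> 0"
    and lim: "\<And>k. k \<le> n \<Longrightarrow> (\<lambda>i. gs i k) \<longlonglongrightarrow> g k"
  shows "PRs q n (\<lambda>k. f k * g k)"
proof (cases "q < 1")
  case True
  then show ?thesis
    using PRs_mult_less_1[OF q(1) _ f gs lim] by blast
next
  case False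
  then have q1: "q = 1"
    using q by simp
  have g: "g k \<ge> 0" if "k \<le> n" for k
    using lim[OF that] gs(2)[OF that] by (intro LIMSEQ_le_const) auto
  have real1: "z \<in> \<real>" if b: "PRs 1 n b" and nz: "lift 1 n (\<lambda>k. b k * gs i k) \<noteq> 0"
    and z: "cpoly (lift 1 n (\<lambda>k. b k * gs i k)) z = 0" for b i z
  proof -
    obtain t where t: "0 < t" "t < 1" "\<And>s. t < s \<Longrightarrow> s < 1 \<Longrightarrow> PRs s n b"
      using PRs_near_1[OF b] by blast
    obtain t' where t': "0 < t'" "t' < 1" "\<And>s. t' < s \<Longrightarrow> s < 1 \<Longrightarrow> PRs s n (gs i)"
      using PRs_near_1 gs(1)[of i] q1 by blast
    show ?thesis
    proof (rule real_roots_limit[OF trivial_limit_at_left_real[of 1] _ degree_lift_le degree_lift_le _ nz z])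
      show "((\<lambda>s. coeff (lift s n (\<lambda>k. b k * gs i k)) k) \<longlongrightarrow>
          coeff (lift 1 n (\<lambda>k. b k * gs i k)) k) (at_left 1)" for k
        unfolding coeff_lift by (intro tendsto_intros)
      have "\<forall>\<^sub>F s in at_left 1. s \<in> {max t t'<..<1}"
        using t t' by (intro eventually_at_leftI[of "max t t'"]) auto
      then show "\<forall>\<^sub>F s in at_left 1. lift s n (\<lambda>k. b k * gs i k) = 0 \<or>
          (\<forall>z. cpoly (lift s n (\<lambda>k. b k * gs i k)) z = 0 \<longrightarrow> z \<in> \<real>)"
      proof eventually_elim
        case (elim s)
        have "PRs s n (\<lambda>k. b k * gs i k)"
          using elim t t' gs(2) by (intro PRs_mult_less_1[where gs = "\<lambda>_. gs i"]) auto
        then show ?case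
          using sep_real unfolding PRs_def by blast
      qed
    qed
  qed
  have real2: "z \<in> \<real>" if F: "sep 1 F" "degree F \<le> n" and nz: "hprod F g \<noteq> 0" and z: "cpoly (hprod F g) z = 0" for F z
  proof -
    obtain b where b: "F = lift 1 n b"
      using ex_lift[of 1 F n] F(2) by auto
    have deg: "degree (hprod F c) \<le> n" for c
      using degree_hprod_le[of F c] F(2) by simp
    show ?thesis
    proof (rule real_roots_limit[where P = "\<lambda>i. hprod F (gs i)", OF trivial_limit_sequentially _ deg deg _ nz z])
      show "(\<lambda>i. coeff (hprod F (gs i)) k) \<longlonglongrightarrow> coeff (hprod F g) k" for k
        using lim[of k] F(2) by (cases "k \<le> n") (auto simp: coeff_eq_0 intro: tendsto_intros)
      show "\<forall>\<^sub>F i in sequentially. hprod F (gs i) = 0 \<or> (\<forall>z. cpoly (hprod F (gs i)) z = 0 \<longrightarrow> z \<in> \<real>)"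
        using real1[of b] F(1) unfolding b hprod_lift PRs_def by (intro always_eventually) blast
    qed
  qed
  interpret weak_multiplier 1 n g
  proof
    show "g j \<noteq> 0" if "i \<le> j" "j \<le> k" "k \<le> n" "g i \<noteq> 0" "g k \<noteq> 0" for i j k
    proof (rule nogap_if_real[OF _ g _ that, of "1 / 2"])
      have "sep 1 (R_poly n (1 / 2))"
        by (intro sep_R_poly) auto
      then show "z \<in> \<real>" if "hprod (R_poly n (1 / 2)) g \<noteq> 0" "cpoly (hprod (R_poly n (1 / 2)) g) z = 0" for z
        using real2 that degree_R_poly_le by blast
    qed auto
  qed (use real2 in auto)
  show ?thesis
  proof (cases "lift 1 n (\<lambda>k. f k * g k) = 0")
    case False
    then have nz: "hprod (lift 1 n f) g \<noteq> 0"
      by (simp add: hprod_lift)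
    then have "sep 1 (lift 1 n f)"
      using f q1 by (auto simp: PRs_def)
    then have "sep 1 (hprod (lift 1 n f) g)"
      using nz degree_lift_le by (intro strict) auto
    then show ?thesis
      by (simp add: PRs_def hprod_lift q1)
  qed (simp add: PRs_def q1)
qed

section \<open>Windows of pre-coefficient sequences\<close>

lemma PRs_trunc:
  assumes q: "0 < q" "q < 1" and a: "PRs q (Suc n) a"
  shows "PRs q n a"
  using a lift_trunc_sep[OF q, of n a] lift_eq_0_iff[OF q(1)] unfolding PRs_def by (metis le_SucI)

lemma PRs_shift:
  assumes q: "0 < q" "q < 1" and a: "PRs q (Suc n) a"
  shows "PRs q n (shift_seq a)"
  using a lift_shift_sep[OF q, of n a] lift_eq_0_iff[OF q(1)] unfolding PRs_def by (metis Suc_le_mono)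

lemma PRs_window:
  assumes q: "0 < q" "q < 1" and a: "PRs q n a" and im: "i + m \<le> n"
  shows "PRs q m (\<lambda>k. a (i + k))"
proof -
  have 1: "PRs q (n - i) (\<lambda>k. a (i + k))" if "i \<le> n" for i
    using that
  proof (induction i)
    case (Suc i)
    have "PRs q (Suc (n - Suc i)) (\<lambda>k. a (i + k))"
      using Suc by (simp add: Suc_diff_Suc)
    from PRs_shift[OF q this] show ?case
      by simp
  qed (use a in simp)
  have 2: "PRs q (j - d) b" if "PRs q j b" "d \<le> j" for j d b
    using that(2)
  proof (induction d)
    case (Suc d)
    then have "PRs q (Suc (j - Suc d)) b"
      by (simp add: Suc_diff_Suc)
    from PRs_trunc[OF q this] show ?case .
  qed (use that in simp)
  show ?thesis
    using 2[OF 1, of i "n - i - m"] im by simp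
qed

subsection \<open>Log-concavity of pre-coefficient sequences\<close>

definition LCs :: "nat \<Rightarrow> (nat \<Rightarrow> real) \<Rightarrow> bool"
  where "LCs n a \<longleftrightarrow> (\<forall>k l m. l \<le> k \<and> k \<le> m \<and> m \<le> n \<and> a l \<noteq> 0 \<and> a m \<noteq> 0 \<and> 0 < k \<and> k < n \<longrightarrow>
    a (k - 1) * a (k + 1) < (a k)\<^sup>2)"

text \<open>If x and y are the zeros of the quadratic \<open>a * R_2(q)\<close>, then
  \<open>(1 + q)^2 (a_1^2 - a_0 a_2) = - q a_2^2 (y - q x)(x - q y)\<close>. For zeros of one sign
  the last product is negative exactly when their ratio lies outside [q, 1/q], so log-concavity of
  three terms is q-separation of two zeros. When \<open>a_0 a_2 < 0\<close> the inequality is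
  immediate.\<close>

lemma PRs_2:
  assumes q: "0 < q" "q < 1" and a: "PRs q 2 a" and nz: "a 0 * a 2 \<noteq> 0"
  shows "a 0 * a 2 < (a 1)\<^sup>2"
proof (cases "a 0 * a 2 > 0")
  case True
  have C: "coeff (R_poly 2 q) 0 = 1" "coeff (R_poly 2 q) (Suc 0) = 1 + q" "coeff (R_poly 2 q) 2 = q"
    by (simp_all add: numeral_2_eq_2 coeff_R_poly_Suc)
  define F where "F = lift q 2 a"
  have cF: "coeff F 0 = a 0" "coeff F 1 = (1 + q) * a 1" "coeff F 2 = q * a 2"
    by (simp_all add: F_def C)
  have "F \<noteq> 0"
    using cF(1) nz by auto
  then have F: "sep q F"
    using a by (auto simp: PRs_def F_def)
  have "coeff F 2 \<noteq> 0"
    using cF nz q by simp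
  then have degF: "degree F = 2"
    using degree_lift_le[of q 2 a] le_degree[of F 2] by (simp add: F_def)
  have rs: "real_simple F" and F0: "F \<noteq> 0"
    using F by (auto simp: sep_def real_simple_def)
  have "order 0 F = 0"
    using cF(1) nz by (intro order_0I) (simp add: poly_0_coeff_0)
  then have "card {x. x \<noteq> 0 \<and> poly F x = 0} = 2"
    using real_simple_degree[OF rs] degF by simp
  then obtain x y where xy: "x \<noteq> y" "{x. x \<noteq> 0 \<and> poly F x = 0} = {x, y}"
    by (auto simp: card_2_iff)
  then have x: "poly F x = 0" "x \<noteq> 0" and y: "poly F y = 0" "y \<noteq> 0"
    by blast+
  have F_eq: "poly F t = a 0 + (1 + q) * a 1 * t + q * a 2 * t\<^sup>2" for t
    using poly_altdef_le[of F 2 t] degF cF by (simp add: numeral_2_eq_2)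
  have "(x - y) * ((1 + q) * a 1 + q * a 2 * (x + y)) = 0"
    using F_eq[of x] F_eq[of y] x y by (simp add: algebra_simps power2_eq_square)
  then have sum: "(1 + q) * a 1 = - (q * a 2 * (x + y))"
    using xy(1) by simp
  have prod: "a 0 = q * a 2 * (x * y)"
    using F_eq[of x] x(1) unfolding sum by (simp add: algebra_simps power2_eq_square)
  have "0 < q * (a 2)\<^sup>2 * (x * y)"
    using True unfolding prod by (simp add: power2_eq_square mult_ac)
  moreover have "q * (a 2)\<^sup>2 > 0"
    using q nz by simp
  ultimately have xy0: "x * y > 0"
    by (rule zero_less_mult_pos)
  have ratio: "\<not> (q \<le> v / u \<and> v / u \<le> 1)" if "(u, v) = (x, y) \<or> (u, v) = (y, x)" for u v
    using F x y xy(1) that unfolding sep_def by blast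
  have pos: "(y - q * x) * (x - q * y) < 0"
  proof -
    have yx: "y / x > 0"
      using xy0 by (auto simp: zero_less_divide_iff zero_less_mult_iff)
    have "(y - q * x) * (x - q * y) = x\<^sup>2 * ((y / x - q) * (1 - q * (y / x)))"
      using x by (simp add: field_simps power2_eq_square)
    moreover have "(y / x - q) * (1 - q * (y / x)) < 0"
    proof (cases "y / x < q")
      case True
      have "q * (y / x) < 1 * 1"
        using True q yx by (intro mult_strict_mono) auto
      then show ?thesis
        using True by (intro mult_neg_pos) auto
    next
      case False
      then have gt: "y / x > 1"
        using ratio[of x y] by auto
      then have "x / y < 1"
        using yx x y by (metis divide_less_eq_1_pos inverse_divide inverse_eq_divide order_less_trans zero_less_one)
      then have "x / y < q"
        using ratio[of y x] by auto
      then have "1 / (y / x) < q"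
        by simp
      then have "1 < q * (y / x)"
        using yx by (simp only: pos_divide_less_eq)
      then show ?thesis
        using gt q by (intro mult_pos_neg) auto
    qed
    ultimately show ?thesis
      using x by (simp add: mult_pos_neg)
  qed
  have "(1 + q)\<^sup>2 * ((a 1)\<^sup>2 - a 0 * a 2) = q * (a 2)\<^sup>2 * (q * (x + y)\<^sup>2 - (1 + q)\<^sup>2 * (x * y))"
  proof -
    have "(1 + q)\<^sup>2 * ((a 1)\<^sup>2 - a 0 * a 2) = ((1 + q) * a 1)\<^sup>2 - (1 + q)\<^sup>2 * (a 0 * a 2)"
      by (simp add: algebra_simps power2_eq_square)
    then show ?thesis
      unfolding sum prod by (simp add: algebra_simps power2_eq_square)
  qed
  also have "q * (x + y)\<^sup>2 - (1 + q)\<^sup>2 * (x * y) = - ((y - q * x) * (x - q * y))"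
    by (simp add: algebra_simps power2_eq_square)
  finally have "(1 + q)\<^sup>2 * ((a 1)\<^sup>2 - a 0 * a 2) > 0"
    using pos q nz by (simp add: mult_pos_neg)
  then show ?thesis
    using q by (simp add: zero_less_mult_iff)
next
  case False
  with nz have "a 0 * a 2 < 0"
    by (metis not_less_iff_gr_or_eq)
  then show ?thesis
    by (rule less_le_trans) simp
qed

text \<open>The convolution is \<open>a_0 + c z^n\<close>, whose real zeros are at most x and -x,
  fewer than the n >= 3 distinct ones that separation requires.\<close>

lemma PRs_no_long_gap:
  assumes q: "0 < q" "q < 1" and a: "PRs q n a" and n: "3 \<le> n" and ends: "a 0 \<noteq> 0" "a n \<noteq> 0"
    and gap: "\<And>k. 0 < k \<Longrightarrow> k < n \<Longrightarrow> a k = 0"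
  shows False
proof -
  define F where "F = lift q n a"
  have C: "coeff (R_poly n q) n > 0"
    using coeff_R_poly_pos[OF q(1), of n n] by simp
  define c where "c = coeff (R_poly n q) n * a n"
  have c: "c \<noteq> 0"
    using C ends by (simp add: c_def)
  have F_eq: "poly F t = a 0 + c * t ^ n" for t
  proof -
    have "poly F t = (\<Sum>k\<le>n. coeff F k * t ^ k)"
      unfolding F_def by (rule poly_altdef_le[OF degree_lift_le])
    also have "\<dots> = (\<Sum>k\<in>{0, n}. coeff F k * t ^ k)"
      using gap by (intro sum.mono_neutral_right) (auto simp: F_def)
    also have "\<dots> = a 0 + c * t ^ n"
      using n by (simp add: F_def c_def)
    finally show ?thesis .
  qed
  have cn: "coeff F n = c"
    by (simp add: F_def c_def)
  then have F0: "F \<noteq> 0"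
    using c by auto
  then have rs: "real_simple F"
    using a by (auto simp: PRs_def F_def sep_def)
  have "n \<le> degree F"
    by (rule le_degree) (simp add: cn c)
  moreover have "degree F \<le> n"
    unfolding F_def by (rule degree_lift_le)
  ultimately have deg: "degree F = n"
    by simp
  have "order 0 F = 0"
    using F_eq[of 0] ends n by (intro order_0I) (simp add: power_0_left)
  then have card: "card {x. x \<noteq> 0 \<and> poly F x = 0} = n"
    using real_simple_degree[OF rs] deg by simp
  have "{x. x \<noteq> 0 \<and> poly F x = 0} \<noteq> {}"
    using card n by (metis card.empty not_numeral_le_zero)
  then obtain x where x: "x \<noteq> 0" "poly F x = 0"
    by blast
  have "{x. x \<noteq> 0 \<and> poly F x = 0} \<subseteq> {x, - x}"
  proof
    fix y assume "y \<in> {x. x \<noteq> 0 \<and> poly F x = 0}"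
    then have "a 0 + c * y ^ n = a 0 + c * x ^ n"
      using F_eq[of x] F_eq[of y] x by simp
    then have "c * y ^ n = c * x ^ n"
      by (simp only: add_left_cancel)
    then have "y ^ n = x ^ n"
      by (rule mult_left_cancel[THEN iffD1, OF c])
    then have "\<bar>y\<bar> ^ n = \<bar>x\<bar> ^ n"
      by (simp only: power_abs[symmetric])
    then have "\<bar>y\<bar> = \<bar>x\<bar>"
      by (rule power_eq_imp_eq_base) (use n in simp_all)
    then have "y = x \<or> y = - x"
      by (simp only: abs_eq_iff)
    then show "y \<in> {x, - x}"
      by simp
  qed
  from card_mono[OF _ this] have "n \<le> card {x, - x}"
    using card by simp
  also have "\<dots> \<le> 2"
    by (simp add: card_insert_if)
  finally show False
    using n by simp
qed

text \<open>Separation passes to windows, so the three-term case gives the inequality when both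
  neighbours are nonzero. Otherwise the point is that \<open>a k\<close> is nonzero: if it vanished,
  the nearest nonzero entries on the two sides would bound a window of length at least 3 with
  nothing inside.\<close>

lemma PRs_imp_LCs:
  assumes q: "0 < q" "q \<le> 1" and a: "PRs q n a"
  shows "LCs n a"
  unfolding LCs_def
proof (intro allI impI, elim conjE)
  fix k l m
  assume h: "l \<le> k" "k \<le> m" "m \<le> n" "a l \<noteq> 0" "a m \<noteq> 0" "0 < k" "k < n"
  \<comment> \<open>Passing to windows requires a parameter below 1, so q is lowered first.\<close>
  define s where "s = q / 2"
  have s: "0 < s" "s < 1" "s \<le> q"
    using q by (auto simp: s_def)
  have as: "PRs s n a"
    using PRs_mono[OF s(1,3) q(2) a] .
  show "a (k - 1) * a (k + 1) < (a k)\<^sup>2"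
  proof (cases "a (k - 1) * a (k + 1) = 0")
    case False
    have "PRs s 2 (\<lambda>j. a (k - 1 + j))"
      using h by (intro PRs_window[OF s(1,2) as]) auto
    then show ?thesis
      using PRs_2[OF s(1,2)] False h by fastforce
  next
    case True
    have "a k \<noteq> 0"
    proof
      assume k0: "a k = 0"
      define L where "L = Max {j. j \<le> k \<and> a j \<noteq> 0}"
      define M where "M = Min {j. k \<le> j \<and> j \<le> n \<and> a j \<noteq> 0}"
      have finL: "finite {j. j \<le> k \<and> a j \<noteq> 0}" "{j. j \<le> k \<and> a j \<noteq> 0} \<noteq> {}"
        using h by (auto intro: finite_subset[of _ "{..k}"])
      have finM: "finite {j. k \<le> j \<and> j \<le> n \<and> a j \<noteq> 0}" "{j. k \<le> j \<and> j \<le> n \<and> a j \<noteq> 0} \<noteq> {}"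
        using h by (auto intro: finite_subset[of _ "{..n}"])
      have L: "L \<le> k" "a L \<noteq> 0" "\<And>j. j \<le> k \<Longrightarrow> a j \<noteq> 0 \<Longrightarrow> j \<le> L"
        using Max_in[OF finL] Max_ge[OF finL(1)] by (auto simp: L_def)
      have M: "k \<le> M" "M \<le> n" "a M \<noteq> 0" "\<And>j. k \<le> j \<Longrightarrow> j \<le> n \<Longrightarrow> a j \<noteq> 0 \<Longrightarrow> M \<le> j"
        using Min_in[OF finM] Min_le[OF finM(1)] by (auto simp: M_def)
      have ne: "L \<noteq> k" "M \<noteq> k"
        using L M k0 by auto
      have "a (k - 1) = 0 \<or> a (k + 1) = 0"
        using True by simp
      then have three: "3 \<le> M - L"
      proof
        assume "a (k - 1) = 0"
        then have "L \<noteq> k - 1"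
          using L by auto
        then show ?thesis
          using L M ne by linarith
      next
        assume "a (k + 1) = 0"
        then have "M \<noteq> k + 1"
          using M by auto
        then show ?thesis
          using L M ne by linarith
      qed
      have gap: "a (L + j) = 0" if "0 < j" "j < M - L" for j
      proof (rule ccontr)
        assume "a (L + j) \<noteq> 0"
        then show False
          using L(3)[of "L + j"] M(4)[of "L + j"] M(2) that by linarith
      qed
      have "PRs s (M - L) (\<lambda>j. a (L + j))"
        using L M by (intro PRs_window[OF s(1,2) as]) auto
      from PRs_no_long_gap[OF s(1,2) this three] show False
        using L M gap by auto
    qed
    then show ?thesis
      unfolding True by simp
  qed
qed

subsection \<open>Strict separation in the closure\<close>

lemma lift_Suc_decomp:
  "lift q (Suc m) f = lift q m f + smult (q ^ m) (pCons 0 (lift q m (shift_seq f)))"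
  by (rule poly_eqI) (simp add: coeff_pCons coeff_R_poly_Suc algebra_simps split: nat.splits)

text \<open>From the first factor of R_(m+1): \<open>F(z) = U(q z) + z V(q z)\<close>; the last
  factor gave \<open>F(z) = U(z) + q^m z V(z)\<close>. Having both allows F(x) and F(q x) to be
  expressed by U and V at the one point q x.\<close>

lemma lift_Suc_decomp':
  "lift q (Suc m) f = hprod (lift q m f) (\<lambda>k. q ^ k) + pCons 0 (hprod (lift q m (shift_seq f)) (\<lambda>k. q ^ k))"
proof (rule poly_eqI)
  fix k
  show "coeff (lift q (Suc m) f) k =
      coeff (hprod (lift q m f) (\<lambda>k. q ^ k) + pCons 0 (hprod (lift q m (shift_seq f)) (\<lambda>k. q ^ k))) k"
    by (cases k) (simp_all add: coeff_R_poly_Suc' algebra_simps)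
qed

text \<open>The first inequality leaves only double zeros and the ratio exactly r to be excluded. In
  both cases the truncated convolution U and the shifted convolution V vanish together: for the
  ratio r by the two decompositions of F at r x, for a double zero by letting z tend to it in the
  second inequality.\<close>

lemma sep_if_no_common_root:
  assumes r: "0 < r" "r < 1" and F0: "lift r (Suc m) f \<noteq> 0"
    and Im: "\<And>z. Im z > 0 \<Longrightarrow>
      Im (z * cpoly (lift r (Suc m) f) (of_real r * z) * cnj (cpoly (lift r (Suc m) f) z)) \<ge> 0"
    and Im': "\<And>z. Im z > 0 \<Longrightarrow> Im (cpoly (lift r m (shift_seq f)) z * cnj (cpoly (lift r m f) z)) \<le> 0"
    and common: "\<And>w. w \<noteq> 0 \<Longrightarrow> poly (lift r m f) w = 0 \<Longrightarrow> poly (lift r m (shift_seq f)) w = 0 \<Longrightarrow> False"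
  shows "sep r (lift r (Suc m) f)"
proof -
  define F U V where "F = lift r (Suc m) f" and "U = lift r m f" and "V = lift r m (shift_seq f)"
  have F: "F \<noteq> 0"
    using F0 by (simp add: F_def)
  have FUV: "cpoly F z = cpoly U z + of_real (r ^ m) * z * cpoly V z" for z
    unfolding F_def U_def V_def by (subst lift_Suc_decomp) simp
  have FUVr: "poly F x = poly U x + r ^ m * x * poly V x" for x
    unfolding F_def U_def V_def by (subst lift_Suc_decomp) simp
  have FUV': "poly F x = poly U (r * x) + x * poly V (r * x)" for x
    unfolding F_def U_def V_def by (subst lift_Suc_decomp') (simp add: poly_dilate)
  have nc: "\<not> (poly U w = 0 \<and> poly V w = 0)" if "w \<noteq> 0" for w
    using common[OF that] by (auto simp: U_def V_def)
  have ImF: "Im (z * cpoly F (of_real r * z) * cnj (cpoly F z)) \<ge> 0" if "Im z > 0" for z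
    using Im[OF that] by (simp add: F_def)
  have ImV: "Im (cpoly V z * cnj (cpoly U z)) \<le> 0" if "Im z > 0" for z
    using Im'[OF that] by (simp add: U_def V_def)
  have simple: "poly (pderiv F) x \<noteq> 0" if x: "x \<noteq> 0" "poly F x = 0" for x
  proof
    assume "poly (pderiv F) x = 0"
    then have qx: "poly (lin_quot F x) x = 0"
      using poly_pderiv_eq_lin_quot[OF x(2)] by simp
    define K where "K = lin_quot (lin_quot F x) x"
    have cevF: "cpoly F z = (z - of_real x)\<^sup>2 * cpoly K z" for z
      using cpoly_lin_quot[OF x(2), of z] cpoly_lin_quot[OF qx, of z] by (simp add: K_def power2_eq_square mult.assoc)
    have Ux: "poly U x \<noteq> 0"
      using nc[OF x(1)] FUVr[of x] x r by auto
    \<comment> \<open>Since \<open>r^m z V = F - U\<close> and F vanishes to second order at x, the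
      inequality for V and U at height \<epsilon>, divided by \<epsilon>, tends to
      \<open>|U(x)|^2 <= 0\<close>.\<close>
    let ?z = "\<lambda>\<epsilon>. complex_of_real x + \<i> * of_real \<epsilon>"
    have "((\<lambda>\<epsilon>. (cmod (cpoly U (?z \<epsilon>)))\<^sup>2 - \<epsilon> * Im (cpoly K (?z \<epsilon>) * cnj (cpoly U (?z \<epsilon>)) * cnj (?z \<epsilon>))) \<longlongrightarrow>
        (cmod (cpoly U (?z 0)))\<^sup>2 - 0 * Im (cpoly K (?z 0) * cnj (cpoly U (?z 0)) * cnj (?z 0))) (at_right 0)"
      by (intro tendsto_intros)
    moreover have "\<forall>\<^sub>F \<epsilon> in at_right 0.
        (cmod (cpoly U (?z \<epsilon>)))\<^sup>2 - \<epsilon> * Im (cpoly K (?z \<epsilon>) * cnj (cpoly U (?z \<epsilon>)) * cnj (?z \<epsilon>)) \<le> 0"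
      using eventually_at_right_less[of "0::real"]
    proof eventually_elim
      case (elim \<epsilon>)
      define z where "z = ?z \<epsilon>"
      let ?U = "cpoly U z" and ?V = "cpoly V z" and ?K = "cpoly K z"
      have z: "Im z > 0" "Im z = \<epsilon>" "(z - of_real x)\<^sup>2 = of_real (- (\<epsilon>\<^sup>2))"
        using elim by (simp_all add: z_def power_mult_distrib)
      have "of_real (r ^ m * (cmod z)\<^sup>2) * (?V * cnj ?U) =
          of_real (r ^ m) * (z * cnj z) * (?V * cnj ?U)"
        by (simp only: of_real_mult complex_norm_square)
      also have "\<dots> = (cpoly F z - ?U) * cnj ?U * cnj z"
        unfolding FUV[of z] by (simp add: algebra_simps)
      also have "\<dots> = of_real (- (\<epsilon>\<^sup>2)) * (?K * cnj ?U * cnj z) - (?U * cnj ?U) * cnj z"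
        unfolding cevF z(3) by (simp add: algebra_simps)
      also have "?U * cnj ?U = of_real ((cmod ?U)\<^sup>2)"
        by (rule complex_norm_square[symmetric])
      finally have "Im (of_real (r ^ m * (cmod z)\<^sup>2) * (?V * cnj ?U)) =
          Im (of_real (- (\<epsilon>\<^sup>2)) * (?K * cnj ?U * cnj z) - of_real ((cmod ?U)\<^sup>2) * cnj z)"
        by simp
      then have "r ^ m * (cmod z)\<^sup>2 * Im (?V * cnj ?U) =
          - (\<epsilon>\<^sup>2) * Im (?K * cnj ?U * cnj z) + (cmod ?U)\<^sup>2 * \<epsilon>"
        by (simp only: minus_complex.sel Im_of_real_mult cnj.sel z(2))
      moreover have "r ^ m * (cmod z)\<^sup>2 * Im (?V * cnj ?U) \<le> 0"
        using r ImV[OF z(1)] by (intro mult_nonneg_nonpos) auto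
      ultimately have "\<epsilon> * ((cmod ?U)\<^sup>2 - \<epsilon> * Im (?K * cnj ?U * cnj z)) \<le> 0"
        by (simp add: power2_eq_square algebra_simps)
      then show ?case
        using elim unfolding z_def by (metis mult_le_0_iff not_le)
    qed
    ultimately have "(cmod (cpoly U (?z 0)))\<^sup>2 - 0 * Im (cpoly K (?z 0) * cnj (cpoly U (?z 0)) * cnj (?z 0)) \<le> 0"
      by (rule tendsto_upperbound) simp
    then show False
      using Ux by simp
  qed
  have rs: "real_simple F"
    unfolding real_simple_def using F simple Im_dilate_imp_real_roots[OF F r ImF] by blast
  have "\<not> y / x \<le> 1" if h: "poly F x = 0" "poly F y = 0" "x \<noteq> 0" "y \<noteq> x" "r \<le> y / x" for x y
  proof
    assume "y / x \<le> 1"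
    moreover have "y / x \<noteq> 1"
      using h by auto
    ultimately have lt: "y / x < 1"
      by (rule order_le_neq_trans)
    have "y / x = r"
      using Im_dilate_imp_separated[OF rs r ImF h(1-3)] lt h(5) by (metis order_le_neq_trans)
    then have y: "y = r * x"
      using h(3) by (simp add: field_simps)
    have 1: "poly U y + x * poly V y = 0" "poly U y + r ^ m * y * poly V y = 0"
      using FUV'[of x] FUVr[of y] h y by auto
    then have "x * poly V y - r ^ m * y * poly V y = 0"
      by linarith
    moreover have "x * poly V y - r ^ m * (r * x) * poly V y = (1 - r ^ Suc m) * (x * poly V y)"
      by (simp add: algebra_simps)
    ultimately have "(1 - r ^ Suc m) * (x * poly V y) = 0"
      by (simp only: y[symmetric])
    moreover have "1 - r ^ Suc m \<noteq> 0"
      using power_Suc_less_one[OF r, of m] by simp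
    ultimately have "poly V y = 0"
      using h(3) by simp
    then have "poly U y = 0"
      using 1 by simp
    then show False
      using nc[of y] \<open>poly V y = 0\<close> y r h(3) by simp
  qed
  then show ?thesis
    using rs unfolding sep_def F_def by blast
qed

lemma sep_monom:
  assumes "c \<noteq> 0"
  shows "sep q (monom c k)"
  using assms by (auto simp: sep_def real_simple_def poly_monom)

text \<open>The interlacing of the two convolutions is strict, because a common zero could be destroyed
  by a perturbation of \<open>P\<close> that keeps one of them and violates the weak interlacing.\<close>

lemma shifted_no_common_root:
  assumes s: "0 < s" "s < 1" and P: "sep s P" "degree P < m"
    and k: "sep s (lift s m \<kappa>)" "\<And>k. k \<le> m \<Longrightarrow> \<kappa> k > 0"
    and w: "w \<noteq> 0" "poly (hprod P \<kappa>) w = 0" "poly (hprod P (shift_seq \<kappa>)) w = 0"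
  shows False
proof -
  define M where "M = hprod P \<kappa>"
  have P0: "P \<noteq> 0"
    using P(1) by (rule sep_nonzero)
  define l where "l = order 0 P"
  have l: "coeff P l \<noteq> 0"
    unfolding l_def using P0 by (rule coeff_order_nonzero)
  have ld: "l \<le> degree P"
    using le_degree[OF l] .
  have M0: "M \<noteq> 0"
  proof
    assume "M = 0"
    then have "coeff P l * \<kappa> l = 0"
      by (metis M_def coeff_0 coeff_hprod)
    then show False
      using l k(2)[of l] ld P(2) by auto
  qed
  have "sep s (hprod P \<kappa>)"
    using k M0 P by (intro multiplier_strict[where gs = "\<lambda>_. \<kappa>" and n = m, OF s(1) order_refl s(2)])
      (auto simp: M_def less_imp_le)
  then have M: "sep s M"
    by (simp add: M_def)
  \<comment> \<open>A monomial convolution has no zero w off the origin, so P is not a monomial and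
    the index \<open>Suc l\<close> stays within its degree.\<close>
  have ldp: "l < degree P"
  proof (rule ccontr)
    assume "\<not> l < degree P"
    then have ld': "degree P = l"
      using ld by simp
    have "poly M w = (\<Sum>j\<le>l. coeff M j * w ^ j)"
      using degree_hprod_le[of P \<kappa>] ld' by (intro poly_altdef_le) (simp add: M_def)
    also have "\<dots> = (\<Sum>j\<in>{l}. coeff M j * w ^ j)"
      using coeff_below_order[of _ P] by (intro sum.mono_neutral_right) (auto simp: M_def l_def)
    finally have "coeff P l * \<kappa> l * w ^ l = 0"
      using w(2) by (simp add: M_def)
    then show False
      using l k(2)[of l] ld P(2) w(1) by auto
  qed
  have kpos: "\<kappa> l > 0" "\<kappa> (Suc l) > 0" "\<kappa> (Suc (Suc l)) > 0"
    using k(2) ldp P(2) by auto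
  have LCm: "LCs m \<kappa>"
    using k(1) s by (intro PRs_imp_LCs[of s]) (auto simp: PRs_def)
  have "l \<le> Suc l \<and> Suc l \<le> Suc (Suc l) \<and> Suc (Suc l) \<le> m \<and> \<kappa> l \<noteq> 0 \<and> \<kappa> (Suc (Suc l)) \<noteq> 0 \<and>
      0 < Suc l \<and> Suc l < m"
    using kpos ldp P(2) by auto
  from LCm[unfolded LCs_def, rule_format, OF this]
  have LC: "\<kappa> l * \<kappa> (Suc (Suc l)) < (\<kappa> (Suc l))\<^sup>2"
    by simp
  \<comment> \<open>\<open>D0\<close> lives on the indices l and l + 1 and is balanced so that its
    convolution with \<kappa> vanishes at w; strict log-concavity of \<kappa> makes the convolution
    with the shifted sequence nonzero there.\<close>
  define D0 where "D0 = monom (\<kappa> (Suc l) * w) l - monom (\<kappa> l) (Suc l)"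
  have hD0: "hprod D0 b = monom (\<kappa> (Suc l) * w * b l) l - monom (\<kappa> l * b (Suc l)) (Suc l)" for b
    by (rule poly_eqI) (simp add: D0_def algebra_simps)
  have D0w: "poly (hprod D0 \<kappa>) w = 0"
    by (simp add: hD0 poly_monom)
  define c where "c = poly (hprod D0 (shift_seq \<kappa>)) w"
  have c: "c = w ^ Suc l * ((\<kappa> (Suc l))\<^sup>2 - \<kappa> l * \<kappa> (Suc (Suc l)))"
    by (simp add: c_def hD0 poly_monom power2_eq_square algebra_simps)
  then have c0: "c \<noteq> 0"
    using LC w(1) by simp
  define \<mu> where "\<mu> = poly (pderiv M) w"
  have mu: "\<mu> \<noteq> 0"
    using M w unfolding sep_def real_simple_def M_def \<mu>_def by blast
  \<comment> \<open>The sign of \<tau> is chosen so that the perturbed residue at w gets the wrong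
    sign.\<close>
  define \<tau> where "\<tau> = w * c * \<mu>"
  have tau: "\<tau> \<noteq> 0"
    using w(1) c0 mu by (simp add: \<tau>_def)
  define D where "D = smult \<tau> D0"
  have degD: "degree D \<le> degree P"
    unfolding D_def D0_def using ldp
    by (intro order_trans[OF degree_smult_le] degree_diff_le order_trans[OF degree_monom_le]) auto
  have lowD: "coeff D j = 0" if "j < l" for j
    using that by (simp add: D_def D0_def)
  have "((\<lambda>\<epsilon>. coeff P k + \<epsilon> * coeff D k) \<longlongrightarrow> coeff P k + 0 * coeff D k) (at_right 0)" for k
    by (intro tendsto_intros)
  then have lim: "((\<lambda>\<epsilon>. coeff (P + smult \<epsilon> D) k) \<longlongrightarrow> coeff P k) (at_right 0)" for k
    by simp
  have degP: "degree (P + smult \<epsilon> D) \<le> degree P" for \<epsilon>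
    using degD by (intro degree_add_le order_trans[OF degree_smult_le]) auto
  have "\<forall>\<^sub>F \<epsilon> in at_right 0. sep s (P + smult \<epsilon> D)"
  proof (rule sep_open[OF P(1) s(1) _ lim degP])
    show "coeff (P + smult \<epsilon> D) k = 0" if "k < order 0 P" for \<epsilon> k
      using lowD that coeff_below_order[OF that] by (simp add: l_def)
  qed (use s in simp)
  moreover have "\<forall>\<^sub>F \<epsilon> in at_right 0. \<tau> * (\<mu> + \<epsilon> * poly (pderiv (hprod D \<kappa>)) w) * (w * c) > 0"
  proof -
    have l: "((\<lambda>\<epsilon>. \<tau> * (\<mu> + \<epsilon> * poly (pderiv (hprod D \<kappa>)) w) * (w * c)) \<longlongrightarrow>
        \<tau> * (\<mu> + 0 * poly (pderiv (hprod D \<kappa>)) w) * (w * c)) (at_right 0)"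
      by (intro tendsto_intros)
    have "\<tau> * (\<mu> + 0 * poly (pderiv (hprod D \<kappa>)) w) * (w * c) = \<tau>\<^sup>2"
      by (simp add: \<tau>_def power2_eq_square algebra_simps)
    moreover have "\<tau>\<^sup>2 > 0"
      using tau by simp
    ultimately have "\<tau> * (\<mu> + 0 * poly (pderiv (hprod D \<kappa>)) w) * (w * c) > 0"
      by (simp only:)
    then show ?thesis
      by (rule order_tendstoD(1)[OF l])
  qed
  ultimately have "\<forall>\<^sub>F \<epsilon> in at_right 0. sep s (P + smult \<epsilon> D) \<and> 0 < \<epsilon> \<and>
      \<tau> * (\<mu> + \<epsilon> * poly (pderiv (hprod D \<kappa>)) w) * (w * c) > 0"
    using eventually_at_right_less[of "0::real"] by eventually_elim blast
  from eventually_happens'[OF trivial_limit_at_right_real this]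
  obtain \<epsilon> where e: "sep s (P + smult \<epsilon> D)" "0 < \<epsilon>"
    "\<tau> * (\<mu> + \<epsilon> * poly (pderiv (hprod D \<kappa>)) w) * (w * c) > 0"
    by blast
  define P' where "P' = P + smult \<epsilon> D"
  have M': "hprod P' \<kappa> = M + smult \<epsilon> (hprod D \<kappa>)" and N': "hprod P' (shift_seq \<kappa>) = hprod P (shift_seq \<kappa>) + smult \<epsilon> (hprod D (shift_seq \<kappa>))"
    by (simp_all add: P'_def M_def hprod_add hprod_smult)
  have root: "poly (hprod P' \<kappa>) w = 0"
    using w(2) D0w unfolding M' M_def by (simp add: D_def hprod_smult)
  have N'w: "poly (hprod P' (shift_seq \<kappa>)) w = \<epsilon> * \<tau> * c"
    unfolding N' using w(3) by (simp add: D_def hprod_smult c_def)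
  have "poly (- pCons 0 (hprod P' (shift_seq \<kappa>))) w * poly (lin_quot (hprod P' \<kappa>) w) w \<ge> 0"
  proof (rule residue_nonneg[OF _ root])
    fix z assume z: "Im z > 0"
    have "Im (z * cpoly (hprod P' (shift_seq \<kappa>)) z * cnj (cpoly (hprod P' \<kappa>) z)) \<ge> 0"
      using outward_rightward[OF s, of m] e(1) degP[of \<epsilon>] P(2) k z less_imp_le
      unfolding rightward_def P'_def by (metis le_less_trans)
    then show "Im (cpoly (- pCons 0 (hprod P' (shift_seq \<kappa>))) z * cnj (cpoly (hprod P' \<kappa>) z)) \<le> 0"
      by simp
  qed
  also have "poly (lin_quot (hprod P' \<kappa>) w) w = poly (pderiv (hprod P' \<kappa>)) w"
    by (rule poly_pderiv_eq_lin_quot[OF root, symmetric])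
  also have "\<dots> = \<mu> + \<epsilon> * poly (pderiv (hprod D \<kappa>)) w"
    unfolding M' by (simp add: \<mu>_def pderiv_add pderiv_smult)
  finally have "\<epsilon> * (\<tau> * (\<mu> + \<epsilon> * poly (pderiv (hprod D \<kappa>)) w) * (w * c)) \<le> 0"
    using N'w by (simp add: mult_ac)
  moreover have "\<epsilon> * (\<tau> * (\<mu> + \<epsilon> * poly (pderiv (hprod D \<kappa>)) w) * (w * c)) > 0"
    by (rule mult_pos_pos[OF e(2,3)])
  ultimately show False
    by simp
qed

text \<open>The coefficient sequences of extremal polynomials.\<close>

definition geometric_seq :: "nat \<Rightarrow> (nat \<Rightarrow> real) \<Rightarrow> bool"
  where "geometric_seq n f \<longleftrightarrow> (\<exists>a b. a \<noteq> 0 \<and> b \<noteq> 0 \<and> (\<forall>k\<le>n. f k = b * a ^ k))"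

lemma PRs_Im_shift_trunc:
  assumes q: "0 < q" "q < 1" and a: "PRs q (Suc m) a" and z: "Im z > 0"
  shows "Im (cpoly (lift q m (shift_seq a)) z * cnj (cpoly (lift q m a) z)) \<le> 0"
proof (cases "lift q (Suc m) a = 0")
  case True
  then have "lift q m a = 0"
    using lift_eq_0_iff[OF q(1)] by simp
  then show ?thesis
    by simp
next
  case False
  then show ?thesis
    using a Im_lift_shift_trunc_le[OF q _ z] by (simp add: PRs_def)
qed

lemma cpoly_lift_limit:
  assumes "\<And>k. k \<le> n \<Longrightarrow> (\<lambda>i. fs i k) \<longlonglongrightarrow> f k"
  shows "(\<lambda>i. cpoly (lift q n (fs i)) z) \<longlonglongrightarrow> cpoly (lift q n f) z"
proof (rule tendsto_cpoly_coeffs[OF _ degree_lift_le degree_lift_le])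
  show "(\<lambda>i. coeff (lift q n (fs i)) k) \<longlonglongrightarrow> coeff (lift q n f) k" for k
    using assms[of k] by (cases "k \<le> n") (auto simp: coeff_R_poly_gt intro: tendsto_intros)
qed

text \<open>Interlacing gives the weak inequality. If the first factor vanished at w, then, as w is
  nonzero, so would the convolution of the quotient of U by \<open>z - x\<close> with the shifted
  sequence, against \<open>shifted_no_common_root\<close>. The second factor is nonzero because the
  convolution of U is separated.\<close>

lemma pole_term_positive:
  assumes s: "0 < s" "s < 1" and k: "sep s (lift s m \<kappa>)" "\<And>k. k \<le> m \<Longrightarrow> \<kappa> k > 0"
    and U: "sep s U" "degree U \<le> m" and x: "poly U x = 0"
    and w: "w \<noteq> 0" "poly (hprod U \<kappa>) w = 0"
  shows "poly (hprod (lin_quot U x) \<kappa>) w * poly (pderiv (hprod U \<kappa>)) w > 0"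
proof -
  have U0: "U \<noteq> 0"
    using U(1) by (rule sep_nonzero)
  define P where "P = lin_quot U x"
  have P: "sep s P" "degree P < m"
    using sep_lin_quot[OF U(1) x] degree_lin_quot[OF x U0] U(2) by (auto simp: P_def)
  have eq: "poly (hprod U \<kappa>) w = w * poly (hprod P (shift_seq \<kappa>)) w - x * poly (hprod P \<kappa>) w"
    unfolding hprod_lin_quot[OF x] P_def by simp
  have M: "poly (hprod P \<kappa>) w \<noteq> 0"
    using shifted_no_common_root[OF s P k w(1)] eq w by auto
  have nn: "poly (hprod P \<kappa>) w * poly (lin_quot (hprod U \<kappa>) w) w \<ge> 0"
  proof (rule residue_nonneg[OF _ w(2)])
    fix z assume z: "Im z > 0"
    have r: "Im (z * cpoly (hprod P (shift_seq \<kappa>)) z * cnj (cpoly (hprod P \<kappa>) z)) \<ge> 0"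
      using outward_rightward[OF s, of m] P k z less_imp_le unfolding rightward_def by blast
    have "cpoly (hprod P \<kappa>) z * cnj (cpoly (hprod U \<kappa>) z) =
        cnj (z * cpoly (hprod P (shift_seq \<kappa>)) z * cnj (cpoly (hprod P \<kappa>) z)) -
        of_real x * (cpoly (hprod P \<kappa>) z * cnj (cpoly (hprod P \<kappa>) z))"
      unfolding cpoly_hprod_lin_quot[OF x] P_def by (simp add: algebra_simps)
    also have "cpoly (hprod P \<kappa>) z * cnj (cpoly (hprod P \<kappa>) z) = of_real ((cmod (cpoly (hprod P \<kappa>) z))\<^sup>2)"
      by (rule complex_norm_square[symmetric])
    finally show "Im (cpoly (hprod P \<kappa>) z * cnj (cpoly (hprod U \<kappa>) z)) \<le> 0"
      using r by (simp only: minus_complex.sel Im_of_real_mult cnj.sel) simp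
  qed
  have "hprod U \<kappa> \<noteq> 0"
  proof
    assume "hprod U \<kappa> = 0"
    then have "coeff U (degree U) * \<kappa> (degree U) = 0"
      by (metis coeff_0 coeff_hprod)
    then show False
      using U0 k(2)[OF U(2)] by auto
  qed
  then have "sep s (hprod U \<kappa>)"
    using k U by (intro multiplier_strict[where gs = "\<lambda>_. \<kappa>" and n = m, OF s(1) order_refl s(2)])
      (auto simp: less_imp_le)
  then have "poly (pderiv (hprod U \<kappa>)) w \<noteq> 0"
    using w unfolding sep_def real_simple_def by blast
  then have "poly (hprod P \<kappa>) w * poly (pderiv (hprod U \<kappa>)) w \<noteq> 0"
    using M by simp
  moreover have "poly (hprod P \<kappa>) w * poly (pderiv (hprod U \<kappa>)) w \<ge> 0"
    using nn poly_pderiv_eq_lin_quot[OF w(2)] by simp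
  ultimately show ?thesis
    unfolding P_def by (metis order_less_le)
qed

text \<open>The counterpart for the pole at infinity, that is, for the term \<open>- e z\<close> of
  the partial fractions.\<close>

lemma infinity_term_positive:
  assumes s: "0 < s" "s < 1" and k: "sep s (lift s m \<kappa>)" "\<And>k. k \<le> m \<Longrightarrow> \<kappa> k > 0"
    and U: "sep s U" "degree U < m" and w: "w \<noteq> 0" "poly (hprod U \<kappa>) w = 0"
  shows "w * poly (hprod U (shift_seq \<kappa>)) w * poly (pderiv (hprod U \<kappa>)) w < 0"
proof -
  have U0: "U \<noteq> 0"
    using U(1) by (rule sep_nonzero)
  have N: "poly (hprod U (shift_seq \<kappa>)) w \<noteq> 0"
    using shifted_no_common_root[OF s U k w] by blast
  have nn: "poly (- pCons 0 (hprod U (shift_seq \<kappa>))) w * poly (lin_quot (hprod U \<kappa>) w) w \<ge> 0"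
  proof (rule residue_nonneg[OF _ w(2)])
    fix z assume z: "Im z > 0"
    have "Im (z * cpoly (hprod U (shift_seq \<kappa>)) z * cnj (cpoly (hprod U \<kappa>) z)) \<ge> 0"
      using outward_rightward[OF s, of m] U k z less_imp_le unfolding rightward_def by blast
    then show "Im (cpoly (- pCons 0 (hprod U (shift_seq \<kappa>))) z * cnj (cpoly (hprod U \<kappa>) z)) \<le> 0"
      by simp
  qed
  have "hprod U \<kappa> \<noteq> 0"
  proof
    assume "hprod U \<kappa> = 0"
    then have "coeff U (degree U) * \<kappa> (degree U) = 0"
      by (metis coeff_0 coeff_hprod)
    then show False
      using U0 k(2)[of "degree U"] U(2) by auto
  qed
  then have "sep s (hprod U \<kappa>)"
    using k U by (intro multiplier_strict[where gs = "\<lambda>_. \<kappa>" and n = m, OF s(1) order_refl s(2)])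
      (auto simp: less_imp_le)
  then have "poly (pderiv (hprod U \<kappa>)) w \<noteq> 0"
    using w unfolding sep_def real_simple_def by blast
  then have "w * poly (hprod U (shift_seq \<kappa>)) w * poly (pderiv (hprod U \<kappa>)) w \<noteq> 0"
    using N w by simp
  moreover have "w * poly (hprod U (shift_seq \<kappa>)) w * poly (pderiv (hprod U \<kappa>)) w \<le> 0"
    using nn poly_pderiv_eq_lin_quot[OF w(2)] by simp
  ultimately show ?thesis
    by (metis order_less_le)
qed

text \<open>Induction on the length. By \<open>sep_if_no_common_root\<close> it remains to exclude a
  common zero w of the truncated and the shifted convolution at level r. By induction the truncation
  is separated at an intermediate level s, where the shifted convolution V expands in the pole terms
  of the truncated one, U. Carried down to level r and evaluated at w, this is a sum of terms of one
  strict sign with nonnegative weights. As the sum is 0, all weights vanish, so V = c U, and f is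
  geometric.\<close>

lemma PRs_closure_strict_less_1:
  assumes r: "0 < r" "r < q" "q < 1" and fs: "\<And>i. PRs q n (fs i)"
    and lim: "\<And>k. k \<le> n \<Longrightarrow> (\<lambda>i. fs i k) \<longlonglongrightarrow> f k" and ext: "\<not> geometric_seq n f"
  shows "PRs r n f"
  using r fs lim ext
proof (induction n arbitrary: r)
  case 0
  have "lift r 0 f = monom (f 0) 0"
    by (rule poly_eqI) (auto simp: coeff_R_poly_gt not_le)
  then show ?case
    using sep_monom[of "f 0" r 0] by (cases "f 0 = 0") (auto simp: PRs_def)
next
  case (Suc m)
  have q0: "0 < q" and r1: "r < 1"
    using Suc.prems by auto
  show ?case
  \<comment> \<open>If one of the two windows vanishes, the whole convolution is 0 or a
    monomial.\<close>
  proof (cases "lift r (Suc m) f = 0 \<or> (\<forall>k\<le>m. f k = 0) \<or> (\<forall>k\<le>m. f (Suc k) = 0)")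
    case True
    then consider "lift r (Suc m) f = 0" | "\<forall>k\<le>m. f k = 0" "lift r (Suc m) f \<noteq> 0"
      | "\<forall>k\<le>m. f (Suc k) = 0" "lift r (Suc m) f \<noteq> 0"
      by blast
    then show ?thesis
    proof cases
      case 2
      then have "lift r (Suc m) f = monom (coeff (R_poly (Suc m) r) (Suc m) * f (Suc m)) (Suc m)"
      proof (intro poly_eqI)
        fix k
        consider "k \<le> m" | "k = Suc m" | "Suc m < k"
          by linarith
        then show "coeff (lift r (Suc m) f) k =
            coeff (monom (coeff (R_poly (Suc m) r) (Suc m) * f (Suc m)) (Suc m)) k"
          by cases (use 2(1) in \<open>auto simp: coeff_R_poly_gt\<close>)
      qed
      then show ?thesis
        using sep_monom 2(2) unfolding PRs_def by (metis monom_eq_0)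
    next
      case 3
      have "lift r (Suc m) f = monom (f 0) 0"
      proof (rule poly_eqI)
        show "coeff (lift r (Suc m) f) k = coeff (monom (f 0) 0) k" for k
          using 3(1) by (cases k; cases "k \<le> Suc m") (auto simp: not_le coeff_R_poly_gt)
      qed
      then show ?thesis
        using sep_monom 3(2) unfolding PRs_def by (metis monom_eq_0)
    qed (simp add: PRs_def)
  next
    case False
    then have F0: "lift r (Suc m) f \<noteq> 0" and u0: "\<not> (\<forall>k\<le>m. f k = 0)" and v0: "\<not> (\<forall>k\<le>m. f (Suc k) = 0)"
      by auto
    have fs_t: "PRs t (Suc m) (fs i)" if "0 < t" "t \<le> q" for t i
      using PRs_mono_less_1[OF that Suc.prems(3,4)] .
    have lim_m: "(\<lambda>i. fs i k) \<longlonglongrightarrow> f k" if "k \<le> m" for k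
      using Suc.prems(5)[of k] that by simp
    have lim_s: "(\<lambda>i. shift_seq (fs i) k) \<longlonglongrightarrow> shift_seq f k" if "k \<le> m" for k
      using Suc.prems(5)[of "Suc k"] that by simp
    have ImUV: "Im (cpoly (lift t m (shift_seq f)) z * cnj (cpoly (lift t m f) z)) \<le> 0"
      if t: "0 < t" "t \<le> q" and z: "Im z > 0" for t z
    proof -
      have "(\<lambda>i. Im (cpoly (lift t m (shift_seq (fs i))) z * cnj (cpoly (lift t m (fs i)) z))) \<longlonglongrightarrow>
          Im (cpoly (lift t m (shift_seq f)) z * cnj (cpoly (lift t m f) z))"
        using cpoly_lift_limit[of m "\<lambda>i. shift_seq (fs i)" "shift_seq f", OF lim_s] cpoly_lift_limit[of m fs f, OF lim_m]
        by (intro tendsto_intros)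
      then show ?thesis
        using PRs_Im_shift_trunc[OF t(1) _ fs_t[OF t] z] t Suc.prems(3) by (intro LIMSEQ_le_const2) auto
    qed
    have ImF: "Im (z * cpoly (lift r (Suc m) f) (of_real r * z) * cnj (cpoly (lift r (Suc m) f) z)) \<ge> 0"
      if z: "Im z > 0" for z
    proof -
      have "(\<lambda>i. Im (z * cpoly (lift r (Suc m) (fs i)) (of_real r * z) * cnj (cpoly (lift r (Suc m) (fs i)) z))) \<longlonglongrightarrow>
          Im (z * cpoly (lift r (Suc m) f) (of_real r * z) * cnj (cpoly (lift r (Suc m) f) z))"
        using cpoly_lift_limit[of "Suc m" fs f, OF Suc.prems(5)] by (intro tendsto_intros)
      then show ?thesis
        using PRs_Im_dilate[OF Suc.prems(1) _ Suc.prems(3,4) z] Suc.prems(2) by (intro LIMSEQ_le_const) auto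
    qed
    have "sep r (lift r (Suc m) f)"
    proof (rule sep_if_no_common_root[OF Suc.prems(1) r1 F0 ImF])
      show "Im (cpoly (lift r m (shift_seq f)) z * cnj (cpoly (lift r m f) z)) \<le> 0" if "Im z > 0" for z
        using ImUV[OF Suc.prems(1) _ that] Suc.prems(2) by simp
      fix w assume w: "w \<noteq> 0" and Uw: "poly (lift r m f) w = 0" and Vw: "poly (lift r m (shift_seq f)) w = 0"
      show False
      proof (cases "geometric_seq m f")
        \<comment> \<open>The induction hypothesis says nothing about a geometric truncation. In
          that case the shifted convolution is a multiple of the truncated one plus a nonzero term
          of degree m, which does not vanish at w.\<close>
        case True
        then obtain a b where ab: "a \<noteq> 0" "b \<noteq> 0" "\<And>k. k \<le> m \<Longrightarrow> f k = b * a ^ k"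
          by (auto simp: geometric_seq_def)
        define d where "d = f (Suc m) - b * a ^ Suc m"
        have "d \<noteq> 0"
        proof
          assume "d = 0"
          then have "f k = b * a ^ k" if "k \<le> Suc m" for k
            using ab(3)[of k] that by (cases "k = Suc m") (auto simp: d_def)
          then show False
            using Suc.prems(6) ab(1,2) unfolding geometric_seq_def by blast
        qed
        have "lift r m (shift_seq f) = smult a (lift r m f) + monom (coeff (R_poly m r) m * d) m"
        proof (rule poly_eqI)
          fix k
          consider "k < m" | "k = m" | "m < k"
            by linarith
          then show "coeff (lift r m (shift_seq f)) k =
              coeff (smult a (lift r m f) + monom (coeff (R_poly m r) m * d) m) k"
            by cases (auto simp: ab(3) d_def coeff_R_poly_gt algebra_simps)
        qed
        then have "coeff (R_poly m r) m * d * w ^ m = 0"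
          using Uw Vw by (simp add: poly_monom)
        then show False
          using \<open>d \<noteq> 0\<close> w coeff_R_poly_pos[OF Suc.prems(1), of m m] by simp
      next
        case False
        \<comment> \<open>Strictly between: below q the induction hypothesis applies, and above r
          the multiplier \<open>R_m(r)/R_m(s)\<close> is s-separated.\<close>
        define s where "s = (r + q) / 2"
        have s: "0 < s" "s < 1" "r < s" "s < q"
          using Suc.prems by (auto simp: s_def)
        have "PRs s m f"
          using PRs_trunc[OF q0 Suc.prems(3,4)] lim_m False s Suc.prems(3)
          by (intro Suc.IH) auto
        moreover have "lift s m f \<noteq> 0"
          using lift_eq_0_iff[OF s(1)] u0 by blast
        ultimately have Us: "sep s (lift s m f)"
          by (simp add: PRs_def)
        define U where "U = lift s m f"
        define V where "V = lift s m (shift_seq f)"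
        have U: "sep s U" "degree U \<le> m" "U \<noteq> 0"
          using Us degree_lift_le sep_nonzero by (auto simp: U_def)
        obtain e c p where p:
          "V = smult (- e) (pCons 0 U) + smult c U + (\<Sum>x | poly U x = 0. smult (p x) (lin_quot U x))"
          "e \<ge> 0" "\<And>x. poly U x = 0 \<Longrightarrow> p x \<ge> 0" "e \<noteq> 0 \<Longrightarrow> degree U < m"
          unfolding U_def V_def
          by (rule lift_partial_fractions[OF _ s(1) ImUV[OF s(1)]]) (use Us s in \<open>auto simp: sep_def\<close>)
        define \<kappa> where "\<kappa> k = coeff (R_poly m r) k / coeff (R_poly m s) k" for k
        have k: "lift s m \<kappa> = R_poly m r"
          using lift_ratio[OF s(1), of m r "\<lambda>k. 1"] by (simp add: \<kappa>_def[abs_def] lift_const_1)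
        have k1: "sep s (lift s m \<kappa>)"
          unfolding k using sep_R_poly[of r s m] Suc.prems(1) s by simp
        have k2: "\<kappa> k > 0" if "k \<le> m" for k
          using coeff_R_poly_pos[OF s(1) that] coeff_R_poly_pos[OF Suc.prems(1) that] by (simp add: \<kappa>_def)
        have Ur: "hprod U \<kappa> = lift r m f" and Vr: "hprod V \<kappa> = lift r m (shift_seq f)"
          unfolding U_def V_def hprod_lift \<kappa>_def[abs_def] using lift_ratio[OF s(1), of m r] by (simp_all add: mult.commute)
        have Uw': "poly (hprod U \<kappa>) w = 0"
          using Uw Ur by simp
        define \<mu> where "\<mu> = poly (pderiv (hprod U \<kappa>)) w"
        have tpos: "poly (hprod (lin_quot U x) \<kappa>) w * \<mu> > 0" if "poly U x = 0" for x
          unfolding \<mu>_def using pole_term_positive[OF s(1,2) k1 k2 U(1,2) that w Uw'] .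
        have "hprod V \<kappa> = smult (- e) (pCons 0 (hprod U (shift_seq \<kappa>))) + smult c (hprod U \<kappa>) +
            (\<Sum>x | poly U x = 0. smult (p x) (hprod (lin_quot U x) \<kappa>))"
          unfolding p(1) by (simp only: hprod_add hprod_smult hprod_sum hprod_pCons_0)
        then have "poly (hprod V \<kappa>) w * \<mu> = - e * (w * poly (hprod U (shift_seq \<kappa>)) w * \<mu>) +
            (\<Sum>x | poly U x = 0. p x * (poly (hprod (lin_quot U x) \<kappa>) w * \<mu>))"
          using Uw' by (simp add: poly_sum sum_distrib_left algebra_simps)
        then have sum0: "- e * (w * poly (hprod U (shift_seq \<kappa>)) w * \<mu>) +
            (\<Sum>x | poly U x = 0. p x * (poly (hprod (lin_quot U x) \<kappa>) w * \<mu>)) = 0"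
          using Vw Vr by simp
        have t1: "e * - (w * poly (hprod U (shift_seq \<kappa>)) w * \<mu>) \<ge> 0"
          and e0: "e = 0 \<or> e * - (w * poly (hprod U (shift_seq \<kappa>)) w * \<mu>) > 0"
        proof -
          have "e = 0 \<or> e * - (w * poly (hprod U (shift_seq \<kappa>)) w * \<mu>) > 0"
          proof (cases "e = 0")
            case False
            then have "- (w * poly (hprod U (shift_seq \<kappa>)) w * \<mu>) > 0"
              unfolding \<mu>_def using infinity_term_positive[OF s(1,2) k1 k2 U(1) p(4) w Uw'] by simp
            then show ?thesis
              using p(2) False by (simp only: zero_less_mult_iff) auto
          qed simp
          then show "e = 0 \<or> e * - (w * poly (hprod U (shift_seq \<kappa>)) w * \<mu>) > 0"
            "e * - (w * poly (hprod U (shift_seq \<kappa>)) w * \<mu>) \<ge> 0"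
            by auto
        qed
        have t2: "p x * (poly (hprod (lin_quot U x) \<kappa>) w * \<mu>) \<ge> 0" if "x \<in> {x. poly U x = 0}" for x
          by (rule mult_nonneg_nonneg[OF p(3) less_imp_le[OF tpos]]) (use that in auto)
        have fin: "finite {x. poly U x = 0}"
          using U(3) by (rule poly_roots_finite)
        have S: "(\<Sum>x | poly U x = 0. p x * (poly (hprod (lin_quot U x) \<kappa>) w * \<mu>)) \<ge> 0"
          by (rule sum_nonneg[OF t2])
        have "e = 0"
          using e0 S sum0 by linarith
        have "(\<Sum>x | poly U x = 0. p x * (poly (hprod (lin_quot U x) \<kappa>) w * \<mu>)) = 0"
          using sum0 \<open>e = 0\<close> by simp
        then have "\<forall>x\<in>{x. poly U x = 0}. p x * (poly (hprod (lin_quot U x) \<kappa>) w * \<mu>) = 0"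
          by (subst (asm) sum_nonneg_eq_0_iff[OF fin]) (use t2 in auto)
        then have "p x * (poly (hprod (lin_quot U x) \<kappa>) w * \<mu>) = 0" if "poly U x = 0" for x
          using that by blast
        then have "p x = 0" if "poly U x = 0" for x
          using tpos[OF that] that by (metis less_irrefl mult_eq_0_iff)
        then have VU: "V = smult c U"
          unfolding p(1) using \<open>e = 0\<close> by simp
        have geo: "f (Suc k) = c * f k" if "k \<le> m" for k
        proof -
          have "coeff (R_poly m s) k * f (Suc k) = coeff (R_poly m s) k * (c * f k)"
            using arg_cong[OF VU, of "\<lambda>p. coeff p k"] by (simp add: U_def V_def)
          then show ?thesis
            using coeff_R_poly_pos[OF s(1) that] by simp
        qed
        have pow: "f k = f 0 * c ^ k" if "k \<le> Suc m" for k
          using that by (induction k) (auto simp: geo)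
        have "f 0 \<noteq> 0"
          using u0 pow by (metis le_SucI mult_zero_left)
        moreover have "c \<noteq> 0"
          using v0 geo by (metis mult_zero_left)
        ultimately show False
          using Suc.prems(6) pow unfolding geometric_seq_def by blast
      qed
    qed
    then show ?thesis
      by (simp add: PRs_def)
  qed
qed

text \<open>Monotonicity in q lowers the level of the sequence to some s < 1 that still exceeds
  r.\<close>

lemma PRs_closure_strict:
  assumes r: "0 < r" "r < q" "q \<le> 1" and fs: "\<And>i. PRs q n (fs i)"
    and lim: "\<And>k. k \<le> n \<Longrightarrow> (\<lambda>i. fs i k) \<longlonglongrightarrow> f k" and ext: "\<not> geometric_seq n f"
  shows "PRs r n f"
proof -
  define s where "s = (r + q) / 2"
  have s: "0 < s" "r < s" "s \<le> q" "s < 1"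
    using r by (auto simp: s_def)
  have "PRs s n (fs i)" for i
    using PRs_mono[OF s(1,3) r(3) fs] .
  then show ?thesis
    using PRs_closure_strict_less_1[OF r(1) s(2,4) _ lim ext] by blast
qed

subsection \<open>Log-concave sequences for small \<open>q\<close>\<close>

text \<open>\<open>k (k - 1)/2\<close>, the exponent of the lowest power of s in the coefficient of
  z^k in R_n(s); the recursion avoids a division of naturals.\<close>

fun tri :: "nat \<Rightarrow> nat"
  where "tri 0 = 0" | "tri (Suc k) = tri k + k"

lemma real_tri: "real (tri k) = real k * (real k - 1) / 2"
  by (induction k) (auto simp: field_simps)

lemma coeff_R_poly_asymp:
  assumes "k \<le> n"
  shows "((\<lambda>s. coeff (R_poly n s) k / s ^ tri k) \<longlongrightarrow> 1) (at_right 0)"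
  using assms
proof (induction n arbitrary: k)
  case (Suc n)
  show ?case
  proof (cases k)
    case (Suc j)
    have j: "((\<lambda>s. coeff (R_poly n s) j / s ^ tri j) \<longlongrightarrow> 1) (at_right 0)"
      using Suc.IH[of j] Suc.prems Suc by simp
    have ev: "\<forall>\<^sub>F s in at_right (0::real).
        coeff (R_poly n s) (Suc j) / s ^ tri (Suc j) + s ^ (n - j) * (coeff (R_poly n s) j / s ^ tri j) =
        coeff (R_poly (Suc n) s) k / s ^ tri k"
      using eventually_at_right_less[of "0::real"]
    proof eventually_elim
      case (elim s)
      have "s ^ n = s ^ (n - j) * s ^ j"
        using Suc Suc.prems by (simp flip: power_add)
      then have "s ^ n * coeff (R_poly n s) j / s ^ tri (Suc j) =
          s ^ (n - j) * (coeff (R_poly n s) j / s ^ tri j)"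
        using elim by (simp add: power_add)
      then show ?case
        by (simp only: Suc coeff_R_poly_Suc add_divide_distrib)
    qed
    have "((\<lambda>s. coeff (R_poly n s) (Suc j) / s ^ tri (Suc j) +
        s ^ (n - j) * (coeff (R_poly n s) j / s ^ tri j)) \<longlongrightarrow> 1) (at_right 0)"
    proof (cases "j = n")
      case True
      then show ?thesis
        using j by (simp add: coeff_R_poly_gt)
    next
      case False
      then have "Suc j \<le> n"
        using Suc Suc.prems by simp
      then have "((\<lambda>s. coeff (R_poly n s) (Suc j) / s ^ tri (Suc j) +
          s ^ (n - j) * (coeff (R_poly n s) j / s ^ tri j)) \<longlongrightarrow> 1 + 0 ^ (n - j) * 1) (at_right 0)"
        by (intro tendsto_add tendsto_mult tendsto_power tendsto_ident_at j Suc.IH)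
      moreover have "(1::real) + 0 ^ (n - j) * 1 = 1"
        using \<open>Suc j \<le> n\<close> by (simp add: power_0_left)
      ultimately show ?thesis
        by (simp only:)
    qed
    then show ?thesis
      by (rule Lim_transform_eventually[OF _ ev])
  qed simp
qed simp

lemma tendsto_powr_zero_right:
  assumes "0 < (e::real)"
  shows "((\<lambda>s::real. s powr e) \<longlongrightarrow> 0) (at_right 0)"
proof -
  have "((\<lambda>s::real. s powr e) \<longlongrightarrow> 0 powr e) (at_right 0)"
    using assms by (intro tendsto_powr' tendsto_intros) (auto simp: eventually_at_right_less intro: eventually_mono[OF eventually_at_right_less] less_imp_le)
  then show ?thesis
    by simp
qed

text \<open>A Newton polygon argument. At \<open>z = c s^(-\<kappa>)\<close> the kth term has order
  \<open>s^(tri k - \<kappa> k)\<close>. The choice of \<kappa> gives b and b + h the same exponent,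
  and relative to it the exponent is \<open>(k - b)(k - b - h)/2\<close>, positive for all other k
  except those strictly in between, where a vanishes. So two terms survive.\<close>

lemma lift_asymp:
  fixes a :: "nat \<Rightarrow> real"
  assumes h: "h = 1 \<or> h = 2" and bh: "b + h \<le> n" and gap: "\<And>k. b < k \<Longrightarrow> k < b + h \<Longrightarrow> a k = 0"
  defines "\<kappa> \<equiv> real b + (real h - 1) / 2"
  shows "((\<lambda>s. s powr (\<kappa> * real b - real (tri b)) * poly (lift s n a) (c * s powr - \<kappa>)) \<longlongrightarrow>
    c ^ b * (a b + a (b + h) * c ^ h)) (at_right 0)"
proof -
  let ?e = "\<lambda>k. (real k - real b) * (real k - real b - real h) / 2"
  let ?t = "\<lambda>s k. coeff (R_poly n s) k / s ^ tri k * (a k * c ^ k) * s powr ?e k"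
  have ev: "\<forall>\<^sub>F s in at_right (0::real). (\<Sum>k\<le>n. ?t s k) =
      s powr (\<kappa> * real b - real (tri b)) * poly (lift s n a) (c * s powr - \<kappa>)"
    using eventually_at_right_less[of "0::real"]
  proof eventually_elim
    case (elim s)
    have "s powr (\<kappa> * real b - real (tri b)) * poly (lift s n a) (c * s powr - \<kappa>) =
        (\<Sum>k\<le>n. s powr (\<kappa> * real b - real (tri b)) * (coeff (R_poly n s) k * a k * (c * s powr - \<kappa>) ^ k))"
      by (simp add: poly_altdef_le[OF degree_lift_le] sum_distrib_left)
    also have "\<dots> = (\<Sum>k\<le>n. ?t s k)"
    proof (rule sum.cong[OF refl])
      fix k
      have "?e k = \<kappa> * real b - real (tri b) + - \<kappa> * real k + real (tri k)"
        using h unfolding real_tri \<kappa>_def by (elim disjE) (simp_all add: field_simps)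
      then have "s powr ?e k = s powr (\<kappa> * real b - real (tri b)) * s powr (- \<kappa> * real k) * s powr real (tri k)"
        by (simp only: powr_add)
      also have "s powr (- \<kappa> * real k) = (s powr - \<kappa>) ^ k"
        using elim by (simp add: powr_powr flip: powr_realpow)
      also have "s powr real (tri k) = s ^ tri k"
        using elim by (simp add: powr_realpow)
      finally have "s powr ?e k = s powr (\<kappa> * real b - real (tri b)) * (s powr - \<kappa>) ^ k * s ^ tri k" .
      then show "s powr (\<kappa> * real b - real (tri b)) * (coeff (R_poly n s) k * a k * (c * s powr - \<kappa>) ^ k) = ?t s k"
        using elim by (simp add: power_mult_distrib)
    qed
    finally show ?case
      by simp
  qed
  have "((\<lambda>s. ?t s k) \<longlongrightarrow> (if k = b \<or> k = b + h then a k * c ^ k else 0)) (at_right 0)" if k: "k \<le> n" for k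
  proof (cases "k = b \<or> k = b + h")
    case True
    then have "?e k = 0"
      by auto
    have ev1: "\<forall>\<^sub>F s in at_right 0. coeff (R_poly n s) k / s ^ tri k * (a k * c ^ k) = ?t s k"
      using eventually_at_right_less[of "0::real"] unfolding \<open>?e k = 0\<close> by eventually_elim simp
    have "((\<lambda>s. coeff (R_poly n s) k / s ^ tri k * (a k * c ^ k)) \<longlongrightarrow> 1 * (a k * c ^ k)) (at_right 0)"
      by (intro tendsto_mult coeff_R_poly_asymp[OF k] tendsto_const)
    then show ?thesis
      unfolding if_P[OF True] using Lim_transform_eventually[OF _ ev1] by simp
  next
    case False
    show ?thesis
    proof (cases "a k = 0")
      case True
      then show ?thesis
        using False by simp
    next
      case a: False
      have "k < b \<or> b + h < k"
        using False gap[of k] a by linarith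
      then have "(real k - real b) * (real k - real b - real h) > 0"
        by (auto simp: zero_less_mult_iff)
      then have e: "?e k > 0"
        by simp
      have "((\<lambda>s::real. s powr ?e k) \<longlongrightarrow> 0) (at_right 0)"
        using e by (rule tendsto_powr_zero_right)
      then have "((\<lambda>s. ?t s k) \<longlongrightarrow> 1 * (a k * c ^ k) * 0) (at_right 0)"
        by (intro tendsto_mult coeff_R_poly_asymp[OF k] tendsto_const)
      then show ?thesis
        unfolding if_not_P[OF False] by simp
    qed
  qed
  then have "((\<lambda>s. \<Sum>k\<le>n. ?t s k) \<longlongrightarrow> (\<Sum>k\<le>n. if k = b \<or> k = b + h then a k * c ^ k else 0)) (at_right 0)"
    by (intro tendsto_sum) simp
  also have "(\<Sum>k\<le>n. if k = b \<or> k = b + h then a k * c ^ k else 0) = (\<Sum>k\<in>{b, b + h}. a k * c ^ k)"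
    using bh by (intro sum.mono_neutral_cong_right) auto
  also have "\<dots> = c ^ b * (a b + a (b + h) * c ^ h)"
    using h by (auto simp: algebra_simps power_add power2_eq_square)
  finally show ?thesis
    by (rule Lim_transform_eventually[OF _ ev])
qed

text \<open>For every index j from the first nonzero entry to just below the last, the surviving
  terms of \<open>lift_asymp\<close> predict one zero. Between nonzero neighbours it is close to
  \<open>- a_j/(a_(j+1) s^j)\<close>. At a vanishing a_k the entries a_(k-1) and a_(k+1) have
  opposite signs, and the indices k - 1 and k share the zeros of a quadratic, one of each sign.
  Log-concavity makes the predicted zeros of one sign s-separated.\<close>

lemma LCs_imp_PRs:
  assumes LC: "LCs n a"
  obtains s where "0 < s" "s \<le> 1" "PRs s n a"
proof (cases "\<forall>k\<le>n. a k = 0")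
  case True
  then have "PRs 1 n a"
    by (simp add: PRs_def lift_eq_0_iff)
  then show ?thesis
    using that[of 1] by simp
next
  case False
  define l where "l = Min {k. k \<le> n \<and> a k \<noteq> 0}"
  define d where "d = Max {k. k \<le> n \<and> a k \<noteq> 0}"
  have fin: "finite {k. k \<le> n \<and> a k \<noteq> 0}" and ne: "{k. k \<le> n \<and> a k \<noteq> 0} \<noteq> {}"
    using False by auto
  have l: "a l \<noteq> 0" "\<And>k. k < l \<Longrightarrow> k \<le> n \<Longrightarrow> a k = 0"
    using Min_in[OF fin ne] Min_le[OF fin] by (fastforce simp: l_def)+
  have d: "a d \<noteq> 0" "d \<le> n" "\<And>k. d < k \<Longrightarrow> k \<le> n \<Longrightarrow> a k = 0"
    using Max_in[OF fin ne] Max_ge[OF fin] by (fastforce simp: d_def)+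
  have lc: "a (k - 1) * a (k + 1) < (a k)\<^sup>2" if "l < k" "k < d" for k
    using LC[unfolded LCs_def, rule_format, of l k d] l d that by simp
  define J where "J = {l..<d}"
  \<comment> \<open>Index j uses the terms \<open>b j\<close> and \<open>b j + h j\<close>. At a gap
    k, both j = k - 1 and j = k refer to the terms k - 1 and k + 1 and take the positive and the
    negative square root, respectively.\<close>
  define b where "b j = (if a j = 0 then j - 1 else j)" for j
  define h where "h j = (if a j = 0 \<or> a (j + 1) = 0 then 2 else 1::nat)" for j
  define m where "m j = (if a j = 0 then - sqrt (- (a (j - 1) / a (j + 1)))
    else if a (j + 1) = 0 then sqrt (- (a j / a (j + 2))) else - (a j / a (j + 1)))" for j
  define \<kappa> where "\<kappa> j = real (b j) + (real (h j) - 1) / 2" for j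
  have neg: "a j \<noteq> 0 \<and> a (j + 2) \<noteq> 0 \<and> a j / a (j + 2) < 0 \<and> j + 2 \<le> d"
    if "l < j + 1" "j + 1 < d" "a (j + 1) = 0" for j
  proof -
    have "a j * a (j + 2) < 0"
      using lc[of "j + 1"] that by simp
    then show ?thesis
      using that by (auto simp: mult_less_0_iff divide_less_0_iff)
  qed
  have gap_up: "l < j + 1 \<and> j + 1 < d" if "j \<in> J" "a (j + 1) = 0" for j
    using that d(1) by (cases "j + 1 = d") (auto simp: J_def)
  have gap_down: "\<exists>i. j = i + 1 \<and> l < i + 1 \<and> i + 1 < d" if "j \<in> J" "a j = 0" for j
  proof -
    have "l < j" "j < d"
      using that l(1) by (auto simp: J_def le_less)
    then show ?thesis
      by (intro exI[of _ "j - 1"]) auto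
  qed
  have base: "a (b j) \<noteq> 0 \<and> a (b j + h j) \<noteq> 0 \<and> b j + h j \<le> n \<and> m j \<noteq> 0 \<and>
      m j ^ h j = - (a (b j) / a (b j + h j)) \<and> (\<forall>k. b j < k \<longrightarrow> k < b j + h j \<longrightarrow> a k = 0)"
    if j: "j \<in> J" for j
  proof -
    consider "a j = 0" | "a j \<noteq> 0" "a (j + 1) = 0" | "a j \<noteq> 0" "a (j + 1) \<noteq> 0"
      by blast
    then show ?thesis
    proof cases
      case 1
      then obtain i where i: "j = i + 1" "l < i + 1" "i + 1 < d"
        using gap_down j by blast
      have "a i \<noteq> 0 \<and> a (i + 2) \<noteq> 0 \<and> a i / a (i + 2) < 0 \<and> i + 2 \<le> d"
        using neg[of i] i 1 by blast
      moreover have "a k = 0" if "i < k" "k < i + 2" for k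
      proof -
        have "k = j"
          using that i by simp
        then show ?thesis
          using 1 by simp
      qed
      ultimately show ?thesis
        using 1 i d(2) by (auto simp: b_def h_def m_def)
    next
      case 2
      then have i: "l < j + 1" "j + 1 < d"
        using gap_up j by blast+
      have "a j \<noteq> 0 \<and> a (j + 2) \<noteq> 0 \<and> a j / a (j + 2) < 0 \<and> j + 2 \<le> d"
        using neg[of j] i 2 by blast
      moreover have "a k = 0" if "j < k" "k < j + 2" for k
      proof -
        have "k = j + 1"
          using that by simp
        then show ?thesis
          using 2 by simp
      qed
      ultimately show ?thesis
        using 2 d(2) by (auto simp: b_def h_def m_def)
    next
      case 3
      then show ?thesis
        using j d(2) by (auto simp: b_def h_def m_def J_def)
    qed
  qed
  \<comment> \<open>The ratio of the zeros i < j is about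
    \<open>(m i / m j) s^(\<kappa> j - \<kappa> i)\<close> and has to stay below s. For zeros of one
    sign the exponent exceeds 1, except for neighbours away from gaps, where it is 1 and
    \<open>m i / m j = a_i a_(i+2) / a_(i+1)^2\<close> is below 1 by log-concavity.\<close>
  have order: "\<kappa> j - \<kappa> i \<ge> 1 \<and> (\<kappa> j - \<kappa> i > 1 \<or> m i / m j < 1)"
    if ij: "i \<in> J" "j \<in> J" "i < j" "m i * m j > 0" for i j
  proof -
    have zi: "a (i + 1) \<noteq> 0" if "a i = 0"
      using gap_down[OF ij(1) that] neg that by (metis add.assoc one_add_one)
    have zj: "a (j + 1) \<noteq> 0" if "a j = 0"
      using gap_down[OF ij(2) that] neg that by (metis add.assoc one_add_one)
    have ki: "\<kappa> i = (if a i = 0 then real i - 1 / 2 else if a (i + 1) = 0 then real i + 1 / 2 else real i)"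
      using gap_down[OF ij(1)] by (auto simp: \<kappa>_def b_def h_def)
    have kj: "\<kappa> j = (if a j = 0 then real j - 1 / 2 else if a (j + 1) = 0 then real j + 1 / 2 else real j)"
      using gap_down[OF ij(2)] by (auto simp: \<kappa>_def b_def h_def)
    have mi: "(a i = 0 \<longrightarrow> m i < 0) \<and> (a i \<noteq> 0 \<and> a (i + 1) = 0 \<longrightarrow> m i > 0)"
    proof (intro conjI impI)
      assume z: "a i = 0"
      then have "m i \<le> 0"
        using gap_down[OF ij(1)] neg by (fastforce simp: m_def)
      then show "m i < 0"
        using base[OF ij(1)] by simp
    next
      assume "a i \<noteq> 0 \<and> a (i + 1) = 0"
      then have "m i \<ge> 0"
        using gap_up[OF ij(1)] neg[of i] by (simp add: m_def less_imp_le)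
      then show "m i > 0"
        using base[OF ij(1)] by simp
    qed
    have mj: "(a j = 0 \<longrightarrow> m j < 0) \<and> (a j \<noteq> 0 \<and> a (j + 1) = 0 \<longrightarrow> m j > 0)"
    proof (intro conjI impI)
      assume z: "a j = 0"
      then have "m j \<le> 0"
        using gap_down[OF ij(2)] neg by (fastforce simp: m_def)
      then show "m j < 0"
        using base[OF ij(2)] by simp
    next
      assume "a j \<noteq> 0 \<and> a (j + 1) = 0"
      then have "m j \<ge> 0"
        using gap_up[OF ij(2)] neg[of j] by (simp add: m_def less_imp_le)
      then show "m j > 0"
        using base[OF ij(2)] by simp
    qed
    show ?thesis
    proof (cases "j = i + 1")
      case False
      then have "real j \<ge> real i + 2"
        using ij(3) by linarith
      then show ?thesis
        using ki kj mi mj ij(4) by (auto simp: zero_less_mult_iff split: if_splits)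
    next
      case True
      show ?thesis
      proof (cases "a i \<noteq> 0 \<and> a j \<noteq> 0 \<and> a (j + 1) \<noteq> 0")
        case False
        then show ?thesis
          using True ki kj mi mj ij(4) zi zj by (auto simp: zero_less_mult_iff split: if_splits)
      next
        case nz: True
        have "l < j" "j < d"
          using ij True by (auto simp: J_def)
        from lc[OF this] have "a i * a (i + 2) < (a (i + 1))\<^sup>2"
          using True by simp
        moreover have "m i / m j = a i * a (i + 2) / (a (i + 1))\<^sup>2"
          using nz True by (simp add: m_def power2_eq_square)
        ultimately have "m i / m j < 1"
          using nz True by (simp add: divide_less_eq)
        then show ?thesis
          unfolding ki kj using nz True by simp
      qed
    qed
  qed
  have finJ: "finite J"
    by (simp add: J_def)
  \<comment> \<open>Leaves room for the relative errors of both zeros in the pairs whose exponent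
    may be exactly 1.\<close>
  have "\<forall>\<^sub>F \<delta> in at_right (0::real). \<forall>i\<in>J. \<forall>j\<in>J. m i / m j < 1 \<longrightarrow> m i / m j * ((1 + \<delta>) / (1 - \<delta>)) < 1"
  proof (intro eventually_ball_finite finJ ballI)
    fix i j
    have "((\<lambda>\<delta>::real. m i / m j * ((1 + \<delta>) / (1 - \<delta>))) \<longlongrightarrow> m i / m j * ((1 + 0) / (1 - 0))) (at_right 0)"
      by (intro tendsto_intros) auto
    then have "((\<lambda>\<delta>::real. m i / m j * ((1 + \<delta>) / (1 - \<delta>))) \<longlongrightarrow> m i / m j) (at_right 0)"
      by simp
    then show "\<forall>\<^sub>F \<delta> in at_right (0::real). m i / m j < 1 \<longrightarrow> m i / m j * ((1 + \<delta>) / (1 - \<delta>)) < 1"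
      by (cases "m i / m j < 1") (auto elim: order_tendstoD)
  qed
  moreover have "\<forall>\<^sub>F \<delta> in at_right (0::real). \<delta> \<in> {0<..<1}"
    by (intro eventually_at_rightI) auto
  ultimately have "\<forall>\<^sub>F \<delta> in at_right (0::real). \<delta> \<in> {0<..<1} \<and>
      (\<forall>i\<in>J. \<forall>j\<in>J. m i / m j < 1 \<longrightarrow> m i / m j * ((1 + \<delta>) / (1 - \<delta>)) < 1)"
    by eventually_elim blast
  from eventually_happens'[OF trivial_limit_at_right_real this]
  obtain \<delta> where \<delta>: "0 < \<delta>" "\<delta> < 1"
    "\<And>i j. i \<in> J \<Longrightarrow> j \<in> J \<Longrightarrow> m i / m j < 1 \<Longrightarrow> m i / m j * ((1 + \<delta>) / (1 - \<delta>)) < 1"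
    by auto
  have ev_sign: "\<forall>\<^sub>F s in at_right 0. \<forall>j\<in>J. poly (lift s n a) (m j * s powr - \<kappa> j * (1 - \<delta>)) *
      poly (lift s n a) (m j * s powr - \<kappa> j * (1 + \<delta>)) < 0"
  proof (intro eventually_ball_finite finJ ballI)
    fix j assume j: "j \<in> J"
    note B = base[OF j]
    have h12: "h j = 1 \<or> h j = 2"
      by (simp add: h_def)
    let ?L = "\<lambda>c. c ^ b j * (a (b j) + a (b j + h j) * c ^ h j)"
    let ?g = "\<lambda>s c. s powr (\<kappa> j * real (b j) - real (tri (b j))) * poly (lift s n a) (c * s powr - \<kappa> j)"
    have lim: "((\<lambda>s. ?g s c) \<longlongrightarrow> ?L c) (at_right 0)" for c
      unfolding \<kappa>_def using lift_asymp[OF h12, of "b j" n a c] B by blast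
    have L: "?L (m j * t) = (m j ^ b j * a (b j)) * (t ^ b j * (1 - t ^ h j))" for t
    proof -
      have "a (b j + h j) * (m j * t) ^ h j = - a (b j) * t ^ h j"
        using B by (simp add: power_mult_distrib)
      then show ?thesis
        by (simp add: power_mult_distrib algebra_simps)
    qed
    have "?L (m j * (1 - \<delta>)) * ?L (m j * (1 + \<delta>)) =
        ((m j ^ b j * a (b j))\<^sup>2 * (1 - \<delta>) ^ b j * (1 + \<delta>) ^ b j) *
          ((1 - (1 - \<delta>) ^ h j) * (1 - (1 + \<delta>) ^ h j))"
      unfolding L by (simp add: power2_eq_square mult_ac)
    also have "\<dots> < 0"
    proof (rule mult_pos_neg)
      have "(m j ^ b j * a (b j))\<^sup>2 > 0"
        using B by simp
      then show "(m j ^ b j * a (b j))\<^sup>2 * (1 - \<delta>) ^ b j * (1 + \<delta>) ^ b j > 0"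
        by (rule mult_pos_pos[OF mult_pos_pos[OF _ zero_less_power] zero_less_power])
          (use \<delta>(1,2) in simp_all)
      have "(1 - \<delta>) ^ h j < 1" "(1 + \<delta>) ^ h j > 1"
        using \<delta>(1,2) h12 by (auto intro!: power_less_one_iff[THEN iffD2] one_less_power)
      then show "(1 - (1 - \<delta>) ^ h j) * (1 - (1 + \<delta>) ^ h j) < 0"
        by (intro mult_pos_neg) auto
    qed
    finally have Lneg: "?L (m j * (1 - \<delta>)) * ?L (m j * (1 + \<delta>)) < 0" .
    have "\<forall>\<^sub>F s in at_right 0. ?g s (m j * (1 - \<delta>)) * ?g s (m j * (1 + \<delta>)) < 0"
      by (rule order_tendstoD(2)[OF tendsto_mult[OF lim lim] Lneg])
    then show "\<forall>\<^sub>F s in at_right 0. poly (lift s n a) (m j * s powr - \<kappa> j * (1 - \<delta>)) *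
        poly (lift s n a) (m j * s powr - \<kappa> j * (1 + \<delta>)) < 0"
      using eventually_at_right_less[of "0::real"]
    proof eventually_elim
      case (elim s)
      let ?p = "s powr (\<kappa> j * real (b j) - real (tri (b j)))"
      let ?u = "poly (lift s n a) (m j * s powr - \<kappa> j * (1 - \<delta>))"
      let ?v = "poly (lift s n a) (m j * s powr - \<kappa> j * (1 + \<delta>))"
      have "?p\<^sup>2 * (?u * ?v) < 0"
        using elim(1) by (simp add: power2_eq_square mult_ac)
      moreover have "?p\<^sup>2 > 0"
        using elim(2) by simp
      ultimately show ?case
        by (metis mult_less_0_iff not_less_iff_gr_or_eq)
    qed
  qed
  have ev_sep: "\<forall>\<^sub>F s in at_right 0. \<forall>i\<in>J. \<forall>j\<in>J. i < j \<and> m i * m j > 0 \<longrightarrow>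
      m i / m j * ((1 + \<delta>) / (1 - \<delta>)) * s powr (\<kappa> j - \<kappa> i - 1) < 1"
  proof (intro eventually_ball_finite finJ ballI)
    fix i j assume ij: "i \<in> J" "j \<in> J"
    show "\<forall>\<^sub>F s in at_right 0. i < j \<and> m i * m j > 0 \<longrightarrow>
        m i / m j * ((1 + \<delta>) / (1 - \<delta>)) * s powr (\<kappa> j - \<kappa> i - 1) < 1"
    proof (cases "i < j \<and> m i * m j > 0")
      case True
      then have o: "\<kappa> j - \<kappa> i \<ge> 1" "\<kappa> j - \<kappa> i > 1 \<or> m i / m j < 1"
        using order ij by blast+
      show ?thesis
      proof (cases "\<kappa> j - \<kappa> i > 1")
        case True
        have "((\<lambda>s. m i / m j * ((1 + \<delta>) / (1 - \<delta>)) * s powr (\<kappa> j - \<kappa> i - 1)) \<longlongrightarrow>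
            m i / m j * ((1 + \<delta>) / (1 - \<delta>)) * 0) (at_right 0)"
          using True by (intro tendsto_mult tendsto_const tendsto_powr_zero_right) simp
        then have "\<forall>\<^sub>F s in at_right 0. m i / m j * ((1 + \<delta>) / (1 - \<delta>)) * s powr (\<kappa> j - \<kappa> i - 1) < 1"
          by (rule order_tendstoD(2)) simp
        then show ?thesis
          by eventually_elim blast
      next
        case False
        then have "\<kappa> j - \<kappa> i - 1 = 0" "m i / m j < 1"
          using o by auto
        then have "m i / m j * ((1 + \<delta>) / (1 - \<delta>)) < 1"
          using \<delta>(3)[OF ij] by blast
        then show ?thesis
          unfolding \<open>\<kappa> j - \<kappa> i - 1 = 0\<close>
          using eventually_at_right_less[of "0::real"] by (auto elim!: eventually_mono)
      qed
    qed auto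
  qed
  have "\<forall>\<^sub>F s in at_right (0::real). s \<in> {0<..<1}"
    by (intro eventually_at_rightI) auto
  with ev_sign ev_sep have "\<forall>\<^sub>F s in at_right 0. s \<in> {0<..<1} \<and>
      (\<forall>j\<in>J. poly (lift s n a) (m j * s powr - \<kappa> j * (1 - \<delta>)) *
        poly (lift s n a) (m j * s powr - \<kappa> j * (1 + \<delta>)) < 0) \<and>
      (\<forall>i\<in>J. \<forall>j\<in>J. i < j \<and> m i * m j > 0 \<longrightarrow>
        m i / m j * ((1 + \<delta>) / (1 - \<delta>)) * s powr (\<kappa> j - \<kappa> i - 1) < 1)"
    by eventually_elim blast
  from eventually_happens'[OF trivial_limit_at_right_real this]
  obtain s where s: "0 < s" "s < 1"
    and sign: "\<And>j. j \<in> J \<Longrightarrow> poly (lift s n a) (m j * s powr - \<kappa> j * (1 - \<delta>)) *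
        poly (lift s n a) (m j * s powr - \<kappa> j * (1 + \<delta>)) < 0"
    and sep: "\<And>i j. i \<in> J \<Longrightarrow> j \<in> J \<Longrightarrow> i < j \<Longrightarrow> m i * m j > 0 \<Longrightarrow>
        m i / m j * ((1 + \<delta>) / (1 - \<delta>)) * s powr (\<kappa> j - \<kappa> i - 1) < 1"
    by auto
  have "\<exists>t. \<bar>t\<bar> < \<delta> \<and> poly (lift s n a) (m j * s powr - \<kappa> j * (1 + t)) = 0" if j: "j \<in> J" for j
    by (rule root_near_if_sign_change[OF _ \<delta>(1) sign[OF j]]) (use base[OF j] s in auto)
  then obtain t where t: "\<And>j. j \<in> J \<Longrightarrow> \<bar>t j\<bar> < \<delta>"
    "\<And>j. j \<in> J \<Longrightarrow> poly (lift s n a) (m j * s powr - \<kappa> j * (1 + t j)) = 0"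
    by metis
  define \<rho> where "\<rho> j = m j * s powr - \<kappa> j * (1 + t j)" for j
  have t1: "1 + t j > 0" "1 - \<delta> \<le> 1 + t j" "1 + t j \<le> 1 + \<delta>" if "j \<in> J" for j
    using t(1)[OF that] \<delta> by auto
  have \<rho>0: "\<rho> j \<noteq> 0" if "j \<in> J" for j
    using base[OF that] s t1(1)[OF that] by (simp add: \<rho>_def)
  have ratio: "\<rho> i / \<rho> j < s" if ij: "i \<in> J" "j \<in> J" "i < j" for i j
  proof -
    let ?u = "(1 + t i) / (1 + t j)"
    have eq: "\<rho> i / \<rho> j = m i / m j * ?u * s powr (\<kappa> j - \<kappa> i)"
      using s by (simp add: \<rho>_def powr_diff powr_minus field_simps)
    have u: "0 < ?u" "?u \<le> (1 + \<delta>) / (1 - \<delta>)"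
      using t1[OF ij(1)] t1[OF ij(2)] \<delta> by (auto intro!: frac_le)
    show ?thesis
    proof (cases "m i * m j > 0")
      case True
      then have mm: "m i / m j > 0"
        by (auto simp: zero_less_mult_iff zero_less_divide_iff)
      have "m i / m j * ?u * s powr (\<kappa> j - \<kappa> i - 1) \<le>
          m i / m j * ((1 + \<delta>) / (1 - \<delta>)) * s powr (\<kappa> j - \<kappa> i - 1)"
        using mm u s by (intro mult_right_mono mult_left_mono) auto
      also have "\<dots> < 1"
        by (rule sep[OF ij True])
      finally have "s * (m i / m j * ?u * s powr (\<kappa> j - \<kappa> i - 1)) < s * 1"
        using s by (intro mult_strict_left_mono)
      moreover have "s powr (\<kappa> j - \<kappa> i) = s * s powr (\<kappa> j - \<kappa> i - 1)"
        using s by (simp add: powr_diff)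
      ultimately show ?thesis
        unfolding eq by (simp add: mult_ac)
    next
      case False
      then have "m i / m j \<le> 0"
        by (auto simp: zero_less_mult_iff divide_le_0_iff not_less)
      then have "\<rho> i / \<rho> j \<le> 0"
        unfolding eq using u s by (intro mult_nonpos_nonneg) (auto simp: mult_nonpos_nonneg)
      then show ?thesis
        using s by simp
    qed
  qed
  have "sep s (lift s n a)"
  proof (rule sep_by_count[of _ d l J \<rho>])
    have "coeff (lift s n a) d \<noteq> 0"
      using coeff_R_poly_pos[OF s(1) d(2)] d(1) by simp
    then show "lift s n a \<noteq> 0"
      by (metis coeff_0)
    show "degree (lift s n a) \<le> d"
    proof (rule degree_le, intro allI impI)
      show "coeff (lift s n a) k = 0" if "d < k" for k
        using d(3)[OF that] by (cases "k \<le> n") (auto simp: coeff_R_poly_gt)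
    qed
    show "coeff (lift s n a) k = 0" if "k < l" for k
      using l(2)[OF that] by (cases "k \<le> n") (auto simp: coeff_R_poly_gt)
    show "d \<le> l + card J"
      by (simp add: J_def)
    show "\<rho> j \<noteq> 0 \<and> poly (lift s n a) (\<rho> j) = 0" if "j \<in> J" for j
      using \<rho>0[OF that] t(2)[OF that] by (simp add: \<rho>_def)
    show "\<not> \<rho> i / \<rho> j \<le> 1" if ij: "i \<in> J" "j \<in> J" "i \<noteq> j" "s \<le> \<rho> i / \<rho> j" for i j
    proof (cases "i < j")
      case True
      then show ?thesis
        using ratio[OF ij(1,2)] ij(4) by simp
    next
      case False
      then have "\<rho> j / \<rho> i < s"
        using ratio[OF ij(2,1)] ij(3) by simp
      then have "\<rho> j / \<rho> i < 1"
        using s by simp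
      moreover have "\<rho> i / \<rho> j > 0"
        using ij(4) s by simp
      moreover have "\<rho> j / \<rho> i = 1 / (\<rho> i / \<rho> j)"
        by simp
      ultimately have "1 < \<rho> i / \<rho> j"
        by (simp only: divide_less_eq_1_pos)
      then show ?thesis
        by simp
    qed
  qed (use finJ s in auto)
  then show ?thesis
    using that[of s] s by (simp add: PRs_def)
qed

subsection \<open>Classes of power series\<close>

lemma order_Suc_lin_quot:
  assumes "poly p x = 0" "p \<noteq> 0"
  shows "order x p = Suc (order x (lin_quot p x))"
proof -
  have eq: "p = [:- x, 1:] * lin_quot p x"
    by (rule lin_quot_eq[OF assms(1)])
  have "[:- x, 1:] * lin_quot p x \<noteq> 0"
    using lin_quot_nonzero[OF assms] by (simp del: mult_pCons_left)
  then have "order x ([:- x, 1:] * lin_quot p x) = order x [:- x, 1:] + order x (lin_quot p x)"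
    by (rule order_mult)
  moreover have "order x [:- x, 1:] = 1"
    using order_power_n_n[of x 1] by simp
  moreover have "order x p = order x ([:- x, 1:] * lin_quot p x)"
    using eq by (rule arg_cong)
  ultimately show ?thesis
    by simp
qed

lemma order_le_1_iff:
  fixes p :: "real poly"
  assumes "poly p x = 0" "p \<noteq> 0"
  shows "order x p \<le> 1 \<longleftrightarrow> poly (pderiv p) x \<noteq> 0"
  using order_Suc_lin_quot[OF assms] order_root[of "lin_quot p x" x] lin_quot_nonzero[OF assms]
    poly_pderiv_eq_lin_quot[OF assms(1)] by auto

lemma card_indices_order:
  fixes p :: "real poly"
  assumes "mset xs = proots p" "p \<noteq> 0"
  shows "card {i. i < length xs \<and> xs ! i = x} = order x p"
proof -
  have "order x p = count (mset xs) x"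
    using assms by simp
  also have "\<dots> = length (filter (\<lambda>y. y = x) xs)"
    by (auto simp: count_mset count_list_eq_length_filter intro!: arg_cong[of _ _ length] filter_cong)
  also have "\<dots> = card {i. i < length xs \<and> xs ! i = x}"
    by (rule length_filter_conv_card)
  finally show ?thesis
    by simp
qed

text \<open>In the list of zeros a repeated nonzero zero is a pair of indices with ratio 1, which is
  not below q; so strict separation contains simplicity off the origin. Zeros at the origin meet
  neither sign condition and may repeat.\<close>

lemma strictly_separated_iff_sep:
  assumes q: "0 < q" "q \<le> 1" and p0: "p \<noteq> 0" and xs: "mset xs = proots p"
  shows "(\<forall>z. poly (map_poly complex_of_real p) z = 0 \<longrightarrow> z \<in> \<real>) \<and>
    strictly_separated q {..<length xs} (nth xs) \<longleftrightarrow> sep q p"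
proof -
  have set_xs: "set xs = {x. poly p x = 0}"
    using set_mset_mset[of xs] p0 unfolding xs by simp
  have root: "poly p (xs ! k) = 0" if "k < length xs" for k
    using nth_mem[OF that] set_xs by auto
  show ?thesis
  proof
    assume h: "(\<forall>z. poly (map_poly complex_of_real p) z = 0 \<longrightarrow> z \<in> \<real>) \<and>
      strictly_separated q {..<length xs} (nth xs)"
    have S: "xs ! k / xs ! l < q" if "k < length xs" "l < length xs" "k \<noteq> l"
      "(xs ! l \<le> xs ! k \<and> xs ! k < 0) \<or> (0 < xs ! k \<and> xs ! k \<le> xs ! l)" for k l
      using h that unfolding strictly_separated_def by blast
    have "poly (pderiv p) x \<noteq> 0" if x: "x \<noteq> 0" "poly p x = 0" for x
    proof (rule ccontr)
      assume "\<not> poly (pderiv p) x \<noteq> 0"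
      then have "2 \<le> card {i. i < length xs \<and> xs ! i = x}"
        using order_le_1_iff[OF x(2) p0] card_indices_order[OF xs p0, of x] by simp
      then obtain T where T: "T \<subseteq> {i. i < length xs \<and> xs ! i = x}" "card T = 2"
        by (meson obtain_subset_with_card_n)
      then obtain k l where "k \<noteq> l" "T = {k, l}"
        by (auto simp: card_2_iff)
      then have "k < length xs" "l < length xs" "xs ! k = x" "xs ! l = x"
        using T by auto
      moreover have "x < 0 \<or> 0 < x"
        using x(1) by linarith
      ultimately have "x / x < q"
        using S[of k l] \<open>k \<noteq> l\<close> by auto
      then show False
        using x(1) q by simp
    qed
    moreover have "\<not> y / x \<le> 1"
      if xy: "poly p x = 0" "poly p y = 0" "x \<noteq> 0" "y \<noteq> x" "q \<le> y / x" for x y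
    proof
      assume le: "y / x \<le> 1"
      have pos: "y / x > 0"
        using xy(5) q by simp
      have "x \<in> set xs" "y \<in> set xs"
        using xy(1,2) by (simp_all add: set_xs)
      then obtain k l where kl: "k < length xs" "xs ! k = y" "l < length xs" "xs ! l = x"
        unfolding in_set_conv_nth by blast
      have "(x \<le> y \<and> y < 0) \<or> (0 < y \<and> y \<le> x)"
        using pos le xy(3) by (auto simp: zero_less_divide_iff divide_le_eq)
      then have "y / x < q"
        using S[OF kl(1,3)] kl xy(4) by auto
      then show False
        using xy(5) by simp
    qed
    ultimately show "sep q p"
      using h p0 unfolding sep_def real_simple_def cpoly_def by blast
  next
    assume s: "sep q p"
    have "xs ! k / xs ! l < q"
      if kl: "k < length xs" "l < length xs" "k \<noteq> l"
        "(xs ! l \<le> xs ! k \<and> xs ! k < 0) \<or> (0 < xs ! k \<and> xs ! k \<le> xs ! l)" for k l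
    proof (rule ccontr)
      assume "\<not> xs ! k / xs ! l < q"
      then have ge: "q \<le> xs ! k / xs ! l"
        by simp
      have nz: "xs ! l \<noteq> 0"
        using kl(4) by auto
      show False
      proof (cases "xs ! k = xs ! l")
        case True
        have "{k, l} \<subseteq> {i. i < length xs \<and> xs ! i = xs ! l}"
          using kl True by auto
        then have "2 \<le> order (xs ! l) p"
          using card_mono[of "{i. i < length xs \<and> xs ! i = xs ! l}" "{k, l}"] kl(3)
            card_indices_order[OF xs p0, of "xs ! l"] by simp
        then show ?thesis
          using order_le_1_iff[OF root[OF kl(2)] p0] s nz root[OF kl(2)]
          unfolding sep_def real_simple_def by force
      next
        case False
        have "xs ! k / xs ! l \<le> 1"
          using kl(4) by (auto simp: divide_le_eq)
        then show ?thesis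
          using s root[OF kl(1)] root[OF kl(2)] nz False ge unfolding sep_def by blast
      qed
    qed
    then show "(\<forall>z. poly (map_poly complex_of_real p) z = 0 \<longrightarrow> z \<in> \<real>) \<and>
        strictly_separated q {..<length xs} (nth xs)"
      using s unfolding strictly_separated_def sep_def real_simple_def cpoly_def by blast
  qed
qed

lemma real_sep_polys_iff:
  assumes q: "0 < q" "q \<le> 1"
  shows "p \<in> real_sep_polys n q \<longleftrightarrow> p = 0 \<or> sep q p \<and> degree p \<le> n"
proof (cases "p = 0")
  case False
  obtain xs where "mset xs = proots p"
    using ex_mset by blast
  then show ?thesis
    using strictly_separated_iff_sep[OF q False] False unfolding real_sep_polys_def by auto
qed (simp add: real_sep_polys_def)

section \<open>The classes of the theorem in terms of real sequences\<close>

definition seq_fps :: "nat \<Rightarrow> (nat \<Rightarrow> real) \<Rightarrow> complex fps"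
  where "seq_fps n a = Abs_fps (\<lambda>k. if k \<le> n then complex_of_real (a k) else 0)"

lemma nth_seq_fps [simp]: "fps_nth (seq_fps n a) k = (if k \<le> n then complex_of_real (a k) else 0)"
  by (simp add: seq_fps_def)

lemma nth_rfps [simp]: "fps_nth (rfps p) k = complex_of_real (coeff p k)"
  by (simp add: rfps_def coeff_map_poly)

lemma nth_hadamard [simp]: "fps_nth (f \<star> g) k = fps_nth f k * fps_nth g k"
  by (simp add: hadamard_def)

lemma seq_fps_hadamard: "seq_fps n a \<star> seq_fps n b = seq_fps n (\<lambda>k. a k * b k)"
  by (rule fps_ext) simp

lemma seq_fps_eq_iff: "seq_fps n a = seq_fps n b \<longleftrightarrow> (\<forall>k\<le>n. a k = b k)"
  by (auto simp: fps_eq_iff)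

lemma rfps_eq_seq_fps: "degree p \<le> n \<Longrightarrow> rfps p = seq_fps n (coeff p)"
  by (rule fps_ext) (simp add: coeff_eq_0)

lemma fps_deg_R_poly:
  assumes "0 < q"
  shows "fps_deg (rfps (R_poly n q)) = ereal (real n)"
proof (rule antisym)
  show "fps_deg (rfps (R_poly n q)) \<le> ereal (real n)"
    by (simp add: fps_deg_le_iff coeff_R_poly_gt)
  show "ereal (real n) \<le> fps_deg (rfps (R_poly n q))"
    unfolding fps_deg_def using coeff_R_poly_pos[OF assms, of n n] by (intro SUP_upper) simp
qed

definition same_sign :: "nat \<Rightarrow> (nat \<Rightarrow> real) \<Rightarrow> bool"
  where "same_sign n a \<longleftrightarrow> (\<forall>k\<le>n. 0 \<le> a k) \<or> (\<forall>k\<le>n. a k \<le> 0)"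

text \<open>Turns the condition on zeros into a sign condition on coefficients. That condition is
  inherited by the sequence, because the coefficients of R_n(q) are positive, and it passes to
  limits.\<close>

lemma sep_roots_nonpos_iff:
  assumes p: "sep q p" "degree p \<le> n"
  shows "(\<forall>x. poly p x = 0 \<longrightarrow> x \<le> 0) \<longleftrightarrow> same_sign n (coeff p)"
proof -
  have p0: "p \<noteq> 0"
    using p(1) by (rule sep_nonzero)
  have *: "(\<forall>x. poly p x = 0 \<longrightarrow> x \<le> 0) \<longleftrightarrow> same_sign n (coeff p)"
    if p: "sep q p" "degree p \<le> n" and lc: "lead_coeff p > 0" for p
  proof
    assume "\<forall>x. poly p x = 0 \<longrightarrow> x \<le> 0"
    then show "same_sign n (coeff p)"
      using coeffs_nonneg[OF sep_nonzero[OF p(1)] sep_real[OF p(1)] _ lc] by (auto simp: same_sign_def)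
  next
    assume s: "same_sign n (coeff p)"
    then have "0 \<le> coeff p k" if "k \<le> n" for k
      using lc p(2) that unfolding same_sign_def by (meson not_le)
    then have "0 \<le> coeff p k" for k
      using p(2) by (cases "k \<le> n") (auto simp: coeff_eq_0)
    then show "\<forall>x. poly p x = 0 \<longrightarrow> x \<le> 0"
      using root_nonpos sep_nonzero[OF p(1)] by blast
  qed
  show ?thesis
  proof (cases "lead_coeff p > 0")
    case False
    then have "lead_coeff (- p) > 0"
      using p0 by (simp add: order_less_le)
    moreover have "sep q (- p)"
      using p(1) sep_smult[of "- 1" q p] by simp
    moreover have "same_sign n (coeff (- p)) \<longleftrightarrow> same_sign n (coeff p)"
      by (auto simp: same_sign_def)
    ultimately show ?thesis
      using *[of "- p"] p(2) by simp
  qed (use * p in blast)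
qed

lemma precoeff_R_class:
  assumes q: "0 < q" "q \<le> 1"
  shows "precoeff_class (R_class n q) (rfps (R_poly n q)) = seq_fps n ` {a. PRs q n a}"
proof (intro equalityI subsetI)
  fix f assume "f \<in> precoeff_class (R_class n q) (rfps (R_poly n q))"
  then have deg: "\<forall>k>n. fps_nth f k = 0" and "f \<star> rfps (R_poly n q) \<in> R_class n q"
    by (auto simp: precoeff_class_def fps_deg_R_poly[OF q(1)] fps_deg_le_iff)
  then obtain p where p: "f \<star> rfps (R_poly n q) = rfps p" "p = 0 \<or> sep q p \<and> degree p \<le> n"
    by (auto simp: R_class_def real_sep_polys_iff[OF q])
  then have "degree p \<le> n"
    by auto
  then obtain a where a: "p = lift q n a"
    by (rule ex_lift[OF q(1)])
  have "f = seq_fps n a"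
  proof (rule fps_ext)
    fix k
    have "fps_nth f k * of_real (coeff (R_poly n q) k) = of_real (coeff (R_poly n q) k * a k)"
      using arg_cong[OF p(1), of "\<lambda>f. fps_nth f k"] by (simp add: a)
    then show "fps_nth f k = fps_nth (seq_fps n a) k"
      using coeff_R_poly_pos[OF q(1), of k n] deg by (cases "k \<le> n") auto
  qed
  then show "f \<in> seq_fps n ` {a. PRs q n a}"
    using p(2) a by (auto simp: PRs_def)
next
  fix f assume "f \<in> seq_fps n ` {a. PRs q n a}"
  then obtain a where a: "f = seq_fps n a" "PRs q n a"
    by auto
  have "f \<star> rfps (R_poly n q) = rfps (lift q n a)"
    by (rule fps_ext) (simp add: a(1) coeff_R_poly_gt)
  then show "f \<in> precoeff_class (R_class n q) (rfps (R_poly n q))"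
    using a degree_lift_le[of q n a]
    by (auto simp: precoeff_class_def fps_deg_R_poly[OF q(1)] fps_deg_le_iff R_class_def
        real_sep_polys_iff[OF q] PRs_def)
qed

lemma same_sign_lift:
  assumes q: "0 < q"
  shows "same_sign n (coeff (lift q n a)) \<longleftrightarrow> same_sign n a"
proof -
  have "(0 \<le> coeff (lift q n a) k \<longleftrightarrow> 0 \<le> a k) \<and> (coeff (lift q n a) k \<le> 0 \<longleftrightarrow> a k \<le> 0)"
    if "k \<le> n" for k
    using coeff_R_poly_pos[OF q that] by (simp add: zero_le_mult_iff mult_le_0_iff not_le[symmetric])
  then show ?thesis
    unfolding same_sign_def by blast
qed

lemma precoeff_N_class:
  assumes q: "0 < q" "q \<le> 1"
  shows "precoeff_class (N_class n q) (rfps (R_poly n q)) = seq_fps n ` {a. PRs q n a \<and> same_sign n a}"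
proof (intro equalityI subsetI)
  fix f assume f: "f \<in> precoeff_class (N_class n q) (rfps (R_poly n q))"
  have "0 \<in> real_sep_polys n q"
    by (simp add: real_sep_polys_iff[OF q])
  then have "N_class n q \<subseteq> R_class n q"
    unfolding N_class_def R_class_def by (intro image_mono) auto
  then have "f \<in> precoeff_class (R_class n q) (rfps (R_poly n q))"
    using f by (auto simp: precoeff_class_def)
  then obtain a where a: "f = seq_fps n a" "PRs q n a"
    unfolding precoeff_R_class[OF q] by auto
  have eq: "f \<star> rfps (R_poly n q) = rfps (lift q n a)"
    by (rule fps_ext) (simp add: a(1) coeff_R_poly_gt)
  then obtain p where p: "rfps (lift q n a) = rfps p" "p = 0 \<or> sep q p \<and> degree p \<le> n \<and> (\<forall>x. poly p x = 0 \<longrightarrow> x \<le> 0)"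
    using f by (auto simp: precoeff_class_def N_class_def real_sep_polys_iff[OF q])
  have "coeff (lift q n a) k = coeff p k" for k
    using arg_cong[OF p(1), of "\<lambda>f. fps_nth f k"] by (simp only: nth_rfps of_real_eq_iff)
  then have lp: "lift q n a = p"
    by (rule poly_eqI)
  have "same_sign n (coeff p)"
  proof (cases "p = 0")
    case False
    then show ?thesis
      using p(2) sep_roots_nonpos_iff by blast
  qed (simp add: same_sign_def)
  then have "same_sign n a"
    using same_sign_lift[OF q(1), of n a] lp by simp
  then show "f \<in> seq_fps n ` {a. PRs q n a \<and> same_sign n a}"
    using a by blast
next
  fix f assume "f \<in> seq_fps n ` {a. PRs q n a \<and> same_sign n a}"
  then obtain a where a: "f = seq_fps n a" "PRs q n a" "same_sign n a"
    by auto
  have eq: "f \<star> rfps (R_poly n q) = rfps (lift q n a)"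
    by (rule fps_ext) (simp add: a(1) coeff_R_poly_gt)
  have "lift q n a = 0 \<or> lift q n a \<in> real_sep_polys n q \<and> (\<forall>x. poly (lift q n a) x = 0 \<longrightarrow> x \<le> 0)"
    using a(2,3) sep_roots_nonpos_iff[OF _ degree_lift_le] same_sign_lift[OF q(1), of n a] degree_lift_le
    unfolding PRs_def real_sep_polys_iff[OF q] by blast
  then have "rfps (lift q n a) \<in> N_class n q"
    unfolding N_class_def by (intro imageI) auto
  then show "f \<in> precoeff_class (N_class n q) (rfps (R_poly n q))"
    using eq a(1) by (simp add: precoeff_class_def fps_deg_R_poly[OF q(1)] fps_deg_le_iff)
qed

text \<open>Puts q = 0 on the same footing: the union over all s in (0, 1] is represented by
  log-concavity, so that limits and products can be taken without following s.\<close>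

definition PRq :: "real \<Rightarrow> nat \<Rightarrow> (nat \<Rightarrow> real) \<Rightarrow> bool"
  where "PRq q n a \<longleftrightarrow> (if q = 0 then LCs n a else PRs q n a)"

lemma LCs_iff_PRs: "LCs n a \<longleftrightarrow> (\<exists>s\<in>{0<..1}. PRs s n a)"
  by (meson LCs_imp_PRs PRs_imp_LCs greaterThanAtMost_iff)

lemma PR_class_eq:
  assumes "0 \<le> q" "q \<le> 1"
  shows "PR_class n q = seq_fps n ` {a. PRq q n a}"
proof (cases "q = 0")
  case True
  have "PR_class n 0 = (\<Union>s\<in>{0<..1}. seq_fps n ` {a. PRs s n a})"
    unfolding PR_class_def using precoeff_R_class by simp
  also have "\<dots> = seq_fps n ` {a. LCs n a}"
    unfolding LCs_iff_PRs by blast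
  finally show ?thesis
    using True by (simp add: PRq_def)
qed (use assms precoeff_R_class[of q n] in \<open>simp add: PR_class_def PRq_def\<close>)

lemma PN_class_eq:
  assumes "0 \<le> q" "q \<le> 1"
  shows "PN_class n q = seq_fps n ` {a. PRq q n a \<and> same_sign n a}"
proof (cases "q = 0")
  case True
  have "PN_class n 0 = (\<Union>s\<in>{0<..1}. seq_fps n ` {a. PRs s n a \<and> same_sign n a})"
    unfolding PN_class_def using precoeff_N_class by simp
  also have "\<dots> = seq_fps n ` {a. LCs n a \<and> same_sign n a}"
    unfolding LCs_iff_PRs by blast
  finally show ?thesis
    using True by (simp add: PRq_def)
qed (use assms precoeff_N_class[of q n] in \<open>simp add: PN_class_def PRq_def\<close>)

text \<open>At the indices 0 and n one outer coefficient is 0, and the condition on l and m makes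
  the middle one nonzero, so the inequality holds there by itself; this is why \<open>LCs\<close>
  speaks of interior indices only.\<close>

lemma log_concave_polys_iff:
  assumes "1 \<le> n"
  shows "p \<in> log_concave_polys n \<longleftrightarrow> degree p \<le> n \<and> LCs n (coeff p)"
proof -
  have icoeff_nat: "icoeff p (int k) = coeff p k" for k
    by (simp add: icoeff_def)
  have hull: "(\<exists>l\<le>int k. icoeff p l \<noteq> 0) \<longleftrightarrow> (\<exists>l\<le>k. coeff p l \<noteq> 0)"
    "(\<exists>m\<ge>int k. icoeff p m \<noteq> 0) \<longleftrightarrow> (\<exists>m\<ge>k. coeff p m \<noteq> 0)" for k
  proof -
    have "\<exists>i\<le>k. coeff p i \<noteq> 0" if "l \<le> int k" "icoeff p l \<noteq> 0" for l
      using that by (intro exI[of _ "nat l"]) (auto simp: icoeff_def split: if_splits)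
    moreover have "\<exists>l\<le>int k. icoeff p l \<noteq> 0" if "i \<le> k" "coeff p i \<noteq> 0" for i
      using that by (intro exI[of _ "int i"]) (auto simp: icoeff_nat)
    ultimately show "(\<exists>l\<le>int k. icoeff p l \<noteq> 0) \<longleftrightarrow> (\<exists>l\<le>k. coeff p l \<noteq> 0)"
      by blast
    have "\<exists>i\<ge>k. coeff p i \<noteq> 0" if "l \<ge> int k" "icoeff p l \<noteq> 0" for l
      using that by (intro exI[of _ "nat l"]) (auto simp: icoeff_def split: if_splits)
    moreover have "\<exists>l\<ge>int k. icoeff p l \<noteq> 0" if "i \<ge> k" "coeff p i \<noteq> 0" for i
      using that by (intro exI[of _ "int i"]) (auto simp: icoeff_nat)
    ultimately show "(\<exists>m\<ge>int k. icoeff p m \<noteq> 0) \<longleftrightarrow> (\<exists>m\<ge>k. coeff p m \<noteq> 0)"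
      by blast
  qed
  have "(\<forall>k\<in>{0..int n}. (\<exists>l\<le>k. icoeff p l \<noteq> 0) \<and> (\<exists>m\<ge>k. icoeff p m \<noteq> 0) \<longrightarrow>
      icoeff p (k - 1) * icoeff p (k + 1) < (icoeff p k)\<^sup>2) \<longleftrightarrow>
    (\<forall>k\<le>n. (\<exists>l\<le>k. coeff p l \<noteq> 0) \<and> (\<exists>m\<ge>k. coeff p m \<noteq> 0) \<longrightarrow>
      icoeff p (int k - 1) * icoeff p (int k + 1) < (coeff p k)\<^sup>2)" (is "?A \<longleftrightarrow> ?B")
  proof
    assume A: ?A
    show ?B
    proof (intro allI impI)
      fix k assume "k \<le> n" "(\<exists>l\<le>k. coeff p l \<noteq> 0) \<and> (\<exists>m\<ge>k. coeff p m \<noteq> 0)"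
      then show "icoeff p (int k - 1) * icoeff p (int k + 1) < (coeff p k)\<^sup>2"
        using A[rule_format, of "int k"] hull[of k] by (simp add: icoeff_nat)
    qed
  next
    assume B: ?B
    show ?A
    proof (intro ballI impI)
      fix k assume k: "k \<in> {0..int n}" "(\<exists>l\<le>k. icoeff p l \<noteq> 0) \<and> (\<exists>m\<ge>k. icoeff p m \<noteq> 0)"
      define j where "j = nat k"
      have j: "k = int j" "j \<le> n"
        using k(1) by (auto simp: j_def)
      show "icoeff p (k - 1) * icoeff p (k + 1) < (icoeff p k)\<^sup>2"
        using B[rule_format, of j] k(2) hull[of j] j by (simp add: icoeff_nat)
    qed
  qed
  also have "\<dots> \<longleftrightarrow> LCs n (coeff p)" if deg: "degree p \<le> n"
  proof
    assume B: ?B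
    show "LCs n (coeff p)"
      unfolding LCs_def
    proof (intro allI impI)
      fix k l m assume h: "l \<le> k \<and> k \<le> m \<and> m \<le> n \<and> coeff p l \<noteq> 0 \<and> coeff p m \<noteq> 0 \<and> 0 < k \<and> k < n"
      then have "int k - 1 = int (k - 1)" "int k + 1 = int (k + 1)"
        by auto
      then show "coeff p (k - 1) * coeff p (k + 1) < (coeff p k)\<^sup>2"
        using B[rule_format, of k] h by (metis icoeff_nat less_imp_le_nat)
    qed
  next
    assume L: "LCs n (coeff p)"
    show ?B
    proof (intro allI impI, elim conjE exE)
      fix k l m assume h: "k \<le> n" "l \<le> k" "coeff p l \<noteq> 0" "k \<le> m" "coeff p m \<noteq> 0"
      have m: "m \<le> n"
        using h(5) deg le_degree[of p m] by simp
      consider "k = 0" | "k = n" | "0 < k" "k < n"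
        using h(1) by linarith
      then show "icoeff p (int k - 1) * icoeff p (int k + 1) < (coeff p k)\<^sup>2"
      proof cases
        case 1
        then show ?thesis
          using h by (simp add: icoeff_def)
      next
        case 2
        then have "m = n"
          using h m by simp
        then show ?thesis
          using 2 h deg by (simp add: icoeff_def coeff_eq_0)
      next
        case 3
        then have "int k - 1 = int (k - 1)" "int k + 1 = int (k + 1)"
          by auto
        then show ?thesis
          using L[unfolded LCs_def, rule_format, of l k m] h m 3 by (metis icoeff_nat)
      qed
    qed
  qed
  finally show ?thesis
    unfolding log_concave_polys_def by auto
qed

lemma LCs_cong: "(\<And>k. k \<le> n \<Longrightarrow> a k = b k) \<Longrightarrow> LCs n a \<longleftrightarrow> LCs n b"
  unfolding LCs_iff_PRs using PRs_cong by blast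

lemma ex_poly_coeff:
  obtains p :: "real poly" where "degree p \<le> n" "\<And>k. k \<le> n \<Longrightarrow> coeff p k = a k"
proof
  show "degree (\<Sum>k\<le>n. monom (a k) k) \<le> n"
    by (rule degree_le) (auto simp: coeff_sum)
  show "coeff (\<Sum>k\<le>n. monom (a k) k) k = a k" if "k \<le> n" for k
    using that by (simp add: coeff_sum)
qed

lemma LC_class_eq:
  assumes "1 \<le> n"
  shows "LC_class n = seq_fps n ` {a. LCs n a}"
    and "LC_plus_class n = seq_fps n ` {a. LCs n a \<and> same_sign n a}"
proof -
  have sgn: "(\<forall>k. coeff p k \<ge> 0) \<or> (\<forall>k. coeff p k \<le> 0) \<longleftrightarrow> same_sign n (coeff p)"
    if "degree p \<le> n" for p :: "real poly"
    using that unfolding same_sign_def by (metis coeff_eq_0 le_less_trans not_le order_refl)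
  have ex: "\<exists>p. degree p \<le> n \<and> seq_fps n a = rfps p \<and> (LCs n a \<longleftrightarrow> LCs n (coeff p)) \<and>
      (same_sign n a \<longleftrightarrow> same_sign n (coeff p))" for a
  proof -
    obtain p :: "real poly" where p: "degree p \<le> n" "\<And>k. k \<le> n \<Longrightarrow> coeff p k = a k"
      using ex_poly_coeff by blast
    have "LCs n a \<longleftrightarrow> LCs n (coeff p)"
      using p(2) by (intro LCs_cong) simp
    moreover have "same_sign n a \<longleftrightarrow> same_sign n (coeff p)"
      using p(2) by (simp add: same_sign_def)
    moreover have "seq_fps n a = rfps p"
      unfolding rfps_eq_seq_fps[OF p(1)] seq_fps_eq_iff using p(2) by simp
    ultimately show ?thesis
      using p(1) by blast
  qed
  show "LC_class n = seq_fps n ` {a. LCs n a}"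
  proof (intro equalityI subsetI)
    fix f assume "f \<in> LC_class n"
    then obtain p where "f = rfps p" "degree p \<le> n" "LCs n (coeff p)"
      by (auto simp: LC_class_def log_concave_polys_iff[OF assms])
    then show "f \<in> seq_fps n ` {a. LCs n a}"
      using rfps_eq_seq_fps by blast
  next
    fix f assume "f \<in> seq_fps n ` {a. LCs n a}"
    then obtain a where a: "f = seq_fps n a" "LCs n a"
      by blast
    obtain p where "degree p \<le> n" "f = rfps p" "LCs n (coeff p)"
      using ex[of a] a by blast
    then show "f \<in> LC_class n"
      unfolding LC_class_def using log_concave_polys_iff[OF assms] by blast
  qed
  show "LC_plus_class n = seq_fps n ` {a. LCs n a \<and> same_sign n a}"
  proof (intro equalityI subsetI)
    fix f assume "f \<in> LC_plus_class n"
    then obtain p where p: "f = rfps p" "degree p \<le> n" "LCs n (coeff p)"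
      "(\<forall>k. coeff p k \<ge> 0) \<or> (\<forall>k. coeff p k \<le> 0)"
      by (auto simp: LC_plus_class_def log_concave_polys_iff[OF assms])
    then show "f \<in> seq_fps n ` {a. LCs n a \<and> same_sign n a}"
      using rfps_eq_seq_fps[OF p(2)] sgn[OF p(2)] by blast
  next
    fix f assume "f \<in> seq_fps n ` {a. LCs n a \<and> same_sign n a}"
    then obtain a where a: "f = seq_fps n a" "LCs n a" "same_sign n a"
      by blast
    obtain p where "degree p \<le> n" "f = rfps p" "LCs n (coeff p)" "same_sign n (coeff p)"
      using ex[of a] a by blast
    then show "f \<in> LC_plus_class n"
      unfolding LC_plus_class_def using log_concave_polys_iff[OF assms] sgn by blast
  qed
qed

subsection \<open>Multiplier classes\<close>

lemma PRs_neg: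
  assumes "PRs q n a"
  shows "PRs q n (\<lambda>k. - a k)"
proof -
  have "lift q n (\<lambda>k. - a k) = smult (- 1) (lift q n a)"
    by (rule poly_eqI) simp
  then show ?thesis
    using assms sep_smult[of "- 1" q "lift q n a"] by (simp add: PRs_def)
qed

lemma sep_reflect:
  assumes "sep q F"
  shows "sep q (hprod F (\<lambda>k. (- 1) ^ k))"
proof -
  let ?G = "hprod F (\<lambda>k. (- 1) ^ k)"
  have G: "?G = pcompose F [:0, - 1:]"
    by (simp add: poly_eq_poly_eq_iff[symmetric] fun_eq_iff poly_dilate poly_pcompose)
  have F0: "F \<noteq> 0"
    using assms by (rule sep_nonzero)
  have pG: "poly ?G x = poly F (- x)" for x
    by (simp add: poly_dilate)
  have "?G \<noteq> 0"
  proof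
    assume "?G = 0"
    then have "poly F (- x) = 0" for x
      using pG[of x] by simp
    then have "poly F x = 0" for x
      by (metis minus_minus)
    then show False
      using F0 by (simp add: poly_eq_poly_eq_iff[symmetric] fun_eq_iff)
  qed
  moreover have "z \<in> \<real>" if "cpoly ?G z = 0" for z
    using sep_real[OF assms, of "- z"] that by (simp add: cpoly_dilate)
  moreover have "poly (pderiv ?G) x \<noteq> 0" if "x \<noteq> 0" "poly ?G x = 0" for x
  proof -
    have "poly (pderiv F) (- x) \<noteq> 0"
      using assms that unfolding sep_def real_simple_def pG by (metis neg_equal_0_iff_equal)
    then show ?thesis
      unfolding G pderiv_pcompose by (simp add: poly_pcompose pderiv_pCons)
  qed
  ultimately have "real_simple ?G"
    unfolding real_simple_def by blast
  moreover have "\<not> y / x \<le> 1"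
    if "poly ?G x = 0" "poly ?G y = 0" "x \<noteq> 0" "y \<noteq> x" "q \<le> y / x" for x y
  proof -
    have "poly F (- x) = 0" "poly F (- y) = 0" "- x \<noteq> 0" "- y \<noteq> - x" "q \<le> (- y) / (- x)"
      using that by (simp_all add: poly_dilate)
    then have "\<not> (- y) / (- x) \<le> 1"
      using assms unfolding sep_def by blast
    then show ?thesis
      by simp
  qed
  ultimately show ?thesis
    unfolding sep_def by blast
qed

lemma PRs_alternate:
  assumes "PRs q n a"
  shows "PRs q n (\<lambda>k. (- 1) ^ k * a k)"
proof -
  have "lift q n (\<lambda>k. (- 1) ^ k * a k) = hprod (lift q n a) (\<lambda>k. (- 1) ^ k)"
    by (rule poly_eqI) simp
  then show ?thesis
    using assms sep_reflect[of q "lift q n a"] by (auto simp: PRs_def)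
qed

lemma PRq_cong: "(\<And>k. k \<le> n \<Longrightarrow> a k = b k) \<Longrightarrow> PRq q n a \<longleftrightarrow> PRq q n b"
  unfolding PRq_def using LCs_cong PRs_cong by metis

lemma PRq_neg: "PRq q n a \<Longrightarrow> PRq q n (\<lambda>k. - a k)"
  unfolding PRq_def LCs_iff_PRs using PRs_neg by (metis (full_types))

lemma PRq_alternate: "PRq q n a \<Longrightarrow> PRq q n (\<lambda>k. (- 1) ^ k * a k)"
  unfolding PRq_def LCs_iff_PRs using PRs_alternate by (metis (full_types))

lemma PRq_imp_LCs: "0 \<le> q \<Longrightarrow> q \<le> 1 \<Longrightarrow> PRq q n a \<Longrightarrow> LCs n a"
  unfolding PRq_def using PRs_imp_LCs[of q n a] by (auto split: if_splits)

lemma same_sign_cases: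
  assumes "same_sign n a"
  shows "(\<forall>k\<le>n. \<bar>a k\<bar> = a k) \<or> (\<forall>k\<le>n. \<bar>a k\<bar> = - a k)"
  using assms by (auto simp: same_sign_def)

lemma PRq_abs:
  assumes "PRq q n a" "same_sign n a"
  shows "PRq q n (\<lambda>k. \<bar>a k\<bar>)"
  using same_sign_cases[OF assms(2)]
proof
  assume "\<forall>k\<le>n. \<bar>a k\<bar> = a k"
  then show ?thesis
    using PRq_cong[of n "\<lambda>k. \<bar>a k\<bar>" a q] assms(1) by blast
next
  assume "\<forall>k\<le>n. \<bar>a k\<bar> = - a k"
  then show ?thesis
    using PRq_cong[of n "\<lambda>k. \<bar>a k\<bar>" "\<lambda>k. - a k" q] PRq_neg[OF assms(1)] by blast
qed

lemma same_sign_pos_mult: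
  assumes "\<And>k. k \<le> n \<Longrightarrow> 0 < e k"
  shows "same_sign n (\<lambda>k. e k * c k) \<longleftrightarrow> same_sign n c"
proof -
  have "(0 \<le> e k * c k \<longleftrightarrow> 0 \<le> c k) \<and> (e k * c k \<le> 0 \<longleftrightarrow> c k \<le> 0)" if "k \<le> n" for k
    using assms[OF that] by (simp add: zero_le_mult_iff mult_le_0_iff)
  then show ?thesis
    by (simp add: same_sign_def)
qed

section \<open>Limits of multipliers\<close>

lemma same_sign_limit:
  assumes "\<And>i::nat. same_sign n (as i)" and lim: "\<And>k. k \<le> n \<Longrightarrow> (\<lambda>i. as i k) \<longlonglongrightarrow> a k"
  shows "same_sign n a"
proof (rule ccontr)
  assume "\<not> ?thesis"
  then obtain j k where jk: "j \<le> n" "a j < 0" "k \<le> n" "0 < a k"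
    unfolding same_sign_def by (meson not_le)
  have "\<forall>\<^sub>F i in sequentially. as i j < 0" "\<forall>\<^sub>F i in sequentially. 0 < as i k"
    using order_tendstoD(2)[OF lim[OF jk(1)] jk(2)] order_tendstoD(1)[OF lim[OF jk(3)] jk(4)] by auto
  then have "\<forall>\<^sub>F i in sequentially. as i j < 0 \<and> 0 < as i k"
    by eventually_elim blast
  from eventually_happens'[OF trivial_limit_sequentially this]
  obtain i where i: "as i j < 0" "0 < as i k"
    by blast
  have "same_sign n (as i)"
    by (rule assms(1))
  then show False
    using i jk unfolding same_sign_def by (meson not_le)
qed

text \<open>Successive ratios decrease, whence this long-range form. Unlike the strict three-term
  inequality it passes to limits, and it still excludes gaps there.\<close>

lemma LCs_nonneg_chain:
  assumes LC: "LCs n b" and b: "\<And>k. k \<le> n \<Longrightarrow> 0 \<le> b k" and ik: "i < k" "k \<le> n"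
  shows "b i * b k \<le> b (Suc i) * b (k - 1)"
proof (cases "b i * b k = 0")
  case True
  have "0 \<le> b (Suc i) * b (k - 1)"
    using b[of "Suc i"] b[of "k - 1"] ik by simp
  then show ?thesis
    unfolding True .
next
  case False
  then have nz: "b i \<noteq> 0" "b k \<noteq> 0"
    by auto
  have lc: "b (j - 1) * b (j + 1) < (b j)\<^sup>2" if "i < j" "j < k" for j
    using LC[unfolded LCs_def, rule_format, of i j k] nz that ik by simp
  have pos: "b j > 0" if "i \<le> j" "j \<le> k" for j
  proof -
    have "b j \<noteq> 0"
    proof (cases "i < j \<and> j < k")
      case True
      have "0 \<le> b (j - 1) * b (j + 1)"
        by (intro mult_nonneg_nonneg b) (use True ik in auto)
      then show ?thesis
        using lc[of j] True by auto
    next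
      case False
      then show ?thesis
        using nz that by (metis le_neq_implies_less)
    qed
    then show ?thesis
      using b[of j] that ik by simp
  qed
  have "b i * b j \<le> b (Suc i) * b (j - 1)" if "Suc i \<le> j" "j \<le> k" for j
    using that
  proof (induction j rule: dec_induct)
    case base
    then show ?case
      by (simp add: mult.commute)
  next
    case (step j)
    have p: "0 < b (j - 1)" "0 < b j"
      using pos[of "j - 1"] pos[of j] step by auto
    have "(b i * b (Suc j)) * (b (j - 1) * b j) = (b i * b j) * (b (j - 1) * b (Suc j))"
      by (simp add: mult_ac)
    also have "\<dots> \<le> (b (Suc i) * b (j - 1)) * (b j)\<^sup>2"
    proof (rule mult_mono)
      show "b i * b j \<le> b (Suc i) * b (j - 1)"
        using step by simp
      show "b (j - 1) * b (Suc j) \<le> (b j)\<^sup>2"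
        using lc[of j] step by simp
      show "0 \<le> b (Suc i) * b (j - 1)" "0 \<le> b (j - 1) * b (Suc j)"
        using b step ik by simp_all
    qed
    also have "\<dots> = (b (Suc i) * b j) * (b (j - 1) * b j)"
      by (simp add: power2_eq_square mult_ac)
    finally have "b i * b (Suc j) \<le> b (Suc i) * b j"
      using p by (simp add: mult_le_cancel_right)
    then show ?case
      by simp
  qed
  then show ?thesis
    using ik by simp
qed

text \<open>The elementary counterpart of \<open>PRs_mult\<close> at q = 0. The limit g is only
  weakly log-concave, but it has no gaps, and the strictness of the product comes from f.\<close>

lemma LCs_mult_limit:
  assumes f: "LCs n f" and as: "\<And>i::nat. LCs n (as i)" "\<And>i k. k \<le> n \<Longrightarrow> 0 \<le> as i k"
    and lim: "\<And>k. k \<le> n \<Longrightarrow> (\<lambda>i. as i k) \<longlonglongrightarrow> g k"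
  shows "LCs n (\<lambda>k. f k * g k)"
proof -
  have g0: "0 \<le> g k" if "k \<le> n" for k
    using lim[OF that] as(2)[OF that] by (intro LIMSEQ_le_const) auto
  have chain: "g i * g k \<le> g (Suc i) * g (k - 1)" if "i < k" "k \<le> n" for i k
  proof (rule LIMSEQ_le)
    show "(\<lambda>j. as j i * as j k) \<longlonglongrightarrow> g i * g k" "(\<lambda>j. as j (Suc i) * as j (k - 1)) \<longlonglongrightarrow> g (Suc i) * g (k - 1)"
      using that by (intro tendsto_mult lim; simp)+
    show "\<exists>N. \<forall>j\<ge>N. as j i * as j k \<le> as j (Suc i) * as j (k - 1)"
      using LCs_nonneg_chain[OF as that] by blast
  qed
  have nogap: "g j \<noteq> 0" if "i \<le> j" "j \<le> k" "k \<le> n" "g i \<noteq> 0" "g k \<noteq> 0" for i j k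
    using that
  proof (induction i rule: inc_induct)
    case (step i)
    have "g i * g k > 0"
      using g0[of i] g0[of k] step by simp
    then have "g (Suc i) * g (k - 1) > 0"
      using chain[of i k] step by linarith
    then have "g (Suc i) \<noteq> 0"
      by auto
    then show ?case
      using step by blast
  qed
  show ?thesis
    unfolding LCs_def
  proof (intro allI impI, elim conjE)
    fix k l m
    assume h: "l \<le> k" "k \<le> m" "m \<le> n" "f l * g l \<noteq> 0" "f m * g m \<noteq> 0" "0 < k" "k < n"
    have nz: "f l \<noteq> 0" "f m \<noteq> 0" "g l \<noteq> 0" "g m \<noteq> 0"
      using h by auto
    have lcf: "f (k - 1) * f (k + 1) < (f k)\<^sup>2"
      using f[unfolded LCs_def, rule_format, of l k m] h nz by simp
    have gk: "g k > 0"
      using nogap[OF h(1-3) nz(3,4)] g0[of k] h by simp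
    have lcg: "g (k - 1) * g (k + 1) \<le> (g k)\<^sup>2"
      using chain[of "k - 1" "k + 1"] h by (simp add: power2_eq_square)
    have gg: "0 \<le> g (k - 1) * g (k + 1)"
      using g0 h by simp
    have eq: "f (k - 1) * g (k - 1) * (f (k + 1) * g (k + 1)) =
        (f (k - 1) * f (k + 1)) * (g (k - 1) * g (k + 1))"
      by (simp add: mult_ac)
    show "f (k - 1) * g (k - 1) * (f (k + 1) * g (k + 1)) < (f k * g k)\<^sup>2"
    proof (cases "f (k - 1) * f (k + 1) > 0")
      case True
      have "(f (k - 1) * f (k + 1)) * (g (k - 1) * g (k + 1)) \<le> (f (k - 1) * f (k + 1)) * (g k)\<^sup>2"
        using True lcg by (intro mult_left_mono) auto
      also have "\<dots> < (f k)\<^sup>2 * (g k)\<^sup>2"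
        using lcf gk by (intro mult_strict_right_mono) auto
      finally show ?thesis
        unfolding eq by (simp add: power_mult_distrib)
    next
      case False
      then have le: "(f (k - 1) * f (k + 1)) * (g (k - 1) * g (k + 1)) \<le> 0"
        using mult_nonpos_nonneg[OF _ gg] by (metis not_less)
      show ?thesis
      proof (cases "f k = 0")
        case False
        then have "0 < (f k * g k)\<^sup>2"
          using gk by simp
        then show ?thesis
          using le unfolding eq by linarith
      next
        \<comment> \<open>At a gap of f the product of the neighbouring entries is negative, and it
          stays so because g is nonzero at both neighbours.\<close>
        case True
        then have "l < k" "k < m"
          using nz h by (metis le_neq_implies_less)+
        then have "g (k - 1) \<noteq> 0" "g (k + 1) \<noteq> 0"
          using nogap[of l "k - 1" m] nogap[of l "k + 1" m] h nz by auto
        then have "0 < g (k - 1) * g (k + 1)"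
          using gg by (metis mult_eq_0_iff order_le_less)
        moreover have "f (k - 1) * f (k + 1) < 0"
          using lcf True by simp
        ultimately show ?thesis
          unfolding eq using True by (simp add: mult_neg_pos)
      qed
    qed
  qed
qed

text \<open>The approximants may be replaced by their absolute values, to which the results on
  nonnegative multipliers apply; the lost sign is constant and is restored by
  \<open>PRq_neg\<close>.\<close>

lemma PRq_mult_limit:
  assumes q: "0 \<le> q" "q \<le> 1" and f: "PRq q n f"
    and as: "\<And>i::nat. PRq q n (as i)" "\<And>i. same_sign n (as i)"
    and lim: "\<And>k. k \<le> n \<Longrightarrow> (\<lambda>i. as i k) \<longlonglongrightarrow> g k"
  shows "PRq q n (\<lambda>k. f k * g k)"
proof -
  have abs: "PRq q n (\<lambda>k. \<bar>as i k\<bar>)" for i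
    using PRq_abs as by blast
  have lim': "(\<lambda>i. \<bar>as i k\<bar>) \<longlonglongrightarrow> \<bar>g k\<bar>" if "k \<le> n" for k
    using lim[OF that] by (rule tendsto_rabs)
  have fg: "PRq q n (\<lambda>k. f k * \<bar>g k\<bar>)"
  proof (cases "q = 0")
    case True
    then show ?thesis
      using f abs lim' LCs_mult_limit[of n f "\<lambda>i k. \<bar>as i k\<bar>" "\<lambda>k. \<bar>g k\<bar>"] by (simp add: PRq_def)
  next
    case False
    then show ?thesis
      using f abs lim' q PRs_mult[of q n f "\<lambda>i k. \<bar>as i k\<bar>" "\<lambda>k. \<bar>g k\<bar>"] by (simp add: PRq_def)
  qed
  have "same_sign n g"
    using same_sign_limit as(2) lim by blast
  from same_sign_cases[OF this] show ?thesis
  proof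
    assume "\<forall>k\<le>n. \<bar>g k\<bar> = g k"
    then show ?thesis
      using fg PRq_cong[of n "\<lambda>k. f k * g k" "\<lambda>k. f k * \<bar>g k\<bar>" q] by simp
  next
    assume "\<forall>k\<le>n. \<bar>g k\<bar> = - g k"
    then show ?thesis
      using PRq_neg[OF fg] PRq_cong[of n "\<lambda>k. f k * g k" "\<lambda>k. - (f k * \<bar>g k\<bar>)" q] by simp
  qed
qed

text \<open>Approximations of the constant sequence 1, which for n >= 2 lies only in the closure.
  For q > 0 they are \<open>R_n(t)/R_n(q)\<close> with t increasing to q; for q = 0 the Gaussian
  \<open>t^(k^2)\<close> is strictly log-concave because
  \<open>(k - 1)^2 + (k + 1)^2 = 2 k^2 + 2\<close>.\<close>

lemma PRq_ones:
  assumes q: "0 \<le> q" "q \<le> 1"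
  obtains es where "\<And>i::nat. PRq q n (es i)" "\<And>i k. k \<le> n \<Longrightarrow> 0 < es i k"
    "\<And>k. k \<le> n \<Longrightarrow> (\<lambda>i. es i k) \<longlonglongrightarrow> 1"
proof (cases "q = 0")
  case True
  obtain t :: "nat \<Rightarrow> real" where t: "\<And>i. 0 < t i" "\<And>i. t i < 1" "t \<longlonglongrightarrow> 1"
    using approx_below[of 1] by auto
  have "LCs n (\<lambda>k. t i ^ k\<^sup>2)" for i
    unfolding LCs_def
  proof (intro allI impI, elim conjE)
    fix k :: nat assume "0 < k"
    then obtain j where j: "k = Suc j"
      by (cases k) auto
    have "(k - 1)\<^sup>2 + (k + 1)\<^sup>2 = 2 * k\<^sup>2 + 2"
      unfolding j by (simp add: power2_eq_square)
    then have "t i ^ (k - 1)\<^sup>2 * t i ^ (k + 1)\<^sup>2 = t i ^ (2 * k\<^sup>2 + 2)"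
      by (metis power_add)
    also have "\<dots> < t i ^ (2 * k\<^sup>2)"
      using t(1,2) by (intro power_strict_decreasing) auto
    also have "\<dots> = (t i ^ k\<^sup>2)\<^sup>2"
      by (simp add: power_mult[symmetric] mult.commute)
    finally show "t i ^ (k - 1)\<^sup>2 * t i ^ (k + 1)\<^sup>2 < (t i ^ k\<^sup>2)\<^sup>2" .
  qed
  moreover have "(\<lambda>i. t i ^ k\<^sup>2) \<longlonglongrightarrow> 1" for k :: nat
    using tendsto_power[OF t(3), of "k\<^sup>2"] by simp
  ultimately show ?thesis
    using that[of "\<lambda>i k. t i ^ k\<^sup>2"] t(1) True by (simp add: PRq_def)
next
  case False
  then have q0: "0 < q"
    using q by simp
  obtain t :: "nat \<Rightarrow> real" where t: "\<And>i. 0 < t i" "\<And>i. t i < q" "t \<longlonglongrightarrow> q"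
    using approx_below[OF q0] by auto
  show ?thesis
  proof (rule that[of "\<lambda>i k. coeff (R_poly n (t i)) k / coeff (R_poly n q) k"])
    fix i
    have "lift q n (\<lambda>k. coeff (R_poly n (t i)) k / coeff (R_poly n q) k) = R_poly n (t i)"
      using lift_ratio[OF q0, of n "t i" "\<lambda>k. 1"] by (simp add: lift_const_1)
    then show "PRq q n (\<lambda>k. coeff (R_poly n (t i)) k / coeff (R_poly n q) k)"
      using sep_R_poly[OF t(1,2) q(2)] False by (simp add: PRq_def PRs_def)
    show "0 < coeff (R_poly n (t i)) k / coeff (R_poly n q) k" if "k \<le> n" for k
      using coeff_R_poly_pos[OF t(1) that] coeff_R_poly_pos[OF q0 that] by simp
  next
    fix k assume k: "k \<le> n"
    have "(\<lambda>i. coeff (R_poly n (t i)) k / coeff (R_poly n q) k) \<longlonglongrightarrow>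
        coeff (R_poly n q) k / coeff (R_poly n q) k"
      using coeff_R_poly_pos[OF q0 k] by (intro tendsto_intros t) auto
    then show "(\<lambda>i. coeff (R_poly n (t i)) k / coeff (R_poly n q) k) \<longlonglongrightarrow> 1"
      using coeff_R_poly_pos[OF q0 k] by simp
  qed
qed

text \<open>For q > 0 the convolution with R_n(q) has, off the origin, only a pair of zeros of
  opposite signs, and separation compares zeros of equal sign. The gap at k makes this sequence a
  test for the signs of a multiplier at k - 1 and k + 1.\<close>

lemma PRq_two_term:
  assumes q: "0 \<le> q" "q \<le> 1" and k: "0 < k" "k < n"
  shows "PRq q n (\<lambda>j. if j = k - 1 then - 1 else if j = k + 1 then 1 else 0)" (is "PRq q n ?a")
proof (cases "q = 0")
  case True
  have "LCs n ?a"
    unfolding LCs_def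
  proof (intro allI impI, elim conjE)
    fix j l m assume h: "l \<le> j" "j \<le> m" "?a l \<noteq> 0" "?a m \<noteq> 0" "0 < j"
    then have "k - 1 \<le> j" "j \<le> k + 1"
      by (auto split: if_splits)
    then consider "j = k - 1" | "j = k" | "j = k + 1"
      by linarith
    then show "?a (j - 1) * ?a (j + 1) < (?a j)\<^sup>2"
      by cases (use h(5) k in auto)
  qed
  then show ?thesis
    using True by (simp add: PRq_def)
next
  case False
  then have q0: "0 < q"
    using q by simp
  define \<alpha> \<beta> where "\<alpha> = coeff (R_poly n q) (k + 1)" and "\<beta> = coeff (R_poly n q) (k - 1)"
  have pos: "\<alpha> > 0" "\<beta> > 0"
    using coeff_R_poly_pos[OF q0] k by (auto simp: \<alpha>_def \<beta>_def)
  have F: "lift q n ?a = monom \<alpha> (k + 1) - monom \<beta> (k - 1)"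
    by (rule poly_eqI) (auto simp: \<alpha>_def \<beta>_def)
  define x where "x = sqrt (\<beta> / \<alpha>)"
  have x: "x > 0" "\<alpha> * x\<^sup>2 = \<beta>"
    using pos by (auto simp: x_def)
  have kk: "k + 1 = (k - 1) + 2"
    using k by simp
  have "sep q (lift q n ?a)"
  proof (rule sep_by_count[of _ "k + 1" "k - 1" "{1, - 1}" "\<lambda>\<sigma>. \<sigma> * x"])
    have "coeff (lift q n ?a) (k + 1) = \<alpha>"
      unfolding F using k by simp
    then show "lift q n ?a \<noteq> 0"
      using pos(1) by (metis coeff_0 less_irrefl)
    show "degree (lift q n ?a) \<le> k + 1"
      unfolding F by (intro degree_diff_le order_trans[OF degree_monom_le]) auto
    show "coeff (lift q n ?a) j = 0" if "j < k - 1" for j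
      unfolding F using that by simp
    show "k + 1 \<le> k - 1 + card {1, - 1 :: real}"
      using k by simp
    show "\<sigma> * x \<noteq> 0 \<and> poly (lift q n ?a) (\<sigma> * x) = 0" if "\<sigma> \<in> {1, - 1}" for \<sigma>
    proof -
      have "\<sigma>\<^sup>2 = 1" "\<sigma> \<noteq> 0"
        using that by auto
      have "poly (lift q n ?a) (\<sigma> * x) = (\<sigma> * x) ^ (k - 1) * (\<alpha> * (\<sigma> * x)\<^sup>2 - \<beta>)"
        unfolding F by (subst kk) (simp add: poly_monom power_add algebra_simps power2_eq_square)
      also have "\<alpha> * (\<sigma> * x)\<^sup>2 = \<beta>"
        using x \<open>\<sigma>\<^sup>2 = 1\<close> by (simp add: power_mult_distrib)
      finally show ?thesis
        using x \<open>\<sigma> \<noteq> 0\<close> by simp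
    qed
    show "\<not> \<sigma> * x / (\<tau> * x) \<le> 1"
      if "\<sigma> \<in> {1, - 1}" "\<tau> \<in> {1, - 1}" "\<sigma> \<noteq> \<tau>" "q \<le> \<sigma> * x / (\<tau> * x)" for \<sigma> \<tau>
      using that x q0 by auto
  qed (use q0 q in auto)
  then show ?thesis
    using False by (simp add: PRq_def PRs_def)
qed

lemma same_sign_if_adjacent:
  assumes zero: "\<And>k. k \<le> n \<Longrightarrow> k < l \<or> d < k \<Longrightarrow> c k = (0::real)"
    and adj: "\<And>k. l \<le> k \<Longrightarrow> k < d \<Longrightarrow> 0 < c k * c (Suc k)"
  shows "same_sign n c"
proof -
  have s: "0 \<le> c l * c k" if "l \<le> k" "k \<le> d" for k
    using that
  proof (induction k rule: dec_induct)
    case (step k)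
    have "0 \<le> (c l * c k) * (c k * c (Suc k))"
      by (rule mult_nonneg_nonneg[OF _ less_imp_le[OF adj]]) (use step in auto)
    then have "0 \<le> (c k)\<^sup>2 * (c l * c (Suc k))"
      by (simp add: power2_eq_square mult_ac)
    moreover have "(c k)\<^sup>2 > 0"
      using adj[of k] step by auto
    ultimately show ?case
      by (metis zero_le_mult_iff not_le)
  qed simp
  show ?thesis
  proof (cases "c l = 0")
    case True
    have "c k = 0" if "k \<le> n" for k
    proof (cases "k < l \<or> d < k")
      case False
      then show ?thesis
        using adj[of l] True by (metis le_neq_implies_less less_irrefl mult_zero_left not_le order_le_less_trans)
    qed (use zero that in blast)
    then show ?thesis
      by (simp add: same_sign_def)
  next
    case False
    then consider "c l > 0" | "c l < 0"
      by linarith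
    then show ?thesis
    proof cases
      case 1
      have "0 \<le> c k" if "k \<le> n" for k
        using s[of k] zero[OF that] 1 by (cases "k < l \<or> d < k") (auto simp: zero_le_mult_iff)
      then show ?thesis
        by (simp add: same_sign_def)
    next
      case 2
      have "c k \<le> 0" if "k \<le> n" for k
        using s[of k] zero[OF that] 2 by (cases "k < l \<or> d < k") (auto simp: zero_le_mult_iff)
      then show ?thesis
        by (simp add: same_sign_def)
    qed
  qed
qed

text \<open>Nonnegative products of entries two apart turn strict log-concavity into the absence of
  gaps. Then \<open>c_k c_(k+1)\<close> and \<open>c_(k+1) c_(k+2)\<close> have the same sign, so
  the signs are constant or alternate throughout.\<close>

lemma sign_pattern:
  assumes LC: "LCs n c" and nn: "\<And>k. 0 < k \<Longrightarrow> k < n \<Longrightarrow> 0 \<le> c (k - 1) * c (k + 1)"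
  shows "same_sign n c \<or> same_sign n (\<lambda>k. (- 1) ^ k * c k)"
proof (cases "\<forall>k\<le>n. c k = 0")
  case False
  define l where "l = Min {k. k \<le> n \<and> c k \<noteq> 0}"
  define d where "d = Max {k. k \<le> n \<and> c k \<noteq> 0}"
  have fin: "finite {k. k \<le> n \<and> c k \<noteq> 0}" and ne: "{k. k \<le> n \<and> c k \<noteq> 0} \<noteq> {}"
    using False by auto
  have l: "c l \<noteq> 0" "\<And>k. k < l \<Longrightarrow> k \<le> n \<Longrightarrow> c k = 0"
    using Min_in[OF fin ne] Min_le[OF fin] by (fastforce simp: l_def)+
  have d: "c d \<noteq> 0" "d \<le> n" "\<And>k. d < k \<Longrightarrow> k \<le> n \<Longrightarrow> c k = 0"
    using Max_in[OF fin ne] Max_ge[OF fin] by (fastforce simp: d_def)+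
  have nz: "c k \<noteq> 0" if "l \<le> k" "k \<le> d" for k
  proof (cases "k = l \<or> k = d")
    case False
    then have "l < k" "k < d"
      using that by auto
    then have "c (k - 1) * c (k + 1) < (c k)\<^sup>2"
      using LC[unfolded LCs_def, rule_format, of l k d] l d by simp
    moreover have "0 \<le> c (k - 1) * c (k + 1)"
      using nn[of k] \<open>l < k\<close> \<open>k < d\<close> d(2) by simp
    ultimately show ?thesis
      by auto
  qed (use l d in auto)
  have two: "0 < c k * c (Suc (Suc k))" if "l \<le> k" "Suc (Suc k) \<le> d" for k
  proof -
    have "0 \<le> c k * c (Suc (Suc k))"
      using nn[of "Suc k"] that d(2) by simp
    moreover have "c k * c (Suc (Suc k)) \<noteq> 0"
      using nz[of k] nz[of "Suc (Suc k)"] that by simp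
    ultimately show ?thesis
      by (metis order_le_less)
  qed
  have adj: "0 < (c l * c (Suc l)) * (c k * c (Suc k))" if "l \<le> k" "k < d" for k
    using that
  proof (induction k rule: dec_induct)
    case base
    then have "c l * c (Suc l) \<noteq> 0"
      using nz[of l] nz[of "Suc l"] by simp
    then show ?case
      using not_real_square_gt_zero by blast
  next
    case (step k)
    have "0 < ((c l * c (Suc l)) * (c k * c (Suc k))) * (c k * c (Suc (Suc k)))"
      by (rule mult_pos_pos[OF _ two]) (use step in auto)
    then have "0 < (c k)\<^sup>2 * ((c l * c (Suc l)) * (c (Suc k) * c (Suc (Suc k))))"
      by (simp add: power2_eq_square mult_ac)
    then show ?case
      by (rule zero_less_mult_pos) (use nz[of k] step in simp)
  qed
  have zero: "c k = 0" if "k \<le> n" "k < l \<or> d < k" for k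
    using l d that by blast
  show ?thesis
  proof (cases "c l * c (Suc l) > 0")
    case True
    have "same_sign n c"
    proof (rule same_sign_if_adjacent[OF zero])
      show "0 < c k * c (Suc k)" if "l \<le> k" "k < d" for k
        using zero_less_mult_pos[OF adj[OF that] True] .
    qed
    then show ?thesis ..
  next
    case False
    have "same_sign n (\<lambda>k. (- 1) ^ k * c k)"
    proof (rule same_sign_if_adjacent[of n l d])
      show "(- 1) ^ k * c k = 0" if "k \<le> n" "k < l \<or> d < k" for k
        using zero[OF that] by simp
      show "0 < (- 1) ^ k * c k * ((- 1) ^ Suc k * c (Suc k))" if "l \<le> k" "k < d" for k
      proof -
        have "c k * c (Suc k) < 0"
          using adj[OF that] False unfolding zero_less_mult_iff[of "c l * c (Suc l)"] by blast
        moreover have "((- 1 :: real) ^ k)\<^sup>2 = 1"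
          by (simp add: power2_eq_square flip: power_mult_distrib)
        then have "(- 1) ^ k * c k * ((- 1) ^ Suc k * c (Suc k)) = - (c k * c (Suc k))"
          by (simp add: power2_eq_square mult_ac)
        ultimately show ?thesis
          by linarith
      qed
    qed
    then show ?thesis ..
  qed
qed (simp add: same_sign_def)

section \<open>Closures, degrees and general facts on multiplier classes\<close>

lemma poly_closure_seq_fps:
  "f \<in> poly_closure n (seq_fps n ` S) \<longleftrightarrow>
    (\<exists>a as. f = seq_fps n a \<and> (\<forall>i::nat. as i \<in> S) \<and> (\<forall>k\<le>n. (\<lambda>i. as i k) \<longlonglongrightarrow> a k))"
proof
  assume "f \<in> poly_closure n (seq_fps n ` S)"
  then obtain s where deg: "\<forall>k>n. fps_nth f k = 0" and s: "\<forall>i. s i \<in> seq_fps n ` S"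
    "\<forall>k. (\<lambda>i. fps_nth (s i) k) \<longlonglongrightarrow> fps_nth f k"
    unfolding poly_closure_iff_sequence by blast
  have "\<forall>i. \<exists>a. a \<in> S \<and> s i = seq_fps n a"
    using s(1) by blast
  then obtain as where as: "\<And>i. as i \<in> S" "\<And>i. s i = seq_fps n (as i)"
    by metis
  have lim: "(\<lambda>i. complex_of_real (as i k)) \<longlonglongrightarrow> fps_nth f k" if "k \<le> n" for k
    using s(2)[rule_format, of k] that by (simp add: as)
  have "f = seq_fps n (\<lambda>k. Re (fps_nth f k))"
  proof (rule fps_ext)
    fix k
    show "fps_nth f k = fps_nth (seq_fps n (\<lambda>k. Re (fps_nth f k))) k"
    proof (cases "k \<le> n")
      case True
      have "(\<lambda>i. 0) \<longlonglongrightarrow> Im (fps_nth f k)"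
        using tendsto_Im[OF lim[OF True]] by simp
      then have "Im (fps_nth f k) = 0"
        using LIMSEQ_unique[OF _ tendsto_const] by blast
      then show ?thesis
        using True by (simp add: complex_eq_iff)
    qed (use deg in auto)
  qed
  moreover have "(\<lambda>i. as i k) \<longlonglongrightarrow> Re (fps_nth f k)" if "k \<le> n" for k
    using tendsto_Re[OF lim[OF that]] by simp
  ultimately show "\<exists>a as. f = seq_fps n a \<and> (\<forall>i::nat. as i \<in> S) \<and> (\<forall>k\<le>n. (\<lambda>i. as i k) \<longlonglongrightarrow> a k)"
    using as(1) by blast
next
  assume "\<exists>a as. f = seq_fps n a \<and> (\<forall>i::nat. as i \<in> S) \<and> (\<forall>k\<le>n. (\<lambda>i. as i k) \<longlonglongrightarrow> a k)"
  then obtain a as where a: "f = seq_fps n a" "\<And>i::nat. as i \<in> S" "\<And>k. k \<le> n \<Longrightarrow> (\<lambda>i. as i k) \<longlonglongrightarrow> a k"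
    by blast
  have "(\<lambda>i. fps_nth (seq_fps n (as i)) k) \<longlonglongrightarrow> fps_nth f k" for k
    using a(3)[of k] by (cases "k \<le> n") (auto simp: a(1) intro: tendsto_of_real)
  then show "f \<in> poly_closure n (seq_fps n ` S)"
    unfolding poly_closure_iff_sequence using a(1,2)
    by (intro conjI exI[of _ "\<lambda>i. seq_fps n (as i)"]) auto
qed

lemma seq_fps_reflect: "fps_compose (seq_fps n a) (- fps_X) = seq_fps n (\<lambda>k. (- 1) ^ k * a k)"
  by (rule fps_ext) (simp add: fps_compose_uminus')

lemma SUP_fps_deg:
  assumes "\<And>h. h \<in> X \<Longrightarrow> fps_deg h \<le> ereal (real n)" "h0 \<in> X" "fps_nth h0 n \<noteq> 0"
  shows "(SUP h\<in>X. fps_deg h) = ereal (real n)"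
proof (rule antisym)
  show "(SUP h\<in>X. fps_deg h) \<le> ereal (real n)"
    using assms(1) by (rule SUP_least)
  have "ereal (real n) \<le> fps_deg h0"
    unfolding fps_deg_def using assms(3) by (intro SUP_upper) simp
  then show "ereal (real n) \<le> (SUP h\<in>X. fps_deg h)"
    using assms(2) by (rule SUP_upper2[rotated])
qed

lemma SUP_fps_deg_seq:
  assumes "a \<in> S" "a n \<noteq> 0"
  shows "(SUP h\<in>seq_fps n ` S. fps_deg h) = ereal (real n)"
  using assms by (intro SUP_fps_deg[of _ _ "seq_fps n a"]) (auto simp: fps_deg_le_iff)

lemma seq_fps_hadamard_real:
  assumes g: "\<forall>k>n. fps_nth g k = 0" and e: "\<And>k. k \<le> n \<Longrightarrow> e k \<noteq> 0"
    and c: "seq_fps n e \<star> g = seq_fps n c"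
  obtains b where "g = seq_fps n b"
proof
  show "g = seq_fps n (\<lambda>k. c k / e k)"
  proof (rule fps_ext)
    fix k
    show "fps_nth g k = fps_nth (seq_fps n (\<lambda>k. c k / e k)) k"
    proof (cases "k \<le> n")
      case True
      have "of_real (e k) * fps_nth g k = of_real (c k)"
        using arg_cong[OF c, of "\<lambda>f. fps_nth f k"] True by simp
      then show ?thesis
        using e[OF True] True by (simp add: field_simps)
    qed (use g in simp)
  qed
qed

text \<open>Multipliers are recovered as limits of their products with separated polynomials whose
  coefficient sequences tend to the constant sequence \<open>1\<close>.\<close>

lemma multiplier_in_closure:
  assumes g: "g \<in> multiplier_class (seq_fps n ` S)"
    and es: "\<And>i::nat. es i \<in> S" "\<And>i k. k \<le> n \<Longrightarrow> 0 < es i k" "\<And>k. k \<le> n \<Longrightarrow> (\<lambda>i. es i k) \<longlonglongrightarrow> (1::real)"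
  obtains b where "g = seq_fps n b"
    "\<And>f. f \<in> S \<Longrightarrow> seq_fps n (\<lambda>k. f k * b k) \<in> seq_fps n ` S"
    "\<And>k. k \<le> n \<Longrightarrow> (\<lambda>i. es i k * b k) \<longlonglongrightarrow> b k"
proof -
  have "(SUP h\<in>seq_fps n ` S. fps_deg h) = ereal (real n)"
    using es(1)[of 0] es(2)[of n 0] by (intro SUP_fps_deg_seq) auto
  then have deg: "\<forall>k>n. fps_nth g k = 0"
    using g by (simp add: multiplier_class_def fps_deg_le_iff)
  have mult: "seq_fps n f \<star> g \<in> seq_fps n ` S" if "f \<in> S" for f
    using g that by (auto simp: multiplier_class_def)
  obtain c where "seq_fps n (es 0) \<star> g = seq_fps n c"
    using mult[OF es(1)] by blast
  then obtain b where b: "g = seq_fps n b"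
    using seq_fps_hadamard_real[OF deg] es(2) by (metis less_irrefl)
  have "(\<lambda>i. es i k * b k) \<longlonglongrightarrow> b k" if "k \<le> n" for k
    using tendsto_mult[OF es(3)[OF that] tendsto_const[of "b k"]] by simp
  then show ?thesis
    using that[OF b] mult by (simp add: b seq_fps_hadamard)
qed

lemma multiplier_classI:
  assumes S: "a \<in> S" "a n \<noteq> 0" and m: "\<And>f. f \<in> S \<Longrightarrow> (\<lambda>k. f k * b k) \<in> S"
  shows "seq_fps n b \<in> multiplier_class (seq_fps n ` S)"
  unfolding multiplier_class_def using m
  by (auto simp: SUP_fps_deg_seq[OF S] fps_deg_le_iff seq_fps_hadamard)

text \<open>Coefficientwise multiplication by h maps the pre-class onto X and commutes with
  multiplication by any g; the element f0 of full degree makes the two degree bounds agree.\<close>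

lemma multiplier_class_precoeff:
  assumes h: "fps_deg h = ereal (real n)" and X: "\<And>f. f \<in> X \<Longrightarrow> fps_deg f \<le> ereal (real n)"
    and nz: "\<And>k. k \<le> n \<Longrightarrow> fps_nth h k \<noteq> 0"
    and full: "f0 \<in> precoeff_class X h" "fps_nth f0 n \<noteq> 0"
  shows "multiplier_class X = multiplier_class (precoeff_class X h)"
proof -
  have hn: "\<forall>k>n. fps_nth h k = 0"
    using h fps_deg_le_iff[of h n] by simp
  have S1: "(SUP f\<in>precoeff_class X h. fps_deg f) = ereal (real n)"
    by (rule SUP_fps_deg[OF _ full]) (simp add: precoeff_class_def h)
  have S2: "(SUP f\<in>X. fps_deg f) = ereal (real n)"
  proof (rule SUP_fps_deg[OF X])
    show "f0 \<star> h \<in> X" "fps_nth (f0 \<star> h) n \<noteq> 0"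
      using full nz[of n] by (simp_all add: precoeff_class_def)
  qed
  have comm: "f \<star> g \<star> h = f \<star> h \<star> g" for f g
    by (rule fps_ext) (simp add: mult_ac)
  have ex: "\<exists>f'. f' \<in> precoeff_class X h \<and> f' \<star> h = f" if f: "f \<in> X" for f
  proof -
    define f' where "f' = Abs_fps (\<lambda>k. fps_nth f k / fps_nth h k)"
    have fn: "\<forall>k>n. fps_nth f k = 0"
      using X[OF f] by (simp add: fps_deg_le_iff)
    have "f' \<star> h = f"
    proof (rule fps_ext)
      show "fps_nth (f' \<star> h) k = fps_nth f k" for k
        using nz[of k] fn hn by (cases "k \<le> n") (auto simp: f'_def)
    qed
    moreover have "fps_deg f' \<le> ereal (real n)"
      unfolding fps_deg_le_iff using fn by (simp add: f'_def)
    ultimately show ?thesis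
      using f h by (auto simp: precoeff_class_def)
  qed
  have "(\<forall>f\<in>X. f \<star> g \<in> X) \<longleftrightarrow> (\<forall>f\<in>precoeff_class X h. f \<star> g \<in> precoeff_class X h)" for g
  proof
    assume L: "\<forall>f\<in>X. f \<star> g \<in> X"
    show "\<forall>f\<in>precoeff_class X h. f \<star> g \<in> precoeff_class X h"
    proof
      fix f assume f: "f \<in> precoeff_class X h"
      then have "\<forall>k>n. fps_nth f k = 0"
        by (simp add: precoeff_class_def h fps_deg_le_iff)
      then have "fps_deg (f \<star> g) \<le> ereal (real n)"
        by (simp add: fps_deg_le_iff)
      then show "f \<star> g \<in> precoeff_class X h"
        using L f by (simp add: precoeff_class_def h comm)
    qed
  next
    assume R: "\<forall>f\<in>precoeff_class X h. f \<star> g \<in> precoeff_class X h"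
    show "\<forall>f\<in>X. f \<star> g \<in> X"
    proof
      fix f assume "f \<in> X"
      then obtain f' where f': "f' \<in> precoeff_class X h" "f' \<star> h = f"
        using ex by blast
      then show "f \<star> g \<in> X"
        using R comm[of f' g] by (auto simp: precoeff_class_def)
    qed
  qed
  then show ?thesis
    by (simp add: multiplier_class_def S1 S2)
qed

section \<open>Determination of the multiplier classes\<close>

lemma multiplier_PN:
  assumes q: "0 \<le> q" "q \<le> 1"
  shows "multiplier_class (PN_class n q) = poly_closure n (PN_class n q)"
proof -
  let ?S = "{a. PRq q n a \<and> same_sign n a}"
  obtain es where es: "\<And>i::nat. PRq q n (es i)" "\<And>i k. k \<le> n \<Longrightarrow> 0 < es i k"
    "\<And>k. k \<le> n \<Longrightarrow> (\<lambda>i. es i k) \<longlonglongrightarrow> (1::real)"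
    using PRq_ones[OF q, where n = n] by blast
  have esS: "es i \<in> ?S" for i
    using es(1,2) by (simp add: same_sign_def less_imp_le)
  have mem: "f \<in> ?S" if "seq_fps n f \<in> seq_fps n ` ?S" for f
  proof -
    obtain a where a: "a \<in> ?S" "\<forall>k\<le>n. f k = a k"
      using \<open>seq_fps n f \<in> seq_fps n ` ?S\<close> unfolding image_iff seq_fps_eq_iff by blast
    then show ?thesis
      using PRq_cong[of n f a q] by (simp add: same_sign_def)
  qed
  show ?thesis
    unfolding PN_class_eq[OF q]
  proof (intro equalityI subsetI)
    fix g assume "g \<in> multiplier_class (seq_fps n ` ?S)"
    then obtain b where b: "g = seq_fps n b"
      "\<And>f. f \<in> ?S \<Longrightarrow> seq_fps n (\<lambda>k. f k * b k) \<in> seq_fps n ` ?S"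
      "\<And>k. k \<le> n \<Longrightarrow> (\<lambda>i. es i k * b k) \<longlonglongrightarrow> b k"
      using multiplier_in_closure[OF _ esS es(2,3)] by blast
    have "(\<lambda>k. es i k * b k) \<in> ?S" for i
      by (rule mem[OF b(2)[OF esS]])
    then show "g \<in> poly_closure n (seq_fps n ` ?S)"
      unfolding poly_closure_seq_fps using b(1,3)
      by (intro exI[of _ b] exI[of _ "\<lambda>i k. es i k * b k"]) simp
  next
    fix g assume "g \<in> poly_closure n (seq_fps n ` ?S)"
    then obtain b bs where b: "g = seq_fps n b" "\<And>i::nat. PRq q n (bs i)" "\<And>i. same_sign n (bs i)"
      "\<And>k. k \<le> n \<Longrightarrow> (\<lambda>i. bs i k) \<longlonglongrightarrow> b k"
      unfolding poly_closure_seq_fps by blast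
    have sb: "same_sign n b"
      using same_sign_limit[OF b(3,4)] .
    show "g \<in> multiplier_class (seq_fps n ` ?S)"
      unfolding b(1)
    proof (rule multiplier_classI[OF esS[of 0]])
      show "es 0 n \<noteq> 0"
        using es(2)[of n 0] by simp
      fix f assume f: "f \<in> ?S"
      have "same_sign n (\<lambda>k. f k * b k)"
        using f sb unfolding same_sign_def
        by (auto simp: mult_nonneg_nonneg mult_nonpos_nonpos mult_nonneg_nonpos mult_nonpos_nonneg)
      then show "(\<lambda>k. f k * b k) \<in> ?S"
        using PRq_mult_limit[OF q _ b(2-4)] f by simp
    qed
  qed
qed

lemma multiplier_PR:
  assumes q: "0 \<le> q" "q \<le> 1"
  shows "multiplier_class (PR_class n q) = plus_minus (poly_closure n (PN_class n q))"
proof -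
  let ?S = "{a. PRq q n a}" and ?N = "{a. PRq q n a \<and> same_sign n a}"
  obtain es where es: "\<And>i::nat. PRq q n (es i)" "\<And>i k. k \<le> n \<Longrightarrow> 0 < es i k"
    "\<And>k. k \<le> n \<Longrightarrow> (\<lambda>i. es i k) \<longlonglongrightarrow> (1::real)"
    using PRq_ones[OF q, where n = n] by blast
  have esS: "es i \<in> ?S" for i
    using es(1) by simp
  have mem: "PRq q n f" if "seq_fps n f \<in> seq_fps n ` ?S" for f
  proof -
    obtain a where "PRq q n a" "\<forall>k\<le>n. f k = a k"
      using \<open>seq_fps n f \<in> seq_fps n ` ?S\<close> unfolding image_iff seq_fps_eq_iff by blast
    then show ?thesis
      using PRq_cong[of n f a q] by simp
  qed
  show ?thesis
    unfolding PR_class_eq[OF q] PN_class_eq[OF q]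
  proof (intro equalityI subsetI)
    fix g assume "g \<in> multiplier_class (seq_fps n ` ?S)"
    then obtain b where b: "g = seq_fps n b"
      "\<And>f. f \<in> ?S \<Longrightarrow> seq_fps n (\<lambda>k. f k * b k) \<in> seq_fps n ` ?S"
      "\<And>k. k \<le> n \<Longrightarrow> (\<lambda>i. es i k * b k) \<longlonglongrightarrow> b k"
      using multiplier_in_closure[OF _ esS es(2,3)] by blast
    have eb: "PRq q n (\<lambda>k. es i k * b k)" for i
      by (rule mem[OF b(2)[OF esS]])
    have nn: "0 \<le> b (k - 1) * b (k + 1)" if k: "0 < k" "k < n" for k
    proof (rule ccontr)
      let ?a = "\<lambda>j. if j = k - 1 then - 1 else if j = k + 1 then 1 else (0::real)"
      assume neg: "\<not> 0 \<le> b (k - 1) * b (k + 1)"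
      \<comment> \<open>The product with the two-term sequence vanishes at k between nonzero
        neighbours, so log-concavity at k reads \<open>- b (k - 1) * b (k + 1) < 0\<close>, against
        \<open>neg\<close>.\<close>
      have "LCs n (\<lambda>j. ?a j * b j)"
        using PRq_imp_LCs[OF q] mem[OF b(2)] PRq_two_term[OF q k] by simp
      moreover have a: "?a (k - 1) = - 1" "?a k = 0" "?a (k + 1) = 1"
        using k by auto
      moreover have "b (k - 1) \<noteq> 0" "b (k + 1) \<noteq> 0"
        using neg by auto
      ultimately have "(- 1 * b (k - 1)) * (1 * b (k + 1)) < (0 * b k)\<^sup>2"
        using k unfolding LCs_def
        by (elim allE[of _ k] allE[of _ "k - 1"] allE[of _ "k + 1"]) (simp only: a, simp)
      then show False
        using neg by simp
    qed
    \<comment> \<open>The multiplier itself may be only weakly log-concave, so the sign pattern is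
      read off its product with the positive sequence \<open>es 0\<close>.\<close>
    have "same_sign n (\<lambda>k. es 0 k * b k) \<or> same_sign n (\<lambda>k. (- 1) ^ k * (es 0 k * b k))"
    proof (rule sign_pattern[OF PRq_imp_LCs[OF q eb]])
      fix k assume k: "0 < k" "k < n"
      have "0 \<le> (es 0 (k - 1) * es 0 (k + 1)) * (b (k - 1) * b (k + 1))"
      proof (rule mult_nonneg_nonneg[OF _ nn[OF k]])
        show "0 \<le> es 0 (k - 1) * es 0 (k + 1)"
          using es(2)[of "k - 1" 0] es(2)[of "k + 1" 0] k by (simp add: less_imp_le)
      qed
      then show "0 \<le> es 0 (k - 1) * b (k - 1) * (es 0 (k + 1) * b (k + 1))"
        by (simp add: mult_ac)
    qed
    then have sgn: "same_sign n b \<or> same_sign n (\<lambda>k. (- 1) ^ k * b k)"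
      unfolding mult.left_commute[of "(- 1) ^ k" "es 0 k" for k] using same_sign_pos_mult es(2) by blast
    have closure: "seq_fps n c \<in> poly_closure n (seq_fps n ` ?N)"
      if c: "same_sign n c" "\<And>i. PRq q n (\<lambda>k. es i k * c k)" for c
    proof -
      have "same_sign n (\<lambda>k. es i k * c k)" for i
        using same_sign_pos_mult c(1) es(2) by blast
      moreover have "(\<lambda>i. es i k * c k) \<longlonglongrightarrow> c k" if "k \<le> n" for k
        using tendsto_mult[OF es(3)[OF that] tendsto_const[of "c k"]] by simp
      ultimately show ?thesis
        unfolding poly_closure_seq_fps using c(2)
        by (intro exI[of _ c] exI[of _ "\<lambda>i k. es i k * c k"]) simp
    qed
    from sgn show "g \<in> plus_minus (poly_closure n (seq_fps n ` ?N))"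
    proof
      assume "same_sign n b"
      then show ?thesis
        using closure[OF _ eb] b(1) by (simp add: plus_minus_def)
    next
      assume s: "same_sign n (\<lambda>k. (- 1) ^ k * b k)"
      have "PRq q n (\<lambda>k. es i k * ((- 1) ^ k * b k))" for i
        using PRq_alternate[OF eb[of i]] by (simp add: mult.left_commute)
      then have "seq_fps n (\<lambda>k. (- 1) ^ k * b k) \<in> poly_closure n (seq_fps n ` ?N)"
        by (rule closure[OF s])
      moreover have "g = fps_compose (seq_fps n (\<lambda>k. (- 1) ^ k * b k)) (- fps_X)"
        unfolding seq_fps_reflect b(1) by (simp flip: mult.assoc power_mult_distrib)
      ultimately show ?thesis
        unfolding plus_minus_def by blast
    qed
  next
    fix g assume "g \<in> plus_minus (poly_closure n (seq_fps n ` ?N))"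
    then obtain g' where g': "g' \<in> poly_closure n (seq_fps n ` ?N)" "g = g' \<or> g = fps_compose g' (- fps_X)"
      by (auto simp: plus_minus_def)
    then obtain b bs where b: "g' = seq_fps n b" "\<And>i::nat. PRq q n (bs i)" "\<And>i. same_sign n (bs i)"
      "\<And>k. k \<le> n \<Longrightarrow> (\<lambda>i. bs i k) \<longlonglongrightarrow> b k"
      unfolding poly_closure_seq_fps by blast
    have nz: "es 0 n \<noteq> 0"
      using es(2)[of n 0] by simp
    from g'(2) show "g \<in> multiplier_class (seq_fps n ` ?S)"
    proof
      assume "g = g'"
      then show ?thesis
        unfolding b(1) using PRq_mult_limit[OF q _ b(2-4)]
        by (auto intro!: multiplier_classI[OF esS[of 0] nz])
    next
      assume g: "g = fps_compose g' (- fps_X)"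
      have "PRq q n (\<lambda>k. f k * ((- 1) ^ k * b k))" if "PRq q n f" for f
        using PRq_mult_limit[OF q PRq_alternate[OF that] b(2-4)] by (simp add: mult_ac)
      then show ?thesis
        unfolding g b(1) seq_fps_reflect by (auto intro!: multiplier_classI[OF esS[of 0] nz])
    qed
  qed
qed

lemma class_deg_le:
  assumes "0 < q" "q \<le> 1" "f \<in> R_class n q \<or> f \<in> N_class n q"
  shows "fps_deg f \<le> ereal (real n)"
proof -
  obtain p where "f = rfps p" "degree p \<le> n"
    using assms unfolding R_class_def N_class_def
    by (auto simp: real_sep_polys_iff[OF assms(1,2)])
  then show ?thesis
    by (simp add: fps_deg_le_iff coeff_eq_0)
qed

lemma multiplier_R_N:
  assumes q: "0 < q" "q \<le> 1"
  shows "multiplier_class (R_class n q) = multiplier_class (PR_class n q)"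
    and "multiplier_class (N_class n q) = multiplier_class (PN_class n q)"
proof -
  have q0: "0 \<le> q"
    using q by simp
  obtain es where es: "\<And>i::nat. PRq q n (es i)" "\<And>i k. k \<le> n \<Longrightarrow> (0::real) < es i k"
    using PRq_ones[OF q0 q(2), where n = n] by metis
  have s: "same_sign n (es 0)"
    using es(2) by (simp add: same_sign_def less_imp_le)
  have nz: "fps_nth (rfps (R_poly n q)) k \<noteq> 0" if "k \<le> n" for k
    using coeff_R_poly_pos[OF q(1) that] by simp
  have f0: "fps_nth (seq_fps n (es 0)) n \<noteq> 0"
    using es(2)[of n 0] by simp
  have PR: "PR_class n q = precoeff_class (R_class n q) (rfps (R_poly n q))"
    "PN_class n q = precoeff_class (N_class n q) (rfps (R_poly n q))"
    using q by (simp_all add: PR_class_def PN_class_def)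
  have "seq_fps n (es 0) \<in> PR_class n q"
    unfolding PR_class_eq[OF q0 q(2)] using es(1) by blast
  then show "multiplier_class (R_class n q) = multiplier_class (PR_class n q)"
    unfolding PR using f0 nz class_deg_le[OF q]
    by (intro multiplier_class_precoeff[OF fps_deg_R_poly[OF q(1)]]) auto
  have "seq_fps n (es 0) \<in> PN_class n q"
    unfolding PN_class_eq[OF q0 q(2)] using es(1) s by blast
  then show "multiplier_class (N_class n q) = multiplier_class (PN_class n q)"
    unfolding PR using f0 nz class_deg_le[OF q]
    by (intro multiplier_class_precoeff[OF fps_deg_R_poly[OF q(1)]]) auto
qed

section \<open>Extremal polynomials and the assembly of the four statements\<close>

lemma geometric_seq_imp_extremal:
  assumes "geometric_seq n a"
  shows "extremal n (seq_fps n a)"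
proof -
  obtain x y where xy: "x \<noteq> 0" "y \<noteq> 0" "\<And>k. k \<le> n \<Longrightarrow> a k = y * x ^ k"
    using assms by (auto simp: geometric_seq_def)
  have "seq_fps n a = rfps (smult y (\<Sum>k\<le>n. monom (x ^ k) k))"
    by (rule fps_ext) (simp add: coeff_sum xy(3))
  then show ?thesis
    using xy(1,2) unfolding extremal_def by blast
qed

lemma PRq_closure_strict:
  assumes r: "0 \<le> r" "r < q" "q \<le> 1" and as: "\<And>i::nat. PRq q n (as i)"
    and lim: "\<And>k. k \<le> n \<Longrightarrow> (\<lambda>i. as i k) \<longlonglongrightarrow> a k" and ext: "\<not> geometric_seq n a"
  shows "PRq r n a"
proof -
  have as': "PRs q n (as i)" for i
    using as[of i] r by (simp add: PRq_def)
  \<comment> \<open>For r = 0, membership at any positive level below q implies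
    log-concavity.\<close>
  define s where "s = (if r = 0 then q / 2 else r)"
  have s: "0 < s" "s < q"
    using r by (auto simp: s_def)
  have "PRs s n a"
    using PRs_closure_strict[OF s r(3) as' lim ext] .
  then show ?thesis
    using PRs_imp_LCs[of s n a] s r by (auto simp: PRq_def s_def split: if_splits)
qed

theorem theorem4:
  fixes q :: real and n :: nat
  assumes "0 \<le> q" and "q \<le> 1" and "n \<ge> 1"
  shows
    "(multiplier_class (PR_class n q) = plus_minus (poly_closure n (PN_class n q)) \<and>
      (0 < q \<longrightarrow> multiplier_class (R_class n q) = plus_minus (poly_closure n (PN_class n q)))) \<and>
     (multiplier_class (PN_class n q) = poly_closure n (PN_class n q) \<and>
      (0 < q \<longrightarrow> multiplier_class (N_class n q) = poly_closure n (PN_class n q))) \<and>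
     (\<forall>r f. 0 \<le> r \<and> r < q \<and> \<not> extremal n f \<longrightarrow>
        (f \<in> poly_closure n (PR_class n q) \<longrightarrow> f \<in> PR_class n r) \<and>
        (f \<in> poly_closure n (PN_class n q) \<longrightarrow> f \<in> PN_class n r)) \<and>
     (PR_class n 0 = LC_class n \<and> PN_class n 0 = LC_plus_class n)"
proof (intro conjI allI impI)
  show "multiplier_class (PR_class n q) = plus_minus (poly_closure n (PN_class n q))"
    by (rule multiplier_PR[OF assms(1,2)])
  then show "multiplier_class (R_class n q) = plus_minus (poly_closure n (PN_class n q))" if "0 < q"
    using multiplier_R_N(1)[OF that assms(2)] by simp
  show "multiplier_class (PN_class n q) = poly_closure n (PN_class n q)"
    by (rule multiplier_PN[OF assms(1,2)])
  then show "multiplier_class (N_class n q) = poly_closure n (PN_class n q)" if "0 < q"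
    using multiplier_R_N(2)[OF that assms(2)] by simp
next
  fix r f assume r: "0 \<le> r \<and> r < q \<and> \<not> extremal n f" and "f \<in> poly_closure n (PR_class n q)"
  then obtain a as where a: "f = seq_fps n a" "\<And>i::nat. PRq q n (as i)"
    "\<And>k. k \<le> n \<Longrightarrow> (\<lambda>i. as i k) \<longlonglongrightarrow> a k"
    unfolding PR_class_eq[OF assms(1,2)] poly_closure_seq_fps by blast
  have "\<not> geometric_seq n a"
    using r geometric_seq_imp_extremal a(1) by blast
  then have "PRq r n a"
    using PRq_closure_strict[OF _ _ assms(2) a(2,3)] r by blast
  then show "f \<in> PR_class n r"
    using r assms(2) a(1) by (subst PR_class_eq) auto
next
  fix r f assume r: "0 \<le> r \<and> r < q \<and> \<not> extremal n f" and "f \<in> poly_closure n (PN_class n q)"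
  then obtain a as where a: "f = seq_fps n a" "\<And>i::nat. PRq q n (as i)" "\<And>i. same_sign n (as i)"
    "\<And>k. k \<le> n \<Longrightarrow> (\<lambda>i. as i k) \<longlonglongrightarrow> a k"
    unfolding PN_class_eq[OF assms(1,2)] poly_closure_seq_fps by blast
  have "\<not> geometric_seq n a"
    using r geometric_seq_imp_extremal a(1) by blast
  then have "PRq r n a"
    using PRq_closure_strict[OF _ _ assms(2) a(2,4)] r by blast
  moreover have "same_sign n a"
    by (rule same_sign_limit[OF a(3,4)])
  ultimately show "f \<in> PN_class n r"
    using r assms(2) a(1) by (subst PN_class_eq) auto
next
  show "PR_class n 0 = LC_class n" "PN_class n 0 = LC_plus_class n"
    using PR_class_eq[of 0 n] PN_class_eq[of 0 n] LC_class_eq[OF assms(3)] by (simp_all add: PRq_def)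
qed

end
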